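(* Assume that the following condition holds. (B) There exist $N\ge 1$ and a ring chain of states $i_0,i_1,\dots,i_N=i_0$ which contains all states of $\mathbb X$ and such that $\liminf_{\varepsilon\to0}p_{\varepsilon,i_{k-1}i_k}>0$ for $k=1,\dots,N$. Let $v_\varepsilon>0$ be a function with $v_\varepsilon\to\infty$ as $\varepsilon\to0$, let $\kappa_\varepsilon(t)=\sum_{n=1}^{[tv_\varepsilon]}\kappa_{\varepsilon,n}$, $t\ge0$, and consider the condition (D) $\theta_\varepsilon=\sum_{n=1}^{[v_\varepsilon]}\theta_{\varepsilon,n}\stackrel{d}{\longrightarrow}\theta_0$ as $\varepsilon\to0$, where $\theta_0$ is some non-negative random variable whose distribution is not concentrated at zero. When (D) holds, the limit in (D) is infinitely divisible, and its cumulant $A(s)$ is defined by $\mathsf E e^{-s\theta_0}=e^{-A(s)}$, $s\ge0$. Then: (i) Condition (D) is necessary and sufficient for the relation $\kappa_\varepsilon(1)\stackrel{d}{\longrightarrow}\theta_0$ as $\varepsilon\to0$, where $\theta_0$ is a non-negative random variable with distribution not concentrated at zero. Precisely: if (D) holds, then this relation holds (with some such $\theta_0$) for any family of initial distributions $\bar q_\varepsilon$, $\varepsilon\in(0,\varepsilon_0]$; conversely, if this relation holds for at least one family of initial distributions $\bar q_\varepsilon$, $\varepsilon\in(0,\varepsilon_0]$, and some such $\theta_0$, then (D) holds. (ii) In this case, the limiting random variable $\theta_0$ in (i) has the infinitely divisible distribution with Laplace transform $\mathsf E e^{-s\theta_0}=e^{-A(s)}$, $s\ge0$, with the cumulant $A(s)$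 from condition (D). (iii) Moreover, in this case, for any family of initial distributions, the processes $\kappa_\varepsilon(t)$, $t\ge0$, converge in the Skorokhod J-topology on $[0,\infty)$ as $\varepsilon\to0$ to $\theta_0(t)$, $t\ge0$, a non-negative Lévy process with $\mathsf E e^{-s\theta_0(t)}=e^{-tA(s)}$, $s,t\ge0$.
   Context: Let $\varepsilon_0>0$ and $\mathbb X=\{1,2,\dots,m\}$. For every $\varepsilon\in(0,\varepsilon_0]$ let $(\eta_{\varepsilon,n},\kappa_{\varepsilon,n},\zeta_{\varepsilon,n})$, $n=0,1,\dots$, be a Markov renewal process, i.e. a homogeneous Markov chain with phase space $\mathbb X\times[0,\infty)\times\{0,1\}$, with $\kappa_{\varepsilon,0}=0$, $\zeta_{\varepsilon,0}=0$, initial distribution $\bar q_\varepsilon=\langle q_{\varepsilon,i}=\mathsf P\{\eta_{\varepsilon,0}=i\},\,i\in\mathbb X\rangle$, and transition probabilities $$\mathsf P\{\eta_{\varepsilon,n+1}=j,\kappa_{\varepsilon,n+1}\le t,\zeta_{\varepsilon,n+1}=\jmath\mid\eta_{\varepsilon,n}=i,\kappa_{\varepsilon,n}=s,\zeta_{\varepsilon,n}=\imath\}=Q_{\varepsilon,ij}(t,\jmath),$$ for $i,j\in\mathbb X$, $s,t\ge0$, $\imath,\jmath\in\{0,1\}$ (so they depend on the past only through $\eta_{\varepsilon,n}=i$). The kernels $Q_{\varepsilon,ij}$ are fixed; the initial distributions may vary. The component $\eta_{\varepsilon,n}$ is a homogeneous Markov chain on $\mathbb X$ with transition probabilities $p_{\varepsilon,ij}=Q_{\varepsilon,ij}(+\infty,0)+Q_{\varepsilon,ij}(+\infty,1)$.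 $\mathsf P_i$ denotes conditional probability given $\eta_{\varepsilon,0}=i$. $[x]$ is the integer part of $x$. (The variables $\zeta_{\varepsilon,n}$ play no role in this statement.) Under (B), for all sufficiently small $\varepsilon$ the chain $\eta_{\varepsilon,n}$ is ergodic (i.e. $\mathbb X$ is one class of communicating states) and $\pi_{\varepsilon,i}$, $i\in\mathbb X$, denotes its unique stationary distribution; quantities involving $\pi_{\varepsilon,i}$ are considered for such $\varepsilon$. Let $G_{\varepsilon,i}(t)=\mathsf P_i\{\kappa_{\varepsilon,1}\le t\}$ and $G_\varepsilon(t)=\sum_{i=1}^m\pi_{\varepsilon,i}G_{\varepsilon,i}(t)$, $t\ge0$. For each $\varepsilon$, $\theta_{\varepsilon,n}$, $n=1,2,\dots$, are i.i.d. random variables with distribution function $G_\varepsilon$. $\stackrel{d}{\longrightarrow}$ is convergence in distribution. Random variables are proper (finite) and convergence in the J-topology means weak convergence of càdlàg processes on $[0,\infty)$ in the Skorokhod J-topology. *)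

theory Defs
  imports "HOL-Probability.Probability"
begin

section \<open>Markov renewal processes\<close>

definition phase_space :: "nat \<Rightarrow> (nat \<times> real \<times> nat) measure" where
  "phase_space m =
     count_space {1..m} \<Otimes>\<^sub>M (restrict_space borel {0..} \<Otimes>\<^sub>M count_space {0, 1})"

text \<open>
  The transition probabilities depend on the current point of the phase space only through its
  first coordinate \<open>i\<close>; \<open>K i\<close> is the law of the next point, so that \<open>kernel_Q K i j t z\<close> is
  \<open>Q\<^sub>i\<^sub>j(t, z)\<close> and \<open>kernel_Q_inf K i j z\<close> is \<open>Q\<^sub>i\<^sub>j(+\<infinity>, z)\<close>.
\<close>

definition semi_markov_kernel :: "nat \<Rightarrow> (nat \<Rightarrow> (nat \<times> real \<times> nat) measure) \<Rightarrow> bool" where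
  "semi_markov_kernel m K \<longleftrightarrow>
     (\<forall>i\<in>{1..m}. prob_space (K i) \<and> sets (K i) = sets (phase_space m))"

definition kernel_Q :: "(nat \<Rightarrow> (nat \<times> real \<times> nat) measure) \<Rightarrow> nat \<Rightarrow> nat \<Rightarrow> real \<Rightarrow> nat \<Rightarrow> real" where
  "kernel_Q K i j t z = measure (K i) ({j} \<times> {0..t} \<times> {z})"

definition kernel_Q_inf :: "(nat \<Rightarrow> (nat \<times> real \<times> nat) measure) \<Rightarrow> nat \<Rightarrow> nat \<Rightarrow> nat \<Rightarrow> real" where
  "kernel_Q_inf K i j z = measure (K i) ({j} \<times> {0..} \<times> {z})"

definition trans_prob :: "(nat \<Rightarrow> (nat \<times> real \<times> nat) measure) \<Rightarrow> nat \<Rightarrow> nat \<Rightarrow> real" where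
  "trans_prob K i j = kernel_Q_inf K i j 0 + kernel_Q_inf K i j 1"

text \<open>
  \<open>X n \<omega>\<close> is the triple \<open>(\<eta>\<^sub>n, \<kappa>\<^sub>n, \<zeta>\<^sub>n)\<close>.  The Markov property is stated with respect to the
  sigma-algebra generated by \<open>X 0, \<dots>, X n\<close>.
\<close>

definition history ::
  "nat \<Rightarrow> 'w measure \<Rightarrow> (nat \<Rightarrow> 'w \<Rightarrow> nat \<times> real \<times> nat) \<Rightarrow> nat \<Rightarrow> 'w measure" where
  "history m M X n =
     vimage_algebra (space M) (\<lambda>\<omega>. \<lambda>k\<in>{..n}. X k \<omega>) (\<Pi>\<^sub>M k\<in>{..n}. phase_space m)"

locale markov_renewal_process = prob_space M
  for m :: nat and K :: "nat \<Rightarrow> (nat \<times> real \<times> nat) measure" and q :: "nat \<Rightarrow> real"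
    and M :: "'w measure" and X :: "nat \<Rightarrow> 'w \<Rightarrow> nat \<times> real \<times> nat" +
  assumes measurable_X: "\<And>n. X n \<in> measurable M (phase_space m)"
    and init_kappa: "AE \<omega> in M. fst (snd (X 0 \<omega>)) = 0"
    and init_zeta: "AE \<omega> in M. snd (snd (X 0 \<omega>)) = 0"
    and init_eta: "\<And>i. i \<in> {1..m} \<Longrightarrow> measure M {\<omega> \<in> space M. fst (X 0 \<omega>) = i} = q i"
    and transition: "\<And>n j t z. j \<in> {1..m} \<Longrightarrow> t \<ge> 0 \<Longrightarrow> z \<in> {0, 1} \<Longrightarrow>
      AE \<omega> in M.
        real_cond_exp M (history m M X n)
          (indicat_real {\<omega> \<in> space M. fst (X (Suc n) \<omega>) = j \<and> fst (snd (X (Suc n) \<omega>)) \<le> t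
             \<and> snd (snd (X (Suc n) \<omega>)) = z}) \<omega>
        = kernel_Q K (fst (X n \<omega>)) j t z"

definition markov_renewal_family ::
  "real \<Rightarrow> nat \<Rightarrow> (real \<Rightarrow> nat \<Rightarrow> (nat \<times> real \<times> nat) measure) \<Rightarrow> (real \<Rightarrow> nat \<Rightarrow> real) \<Rightarrow>
   (real \<Rightarrow> 'w measure) \<Rightarrow> (real \<Rightarrow> nat \<Rightarrow> 'w \<Rightarrow> nat \<times> real \<times> nat) \<Rightarrow> bool" where
  "markov_renewal_family \<epsilon>0 m K q M X \<longleftrightarrow>
     (\<forall>\<epsilon>\<in>{0<..\<epsilon>0}. markov_renewal_process m (K \<epsilon>) (q \<epsilon>) (M \<epsilon>) (X \<epsilon>))"

definition kappa_process ::
  "real \<Rightarrow> (nat \<Rightarrow> 'w \<Rightarrow> nat \<times> real \<times> nat) \<Rightarrow> real \<Rightarrow> 'w \<Rightarrow> real" where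
  "kappa_process v X t \<omega> = (\<Sum>n = 1..nat \<lfloor>t * v\<rfloor>. fst (snd (X n \<omega>)))"

definition ring_chain_condition ::
  "nat \<Rightarrow> (real \<Rightarrow> nat \<Rightarrow> (nat \<times> real \<times> nat) measure) \<Rightarrow> bool" where
  "ring_chain_condition m K \<longleftrightarrow>
     (\<exists>N\<ge>1. \<exists>i :: nat \<Rightarrow> nat. i N = i 0 \<and> i ` {0..N} = {1..m} \<and>
        (\<forall>k\<in>{1..N}. Liminf (at_right 0) (\<lambda>\<epsilon>. ereal (trans_prob (K \<epsilon>) (i (k - 1)) (i k))) > 0))"

definition ergodic_chain :: "nat \<Rightarrow> (nat \<Rightarrow> nat \<Rightarrow> real) \<Rightarrow> bool" where
  "ergodic_chain m p \<longleftrightarrow>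
     (\<forall>i\<in>{1..m}. \<forall>j\<in>{1..m}. (i, j) \<in> {(k, l). k \<in> {1..m} \<and> l \<in> {1..m} \<and> p k l > 0}\<^sup>*)"

definition stationary_distribution :: "nat \<Rightarrow> (nat \<Rightarrow> nat \<Rightarrow> real) \<Rightarrow> (nat \<Rightarrow> real) \<Rightarrow> bool" where
  "stationary_distribution m p \<pi> \<longleftrightarrow>
     (\<forall>i\<in>{1..m}. \<pi> i \<ge> 0) \<and> (\<Sum>i = 1..m. \<pi> i) = 1 \<and>
     (\<forall>j\<in>{1..m}. (\<Sum>i = 1..m. \<pi> i * p i j) = \<pi> j)"

text \<open>
  \<open>P\<^sub>i{\<kappa>\<^sub>1 \<le> t}\<close>, where \<open>P\<^sub>i\<close> governs the process started at \<open>\<eta>\<^sub>0 = i\<close>: the first point then has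
  law \<open>K i\<close>, whatever the initial distribution is.  The value is 0 for \<open>t < 0\<close>.
\<close>

definition step_cdf :: "(nat \<Rightarrow> (nat \<times> real \<times> nat) measure) \<Rightarrow> nat \<Rightarrow> real \<Rightarrow> real" where
  "step_cdf K i t = measure (K i) {x \<in> space (K i). fst (snd x) \<le> t}"

definition averaged_step_cdf ::
  "nat \<Rightarrow> (nat \<Rightarrow> (nat \<times> real \<times> nat) measure) \<Rightarrow> (nat \<Rightarrow> real) \<Rightarrow> real \<Rightarrow> real" where
  "averaged_step_cdf m K \<pi> t = (\<Sum>i = 1..m. \<pi> i * step_cdf K i t)"

definition iid_with_cdf :: "'v measure \<Rightarrow> (nat \<Rightarrow> 'v \<Rightarrow> real) \<Rightarrow> (real \<Rightarrow> real) \<Rightarrow> bool" where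
  "iid_with_cdf P \<theta> G \<longleftrightarrow> prob_space P \<and>
     prob_space.indep_vars P (\<lambda>_. borel) \<theta> {1..} \<and>
     (\<forall>n\<ge>1. cdf (distr P borel (\<theta> n)) = G)"


section \<open>Limit laws on the real line\<close>

text \<open>\<^const>\<open>weak_conv_m\<close> for families indexed along an arbitrary filter.\<close>

definition weak_conv_along :: "('e \<Rightarrow> real measure) \<Rightarrow> real measure \<Rightarrow> 'e filter \<Rightarrow> bool" where
  "weak_conv_along \<mu>s \<mu> F \<longleftrightarrow>
     (\<forall>x. isCont (cdf \<mu>) x \<longrightarrow> ((\<lambda>e. cdf (\<mu>s e) x) \<longlongrightarrow> cdf \<mu> x) F)"

text \<open>Laws of non-negative random variables that are not concentrated at zero.\<close>

definition nonneg_nonzero_law :: "real measure \<Rightarrow> bool" where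
  "nonneg_nonzero_law \<mu> \<longleftrightarrow>
     real_distribution \<mu> \<and> (AE x in \<mu>. x \<ge> 0) \<and> measure \<mu> {0} < 1"

definition infinitely_divisible :: "real measure \<Rightarrow> bool" where
  "infinitely_divisible \<mu> \<longleftrightarrow>
     (\<forall>n::nat. n \<ge> 1 \<longrightarrow> (\<exists>\<nu>. real_distribution \<nu> \<and>
        distr (\<Pi>\<^sub>M k\<in>{..<n}. \<nu>) borel (\<lambda>x. \<Sum>k<n. x k) = \<mu>))"

definition laplace_transform :: "real measure \<Rightarrow> real \<Rightarrow> real" where
  "laplace_transform \<mu> s = (LINT x|\<mu>. exp (- s * x))"

definition cumulant :: "real measure \<Rightarrow> real \<Rightarrow> real" where
  "cumulant \<mu> s = - ln (laplace_transform \<mu> s)"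

definition theta_conv ::
  "(real \<Rightarrow> real) \<Rightarrow> (real \<Rightarrow> 'v measure) \<Rightarrow> (real \<Rightarrow> nat \<Rightarrow> 'v \<Rightarrow> real) \<Rightarrow> real measure \<Rightarrow> bool" where
  "theta_conv v P \<theta> \<mu> \<longleftrightarrow> nonneg_nonzero_law \<mu> \<and>
     weak_conv_along (\<lambda>\<epsilon>. distr (P \<epsilon>) borel (\<lambda>\<omega>. \<Sum>n = 1..nat \<lfloor>v \<epsilon>\<rfloor>. \<theta> \<epsilon> n \<omega>)) \<mu> (at_right 0)"

definition kappa_conv ::
  "(real \<Rightarrow> real) \<Rightarrow> (real \<Rightarrow> 'w measure) \<Rightarrow> (real \<Rightarrow> nat \<Rightarrow> 'w \<Rightarrow> nat \<times> real \<times> nat) \<Rightarrow>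
   real measure \<Rightarrow> bool" where
  "kappa_conv v M X \<mu> \<longleftrightarrow> nonneg_nonzero_law \<mu> \<and>
     weak_conv_along (\<lambda>\<epsilon>. distr (M \<epsilon>) borel (kappa_process (v \<epsilon>) (X \<epsilon>) 1)) \<mu> (at_right 0)"


section \<open>The Skorokhod J-topology on the half-line\<close>

text \<open>Paths on \<open>[0, \<infinity>)\<close> are represented by functions that are extensional on \<open>{0..}\<close>.\<close>

definition cadlag_paths :: "(real \<Rightarrow> real) set" where
  "cadlag_paths = {x \<in> extensional {0..}.
     (\<forall>t\<ge>0. continuous (at_right t) x) \<and> (\<forall>t>0. \<exists>l. (x \<longlongrightarrow> l) (at_left t))}"

definition time_changes :: "(real \<Rightarrow> real) set" where
  "time_changes = {\<tau>. strict_mono_on {0..} \<tau> \<and> \<tau> ` {0..} = {0..}}"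

text \<open>
  A sequence \<open>x\<^sub>n\<close> is eventually in every \<open>J_nbhd x T \<delta>\<close> iff there are time changes \<open>\<tau>\<^sub>n\<close> with
  \<open>sup\<^sub>t \<bar>\<tau>\<^sub>n t - t\<bar> \<longrightarrow> 0\<close> and \<open>sup\<^bsub>t \<le> T\<^esub> \<bar>x\<^sub>n (\<tau>\<^sub>n t) - x t\<bar> \<longrightarrow> 0\<close> for all \<open>T\<close>, which is the usual
  description of convergence in the metrizable J-topology on \<open>D[0, \<infinity>)\<close>.  Hence these sets are
  neighbourhood bases of that topology.
\<close>

definition J_nbhd :: "(real \<Rightarrow> real) \<Rightarrow> real \<Rightarrow> real \<Rightarrow> (real \<Rightarrow> real) set" where
  "J_nbhd x T \<delta> = {y \<in> cadlag_paths. \<exists>\<tau>\<in>time_changes.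
     (\<forall>t\<ge>0. \<bar>\<tau> t - t\<bar> < \<delta>) \<and> (\<forall>t\<in>{0..T}. \<bar>y (\<tau> t) - x t\<bar> < \<delta>)}"

definition J_topology :: "(real \<Rightarrow> real) topology" where
  "J_topology = topology (\<lambda>U. U \<subseteq> cadlag_paths \<and>
     (\<forall>x\<in>U. \<exists>T>0. \<exists>\<delta>>0. J_nbhd x T \<delta> \<subseteq> U))"

lemma J_nbhd_mono:
  assumes "T' \<le> T" and "\<delta> \<le> \<delta>'"
  shows "J_nbhd x T \<delta> \<subseteq> J_nbhd x T' \<delta>'"
proof
  fix y assume "y \<in> J_nbhd x T \<delta>"
  then obtain \<tau> where "y \<in> cadlag_paths" "\<tau> \<in> time_changes"
    and "\<forall>t\<ge>0. \<bar>\<tau> t - t\<bar> < \<delta>" "\<forall>t\<in>{0..T}. \<bar>y (\<tau> t) - x t\<bar> < \<delta>"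
    unfolding J_nbhd_def by blast
  moreover from this have "\<forall>t\<ge>0. \<bar>\<tau> t - t\<bar> < \<delta>'" "\<forall>t\<in>{0..T'}. \<bar>y (\<tau> t) - x t\<bar> < \<delta>'"
    using assms by (force intro: less_le_trans)+
  ultimately show "y \<in> J_nbhd x T' \<delta>'"
    unfolding J_nbhd_def by blast
qed

lemma openin_J_topology:
  "openin J_topology U \<longleftrightarrow>
     U \<subseteq> cadlag_paths \<and> (\<forall>x\<in>U. \<exists>T>0. \<exists>\<delta>>0. J_nbhd x T \<delta> \<subseteq> U)"
proof -
  let ?P = "\<lambda>U. U \<subseteq> cadlag_paths \<and> (\<forall>x\<in>U. \<exists>T>0. \<exists>\<delta>>0. J_nbhd x T \<delta> \<subseteq> U)"
  have inter: "?P (A \<inter> B)" if A: "?P A" and B: "?P B" for A B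
  proof (intro conjI ballI)
    show "A \<inter> B \<subseteq> cadlag_paths" using A by blast
    fix x assume x: "x \<in> A \<inter> B"
    obtain T1 d1 where 1: "T1 > 0" "d1 > 0" "J_nbhd x T1 d1 \<subseteq> A" using A x by blast
    obtain T2 d2 where 2: "T2 > 0" "d2 > 0" "J_nbhd x T2 d2 \<subseteq> B" using B x by blast
    have "J_nbhd x (max T1 T2) (min d1 d2) \<subseteq> A \<inter> B"
      using J_nbhd_mono[of T1 "max T1 T2" "min d1 d2" d1 x]
        J_nbhd_mono[of T2 "max T1 T2" "min d1 d2" d2 x] 1(3) 2(3)
      by auto
    then show "\<exists>T>0. \<exists>\<delta>>0. J_nbhd x T \<delta> \<subseteq> A \<inter> B"
      using 1 2 by (intro exI[of _ "max T1 T2"] exI[of _ "min d1 d2"] conjI) auto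
  qed
  have union: "?P (\<Union>\<K>)" if "\<forall>A\<in>\<K>. ?P A" for \<K>
  proof (intro conjI ballI)
    show "\<Union>\<K> \<subseteq> cadlag_paths" using that by blast
    fix x assume "x \<in> \<Union>\<K>"
    then obtain A where "A \<in> \<K>" "x \<in> A" by blast
    then show "\<exists>T>0. \<exists>\<delta>>0. J_nbhd x T \<delta> \<subseteq> \<Union>\<K>" using that by (meson Sup_upper order_trans)
  qed
  have "istopology ?P"
    unfolding istopology_def using inter union by blast
  then show ?thesis
    unfolding J_topology_def by (simp add: topology_inverse')
qed

lemma topspace_J_topology: "topspace J_topology = cadlag_paths"
proof
  show "topspace J_topology \<subseteq> cadlag_paths"
    using openin_J_topology[of "topspace J_topology"] by auto
  have "\<exists>T>0. \<exists>\<delta>>0. J_nbhd x T \<delta> \<subseteq> cadlag_paths" for x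
    using zero_less_one[where 'a = real] unfolding J_nbhd_def by blast
  then have "openin J_topology cadlag_paths"
    by (simp add: openin_J_topology)
  then show "cadlag_paths \<subseteq> topspace J_topology"
    by (rule openin_subset)
qed

definition path_of :: "(real \<Rightarrow> 'a \<Rightarrow> real) \<Rightarrow> 'a \<Rightarrow> real \<Rightarrow> real" where
  "path_of Z \<omega> = (\<lambda>t\<in>{0..}. Z t \<omega>)"

definition cadlag_process :: "'a measure \<Rightarrow> (real \<Rightarrow> 'a \<Rightarrow> real) \<Rightarrow> bool" where
  "cadlag_process M Z \<longleftrightarrow> prob_space M \<and>
     (\<forall>t\<ge>0. Z t \<in> borel_measurable M) \<and> (\<forall>\<omega>\<in>space M. path_of Z \<omega> \<in> cadlag_paths)"

text \<open>
  Weak convergence in the J-topology.  The integrability clauses make sure that the expectations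
  exist, so that no limit is taken of the default value 0 of the Bochner integral.
\<close>

definition weak_conv_J ::
  "('e \<Rightarrow> 'a measure) \<Rightarrow> ('e \<Rightarrow> real \<Rightarrow> 'a \<Rightarrow> real) \<Rightarrow> 'b measure \<Rightarrow> (real \<Rightarrow> 'b \<Rightarrow> real) \<Rightarrow>
   'e filter \<Rightarrow> bool" where
  "weak_conv_J M Z P Y F \<longleftrightarrow>
     (\<forall>\<^sub>F e in F. cadlag_process (M e) (Z e)) \<and> cadlag_process P Y \<and>
     (\<forall>f. continuous_map J_topology euclideanreal f \<and> bounded (f ` cadlag_paths) \<longrightarrow>
        (\<forall>\<^sub>F e in F. integrable (M e) (\<lambda>\<omega>. f (path_of (Z e) \<omega>))) \<and>
        integrable P (\<lambda>\<omega>. f (path_of Y \<omega>)) \<and>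
        ((\<lambda>e. LINT \<omega>|M e. f (path_of (Z e) \<omega>)) \<longlongrightarrow> (LINT \<omega>|P. f (path_of Y \<omega>))) F)"

locale levy_process = prob_space P for P :: "'b measure" and Y :: "real \<Rightarrow> 'b \<Rightarrow> real" +
  assumes cadlag: "cadlag_process P Y"
    and start_zero: "AE \<omega> in P. Y 0 \<omega> = 0"
    and indep_increments: "\<And>(t :: nat \<Rightarrow> real) n. 0 \<le> t 0 \<Longrightarrow> mono t \<Longrightarrow>
      indep_vars (\<lambda>_. borel) (\<lambda>k \<omega>. Y (t (Suc k)) \<omega> - Y (t k) \<omega>) {..<n}"
    and stationary_increments: "\<And>s h. 0 \<le> s \<Longrightarrow> 0 \<le> h \<Longrightarrow>
      distr P borel (\<lambda>\<omega>. Y (s + h) \<omega> - Y s \<omega>) = distr P borel (Y h)"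

end

theory Submission
  imports Defs
begin

text \<open>
  Put \<open>u\<^sub>n i = E\<^sub>i exp (- s (\<kappa>\<^sub>1 + \<dots> + \<kappa>\<^sub>n))\<close>.  Then \<open>u\<^sub>n\<^sub>+\<^sub>1\<close> arises from \<open>u\<^sub>n\<close> by a substochastic matrix that is
  dominated by the transition matrix; the ring chain forces the oscillation of \<open>u\<^sub>n\<close> to be of the order of
  the defect \<open>a s = 1 - E exp (- s \<theta>)\<close>, and up to this oscillation the \<open>\<pi>\<close>-mean of \<open>u\<^sub>n\<close> is multiplied by
  \<open>1 - a s\<close> in each step.  Hence the sums of the \<open>\<kappa>\<^sub>n\<close>, for every initial distribution, and the sums of the
  \<open>\<theta>\<^sub>n\<close> have Laplace transforms close to \<open>(1 - a s)\<^sup>n\<close>, and both convergences mean that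
  \<open>v\<^sub>\<epsilon> a\<^sub>\<epsilon> s \<longlongrightarrow> A s\<close>.

  The Markov property upgrades this to joint Laplace transforms of increments on a grid, and to the bound
  \<open>O(h\<^sup>2)\<close> for the probability of two large increments within a block of length \<open>h\<close>.  A monotone path without
  two large increments in a block is J-close to its discretization, so that functionals which are Lipschitz
  for a J-pseudometric converge; a bounded J-continuous functional is the increasing limit of such
  functionals on monotone paths, which bounds the lower limits of the expectations of the functional and of
  its negative.  The Levy process comes from the laws with transforms \<open>exp (- A s / 2\<^sup>n)\<close>, which are again
  limit laws, by Kolmogorov extension over the dyadic times.
\<close>

section \<open>Kernels dominated by a ring chain\<close>

text \<open>All constants have to be uniform in \<open>\<epsilon>\<close>. The error of the power
  approximation is therefore kept as an explicit multiple, depending only on \<open>m\<close>,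
  \<open>N\<close> and \<open>c\<close>, of \<open>a s * (1 + n * a s)\<close>. It is small only
  while \<open>n * a s\<close> stays bounded. This is clear once (D) provides the limit of
  \<open>v * a s\<close>, but in the converse direction nothing bounds \<open>v * a s\<close>
  beforehand. There the transform is monotone and the defect continuous in the frequency: if the
  defect at \<open>s\<close> exceeded \<open>T / v\<close>, it would equal \<open>T / v\<close> at
  some smaller frequency, where the estimate is already effective. Transforms at natural frequencies
  suffice because \<open>exp (- x)\<close> maps non-negative sequences into a compact cube on which
  polynomials are dense. The same argument, applied to a constant family, yields uniqueness and
  independence. A J-continuous functional comes without measurability; along monotone paths it is a
  pointwise limit of functions of grid values. Its Lipschitz envelopes are interposed because for
  them a bound on the J-distance is a bound on the error.\<close>

primrec kernel_iter :: "nat \<Rightarrow> (nat \<Rightarrow> nat \<Rightarrow> real) \<Rightarrow> nat \<Rightarrow> (nat \<Rightarrow> real) \<Rightarrow> nat \<Rightarrow> real" where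
  "kernel_iter m r 0 w = w"
| "kernel_iter m r (Suc n) w = (\<lambda>i. \<Sum>j=1..m. r i j * kernel_iter m r n w j)"

text \<open>Applied with \<open>p\<close> the transition matrix and \<open>r\<close> the matrix of
  step transforms at a fixed frequency. The ring enters only through the single lower bound
  \<open>c\<close>, so that the bounds below depend on \<open>m\<close>, \<open>N\<close>,
  \<open>c\<close> and the mean defect alone.\<close>

locale dominated_ring_kernel =
  fixes m N :: nat and c :: real and z :: "nat \<Rightarrow> nat"
    and p r :: "nat \<Rightarrow> nat \<Rightarrow> real" and \<pi> :: "nat \<Rightarrow> real"
  assumes c: "0 < c" "c \<le> 1" and m: "m \<ge> 1"
    and N: "N \<ge> 1" "z N = z 0" "z ` {0..N} = {1..m}"
    and ring: "\<And>k. k \<in> {1..N} \<Longrightarrow> c \<le> p (z (k - 1)) (z k)"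
    and stochastic: "\<And>i. i \<in> {1..m} \<Longrightarrow> (\<Sum>j=1..m. p i j) = 1"
    and r: "\<And>i j. i \<in> {1..m} \<Longrightarrow> j \<in> {1..m} \<Longrightarrow> 0 \<le> r i j \<and> r i j \<le> p i j"
    and stationary: "stationary_distribution m p \<pi>"
begin

abbreviation u :: "nat \<Rightarrow> nat \<Rightarrow> real" where
  "u n \<equiv> kernel_iter m r n (\<lambda>_. 1)"

definition mean_defect :: real where
  "mean_defect = (\<Sum>i=1..m. \<pi> i * (1 - (\<Sum>j=1..m. r i j)))"

text \<open>A bound for the defect of every single row: the mean defect divided by the lower bound
  \<open>c ^ (2 * N) / m\<close> for the weights of \<open>\<pi>\<close>.\<close>

definition step_defect :: real where
  "step_defect = mean_defect * (m / c ^ (2 * N))"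

lemma p_nonneg: "i \<in> {1..m} \<Longrightarrow> j \<in> {1..m} \<Longrightarrow> 0 \<le> p i j"
  using r order_trans by blast

lemma \<pi>_nonneg: "i \<in> {1..m} \<Longrightarrow> 0 \<le> \<pi> i"
  and \<pi>_sum: "(\<Sum>i = 1..m. \<pi> i) = 1"
  and \<pi>_inv: "j \<in> {1..m} \<Longrightarrow> (\<Sum>i = 1..m. \<pi> i * p i j) = \<pi> j"
  using stationary unfolding stationary_distribution_def by auto

text \<open>The ring continued periodically, so that a walk along it need not stop at
  \<open>N\<close>.\<close>

definition y :: "nat \<Rightarrow> nat" where "y k = z (k mod N)"

lemma y_in: "y k \<in> {1..m}"
proof -
  have "k mod N \<in> {0..N}" using N(1) by (auto simp: less_imp_le)
  thus ?thesis unfolding y_def using N(3) by blast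
qed

lemma y_step: "c \<le> p (y k) (y (Suc k))"
proof (cases "Suc (k mod N) = N")
  case True
  have "y (Suc k) = z N" using True N(2) by (simp add: y_def mod_Suc)
  moreover have "y k = z (N - 1)" unfolding y_def using True by (metis diff_Suc_1)
  ultimately show ?thesis using ring[of N] N(1) by simp
next
  case False
  have lt: "k mod N < N" using N(1) by simp
  have "y (Suc k) = z (Suc (k mod N))" using False by (simp add: y_def mod_Suc)
  thus ?thesis using ring[of "Suc (k mod N)"] False lt by (simp add: y_def)
qed

lemma y_periodic: "y (k + N) = y k"
  by (simp add: y_def)

lemma y_surj:
  assumes "i \<in> {1..m}"
  obtains k where "k < N" "i = y k"
proof -
  obtain k where k: "k \<le> N" "i = z k" using assms N(3) by (metis atLeastAtMost_iff imageE)
  show ?thesis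
  proof (cases "k = N")
    case True thus ?thesis using that[of 0] k N by (simp add: y_def)
  next
    case False thus ?thesis using that[of k] k by (simp add: y_def)
  qed
qed

lemma y_reach:
  assumes "i \<in> {1..m}" "j \<in> {1..m}"
  obtains k l where "l \<le> 2 * N" "i = y k" "j = y (k + l)"
proof -
  obtain a where a: "a < N" "i = y a" using y_surj assms(1) by blast
  obtain b where b: "b < N" "j = y b" using y_surj assms(2) by blast
  \<comment> \<open>One extra turn of the ring keeps the difference of the indices non-negative;
    hence the bound \<open>2 * N\<close> instead of \<open>N\<close> on the number of steps.\<close>
  show ?thesis using that[of "b + N - a" a] a b y_periodic by simp
qed

lemma c_pow: "l \<le> 2 * N \<Longrightarrow> c ^ (2 * N) \<le> c ^ l"
  using c by (intro power_decreasing) auto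

text \<open>Invariance pushes at least the fraction \<open>c\<close> of the mass of a ring state to
  its successor. No state can therefore have less than \<open>c ^ (2 * N)\<close> times the mass of
  any other one, and the masses sum to 1.\<close>

lemma \<pi>_lower:
  assumes j: "j \<in> {1..m}"
  shows "c ^ (2 * N) / m \<le> \<pi> j"
proof -
  have step: "c * \<pi> (y k) \<le> \<pi> (y (Suc k))" for k
  proof -
    have "c * \<pi> (y k) \<le> \<pi> (y k) * p (y k) (y (Suc k))"
      using mult_left_mono[OF y_step[of k] \<pi>_nonneg[OF y_in, of k]] by (simp add: mult.commute)
    also have "\<dots> \<le> (\<Sum>i = 1..m. \<pi> i * p i (y (Suc k)))"
      by (rule member_le_sum[of "y k" "{1..m}" "\<lambda>i. \<pi> i * p i (y (Suc k))"])
        (use y_in \<pi>_nonneg p_nonneg in auto)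
    finally show ?thesis using \<pi>_inv[OF y_in] by simp
  qed
  have walk: "c ^ l * \<pi> (y k) \<le> \<pi> (y (k + l))" for k l
  proof (induction l)
    case (Suc l)
    have "c ^ Suc l * \<pi> (y k) \<le> c * \<pi> (y (k + l))"
      using Suc c(1) by (simp add: mult.assoc)
    also have "\<dots> \<le> \<pi> (y (k + Suc l))" using step[of "k + l"] by simp
    finally show ?case .
  qed simp
  have "c ^ (2 * N) * \<pi> i \<le> \<pi> j" if i: "i \<in> {1..m}" for i
  proof -
    obtain k l where kl: "l \<le> 2 * N" "i = y k" "j = y (k + l)" using y_reach[OF i j] .
    have "c ^ (2 * N) * \<pi> i \<le> c ^ l * \<pi> i"
      using c_pow[OF kl(1)] \<pi>_nonneg[OF i] by (rule mult_right_mono)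
    thus ?thesis using walk[of l k] kl by simp
  qed
  hence "(\<Sum>i = 1..m. c ^ (2 * N) * \<pi> i) \<le> (\<Sum>i = 1..m. \<pi> j)"
    by (intro sum_mono) auto
  hence "c ^ (2 * N) \<le> m * \<pi> j"
    by (simp add: sum_distrib_left[symmetric] \<pi>_sum[simplified])
  thus ?thesis using m by (simp add: field_simps)
qed

lemma row_le: "i \<in> {1..m} \<Longrightarrow> (\<Sum>j=1..m. r i j) \<le> 1"
  using sum_mono[of "{1..m}" "r i" "p i"] r stochastic by fastforce

lemma mean_defect_nonneg: "0 \<le> mean_defect"
  unfolding mean_defect_def using row_le \<pi>_nonneg by (intro sum_nonneg mult_nonneg_nonneg) auto

lemma mean_defect_le_1: "mean_defect \<le> 1"
proof -
  have "mean_defect \<le> (\<Sum>i=1..m. \<pi> i * 1)"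
    unfolding mean_defect_def using r \<pi>_nonneg
    by (intro sum_mono mult_left_mono) (auto intro!: sum_nonneg)
  thus ?thesis using \<pi>_sum by simp
qed

lemma step_defect_nonneg: "0 \<le> step_defect"
  unfolding step_defect_def using mean_defect_nonneg c by simp

text \<open>The mean defect is a sum of non-negative terms, so each row contributes at most the
  whole, and the weight of the row is bounded below.\<close>

lemma row_defect:
  assumes i: "i \<in> {1..m}"
  shows "1 - (\<Sum>j=1..m. r i j) \<le> step_defect"
proof -
  have "\<pi> i * (1 - (\<Sum>j=1..m. r i j)) \<le> mean_defect"
    unfolding mean_defect_def
    by (rule member_le_sum[of i "{1..m}" "\<lambda>i. \<pi> i * (1 - (\<Sum>j=1..m. r i j))"])
       (use i row_le \<pi>_nonneg in auto)
  moreover have "c ^ (2 * N) / m * (1 - (\<Sum>j=1..m. r i j)) \<le> \<pi> i * (1 - (\<Sum>j=1..m. r i j))"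
    using \<pi>_lower[OF i] row_le[OF i] by (intro mult_right_mono) auto
  ultimately have "c ^ (2 * N) / m * (1 - (\<Sum>j=1..m. r i j)) \<le> mean_defect" by linarith
  thus ?thesis unfolding step_defect_def using c m by (simp add: field_simps)
qed

lemma u_nonneg: "i \<in> {1..m} \<Longrightarrow> 0 \<le> u n i"
  by (induction n arbitrary: i) (use r in \<open>auto intro!: sum_nonneg mult_nonneg_nonneg\<close>)

text \<open>The defect of the first step is only averaged by substochastic rows afterwards, so it
  cannot grow with \<open>n\<close>.\<close>

lemma u_step: "i \<in> {1..m} \<Longrightarrow> u n i - u (Suc n) i \<le> step_defect"
proof (induction n arbitrary: i)
  case 0 thus ?case using row_defect by simp
next
  case (Suc n)
  have "u (Suc n) i - u (Suc (Suc n)) i = (\<Sum>j=1..m. r i j * (u n j - u (Suc n) j))"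
    by (simp add: sum_subtractf right_diff_distrib)
  also have "\<dots> \<le> (\<Sum>j=1..m. r i j * step_defect)"
    using Suc r by (intro sum_mono mult_left_mono) auto
  also have "\<dots> = (\<Sum>j=1..m. r i j) * step_defect" by (simp add: sum_distrib_right)
  also have "\<dots> \<le> step_defect" using row_le[OF Suc.prems] step_defect_nonneg
    by (metis mult_left_mono mult.commute mult.right_neutral)
  finally show ?case .
qed

lemma u_lower: "i \<in> {1..m} \<Longrightarrow> 1 - u n i \<le> n * step_defect"
proof (induction n)
  case (Suc n)
  thus ?case using u_step[OF Suc.prems, of n] by (simp add: algebra_simps)
qed simp

definition osc_bound :: real where
  "osc_bound = 2 * N * (step_defect / c ^ (2 * N))"

text \<open>A subharmonic defect at the maximum is amplified by at most \<open>1 / c\<close> per step along the ring.\<close>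

lemma osc_le:
  assumes i: "i \<in> {1..m}" and j: "j \<in> {1..m}"
  shows "u n i - u n j \<le> osc_bound"
proof -
  let ?a = step_defect
  \<comment> \<open>Up to the one-step defect, \<open>u n\<close> is subharmonic for the stochastic
    matrix \<open>p\<close>, because \<open>r\<close> is dominated by \<open>p\<close>. From here on
    only \<open>p\<close> is iterated.\<close>
  have sub: "u n k \<le> (\<Sum>l=1..m. p k l * u n l) + ?a" if k: "k \<in> {1..m}" for k
  proof -
    have "u (Suc n) k \<le> (\<Sum>l=1..m. p k l * u n l)"
      using r k u_nonneg by (auto intro!: sum_mono mult_right_mono)
    thus ?thesis using u_step[OF k, of n] by linarith
  qed
  define M where "M = Max (u n ` {1..m})"
  have le_M: "u n k \<le> M" if "k \<in> {1..m}" for k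
    unfolding M_def using that by (intro Max_ge) auto
  have "M \<in> u n ` {1..m}" unfolding M_def using m by (intro Max_in) auto
  then obtain i0 where i0: "i0 \<in> {1..m}" "M = u n i0" by blast
  obtain k l where kl: "l \<le> 2 * N" "i0 = y k" "j = y (k + l)" using y_reach[OF i0(1) j] .
  have walk: "M - u n (y (k + d)) \<le> d * ?a / c ^ d" for d
  proof (induction d)
    case 0 thus ?case using i0 kl by simp
  next
    case (Suc d)
    let ?s = "y (k + d)" and ?t = "y (k + Suc d)"
    have "u n ?s \<le> (\<Sum>l=1..m. p ?s l * u n l) + ?a" by (rule sub[OF y_in])
    also have "(\<Sum>l=1..m. p ?s l * u n l) = M - (\<Sum>l=1..m. p ?s l * (M - u n l))"
      by (simp add: right_diff_distrib sum_subtractf sum_distrib_right[symmetric] stochastic[OF y_in, simplified])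
    also have "\<dots> \<le> M - p ?s ?t * (M - u n ?t)"
      using member_le_sum[of ?t "{1..m}" "\<lambda>l. p ?s l * (M - u n l)"] y_in[of "k + Suc d"] le_M p_nonneg[OF y_in] by auto
    also have "\<dots> \<le> M - c * (M - u n ?t)"
      using y_step[of "k + d"] le_M[OF y_in, of "k + Suc d"] by (simp add: mult_right_mono)
    finally have "c * (M - u n ?t) \<le> d * ?a / c ^ d + ?a" using Suc by linarith
    also have "\<dots> \<le> d * ?a / c ^ d + ?a / c ^ d"
      using step_defect_nonneg c by (simp add: pos_le_divide_eq mult_left_le power_le_one)
    also have "\<dots> = (Suc d) * ?a / c ^ d" by (simp add: add_divide_distrib[symmetric] algebra_simps)
    finally have "M - u n ?t \<le> (Suc d) * ?a / c ^ d / c"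
      using c(1) by (subst pos_le_divide_eq) (simp_all only: mult.commute)
    thus ?case by (simp add: mult.commute)
  qed
  have "u n i - u n j \<le> M - u n (y (k + l))" using le_M[OF i] kl by simp
  also have "\<dots> \<le> l * ?a / c ^ l" by (rule walk)
  also have "\<dots> \<le> (2 * N) * ?a / c ^ (2 * N)"
    using kl(1) c c_pow[OF kl(1)] step_defect_nonneg by (intro frac_le mult_right_mono) (auto intro!: mult_nonneg_nonneg simp del: of_nat_mult)
  finally show ?thesis unfolding osc_bound_def by simp
qed

lemma u_near_mean:
  assumes "i \<in> {1..m}"
  shows "\<bar>u n i - (\<Sum>j=1..m. \<pi> j * u n j)\<bar> \<le> osc_bound"
proof -
  have "u n i - (\<Sum>j=1..m. \<pi> j * u n j) = (\<Sum>j=1..m. \<pi> j * (u n i - u n j))"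
    by (simp add: right_diff_distrib sum_subtractf sum_distrib_right[symmetric] \<pi>_sum[simplified])
  also have "\<bar>\<dots>\<bar> \<le> (\<Sum>j=1..m. \<pi> j * osc_bound)"
  proof (rule order_trans[OF sum_abs sum_mono])
    fix j assume j: "j \<in> {1..m}"
    have "\<bar>u n i - u n j\<bar> \<le> osc_bound" using osc_le[OF assms j, of n] osc_le[OF j assms, of n] by linarith
    thus "\<bar>\<pi> j * (u n i - u n j)\<bar> \<le> \<pi> j * osc_bound"
      using \<pi>_nonneg[OF j] by (simp add: abs_mult mult_left_mono)
  qed
  finally show ?thesis by (simp add: sum_distrib_right[symmetric] \<pi>_sum[simplified])
qed

lemma mean_near_power:
  "\<bar>(\<Sum>i=1..m. \<pi> i * u n i) - (1 - mean_defect) ^ n\<bar> \<le> n * (mean_defect * osc_bound)"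
proof (induction n)
  case 0 thus ?case by (simp add: \<pi>_sum[simplified])
next
  case (Suc n)
  let ?a = mean_defect and ?D = osc_bound
  let ?U = "\<lambda>n. \<Sum>i=1..m. \<pi> i * u n i"
  \<comment> \<open>\<open>\<rho> j\<close> is the mass that one step from \<open>\<pi>\<close>
    loses on its way to \<open>j\<close>; its total is the mean defect. The mean of \<open>u\<close>
    decreases by the \<open>\<rho>\<close>-integral of \<open>u n\<close>, which differs from the
    mean defect times the mean by at most the oscillation.\<close>
  define \<rho> where "\<rho> j = (\<Sum>i=1..m. \<pi> i * (p i j - r i j))" for j
  have \<rho>: "0 \<le> \<rho> j" if "j \<in> {1..m}" for j
    unfolding \<rho>_def using r \<pi>_nonneg that by (intro sum_nonneg mult_nonneg_nonneg) auto
  have "(\<Sum>j=1..m. \<rho> j) = (\<Sum>i=1..m. \<Sum>j=1..m. \<pi> i * (p i j - r i j))"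
    unfolding \<rho>_def by (rule sum.swap)
  also have "\<dots> = ?a" unfolding mean_defect_def
    by (intro sum.cong refl)
       (simp add: sum_distrib_left[symmetric] sum_subtractf stochastic[simplified])
  finally have \<rho>_sum: "(\<Sum>j=1..m. \<rho> j) = ?a" .
  have "?U n = (\<Sum>j=1..m. (\<Sum>i=1..m. \<pi> i * p i j) * u n j)"
    by (intro sum.cong refl) (use \<pi>_inv in simp)
  moreover have "?U (Suc n) = (\<Sum>j=1..m. (\<Sum>i=1..m. \<pi> i * r i j) * u n j)"
    by (simp add: sum_distrib_left sum_distrib_right mult.assoc) (rule sum.swap)
  ultimately have "?U n - ?U (Suc n) = (\<Sum>j=1..m. \<rho> j * u n j)"
    unfolding \<rho>_def by (simp add: sum_subtractf[symmetric] left_diff_distrib[symmetric] right_diff_distrib)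
  also have "\<dots> = ?a * ?U n + (\<Sum>j=1..m. \<rho> j * (u n j - ?U n))"
    by (simp add: right_diff_distrib sum_subtractf sum_distrib_right[symmetric] \<rho>_sum[simplified])
  finally have eq: "?U (Suc n) - (1 - ?a) ^ Suc n
      = (1 - ?a) * (?U n - (1 - ?a) ^ n) - (\<Sum>j=1..m. \<rho> j * (u n j - ?U n))"
    by (simp add: algebra_simps)
  have "\<bar>\<Sum>j=1..m. \<rho> j * (u n j - ?U n)\<bar> \<le> (\<Sum>j=1..m. \<rho> j * ?D)"
    using \<rho> u_near_mean
    by (intro order_trans[OF sum_abs sum_mono]) (auto simp: abs_mult intro!: mult_left_mono)
  also have "\<dots> = ?a * ?D" by (simp add: sum_distrib_right[symmetric] \<rho>_sum[simplified])
  finally have 1: "\<bar>\<Sum>j=1..m. \<rho> j * (u n j - ?U n)\<bar> \<le> ?a * ?D" .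
  have "\<bar>(1 - ?a) * (?U n - (1 - ?a) ^ n)\<bar> \<le> 1 * \<bar>?U n - (1 - ?a) ^ n\<bar>"
    unfolding abs_mult using mean_defect_nonneg mean_defect_le_1 by (intro mult_right_mono) auto
  hence "\<bar>?U (Suc n) - (1 - ?a) ^ Suc n\<bar> \<le> n * (?a * ?D) + ?a * ?D"
    unfolding eq using 1 Suc
    by (intro order_trans[OF abs_triangle_ineq4 add_mono]) simp_all
  thus ?case by (simp add: algebra_simps)
qed

text \<open>For \<open>n\<close> of order \<open>v\<close> and a defect of order
  \<open>1 / v\<close> the right-hand side is of order \<open>1 / v\<close>. The exponent
  \<open>4 * N\<close> collects one factor \<open>c ^ (2 * N)\<close> from the weights of
  \<open>\<pi>\<close> and one from the oscillation.\<close>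

lemma kernel_iter_estimate:
  assumes "i \<in> {1..m}"
  shows "\<bar>u n i - (1 - mean_defect) ^ n\<bar>
    \<le> 2 * N * m / c ^ (4 * N) * mean_defect * (1 + n * mean_defect)"
proof -
  have "\<bar>u n i - (1 - mean_defect) ^ n\<bar> \<le> osc_bound + n * (mean_defect * osc_bound)"
    using u_near_mean[OF assms, of n] mean_near_power[of n] by linarith
  also have "osc_bound = 2 * N * m / c ^ (4 * N) * mean_defect"
    unfolding osc_bound_def step_defect_def by (simp add: power_add[symmetric])
  finally show ?thesis by (simp only: distrib_left mult_1_right mult.assoc mult.left_commute)
qed

end

section \<open>The Markov property\<close>

text \<open>Realized as the bind of a weighted counting measure, the mixture is a genuine measure,
  to which uniqueness by distribution functions can be applied.\<close>

lemma mixture_measure: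
  fixes w :: "nat \<Rightarrow> real" and N :: "nat \<Rightarrow> 'a measure"
  assumes fin: "finite I" and ne: "I \<noteq> {}" and w: "\<And>i. i \<in> I \<Longrightarrow> 0 \<le> w i"
    and N: "\<And>i. i \<in> I \<Longrightarrow> subprob_space (N i)" and sets: "\<And>i. i \<in> I \<Longrightarrow> sets (N i) = sets B"
  obtains \<nu> where "sets \<nu> = sets B"
    "\<And>f. f \<in> borel_measurable B \<Longrightarrow>
       (\<integral>\<^sup>+x. f x \<partial>\<nu>) = (\<Sum>i\<in>I. ennreal (w i) * (\<integral>\<^sup>+x. f x \<partial>N i))"
proof -
  define D where "D = density (count_space I) (\<lambda>i. ennreal (w i))"
  have N_meas: "N \<in> measurable D (subprob_algebra B)"
    unfolding D_def using N sets by (auto simp: space_subprob_algebra)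
  show ?thesis
  proof
    show "sets (D \<bind> N) = sets B"
      by (rule sets_bind) (use sets ne in \<open>auto simp: D_def\<close>)
    fix f :: "'a \<Rightarrow> ennreal" assume f: "f \<in> borel_measurable B"
    have "(\<integral>\<^sup>+x. f x \<partial>(D \<bind> N)) = (\<integral>\<^sup>+i. \<integral>\<^sup>+x. f x \<partial>N i \<partial>D)"
      by (rule nn_integral_bind[OF f N_meas])
    also have "\<dots> = (\<integral>\<^sup>+i. ennreal (w i) * (\<integral>\<^sup>+x. f x \<partial>N i) \<partial>count_space I)"
      unfolding D_def by (subst nn_integral_density) auto
    also have "\<dots> = (\<Sum>i\<in>I. ennreal (w i) * (\<integral>\<^sup>+x. f x \<partial>N i))"
      using fin by (simp add: nn_integral_count_space_finite)
    finally show "(\<integral>\<^sup>+x. f x \<partial>(D \<bind> N)) = (\<Sum>i\<in>I. ennreal (w i) * (\<integral>\<^sup>+x. f x \<partial>N i))" .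
  qed
qed

lemma space_phase_space: "space (phase_space m) = {1..m} \<times> {0..} \<times> {0, 1}"
  by (auto simp: phase_space_def space_pair_measure space_restrict_space)

lemma measurable_state: "fst \<in> measurable (phase_space m) (count_space {1..m})"
  and measurable_kappa: "(\<lambda>x. fst (snd x)) \<in> borel_measurable (phase_space m)"
  and measurable_zeta: "(\<lambda>x. snd (snd x)) \<in> measurable (phase_space m) (count_space {0, 1})"
proof -
  show "fst \<in> measurable (phase_space m) (count_space {1..m})"
    unfolding phase_space_def by measurable
  have "(\<lambda>x. fst (snd x)) \<in> measurable (phase_space m) (restrict_space borel {0..})"
    unfolding phase_space_def by measurable
  thus "(\<lambda>x. fst (snd x)) \<in> borel_measurable (phase_space m)"
    using measurable_restrict_space2_iff by blast
  show "(\<lambda>x. snd (snd x)) \<in> measurable (phase_space m) (count_space {0, 1})"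
    unfolding phase_space_def by measurable
qed

text \<open>Arbitrary \<open>g\<close> is admissible because the state space is discrete.\<close>

lemma measurable_from_state:
  assumes "f \<in> measurable M (phase_space m)"
  shows "(\<lambda>\<omega>. g (fst (f \<omega>)) :: 'b::topological_space) \<in> borel_measurable M"
proof -
  have "(\<lambda>\<omega>. fst (f \<omega>)) \<in> measurable M (count_space {1..m})"
    by (rule measurable_compose[OF assms measurable_state])
  thus ?thesis by (rule measurable_compose) simp
qed

lemma borel_measurable_kappa:
  "f \<in> measurable M (phase_space m) \<Longrightarrow> (\<lambda>\<omega>. fst (snd (f \<omega>))) \<in> borel_measurable M"
  using measurable_compose[OF _ measurable_kappa] .

section \<open>Transforms of the step kernels\<close>

definition laplace_kernel :: "(nat \<Rightarrow> (nat \<times> real \<times> nat) measure) \<Rightarrow> real \<Rightarrow> nat \<Rightarrow> nat \<Rightarrow> real" where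
  "laplace_kernel K s i j = (LINT x|K i. indicator {j} (fst x) * exp (- s * fst (snd x)))"

definition state_laplace :: "(nat \<Rightarrow> (nat \<times> real \<times> nat) measure) \<Rightarrow> real \<Rightarrow> nat \<Rightarrow> real" where
  "state_laplace K s i = (LINT x|K i. exp (- s * fst (snd x)))"

locale step_kernel =
  fixes m :: nat and K :: "nat \<Rightarrow> (nat \<times> real \<times> nat) measure"
  assumes kernel: "semi_markov_kernel m K" and m: "m \<ge> 1"
begin

lemma prob_space_K: "i \<in> {1..m} \<Longrightarrow> prob_space (K i)"
  and sets_K: "i \<in> {1..m} \<Longrightarrow> sets (K i) = sets (phase_space m)"
  using kernel unfolding semi_markov_kernel_def by auto

lemma space_K: "i \<in> {1..m} \<Longrightarrow> space (K i) = {1..m} \<times> {0..} \<times> {0, 1}"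
  using sets_eq_imp_space_eq[OF sets_K] space_phase_space by simp

lemma measurable_K: "i \<in> {1..m} \<Longrightarrow> f \<in> measurable (phase_space m) B \<Longrightarrow> f \<in> measurable (K i) B"
  using measurable_cong_sets[OF sets_K refl] by blast

lemma measurable_state_K:
  "i \<in> {1..m} \<Longrightarrow> (\<lambda>x. f (fst x)::real) \<in> borel_measurable (K i)"
  by (rule measurable_K, assumption, rule measurable_from_state[where f="\<lambda>x. x" and m=m]) simp

lemma measurable_kappa_K[simp]:
  "i \<in> {1..m} \<Longrightarrow> (\<lambda>x. fst (snd x)) \<in> borel_measurable (K i)"
  by (rule measurable_K[OF _ measurable_kappa])

lemma mem_space_K: "i \<in> {1..m} \<Longrightarrow>
    x \<in> space (K i) \<longleftrightarrow> fst x \<in> {1..m} \<and> 0 \<le> fst (snd x) \<and> snd (snd x) \<in> {0, 1}"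
  by (simp add: space_K mem_Times_iff)

lemma kappa_nonneg: "i \<in> {1..m} \<Longrightarrow> x \<in> space (K i) \<Longrightarrow> 0 \<le> fst (snd x)"
  using mem_space_K by blast

lemma integrable_laplace_kernel:
  assumes i: "i \<in> {1..m}" and s: "0 \<le> s"
  shows "integrable (K i) (\<lambda>x. indicator {j} (fst x) * exp (- s * fst (snd x)) :: real)"
proof -
  interpret prob_space "K i" by (rule prob_space_K[OF i])
  have "AE x in K i. norm (indicator {j} (fst x) * exp (- s * fst (snd x)) :: real) \<le> 1"
    using s kappa_nonneg[OF i] by (auto intro!: AE_I2 simp: indicator_def)
  moreover have "(\<lambda>x. indicator {j} (fst x) * exp (- s * fst (snd x)) :: real) \<in> borel_measurable (K i)"
    using measurable_kappa_K[OF i] measurable_state_K[OF i, of "indicator {j}"] by measurable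
  ultimately show ?thesis by (rule integrable_const_bound)
qed

lemma laplace_kernel_nonneg: "0 \<le> laplace_kernel K s i j"
  unfolding laplace_kernel_def by simp

lemma laplace_kernel_antimono:
  assumes "i \<in> {1..m}" "0 \<le> s" "s \<le> t"
  shows "laplace_kernel K t i j \<le> laplace_kernel K s i j"
  unfolding laplace_kernel_def
  using assms kappa_nonneg
  by (intro integral_mono integrable_laplace_kernel) (auto simp: indicator_def intro!: mult_right_mono)

lemma laplace_kernel_sum:
  assumes i: "i \<in> {1..m}" and s: "0 \<le> s"
  shows "(\<Sum>j=1..m. laplace_kernel K s i j) = state_laplace K s i"
proof -
  have "(\<Sum>j=1..m. laplace_kernel K s i j)
      = (LINT x|K i. (\<Sum>j=1..m. indicator {j} (fst x) * exp (- s * fst (snd x))))"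
    unfolding laplace_kernel_def using integrable_laplace_kernel[OF i s] by (subst Bochner_Integration.integral_sum) auto
  also have "\<dots> = state_laplace K s i"
    unfolding state_laplace_def
  proof (intro Bochner_Integration.integral_cong refl)
    fix x assume "x \<in> space (K i)"
    hence "fst x \<in> {1..m}" using mem_space_K[OF i] by blast
    thus "(\<Sum>j=1..m. indicator {j} (fst x) * exp (- s * fst (snd x))) = exp (- s * fst (snd x))"
      by (subst sum_distrib_right[symmetric]) (simp add: indicator_def of_bool_def)
  qed
  finally show ?thesis .
qed

lemma laplace_kernel_0:
  assumes i: "i \<in> {1..m}" and j: "j \<in> {1..m}"
  shows "laplace_kernel K 0 i j = trans_prob K i j"
proof -
  interpret prob_space "K i" by (rule prob_space_K[OF i])
  have sing: "{j} \<times> {0..} \<times> {z} \<in> sets (K i)" if "z \<in> {0, 1}" for z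
  proof -
    have "{0::real..} \<in> sets (restrict_space borel {0..})"
      by (simp add: sets_restrict_space_iff)
    thus ?thesis unfolding sets_K[OF i] phase_space_def using j that
      by (intro pair_measureI) auto
  qed
  have "laplace_kernel K 0 i j = (LINT x|K i. indicator ({j} \<times> {0..} \<times> {0} \<union> {j} \<times> {0..} \<times> {1}) x)"
    unfolding laplace_kernel_def
    by (intro Bochner_Integration.integral_cong refl)
      (simp add: mem_space_K[OF i] indicator_def mem_Times_iff, blast)
  also have "\<dots> = prob ({j} \<times> {0..} \<times> {0} \<union> {j} \<times> {0..} \<times> {1})"
    using sing[of 0] sing[of 1] by (simp add: Int_absorb2 sets.sets_into_space)
  also have "\<dots> = trans_prob K i j"
    unfolding trans_prob_def kernel_Q_inf_def using sing
    by (subst finite_measure_Union) auto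
  finally show ?thesis .
qed

lemma trans_prob_sum: "i \<in> {1..m} \<Longrightarrow> (\<Sum>j=1..m. trans_prob K i j) = 1"
  using laplace_kernel_sum[of i 0] prob_space.prob_space[OF prob_space_K[of i]]
  by (simp add: laplace_kernel_0 state_laplace_def)

lemma state_laplace_bounds:
  assumes i: "i \<in> {1..m}" and s: "0 \<le> s"
  shows "0 < state_laplace K s i" "state_laplace K s i \<le> 1"
proof -
  interpret prob_space "K i" by (rule prob_space_K[OF i])
  have int: "integrable (K i) (\<lambda>x. exp (- s * fst (snd x)))"
    using s kappa_nonneg[OF i] measurable_kappa_K[OF i]
    by (intro integrable_const_bound[of _ 1]) (auto intro!: AE_I2)
  show "0 < state_laplace K s i"
    unfolding state_laplace_def
    using int by (rule integral_less_AE_space[of "\<lambda>_. 0", simplified]) (auto simp: emeasure_space_1)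
  show "state_laplace K s i \<le> 1"
    unfolding state_laplace_def
    by (rule integral_le_const[OF int]) (use s kappa_nonneg[OF i] in \<open>auto intro!: AE_I2\<close>)
qed

text \<open>Dominated convergence with the bound 1. Continuity in the frequency is what makes it
  possible to pick a frequency with a prescribed defect.\<close>

lemma continuous_state_laplace:
  assumes i: "i \<in> {1..m}"
  shows "continuous_on {0..} (\<lambda>s. state_laplace K s i)"
  unfolding state_laplace_def continuous_on_sequentially
proof (safe, unfold o_def)
  interpret prob_space "K i" by (rule prob_space_K[OF i])
  fix x :: "nat \<Rightarrow> real" and a
  assume x: "\<forall>n. x n \<in> {0..}" "x \<longlonglongrightarrow> a"
  show "(\<lambda>n. LINT y|K i. exp (- x n * fst (snd y))) \<longlonglongrightarrow> (LINT y|K i. exp (- a * fst (snd y)))"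
  proof (rule integral_dominated_convergence[where w="\<lambda>_. 1"])
    show "AE y in K i. (\<lambda>n. exp (- x n * fst (snd y))) \<longlonglongrightarrow> exp (- a * fst (snd y))"
      using x by (intro AE_I2 tendsto_intros)
    show "AE y in K i. norm (exp (- x n * fst (snd y))) \<le> 1" for n
      using x kappa_nonneg[OF i] by (auto intro!: AE_I2)
  qed (use measurable_kappa_K[OF i] in auto)
qed

text \<open>Of \<open>D\<close> only the distribution function is given. The mixture of the step
  laws with weights \<open>\<pi>\<close> has the same one, so it equals \<open>D\<close>, and both
  claims can be read off the mixture.\<close>

lemma expectation_averaged_step_cdf:
  assumes \<pi>: "\<And>i. i \<in> {1..m} \<Longrightarrow> 0 \<le> \<pi> i" "(\<Sum>i=1..m. \<pi> i) = 1"
    and D: "real_distribution D" "cdf D = averaged_step_cdf m K \<pi>"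
  shows "AE x in D. 0 \<le> x"
    and "0 \<le> s \<Longrightarrow> laplace_transform D s = (\<Sum>i=1..m. \<pi> i * state_laplace K s i)"
proof -
  interpret D: real_distribution D by fact
  define L where "L i = distr (K i) borel (\<lambda>x. fst (snd x))" for i
  have L: "prob_space (L i)" "sets (L i) = sets borel" if "i \<in> {1..m}" for i
    unfolding L_def using prob_space.prob_space_distr[OF prob_space_K[OF that] measurable_kappa_K[OF that]] by auto
  obtain \<nu> where \<nu>: "sets \<nu> = sets (borel::real measure)"
    and int: "\<And>f. f \<in> borel_measurable (borel::real measure) \<Longrightarrow>
       (\<integral>\<^sup>+x. f x \<partial>\<nu>) = (\<Sum>i\<in>{1..m}. ennreal (\<pi> i) * (\<integral>\<^sup>+x. f x \<partial>L i))"
    by (rule mixture_measure[of "{1..m}" \<pi> L borel])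
      (use \<pi> L m in \<open>auto intro: prob_space_imp_subprob_space\<close>)
  have em: "emeasure \<nu> A = ennreal (\<Sum>i\<in>{1..m}. \<pi> i * measure (L i) A)" if A: "A \<in> sets borel" for A
  proof -
    have "emeasure \<nu> A = (\<Sum>i\<in>{1..m}. ennreal (\<pi> i) * emeasure (L i) A)"
      using int[of "indicator A"] A \<nu> L by simp
    also have "\<dots> = (\<Sum>i\<in>{1..m}. ennreal (\<pi> i * measure (L i) A))"
      using L \<pi> by (intro sum.cong refl)
        (simp add: ennreal_mult finite_measure.emeasure_eq_measure prob_space.finite_measure)
    also have "\<dots> = ennreal (\<Sum>i\<in>{1..m}. \<pi> i * measure (L i) A)"
      using \<pi> by (intro sum_ennreal) auto
    finally show ?thesis .
  qed
  have me: "measure \<nu> A = (\<Sum>i\<in>{1..m}. \<pi> i * measure (L i) A)" if "A \<in> sets borel" for A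
    unfolding measure_def[of \<nu>] em[OF that] using \<pi> by (intro enn2real_ennreal sum_nonneg) auto
  have sp: "space \<nu> = UNIV" "\<And>i. i \<in> {1..m} \<Longrightarrow> space (L i) = UNIV"
    using sets_eq_imp_space_eq[OF \<nu>] by (auto simp: L_def)
  have "emeasure \<nu> (space \<nu>) = 1"
    unfolding sp(1) using em[of UNIV] \<pi>(2) prob_space.prob_space[OF L(1)] sp(2) by simp
  hence "prob_space \<nu>" by (rule prob_spaceI)
  then interpret \<nu>: real_distribution \<nu>
    using \<nu> unfolding real_distribution_def real_distribution_axioms_def by auto
  have "cdf \<nu> = cdf D"
  proof
    fix t
    have "measure (L i) {..t} = step_cdf K i t" if "i \<in> {1..m}" for i
      unfolding L_def step_cdf_def using measurable_kappa_K[OF that]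
      by (subst measure_distr) (auto simp: vimage_def Int_def intro!: arg_cong[where f="measure (K i)"])
    thus "cdf \<nu> t = cdf D t" using me[of "{..t}"]
      by (simp add: D(2) cdf_def2 averaged_step_cdf_def)
  qed
  hence eq: "\<nu> = D" by (intro cdf_unique) (unfold_locales)
  have L_nonneg: "measure (L i) {..<0} = 0" if "i \<in> {1..m}" for i
  proof -
    have "measure (L i) {..<0} = measure (K i) ((\<lambda>x. fst (snd x)) -` {..<0} \<inter> space (K i))"
      unfolding L_def using measurable_kappa_K[OF that] by (subst measure_distr) auto
    also have "(\<lambda>x. fst (snd x)) -` {..<0} \<inter> space (K i) = {}"
      using kappa_nonneg[OF that] by (force simp: not_le)
    finally show ?thesis by simp
  qed
  have "measure D {..<0} = 0" using me[of "{..<0}"] L_nonneg eq by simp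
  hence "emeasure D {..<0} = 0" by (simp add: D.emeasure_eq_measure)
  hence "{..<0} \<in> null_sets D" by (simp add: null_sets_def)
  thus AE: "AE x in D. 0 \<le> x" by (rule AE_I') auto
  assume s: "0 \<le> s"
  have "ennreal (laplace_transform D s) = (\<integral>\<^sup>+x. ennreal (exp (- s * x)) \<partial>D)"
    unfolding laplace_transform_def using AE s
    by (intro nn_integral_eq_integral[symmetric] D.integrable_const_bound[of _ 1]) (auto elim!: eventually_mono)
  also have "\<dots> = (\<Sum>i\<in>{1..m}. ennreal (\<pi> i) * (\<integral>\<^sup>+x. ennreal (exp (- s * x)) \<partial>L i))"
    unfolding eq[symmetric] by (rule int) auto
  also have "\<dots> = (\<Sum>i\<in>{1..m}. ennreal (\<pi> i * state_laplace K s i))"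
  proof (intro sum.cong refl)
    fix i assume i: "i \<in> {1..m}"
    interpret Ki: prob_space "K i" by (rule prob_space_K[OF i])
    have "(\<integral>\<^sup>+x. ennreal (exp (- s * x)) \<partial>L i) = (\<integral>\<^sup>+x. ennreal (exp (- s * fst (snd x))) \<partial>K i)"
      unfolding L_def using measurable_kappa_K[OF i] by (subst nn_integral_distr) auto
    also have "\<dots> = ennreal (state_laplace K s i)"
      unfolding state_laplace_def using s kappa_nonneg[OF i] measurable_kappa_K[OF i]
      by (intro nn_integral_eq_integral Ki.integrable_const_bound[of _ 1]) (auto intro!: AE_I2)
    finally show "ennreal (\<pi> i) * (\<integral>\<^sup>+x. ennreal (exp (- s * x)) \<partial>L i) = ennreal (\<pi> i * state_laplace K s i)"
      using \<pi>(1)[OF i] state_laplace_bounds[OF i s] by (simp add: ennreal_mult)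
  qed
  also have "\<dots> = ennreal (\<Sum>i=1..m. \<pi> i * state_laplace K s i)"
    using \<pi> state_laplace_bounds[OF _ s]
    by (intro sum_ennreal mult_nonneg_nonneg) (auto intro: less_imp_le)
  finally show "laplace_transform D s = (\<Sum>i=1..m. \<pi> i * state_laplace K s i)"
    using \<pi> state_laplace_bounds[OF _ s]
    by (subst (asm) ennreal_inj) (auto intro!: sum_nonneg mult_nonneg_nonneg intro: less_imp_le simp: laplace_transform_def)
qed

end

section \<open>The Markov property tested against bounded functionals of the past\<close>

locale markov_renewal = markov_renewal_process m K q M X + step_kernel m K
  for m K q and M :: "'w measure" and X
begin

abbreviation \<eta> :: "nat \<Rightarrow> 'w \<Rightarrow> nat" where "\<eta> n \<omega> \<equiv> fst (X n \<omega>)"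
abbreviation \<kappa> :: "nat \<Rightarrow> 'w \<Rightarrow> real" where "\<kappa> n \<omega> \<equiv> fst (snd (X n \<omega>))"

lemma X_space: "\<omega> \<in> space M \<Longrightarrow> X n \<omega> \<in> {1..m} \<times> {0..} \<times> {0, 1}"
  using measurable_space[OF measurable_X] space_phase_space by blast

lemma \<eta>_in: "\<omega> \<in> space M \<Longrightarrow> \<eta> n \<omega> \<in> {1..m}" and \<kappa>_nonneg: "\<omega> \<in> space M \<Longrightarrow> 0 \<le> \<kappa> n \<omega>"
  using X_space[of \<omega> n] by auto

lemma space_history[simp]: "space (history m M X n) = space M"
  by (simp add: history_def)

lemma restrict_measurable: "(\<lambda>\<omega>. \<lambda>k\<in>{..n}. X k \<omega>) \<in> measurable M (\<Pi>\<^sub>M k\<in>{..n}. phase_space m)"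
  using measurable_X by measurable

lemma subalgebra_history: "subalgebra M (history m M X n)"
  unfolding subalgebra_def
proof
  show "sets (history m M X n) \<subseteq> sets M"
    unfolding history_def using measurable_sets[OF restrict_measurable]
    by (auto simp: sets_vimage_algebra2 measurable_space[OF restrict_measurable] Pi_iff)
qed simp

lemma X_history:
  assumes "k \<le> n"
  shows "X k \<in> measurable (history m M X n) (phase_space m)"
proof -
  have "(\<lambda>\<omega>. \<lambda>k\<in>{..n}. X k \<omega>) \<in> measurable (history m M X n) (\<Pi>\<^sub>M k\<in>{..n}. phase_space m)"
    unfolding history_def using measurable_space[OF restrict_measurable]
    by (intro measurable_vimage_algebra1) auto
  moreover have "(\<lambda>f. f k) \<in> measurable (\<Pi>\<^sub>M k\<in>{..n}. phase_space m) (phase_space m)"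
    using assms by (intro measurable_component_singleton) auto
  ultimately have "(\<lambda>\<omega>. (\<lambda>k\<in>{..n}. X k \<omega>) k) \<in> measurable (history m M X n) (phase_space m)"
    by (rule measurable_compose)
  thus ?thesis using assms by simp
qed

lemma history_mono:
  assumes "k \<le> n" "H \<in> borel_measurable (history m M X k)"
  shows "H \<in> borel_measurable (history m M X n)"
proof -
  have "(\<lambda>\<omega>. \<lambda>j\<in>{..k}. X j \<omega>) \<in> measurable (history m M X n) (\<Pi>\<^sub>M j\<in>{..k}. phase_space m)"
    using X_history assms(1) by (intro measurable_restrict) auto
  hence "id \<in> measurable (history m M X n) (vimage_algebra (space M) (\<lambda>\<omega>. \<lambda>j\<in>{..k}. X j \<omega>) (\<Pi>\<^sub>M j\<in>{..k}. phase_space m))"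
    by (intro measurable_vimage_algebra2) auto
  from measurable_compose[OF this] assms(2) show ?thesis by (simp add: history_def)
qed

lemma history_measurable:
  "H \<in> borel_measurable (history m M X n) \<Longrightarrow> H \<in> borel_measurable M"
  by (rule measurable_from_subalg[OF subalgebra_history])

lemma integrable_weighted:
  assumes H: "H \<in> borel_measurable M" "\<And>\<omega>. \<omega> \<in> space M \<Longrightarrow> 0 \<le> H \<omega> \<and> H \<omega> \<le> (C::real)"
    and g: "g \<in> borel_measurable M" "\<And>\<omega>. \<omega> \<in> space M \<Longrightarrow> 0 \<le> g \<omega> \<and> g \<omega> \<le> (1::real)"
  shows "integrable M (\<lambda>\<omega>. H \<omega> * g \<omega>)"
proof (rule integrable_const_bound[of _ C])
  have "H \<omega> * g \<omega> \<le> C" if "\<omega> \<in> space M" for \<omega>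
    using mult_mono[of "H \<omega>" C "g \<omega>" 1] H(2)[OF that] g(2)[OF that] by auto
  thus "AE \<omega> in M. norm (H \<omega> * g \<omega>) \<le> C" using H(2) g(2) by (intro AE_I2) auto
qed (use H(1) g(1) in measurable)

text \<open>The defining property of the conditional expectation, with a bounded functional
  \<open>H\<close> of the past in place of the indicator of a past event.\<close>

lemma transition_integral:
  assumes H: "H \<in> borel_measurable (history m M X n)" "\<And>\<omega>. \<omega> \<in> space M \<Longrightarrow> 0 \<le> H \<omega> \<and> H \<omega> \<le> (C::real)"
    and j: "j \<in> {1..m}" and t: "0 \<le> t" and z: "z \<in> {0, 1}"
  shows "(LINT \<omega>|M. H \<omega> * indicator {\<omega> \<in> space M. \<eta> (Suc n) \<omega> = j \<and> \<kappa> (Suc n) \<omega> \<le> t \<and> snd (snd (X (Suc n) \<omega>)) = z} \<omega>)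
    = (LINT \<omega>|M. H \<omega> * kernel_Q K (\<eta> n \<omega>) j t z)"
proof -
  interpret F: finite_measure_subalgebra M "history m M X n"
    using subalgebra_history by unfold_locales
  let ?A = "{\<omega> \<in> space M. \<eta> (Suc n) \<omega> = j \<and> \<kappa> (Suc n) \<omega> \<le> t \<and> snd (snd (X (Suc n) \<omega>)) = z}"
  have meas: "(\<lambda>\<omega>. \<eta> (Suc n) \<omega>) \<in> measurable M (count_space {1..m})"
    "(\<lambda>\<omega>. \<kappa> (Suc n) \<omega>) \<in> borel_measurable M"
    "(\<lambda>\<omega>. snd (snd (X (Suc n) \<omega>))) \<in> measurable M (count_space {0,1})"
    using measurable_X measurable_state measurable_kappa measurable_zeta measurable_compose by blast+
  have "\<eta> (Suc n) -` {j} \<inter> space M \<in> sets M" "(\<lambda>\<omega>. snd (snd (X (Suc n) \<omega>))) -` {z} \<inter> space M \<in> sets M"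
    "\<kappa> (Suc n) -` {..t} \<inter> space M \<in> sets M"
    using j z by (auto intro!: measurable_sets[OF meas(1)] measurable_sets[OF meas(2)] measurable_sets[OF meas(3)])
  hence "(\<eta> (Suc n) -` {j} \<inter> space M) \<inter> ((\<lambda>\<omega>. snd (snd (X (Suc n) \<omega>))) -` {z} \<inter> space M)
      \<inter> (\<kappa> (Suc n) -` {..t} \<inter> space M) \<in> sets M" by blast
  also have "(\<eta> (Suc n) -` {j} \<inter> space M) \<inter> ((\<lambda>\<omega>. snd (snd (X (Suc n) \<omega>))) -` {z} \<inter> space M)
      \<inter> (\<kappa> (Suc n) -` {..t} \<inter> space M) = ?A" by auto
  finally have A[measurable]: "?A \<in> sets M" .
  have [measurable]: "H \<in> borel_measurable M" by (rule history_measurable[OF H(1)])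
  have int: "integrable M (\<lambda>\<omega>. H \<omega> * indicat_real ?A \<omega>)"
    by (rule integrable_weighted[OF _ H(2)]) (auto simp: indicator_def)
  have "(LINT \<omega>|M. H \<omega> * indicator ?A \<omega>) = (LINT \<omega>|M. H \<omega> * real_cond_exp M (history m M X n) (indicat_real ?A) \<omega>)"
    by (rule F.real_cond_exp_intg(2)[OF int H(1), symmetric]) measurable
  also have "\<dots> = (LINT \<omega>|M. H \<omega> * kernel_Q K (\<eta> n \<omega>) j t z)"
    using transition[OF j t z, of n] measurable_from_state[OF measurable_X, of "\<lambda>i. kernel_Q K i j t z"]
    by (intro integral_cong_AE) auto
  finally show ?thesis .
qed

lemma integral_by_state:
  assumes H: "H \<in> borel_measurable M" "\<And>\<omega>. \<omega> \<in> space M \<Longrightarrow> 0 \<le> H \<omega> \<and> H \<omega> \<le> (C::real)"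
  shows "(LINT \<omega>|M. H \<omega> * g (\<eta> n \<omega>)) = (\<Sum>i=1..m. (LINT \<omega>|M. H \<omega> * indicator {i} (\<eta> n \<omega>)) * g i)"
proof -
  have ind: "(\<lambda>\<omega>. indicator {i} (\<eta> n \<omega>) :: real) \<in> borel_measurable M" for i
    by (rule measurable_from_state[OF measurable_X])
  have int: "integrable M (\<lambda>\<omega>. H \<omega> * indicator {i} (\<eta> n \<omega>))" for i
    by (rule integrable_weighted[OF H _ _])
      (simp, rule ind, simp add: indicator_def)
  have "(LINT \<omega>|M. H \<omega> * g (\<eta> n \<omega>)) = (LINT \<omega>|M. (\<Sum>i=1..m. H \<omega> * indicator {i} (\<eta> n \<omega>) * g i))"
  proof (intro Bochner_Integration.integral_cong refl)
    fix \<omega> assume "\<omega> \<in> space M"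
    hence "\<eta> n \<omega> \<in> {1..m}" by (rule \<eta>_in)
    thus "H \<omega> * g (\<eta> n \<omega>) = (\<Sum>i=1..m. H \<omega> * indicator {i} (\<eta> n \<omega>) * g i)"
      by (simp add: indicator_def of_bool_def mult.assoc if_distrib if_distribR cong: if_cong)
  qed
  also have "\<dots> = (\<Sum>i=1..m. (LINT \<omega>|M. H \<omega> * indicator {i} (\<eta> n \<omega>)) * g i)"
    using int by (subst Bochner_Integration.integral_sum) auto
  finally show ?thesis .
qed

text \<open>The transition law is prescribed only on rectangles reaching up to some
  \<open>t\<close>. As functionals of \<open>f\<close> both sides are integrals against finite
  measures on the line; these have the same distribution function and hence agree for every
  \<open>f\<close>.\<close>

lemma step_measure:
  assumes H: "H \<in> borel_measurable (history m M X n)" "\<And>\<omega>. \<omega> \<in> space M \<Longrightarrow> 0 \<le> H \<omega> \<and> H \<omega> \<le> (C::real)"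
    and j: "j \<in> {1..m}" and f: "f \<in> borel_measurable (borel :: real measure)"
  shows "(\<integral>\<^sup>+\<omega>. ennreal (H \<omega> * indicator {j} (\<eta> (Suc n) \<omega>)) * f (\<kappa> (Suc n) \<omega>) \<partial>M)
    = (\<Sum>i=1..m. ennreal (LINT \<omega>|M. H \<omega> * indicator {i} (\<eta> n \<omega>))
         * (\<integral>\<^sup>+x. indicator {j} (fst x) * f (fst (snd x)) \<partial>K i))"
proof -
  have [measurable]: "(\<lambda>\<omega>. indicator {i} (\<eta> k \<omega>) :: real) \<in> borel_measurable M" 
    "\<kappa> k \<in> borel_measurable M" for i k
    using measurable_from_state[OF measurable_X] borel_measurable_kappa[OF measurable_X] by auto
  have [measurable]: "H \<in> borel_measurable M" by (rule history_measurable[OF H(1)])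
  have C: "0 \<le> C" using not_empty H(2) by (metis ex_in_conv order_trans)
  have intH: "integrable M (\<lambda>\<omega>. H \<omega> * indicator B \<omega> :: real)" if "B \<in> sets M" for B
    by (rule integrable_weighted[OF _ H(2)]) (use that in \<open>auto simp: indicator_def\<close>)
  define w where "w i = (LINT \<omega>|M. H \<omega> * indicator {i} (\<eta> n \<omega>))" for i
  have w: "0 \<le> w i" for i unfolding w_def using H(2) by (intro Bochner_Integration.integral_nonneg) simp
  have [measurable]: "(\<lambda>x. indicator {j} (fst x) :: ennreal) \<in> borel_measurable (K i)"
    "(\<lambda>x. fst (snd x)) \<in> borel_measurable (K i)" if "i \<in> {1..m}" for i
    by (rule measurable_K[OF that measurable_from_state[where f="\<lambda>x. x" and m=m]], simp)
      (rule measurable_kappa_K[OF that])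
  define D where "D = density M (\<lambda>\<omega>. ennreal (H \<omega> * indicator {j} (\<eta> (Suc n) \<omega>)))"
  define \<mu>1 where "\<mu>1 = distr D borel (\<kappa> (Suc n))"
  have \<kappa>D: "\<kappa> (Suc n) \<in> borel_measurable D" unfolding D_def by measurable
  define L where "L i = distr (density (K i) (\<lambda>x. indicator {j} (fst x))) borel (\<lambda>x. fst (snd x))" for i
  have L_int: "(\<integral>\<^sup>+x. g x \<partial>L i) = (\<integral>\<^sup>+x. indicator {j} (fst x) * g (fst (snd x)) \<partial>K i)"
    if i: "i \<in> {1..m}" and [measurable]: "g \<in> borel_measurable (borel::real measure)" for i g
    using \<open>i \<in> {1..m}\<close> unfolding L_def by (simp add: nn_integral_distr nn_integral_density)
  have L_sub: "subprob_space (L i)" if i: "i \<in> {1..m}" for i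
  proof (rule subprob_spaceI)
    interpret Ki: prob_space "K i" by (rule prob_space_K[OF i])
    have "emeasure (L i) (space (L i)) = (\<integral>\<^sup>+x. 1 \<partial>L i)" by simp
    also have "\<dots> = (\<integral>\<^sup>+x. indicator {j} (fst x) \<partial>K i)" using i by (subst L_int) auto
    also have "\<dots> \<le> (\<integral>\<^sup>+x. 1 \<partial>K i)" by (intro nn_integral_mono) (auto simp: indicator_def)
    finally show "emeasure (L i) (space (L i)) \<le> 1" by (simp add: Ki.emeasure_space_1)
    show "space (L i) \<noteq> {}" by (simp add: L_def)
  qed
  obtain \<mu>2 where \<mu>2: "sets \<mu>2 = sets (borel::real measure)"
    and int2: "\<And>f. f \<in> borel_measurable (borel::real measure) \<Longrightarrow>
       (\<integral>\<^sup>+x. f x \<partial>\<mu>2) = (\<Sum>i\<in>{1..m}. ennreal (w i) * (\<integral>\<^sup>+x. f x \<partial>L i))"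
    by (rule mixture_measure[of "{1..m}" w L borel]) (use w L_sub m in \<open>auto simp: L_def\<close>)
  have int1: "(\<integral>\<^sup>+x. g x \<partial>\<mu>1) = (\<integral>\<^sup>+\<omega>. ennreal (H \<omega> * indicator {j} (\<eta> (Suc n) \<omega>)) * g (\<kappa> (Suc n) \<omega>) \<partial>M)"
    if "g \<in> borel_measurable borel" for g
    unfolding \<mu>1_def using that \<kappa>D by (subst nn_integral_distr) (auto simp: D_def nn_integral_density)
  have em1: "emeasure \<mu>1 {..t} = ennreal (LINT \<omega>|M. H \<omega> * indicator {\<omega>\<in>space M. \<eta> (Suc n) \<omega> = j \<and> \<kappa> (Suc n) \<omega> \<le> t} \<omega>)" for t
  proof -
    have A: "{\<omega>\<in>space M. \<eta> (Suc n) \<omega> = j \<and> \<kappa> (Suc n) \<omega> \<le> t} \<in> sets M"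
    proof -
      have "{\<omega>\<in>space M. indicator {j} (\<eta> (Suc n) \<omega>) = (1::real) \<and> \<kappa> (Suc n) \<omega> \<le> t} \<in> sets M" by measurable
      thus ?thesis by (simp add: indicator_eq_1_iff)
    qed
    have "emeasure \<mu>1 {..t} = (\<integral>\<^sup>+x. indicator {..t} x \<partial>\<mu>1)" by (simp add: \<mu>1_def)
    also have "\<dots> = (\<integral>\<^sup>+\<omega>. ennreal (H \<omega> * indicator {\<omega>\<in>space M. \<eta> (Suc n) \<omega> = j \<and> \<kappa> (Suc n) \<omega> \<le> t} \<omega>) \<partial>M)"
      by (subst int1) (auto intro!: nn_integral_cong simp: indicator_def)
    also have "\<dots> = ennreal (LINT \<omega>|M. H \<omega> * indicator {\<omega>\<in>space M. \<eta> (Suc n) \<omega> = j \<and> \<kappa> (Suc n) \<omega> \<le> t} \<omega>)"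
      using intH[OF A] H(2) by (intro nn_integral_eq_integral) auto
    finally show ?thesis .
  qed
  have em2: "emeasure \<mu>2 {..t} = (\<Sum>i\<in>{1..m}. ennreal (w i) * emeasure (L i) {..t})" for t
    using int2[of "indicator {..t}"] \<mu>2 by (simp add: L_def)
  have em_eq: "emeasure \<mu>1 {..t} = emeasure \<mu>2 {..t}" for t
  proof (cases "0 \<le> t")
    \<comment> \<open>The transition hypothesis covers only \<open>t \<ge> 0\<close>; below 0 both
      measures vanish because durations are non-negative.\<close>
    case False
    have 1: "(LINT \<omega>|M. H \<omega> * indicator {\<omega>\<in>space M. \<eta> (Suc n) \<omega> = j \<and> \<kappa> (Suc n) \<omega> \<le> t} \<omega>) = 0"
      using \<kappa>_nonneg[of _ "Suc n"] False by (intro integral_eq_zero_AE AE_I2) (force simp: indicator_def)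
    have "emeasure (L i) {..t} = 0" if i: "i \<in> {1..m}" for i
    proof -
      have "emeasure (L i) {..t} = (\<integral>\<^sup>+x. indicator {j} (fst x) * indicator {..t} (fst (snd x)) \<partial>K i)"
        using L_int[OF i, of "indicator {..t}"] by (simp add: L_def)
      also have "\<dots> = (\<integral>\<^sup>+x. 0 \<partial>K i)" using kappa_nonneg[OF i] False
        by (intro nn_integral_cong) (force simp: indicator_def)
      finally show ?thesis by simp
    qed
    thus ?thesis unfolding em1 em2 1 by simp
  next
    case True
    have sets: "{j} \<times> {0..t} \<times> {z} \<in> sets (K i)" if "z \<in> {0, 1}" "i \<in> {1..m}" for z i
    proof -
      have "{0..t} \<in> sets (restrict_space borel {0..})" by (simp add: sets_restrict_space_iff)
      thus ?thesis unfolding sets_K[OF that(2)] phase_space_def using j that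
        by (intro pair_measureI) auto
    qed
    have L_em: "emeasure (L i) {..t} = ennreal (kernel_Q K i j t 0 + kernel_Q K i j t 1)" if i: "i \<in> {1..m}" for i
    proof -
      interpret Ki: prob_space "K i" by (rule prob_space_K[OF i])
      have "emeasure (L i) {..t} = (\<integral>\<^sup>+x. indicator {j} (fst x) * indicator {..t} (fst (snd x)) \<partial>K i)"
        using L_int[OF i, of "indicator {..t}"] by (simp add: L_def)
      also have "\<dots> = (\<integral>\<^sup>+x. indicator ({j} \<times> {0..t} \<times> {0} \<union> {j} \<times> {0..t} \<times> {1}) x \<partial>K i)"
        by (intro nn_integral_cong) (auto simp: mem_space_K[OF i] indicator_def mem_Times_iff)
      also have "\<dots> = emeasure (K i) ({j} \<times> {0..t} \<times> {0} \<union> {j} \<times> {0..t} \<times> {1})"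
        using sets[OF _ i] by (subst nn_integral_indicator) auto
      also have "\<dots> = ennreal (kernel_Q K i j t 0 + kernel_Q K i j t 1)"
        unfolding Ki.emeasure_eq_measure kernel_Q_def using sets[OF _ i]
        by (subst Ki.finite_measure_Union) auto
      finally show ?thesis .
    qed
    let ?A = "\<lambda>z. {\<omega> \<in> space M. \<eta> (Suc n) \<omega> = j \<and> \<kappa> (Suc n) \<omega> \<le> t \<and> snd (snd (X (Suc n) \<omega>)) = z}"
    let ?B = "{\<omega>\<in>space M. \<eta> (Suc n) \<omega> = j \<and> \<kappa> (Suc n) \<omega> \<le> t}"
    have zM: "(\<lambda>\<omega>. snd (snd (X (Suc n) \<omega>))) \<in> measurable M (count_space {0,1})"
      using measurable_compose[OF measurable_X measurable_zeta] .
    have A: "?A z \<in> sets M" if "z \<in> {0,1}" for z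
    proof -
      have "{\<omega>\<in>space M. indicator {j} (\<eta> (Suc n) \<omega>) = (1::real) \<and> \<kappa> (Suc n) \<omega> \<le> t} \<inter> 
        ((\<lambda>\<omega>. snd (snd (X (Suc n) \<omega>))) -` {z} \<inter> space M) \<in> sets M"
        using that by (intro sets.Int measurable_sets[OF zM]) auto
      also have "{\<omega>\<in>space M. indicator {j} (\<eta> (Suc n) \<omega>) = (1::real) \<and> \<kappa> (Suc n) \<omega> \<le> t} \<inter> 
        ((\<lambda>\<omega>. snd (snd (X (Suc n) \<omega>))) -` {z} \<inter> space M) = ?A z" by (auto simp: indicator_eq_1_iff)
      finally show ?thesis .
    qed
    \<comment> \<open>The third coordinate takes only the values 0 and 1, so adding the two cases
      eliminates it.\<close>
    have "(LINT \<omega>|M. H \<omega> * indicator ?B \<omega>) = (LINT \<omega>|M. H \<omega> * indicator (?A 0) \<omega> + H \<omega> * indicator (?A 1) \<omega>)"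
      by (intro Bochner_Integration.integral_cong refl) (use X_space[of _ "Suc n"] in \<open>force simp: indicator_def mem_Times_iff\<close>)
    also have "\<dots> = (LINT \<omega>|M. H \<omega> * indicator (?A 0) \<omega>) + (LINT \<omega>|M. H \<omega> * indicator (?A 1) \<omega>)"
      by (intro Bochner_Integration.integral_add intH A) auto
    also have "\<dots> = (LINT \<omega>|M. H \<omega> * kernel_Q K (\<eta> n \<omega>) j t 0) + (LINT \<omega>|M. H \<omega> * kernel_Q K (\<eta> n \<omega>) j t 1)"
      by (subst (1 2) transition_integral[OF H j True]) auto
    also have "\<dots> = (\<Sum>i=1..m. w i * (kernel_Q K i j t 0 + kernel_Q K i j t 1))"
      unfolding w_def by (subst (1 2) integral_by_state[OF _ H(2)]) (auto simp: sum.distrib[symmetric] distrib_left)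
    finally have "emeasure \<mu>1 {..t} = ennreal (\<Sum>i=1..m. w i * (kernel_Q K i j t 0 + kernel_Q K i j t 1))"
      unfolding em1 by simp
    also have "\<dots> = (\<Sum>i=1..m. ennreal (w i * (kernel_Q K i j t 0 + kernel_Q K i j t 1)))"
      using w by (intro sum_ennreal[symmetric]) (auto simp: kernel_Q_def)
    also have "\<dots> = emeasure \<mu>2 {..t}"
      unfolding em2 using w by (intro sum.cong refl) (simp add: L_em ennreal_mult kernel_Q_def)
    finally show ?thesis .
  qed
  have fin1: "finite_borel_measure \<mu>1"
  proof -
    have "emeasure \<mu>1 (space \<mu>1) = (\<integral>\<^sup>+\<omega>. ennreal (H \<omega> * indicator {j} (\<eta> (Suc n) \<omega>)) \<partial>M)"
      using int1[of "\<lambda>_. 1"] by (simp add: \<mu>1_def)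
    also have "\<dots> \<le> (\<integral>\<^sup>+\<omega>. ennreal C \<partial>M)"
      using H(2) C by (intro nn_integral_mono ennreal_leI) (auto simp: indicator_def)
    also have "\<dots> < \<infinity>" by (simp add: emeasure_space_1)
    finally show ?thesis
      by (auto simp: finite_borel_measure_def finite_borel_measure_axioms_def \<mu>1_def intro!: finite_measureI)
  qed
  have fin2: "finite_borel_measure \<mu>2"
  proof -
    have "emeasure \<mu>2 (space \<mu>2) = (\<Sum>i\<in>{1..m}. ennreal (w i) * emeasure (L i) (space (L i)))"
      using int2[of "\<lambda>_. 1"] by simp
    also have "\<dots> \<le> (\<Sum>i\<in>{1..m}. ennreal (w i) * 1)"
      using L_sub by (intro sum_mono mult_left_mono subprob_space.emeasure_space_le_1) auto
    also have "\<dots> < \<infinity>" by simp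
    finally show ?thesis using \<mu>2
      by (auto simp: finite_borel_measure_def finite_borel_measure_axioms_def intro!: finite_measureI)
  qed
  have "\<mu>1 = \<mu>2"
    by (rule cdf_unique'[OF fin1 fin2]) (auto simp: fun_eq_iff cdf_def2 measure_def em_eq)
  hence "(\<integral>\<^sup>+x. f x \<partial>\<mu>1) = (\<integral>\<^sup>+x. f x \<partial>\<mu>2)" by simp
  also have "\<dots> = (\<Sum>i=1..m. ennreal (w i) * (\<integral>\<^sup>+x. indicator {j} (fst x) * f (fst (snd x)) \<partial>K i))"
    using f by (subst int2) (auto intro!: sum.cong simp: L_int)
  finally show ?thesis unfolding int1[OF f] w_def .
qed

lemma laplace_step:
  assumes H: "H \<in> borel_measurable (history m M X n)" "\<And>\<omega>. \<omega> \<in> space M \<Longrightarrow> 0 \<le> H \<omega> \<and> H \<omega> \<le> (C::real)"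
    and s: "0 \<le> s"
  shows "(LINT \<omega>|M. H \<omega> * exp (- s * \<kappa> (Suc n) \<omega>) * w (\<eta> (Suc n) \<omega>))
    = (LINT \<omega>|M. H \<omega> * (\<Sum>j=1..m. laplace_kernel K s (\<eta> n \<omega>) j * w j))"
proof -
  have HM: "H \<in> borel_measurable M" by (rule history_measurable[OF H(1)])
  have [measurable]: "(\<lambda>\<omega>. indicator {i} (\<eta> k \<omega>) :: real) \<in> borel_measurable M"
    "\<kappa> k \<in> borel_measurable M" "H \<in> borel_measurable M" for i k
    using measurable_from_state[OF measurable_X] borel_measurable_kappa[OF measurable_X] HM by auto
  define b where "b i = (LINT \<omega>|M. H \<omega> * indicator {i} (\<eta> n \<omega>))" for i
  have b: "0 \<le> b i" for i unfolding b_def using H(2) by (intro Bochner_Integration.integral_nonneg) simp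
  have exp_le: "exp (- s * \<kappa> (Suc n) \<omega>) \<le> 1" if "\<omega> \<in> space M" for \<omega>
    using s \<kappa>_nonneg[OF that] by simp
  have int: "integrable M (\<lambda>\<omega>. H \<omega> * (indicator {j} (\<eta> (Suc n) \<omega>) * exp (- s * \<kappa> (Suc n) \<omega>)))" for j
    by (rule integrable_weighted[OF HM H(2)]) (measurable, use exp_le in \<open>simp add: indicator_def\<close>)
  have one: "(LINT \<omega>|M. H \<omega> * (indicator {j} (\<eta> (Suc n) \<omega>) * exp (- s * \<kappa> (Suc n) \<omega>)))
      = (\<Sum>i=1..m. b i * laplace_kernel K s i j)" if j: "j \<in> {1..m}" for j
  proof -
    have "ennreal (LINT \<omega>|M. H \<omega> * (indicator {j} (\<eta> (Suc n) \<omega>) * exp (- s * \<kappa> (Suc n) \<omega>)))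
      = (\<integral>\<^sup>+\<omega>. ennreal (H \<omega> * (indicator {j} (\<eta> (Suc n) \<omega>) * exp (- s * \<kappa> (Suc n) \<omega>))) \<partial>M)"
      using int H(2) by (intro nn_integral_eq_integral[symmetric]) auto
    also have "\<dots> = (\<integral>\<^sup>+\<omega>. ennreal (H \<omega> * indicator {j} (\<eta> (Suc n) \<omega>)) * ennreal (exp (- s * \<kappa> (Suc n) \<omega>)) \<partial>M)"
      using H(2) by (intro nn_integral_cong) (simp add: ennreal_mult[symmetric] mult.assoc)
    also have "\<dots> = (\<Sum>i=1..m. ennreal (b i) * (\<integral>\<^sup>+x. indicator {j} (fst x) * ennreal (exp (- s * fst (snd x))) \<partial>K i))"
      unfolding b_def by (rule step_measure[OF H j]) auto
    also have "\<dots> = (\<Sum>i=1..m. ennreal (b i * laplace_kernel K s i j))"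
    proof (intro sum.cong refl)
      fix i assume i: "i \<in> {1..m}"
      have "(\<integral>\<^sup>+x. indicator {j} (fst x) * ennreal (exp (- s * fst (snd x))) \<partial>K i)
          = (\<integral>\<^sup>+x. ennreal (indicator {j} (fst x) * exp (- s * fst (snd x))) \<partial>K i)"
        by (intro nn_integral_cong) (simp add: indicator_def)
      also have "\<dots> = ennreal (laplace_kernel K s i j)" unfolding laplace_kernel_def
        by (intro nn_integral_eq_integral integrable_laplace_kernel i s) auto
      finally show "ennreal (b i) * (\<integral>\<^sup>+x. indicator {j} (fst x) * ennreal (exp (- s * fst (snd x))) \<partial>K i)
          = ennreal (b i * laplace_kernel K s i j)"
        using b laplace_kernel_nonneg by (simp add: ennreal_mult)
    qed
    also have "\<dots> = ennreal (\<Sum>i=1..m. b i * laplace_kernel K s i j)"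
      using b laplace_kernel_nonneg by (intro sum_ennreal) auto
    finally show ?thesis using b laplace_kernel_nonneg H(2)
      by (subst (asm) ennreal_inj) (auto intro!: sum_nonneg Bochner_Integration.integral_nonneg)
  qed
  have "(LINT \<omega>|M. H \<omega> * exp (- s * \<kappa> (Suc n) \<omega>) * w (\<eta> (Suc n) \<omega>))
      = (LINT \<omega>|M. (\<Sum>j=1..m. H \<omega> * (indicator {j} (\<eta> (Suc n) \<omega>) * exp (- s * \<kappa> (Suc n) \<omega>)) * w j))"
  proof (intro Bochner_Integration.integral_cong refl)
    fix \<omega> assume "\<omega> \<in> space M"
    hence "\<eta> (Suc n) \<omega> \<in> {1..m}" by (rule \<eta>_in)
    thus "H \<omega> * exp (- s * \<kappa> (Suc n) \<omega>) * w (\<eta> (Suc n) \<omega>)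
        = (\<Sum>j=1..m. H \<omega> * (indicator {j} (\<eta> (Suc n) \<omega>) * exp (- s * \<kappa> (Suc n) \<omega>)) * w j)"
      by (simp add: indicator_def of_bool_def mult.assoc sum_distrib_left[symmetric] if_distrib if_distribR cong: if_cong)
  qed
  also have "\<dots> = (\<Sum>j=1..m. (\<Sum>i=1..m. b i * laplace_kernel K s i j) * w j)"
    using int by (subst Bochner_Integration.integral_sum) (auto intro!: sum.cong simp: one[simplified])
  also have "\<dots> = (\<Sum>i=1..m. b i * (\<Sum>j=1..m. laplace_kernel K s i j * w j))"
    by (simp add: sum_distrib_left sum_distrib_right mult.assoc) (rule sum.swap)
  also have "\<dots> = (LINT \<omega>|M. H \<omega> * (\<Sum>j=1..m. laplace_kernel K s (\<eta> n \<omega>) j * w j))"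
    unfolding b_def by (rule integral_by_state[OF HM H(2), symmetric])
  finally show ?thesis .
qed

text \<open>Each step multiplies the test functional by one exponential factor, which keeps it
  bounded and measurable for the next history. Therefore \<open>H\<close> and \<open>n\<close> are
  generalized in the induction.\<close>

lemma laplace_steps:
  assumes "H \<in> borel_measurable (history m M X n)" "\<And>\<omega>. \<omega> \<in> space M \<Longrightarrow> 0 \<le> H \<omega> \<and> H \<omega> \<le> (C::real)"
    and s: "0 \<le> s"
  shows "(LINT \<omega>|M. H \<omega> * exp (- s * (\<Sum>k=Suc n..n + l. \<kappa> k \<omega>)) * w (\<eta> (n + l) \<omega>))
    = (LINT \<omega>|M. H \<omega> * kernel_iter m (laplace_kernel K s) l w (\<eta> n \<omega>))"
  using assms(1,2)
proof (induction l arbitrary: n H)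
  case 0
  thus ?case by simp
next
  case (Suc l)
  let ?H = "\<lambda>\<omega>. H \<omega> * exp (- s * \<kappa> (Suc n) \<omega>)"
  have "?H \<in> borel_measurable (history m M X (Suc n))"
    using history_mono[OF _ Suc.prems(1), of "Suc n"] borel_measurable_kappa[OF X_history[OF order_refl]]
    by measurable
  moreover have "0 \<le> ?H \<omega> \<and> ?H \<omega> \<le> C" if "\<omega> \<in> space M" for \<omega>
    using mult_mono[of "H \<omega>" C "exp (- s * \<kappa> (Suc n) \<omega>)" 1] Suc.prems(2)[OF that] \<kappa>_nonneg[OF that] s by auto
  ultimately have IH: "(LINT \<omega>|M. ?H \<omega> * exp (- s * (\<Sum>k=Suc (Suc n)..Suc n + l. \<kappa> k \<omega>)) * w (\<eta> (Suc n + l) \<omega>))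
    = (LINT \<omega>|M. ?H \<omega> * kernel_iter m (laplace_kernel K s) l w (\<eta> (Suc n) \<omega>))" by (rule Suc.IH)
  have "(\<Sum>k=Suc n..n + Suc l. \<kappa> k \<omega>) = \<kappa> (Suc n) \<omega> + (\<Sum>k=Suc (Suc n)..Suc n + l. \<kappa> k \<omega>)" for \<omega>
    by (simp add: sum.atLeast_Suc_atMost)
  hence "(LINT \<omega>|M. H \<omega> * exp (- s * (\<Sum>k=Suc n..n + Suc l. \<kappa> k \<omega>)) * w (\<eta> (n + Suc l) \<omega>))
    = (LINT \<omega>|M. ?H \<omega> * exp (- s * (\<Sum>k=Suc (Suc n)..Suc n + l. \<kappa> k \<omega>)) * w (\<eta> (Suc n + l) \<omega>))"
    by (simp add: distrib_left exp_add[symmetric] mult.assoc)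
  also note IH
  also have "(LINT \<omega>|M. ?H \<omega> * kernel_iter m (laplace_kernel K s) l w (\<eta> (Suc n) \<omega>))
    = (LINT \<omega>|M. H \<omega> * (\<Sum>j=1..m. laplace_kernel K s (\<eta> n \<omega>) j * kernel_iter m (laplace_kernel K s) l w j))"
    by (rule laplace_step[OF Suc.prems s])
  finally show ?case by simp
qed

end

section \<open>Laplace transforms of non-negative sequences\<close>

text \<open>The coordinates \<open>exp (- x i)\<close> carry non-negative sequences into this cube,
  which is compact by Tychonoff although the space of sequences is not.\<close>

definition unit_cube :: "(nat \<Rightarrow> real) set" where "unit_cube = {u. \<forall>i. u i \<in> {0..1}}"

definition nonneg_seqs :: "(nat \<Rightarrow> real) set" where "nonneg_seqs = {x. \<forall>i. 0 \<le> x i}"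

lemma compact_unit_cube: "compact unit_cube"
proof -
  have "compactin (product_topology (\<lambda>_. euclidean) UNIV) (PiE UNIV (\<lambda>_::nat. {0..1::real}))"
    by (simp add: compactin_PiE)
  moreover have "PiE UNIV (\<lambda>_::nat. {0..1::real}) = unit_cube" by (auto simp: unit_cube_def)
  ultimately show ?thesis by (simp add: euclidean_product_topology)
qed

text \<open>Polynomials in finitely many coordinates. At \<open>u i = exp (- x i)\<close> a monomial
  becomes the exponential of a linear form with natural coefficients, so the expectations of these
  functions are combinations of joint Laplace transforms at integer points.\<close>

inductive monomial_sum :: "((nat \<Rightarrow> real) \<Rightarrow> real) \<Rightarrow> bool" where
  monomial: "monomial_sum (\<lambda>u. a * (\<Prod>i<J. u i ^ c i))"
| add: "monomial_sum f \<Longrightarrow> monomial_sum g \<Longrightarrow> monomial_sum (\<lambda>u. f u + g u)"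

lemma monomial_mult:
  fixes J L :: nat
  shows
  "(a * (\<Prod>i<J. u i ^ c i)) * (b * (\<Prod>i<L. u i ^ d i))
     = (a * b) * (\<Prod>i<max J L. (u i :: real) ^ ((if i < J then c i else 0) + (if i < L then d i else 0)))"
proof -
  have "(\<Prod>i<J. u i ^ c i) = (\<Prod>i<max J L. u i ^ (if i < J then c i else 0))"
    by (rule prod.mono_neutral_cong_left) auto
  moreover have "(\<Prod>i<L. u i ^ d i) = (\<Prod>i<max J L. u i ^ (if i < L then d i else 0))"
    by (rule prod.mono_neutral_cong_left) auto
  ultimately show ?thesis by (simp add: power_add prod.distrib)
qed

lemma monomial_sum_mult:
  assumes "monomial_sum f" "monomial_sum g"
  shows "monomial_sum (\<lambda>u. f u * g u)"
proof -
  have mono: "monomial_sum (\<lambda>u. (a * (\<Prod>i<J. u i ^ c i)) * g u)" for a J c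
    using assms(2)
  proof induction
    case (monomial b d L)
    show ?case unfolding monomial_mult by (rule monomial_sum.monomial)
  next
    case (add f g)
    show ?case unfolding distrib_left by (rule monomial_sum.add[OF add.IH])
  qed
  from assms(1) show ?thesis
  proof induction
    case (monomial a c J) show ?case by (rule mono)
  next
    case (add f1 f2) show ?case unfolding distrib_right by (rule monomial_sum.add[OF add.IH])
  qed
qed

lemma monomial_sum_continuous: "monomial_sum f \<Longrightarrow> continuous_on UNIV f"
  by (induction rule: monomial_sum.induct) (auto intro!: continuous_intros)

interpretation monomial_ring: function_ring_on "Collect monomial_sum" unit_cube
proof
  show "compact unit_cube" by (rule compact_unit_cube)
  fix f g :: "(nat \<Rightarrow> real) \<Rightarrow> real" and c :: real and x y :: "nat \<Rightarrow> real"
  show "f \<in> Collect monomial_sum \<Longrightarrow> continuous_on unit_cube f"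
    using monomial_sum_continuous continuous_on_subset by blast
  assume "f \<in> Collect monomial_sum" "g \<in> Collect monomial_sum"
  thus "(\<lambda>x. f x + g x) \<in> Collect monomial_sum" "(\<lambda>x. f x * g x) \<in> Collect monomial_sum"
    using monomial_sum.add monomial_sum_mult by auto
next
  fix c :: real
  show "(\<lambda>_. c) \<in> Collect monomial_sum" using monomial_sum.monomial[where a=c and J=0] by simp
next
  fix x y :: "nat \<Rightarrow> real" assume "x \<noteq> y"
  then obtain i where i: "x i \<noteq> y i" by blast
  have "(\<Prod>k<Suc i. u k ^ (if k = i then 1 else 0)) = u i" for u :: "nat \<Rightarrow> real"
    by (subst prod.remove[of _ i]) (auto intro!: prod.neutral)
  hence "monomial_sum (\<lambda>u. u i)"
    using monomial_sum.monomial[where a=1 and J="Suc i" and c="\<lambda>k. if k = i then 1 else 0"] by simp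
  thus "\<exists>f\<in>Collect monomial_sum. f x \<noteq> f y" using i by (intro bexI[of _ "\<lambda>u. u i"]) auto
qed

lemma measurable_continuous_on_cube:
  assumes H: "continuous_on unit_cube H" and U: "\<And>i. (\<lambda>\<omega>. U \<omega> i) \<in> borel_measurable M"
    and cube: "\<And>\<omega>. \<omega> \<in> space M \<Longrightarrow> U \<omega> \<in> unit_cube"
  shows "(\<lambda>\<omega>. H (U \<omega>) :: real) \<in> borel_measurable M"
proof -
  \<comment> \<open>Clamping the coordinates extends \<open>H\<close> continuously to the whole
    product space, where continuity gives Borel measurability.\<close>
  define cl where "cl u = (\<lambda>i. min 1 (max 0 (u i :: real)))" for u :: "nat \<Rightarrow> real"
  have "continuous_on UNIV cl" unfolding cl_def by (intro continuous_intros) auto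
  moreover have "cl u \<in> unit_cube" for u by (auto simp: cl_def unit_cube_def)
  ultimately have "continuous_on UNIV (\<lambda>u. H (cl u))"
    by (intro continuous_on_compose2[OF H]) auto
  hence "(\<lambda>u. H (cl u)) \<in> borel_measurable borel" by (rule borel_measurable_continuous_onI)
  moreover have "U \<in> borel_measurable M"
    by (rule measurable_coordinatewise_then_product) (rule U)
  ultimately have "(\<lambda>\<omega>. H (cl (U \<omega>))) \<in> borel_measurable M" by measurable
  moreover have "cl (U \<omega>) = U \<omega>" if "\<omega> \<in> space M" for \<omega>
    using cube[OF that] by (auto simp: cl_def unit_cube_def fun_eq_iff min_def max_def intro: antisym)
  ultimately show ?thesis by (subst measurable_cong[where g="\<lambda>\<omega>. H (cl (U \<omega>))"]) auto
qed

lemma bounded_on_cube: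
  assumes "continuous_on unit_cube H"
  obtains B where "0 \<le> B" "\<And>u. u \<in> unit_cube \<Longrightarrow> \<bar>H u\<bar> \<le> (B::real)"
proof -
  have "bounded (H ` unit_cube)"
    using compact_continuous_image[OF assms compact_unit_cube] compact_imp_bounded by blast
  then obtain B where "\<And>u. u \<in> unit_cube \<Longrightarrow> \<bar>H u\<bar> \<le> B" unfolding bounded_iff by auto
  thus ?thesis using that[of "\<bar>B\<bar>"] by force
qed

locale nonneg_sequence = prob_space M for M :: "'a measure" and \<xi> :: "nat \<Rightarrow> 'a \<Rightarrow> real" +
  assumes \<xi>_measurable[measurable]: "\<And>i. \<xi> i \<in> borel_measurable M"
    and \<xi>_nonneg: "\<And>i \<omega>. \<omega> \<in> space M \<Longrightarrow> 0 \<le> \<xi> i \<omega>"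
begin

lemma exp_in_cube: "\<omega> \<in> space M \<Longrightarrow> (\<lambda>i. exp (- \<xi> i \<omega>)) \<in> unit_cube"
  using \<xi>_nonneg by (auto simp: unit_cube_def)

lemma integrable_cube:
  assumes "continuous_on unit_cube H"
  shows "integrable M (\<lambda>\<omega>. H (\<lambda>i. exp (- \<xi> i \<omega>)) :: real)"
proof -
  obtain B where "\<And>u. u \<in> unit_cube \<Longrightarrow> \<bar>H u\<bar> \<le> B" using bounded_on_cube[OF assms] by metis
  thus ?thesis using exp_in_cube
    by (intro integrable_const_bound[of _ B] measurable_continuous_on_cube[OF assms]) auto
qed

lemma integral_cube_diff:
  assumes "continuous_on unit_cube H" "continuous_on unit_cube f" "\<And>u. u \<in> unit_cube \<Longrightarrow> \<bar>H u - f u\<bar> < (\<delta>::real)"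
  shows "\<bar>(LINT \<omega>|M. H (\<lambda>i. exp (- \<xi> i \<omega>))) - (LINT \<omega>|M. f (\<lambda>i. exp (- \<xi> i \<omega>)))\<bar> \<le> \<delta>"
proof -
  have "\<bar>LINT \<omega>|M. H (\<lambda>i. exp (- \<xi> i \<omega>)) - f (\<lambda>i. exp (- \<xi> i \<omega>))\<bar>
      \<le> (LINT \<omega>|M. \<bar>H (\<lambda>i. exp (- \<xi> i \<omega>)) - f (\<lambda>i. exp (- \<xi> i \<omega>))\<bar>)"
    by (rule integral_abs_bound)
  also have "\<dots> \<le> \<delta>"
    using assms(3)[OF exp_in_cube] integrable_cube[OF assms(1)] integrable_cube[OF assms(2)]
    by (intro integral_le_const) (auto intro!: AE_I2 less_imp_le)
  finally show ?thesis using integrable_cube[OF assms(1)] integrable_cube[OF assms(2)] by simp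
qed

end

text \<open>Natural frequencies suffice: they give all mixed moments of the bounded variables
  \<open>exp (- \<xi> i)\<close>.\<close>

locale laplace_convergence =
  lim: nonneg_sequence P \<zeta> for P :: "'b measure" and \<zeta> +
  fixes M :: "'e \<Rightarrow> 'a measure" and \<xi> :: "'e \<Rightarrow> nat \<Rightarrow> 'a \<Rightarrow> real" and F :: "'e filter"
  assumes seq: "\<forall>\<^sub>F e in F. nonneg_sequence (M e) (\<xi> e)"
    and conv: "\<And>J (c::nat \<Rightarrow> nat). ((\<lambda>e. LINT \<omega>|M e. exp (- (\<Sum>i<J. c i * \<xi> e i \<omega>)))
      \<longlongrightarrow> (LINT \<omega>|P. exp (- (\<Sum>i<J. c i * \<zeta> i \<omega>)))) F"
begin

lemma conv_monomial_sum:
  assumes "monomial_sum f"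
  shows "((\<lambda>e. LINT \<omega>|M e. f (\<lambda>i. exp (- \<xi> e i \<omega>))) \<longlongrightarrow> (LINT \<omega>|P. f (\<lambda>i. exp (- \<zeta> i \<omega>)))) F"
  using assms
proof induction
  case (monomial a c J)
  have "(\<Prod>i<J. exp (- x i) ^ c i) = exp (- (\<Sum>i<J. c i * x i))" for x :: "nat \<Rightarrow> real"
    by (simp add: exp_of_nat_mult[symmetric] exp_sum[symmetric] sum_negf)
  thus ?case using tendsto_mult[OF tendsto_const[of a] conv[of c J]] by simp
next
  case (add f g)
  have cont: "continuous_on unit_cube f" "continuous_on unit_cube g"
    using add.hyps monomial_sum_continuous continuous_on_subset by blast+
  have "\<forall>\<^sub>F e in F. (LINT \<omega>|M e. f (\<lambda>i. exp (- \<xi> e i \<omega>))) + (LINT \<omega>|M e. g (\<lambda>i. exp (- \<xi> e i \<omega>)))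
      = (LINT \<omega>|M e. f (\<lambda>i. exp (- \<xi> e i \<omega>)) + g (\<lambda>i. exp (- \<xi> e i \<omega>)))"
    using seq
  proof eventually_elim
    case (elim e)
    thus ?case using nonneg_sequence.integrable_cube[OF elim cont(1)] nonneg_sequence.integrable_cube[OF elim cont(2)]
      by simp
  qed
  from Lim_transform_eventually[OF tendsto_add[OF add.IH] this]
  show ?case using lim.integrable_cube[OF cont(1)] lim.integrable_cube[OF cont(2)] by simp
qed

lemma conv_continuous_cube:
  assumes H: "continuous_on unit_cube H"
  shows "((\<lambda>e. LINT \<omega>|M e. H (\<lambda>i. exp (- \<xi> e i \<omega>)) :: real) \<longlongrightarrow> (LINT \<omega>|P. H (\<lambda>i. exp (- \<zeta> i \<omega>)))) F"
proof (rule tendstoI)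
  fix \<delta> :: real assume "0 < \<delta>"
  hence \<delta>: "0 < \<delta> / 3" by simp
  obtain f where f: "monomial_sum f" "\<And>u. u \<in> unit_cube \<Longrightarrow> \<bar>H u - f u\<bar> < \<delta> / 3"
    using monomial_ring.Stone_Weierstrass_basic[OF H \<delta>] by auto
  have cont: "continuous_on unit_cube f" using f(1) monomial_sum_continuous continuous_on_subset by blast
  show "\<forall>\<^sub>F e in F. dist (LINT \<omega>|M e. H (\<lambda>i. exp (- \<xi> e i \<omega>))) (LINT \<omega>|P. H (\<lambda>i. exp (- \<zeta> i \<omega>))) < \<delta>"
    using seq tendstoD[OF conv_monomial_sum[OF f(1)] \<delta>]
  proof eventually_elim
    case (elim e)
    show ?case
      using nonneg_sequence.integral_cube_diff[OF elim(1) H cont f(2)] lim.integral_cube_diff[OF H cont f(2)] elim(2)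
      unfolding dist_real_def by linarith
  qed
qed

text \<open>A continuous function of \<open>x\<close> need not extend to the points of the cube with
  some \<open>u i = 0\<close>, which correspond to infinite \<open>x i\<close>. The cutoff vanishes
  before this boundary is reached, so the truncated functional is a continuous function on the
  cube.\<close>

lemma conv_truncated:
  fixes G :: "(nat \<Rightarrow> real) \<Rightarrow> real" and J :: nat
  assumes G: "continuous_on nonneg_seqs G" and R: "0 \<le> R"
  defines "T \<equiv> \<lambda>x. G (\<lambda>i. if i < J then x i else 0) * (\<Prod>i<J. cts_step R (R + 1) (x i))"
  shows "((\<lambda>e. LINT \<omega>|M e. T (\<lambda>i. \<xi> e i \<omega>)) \<longlongrightarrow> (LINT \<omega>|P. T (\<lambda>i. \<zeta> i \<omega>))) F"
    and "\<forall>\<^sub>F e in F. integrable (M e) (\<lambda>\<omega>. T (\<lambda>i. \<xi> e i \<omega>))" and "integrable P (\<lambda>\<omega>. T (\<lambda>i. \<zeta> i \<omega>))"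
proof -
  \<comment> \<open>The inverse of the exponential coordinate, frozen at the level
    \<open>R + 1\<close> where the cutoff already vanishes and exact below it.\<close>
  define L where "L u = - ln (max u (exp (- (R + 1))))" for u :: real
  define H where "H u = G (\<lambda>i. if i < J then max 0 (L (u i)) else 0) * (\<Prod>i<J. cts_step R (R + 1) (L (u i)))"
    for u :: "nat \<Rightarrow> real"
  have L_cont: "continuous_on UNIV L" unfolding L_def
    by (intro continuous_intros) (auto simp: max_def not_le intro: less_le_trans[OF exp_gt_zero])
  have L_cont': "continuous_on A (\<lambda>u. L (u i))" for A :: "(nat \<Rightarrow> real) set" and i
    by (rule continuous_on_compose2[OF L_cont]) (auto intro: continuous_on_subset[OF continuous_on_product_coordinates])
  have step: "continuous_on UNIV (cts_step R (R + 1))"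
    by (rule uniformly_continuous_imp_continuous[OF cts_step_uniformly_continuous]) simp
  have "continuous_on unit_cube (\<lambda>u. (\<lambda>i. if i < J then max 0 (L (u i)) else 0))"
  proof (rule continuous_on_coordinatewise_then_product)
    fix i show "continuous_on unit_cube (\<lambda>u. if i < J then max 0 (L (u i)) else 0)"
      by (cases "i < J") (auto intro!: continuous_intros L_cont')
  qed
  hence "continuous_on unit_cube (\<lambda>u. G (\<lambda>i. if i < J then max 0 (L (u i)) else 0))"
    by (rule continuous_on_compose2[OF G]) (auto simp: nonneg_seqs_def)
  moreover have "continuous_on unit_cube (\<lambda>u. cts_step R (R + 1) (L (u i)))" for i
    by (rule continuous_on_compose2[OF step L_cont']) auto
  ultimately have "continuous_on unit_cube H" unfolding H_def by (intro continuous_intros)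
  moreover have HT: "H (\<lambda>i. exp (- x i)) = T x" if x: "\<And>i. 0 \<le> x i" for x :: "nat \<Rightarrow> real"
  proof (cases "\<forall>i<J. x i \<le> R + 1")
    case True
    have L: "L (exp (- x i)) = x i" if "i < J" for i
    proof -
      have "x i \<le> R + 1" using True that by blast
      thus ?thesis by (simp add: L_def max_def)
    qed
    have "(\<lambda>i. if i < J then max 0 (L (exp (- x i))) else 0) = (\<lambda>i. if i < J then x i else 0)"
      using L x by (auto simp: max_def)
    moreover have "(\<Prod>i<J. cts_step R (R + 1) (L (exp (- x i)))) = (\<Prod>i<J. cts_step R (R + 1) (x i))"
      by (intro prod.cong refl) (simp add: L)
    ultimately show ?thesis by (simp add: H_def T_def)
  next
    case False
    then obtain i where i: "i < J" "\<not> x i \<le> R + 1" by blast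
    hence L: "L (exp (- x i)) = R + 1" by (simp add: L_def max_def)
    have z: "cts_step R (R + 1) (R + 1) = 0" "cts_step R (R + 1) (x i) = 0"
      using i(2) by (auto simp: cts_step_def)
    have "(\<Prod>i<J. cts_step R (R + 1) (L (exp (- x i)))) = 0" "(\<Prod>i<J. cts_step R (R + 1) (x i)) = 0"
      using i L z by (auto intro!: prod_zero bexI[of _ i])
    thus ?thesis by (simp only: H_def T_def mult_zero_right)
  qed
  ultimately have H: "continuous_on unit_cube H" by blast
  have ev: "\<forall>\<^sub>F e in F. (LINT \<omega>|M e. H (\<lambda>i. exp (- \<xi> e i \<omega>))) = (LINT \<omega>|M e. T (\<lambda>i. \<xi> e i \<omega>))"
    using seq
  proof eventually_elim
    case (elim e)
    show ?case using nonneg_sequence.\<xi>_nonneg[OF elim] by (intro Bochner_Integration.integral_cong refl HT) auto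
  qed
  have P: "(LINT \<omega>|P. H (\<lambda>i. exp (- \<zeta> i \<omega>))) = (LINT \<omega>|P. T (\<lambda>i. \<zeta> i \<omega>))"
    using lim.\<xi>_nonneg by (intro Bochner_Integration.integral_cong refl HT) auto
  show "((\<lambda>e. LINT \<omega>|M e. T (\<lambda>i. \<xi> e i \<omega>)) \<longlongrightarrow> (LINT \<omega>|P. T (\<lambda>i. \<zeta> i \<omega>))) F"
    using Lim_transform_eventually[OF conv_continuous_cube[OF H] ev] unfolding P .
  show "integrable P (\<lambda>\<omega>. T (\<lambda>i. \<zeta> i \<omega>))"
    using lim.integrable_cube[OF H] lim.\<xi>_nonneg HT
    by (subst Bochner_Integration.integrable_cong[OF refl, where g="\<lambda>\<omega>. H (\<lambda>i. exp (- \<zeta> i \<omega>))"]) auto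
  show "\<forall>\<^sub>F e in F. integrable (M e) (\<lambda>\<omega>. T (\<lambda>i. \<xi> e i \<omega>))"
    using seq
  proof eventually_elim
    case (elim e)
    show ?case
      using nonneg_sequence.integrable_cube[OF elim H] nonneg_sequence.\<xi>_nonneg[OF elim] HT
      by (subst Bochner_Integration.integrable_cong[OF refl, where g="\<lambda>\<omega>. H (\<lambda>i. exp (- \<xi> e i \<omega>))"]) auto
  qed
qed

end

lemma (in nonneg_sequence) integrable_nonneg_seqs:
  assumes G: "continuous_on nonneg_seqs G" and B: "\<And>x. x \<in> nonneg_seqs \<Longrightarrow> \<bar>G x\<bar> \<le> (B::real)"
  shows "integrable M (\<lambda>\<omega>. G (\<lambda>i. \<xi> i \<omega>))"
proof (rule integrable_const_bound[of _ B])
  define cl where "cl u = (\<lambda>i. max 0 (u i :: real))" for u :: "nat \<Rightarrow> real"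
  have "continuous_on UNIV cl" unfolding cl_def by (intro continuous_intros) auto
  moreover have "cl u \<in> nonneg_seqs" for u by (auto simp: cl_def nonneg_seqs_def)
  ultimately have "continuous_on UNIV (\<lambda>u. G (cl u))"
    by (intro continuous_on_compose2[OF G]) auto
  hence "(\<lambda>u. G (cl u)) \<in> borel_measurable borel" by (rule borel_measurable_continuous_onI)
  moreover have "(\<lambda>\<omega>. \<lambda>i. \<xi> i \<omega>) \<in> borel_measurable M"
    by (rule measurable_coordinatewise_then_product) simp
  ultimately have "(\<lambda>\<omega>. G (cl (\<lambda>i. \<xi> i \<omega>))) \<in> borel_measurable M" by measurable
  moreover have "cl (\<lambda>i. \<xi> i \<omega>) = (\<lambda>i. \<xi> i \<omega>)" if "\<omega> \<in> space M" for \<omega>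
    using \<xi>_nonneg[OF that] by (auto simp: cl_def fun_eq_iff max_def)
  ultimately show "(\<lambda>\<omega>. G (\<lambda>i. \<xi> i \<omega>)) \<in> borel_measurable M"
    by (subst measurable_cong[where g="\<lambda>\<omega>. G (cl (\<lambda>i. \<xi> i \<omega>))"]) auto
  show "AE \<omega> in M. norm (G (\<lambda>i. \<xi> i \<omega>)) \<le> B"
    using \<xi>_nonneg by (intro AE_I2) (auto simp: nonneg_seqs_def intro!: B)
qed

text \<open>The two integrands differ by \<open>G\<close> times the complement of the
  cutoff.\<close>

lemma (in nonneg_sequence) truncation_error:
  assumes G: "continuous_on nonneg_seqs G" and B: "\<And>x. x \<in> nonneg_seqs \<Longrightarrow> \<bar>G x\<bar> \<le> (B::real)"
    and fin: "\<And>x. x \<in> nonneg_seqs \<Longrightarrow> G (\<lambda>i. if i < J then x i else 0) = G x"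
    and intT: "integrable M (\<lambda>\<omega>. G (\<lambda>i. if i < J then \<xi> i \<omega> else 0) * (\<Prod>i<J. cts_step R (R + 1) (\<xi> i \<omega>)))"
    and intcut: "integrable M (\<lambda>\<omega>. \<Prod>i<J. cts_step R (R + 1) (\<xi> i \<omega>))"
  shows "\<bar>(LINT \<omega>|M. G (\<lambda>i. \<xi> i \<omega>)) - (LINT \<omega>|M. G (\<lambda>i. if i < J then \<xi> i \<omega> else 0) * (\<Prod>i<J. cts_step R (R + 1) (\<xi> i \<omega>)))\<bar>
    \<le> B * (1 - (LINT \<omega>|M. (\<Prod>i<J. cts_step R (R + 1) (\<xi> i \<omega>))))"
proof -
  let ?cut = "\<lambda>\<omega>. \<Prod>i<J. cts_step R (R + 1) (\<xi> i \<omega>)"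
  have cut: "0 \<le> ?cut \<omega> \<and> ?cut \<omega> \<le> 1" for \<omega>
    by (intro conjI prod_nonneg prod_le_1) (auto simp: cts_step_def)
  note intG = integrable_nonneg_seqs[OF G B]
  have "\<bar>LINT \<omega>|M. G (\<lambda>i. \<xi> i \<omega>) - G (\<lambda>i. if i < J then \<xi> i \<omega> else 0) * ?cut \<omega>\<bar>
      \<le> (LINT \<omega>|M. \<bar>G (\<lambda>i. \<xi> i \<omega>) - G (\<lambda>i. if i < J then \<xi> i \<omega> else 0) * ?cut \<omega>\<bar>)"
    by (rule integral_abs_bound)
  also have "\<dots> \<le> (LINT \<omega>|M. B * (1 - ?cut \<omega>))"
  proof (rule integral_mono)
    fix \<omega> assume "\<omega> \<in> space M"
    hence x: "(\<lambda>i. \<xi> i \<omega>) \<in> nonneg_seqs" using \<xi>_nonneg by (simp add: nonneg_seqs_def)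
    have "G (\<lambda>i. \<xi> i \<omega>) - G (\<lambda>i. if i < J then \<xi> i \<omega> else 0) * ?cut \<omega> = G (\<lambda>i. \<xi> i \<omega>) * (1 - ?cut \<omega>)"
      using fin[OF x] by (simp add: algebra_simps)
    also have "\<bar>\<dots>\<bar> = \<bar>G (\<lambda>i. \<xi> i \<omega>)\<bar> * (1 - ?cut \<omega>)" using cut[of \<omega>] by (simp add: abs_mult)
    also have "\<dots> \<le> B * (1 - ?cut \<omega>)" using B[OF x] cut[of \<omega>] by (intro mult_right_mono) auto
    finally show "\<bar>G (\<lambda>i. \<xi> i \<omega>) - G (\<lambda>i. if i < J then \<xi> i \<omega> else 0) * ?cut \<omega>\<bar> \<le> B * (1 - ?cut \<omega>)" .
  qed (use intG intT intcut in auto)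
  also have "\<dots> = B * (1 - (LINT \<omega>|M. ?cut \<omega>))" using intcut by (simp add: prob_space)
  finally show ?thesis using intG intT by simp
qed

context laplace_convergence
begin

text \<open>Tightness need not be assumed: the cutoff is itself a truncated functional, with
  \<open>G = 1\<close>, so its expectations converge, and the mass which the family has beyond
  \<open>R\<close> is eventually about as small as that of the limit.\<close>

lemma conv_bounded_continuous:
  fixes G :: "(nat \<Rightarrow> real) \<Rightarrow> real"
  assumes G: "continuous_on nonneg_seqs G" and B: "\<And>x. x \<in> nonneg_seqs \<Longrightarrow> \<bar>G x\<bar> \<le> B"
    and fin: "\<And>x. x \<in> nonneg_seqs \<Longrightarrow> G (\<lambda>i. if i < J then x i else 0) = G x"
  shows "((\<lambda>e. LINT \<omega>|M e. G (\<lambda>i. \<xi> e i \<omega>)) \<longlongrightarrow> (LINT \<omega>|P. G (\<lambda>i. \<zeta> i \<omega>))) F"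
proof (rule tendstoI)
  fix \<delta> :: real assume \<delta>: "0 < \<delta>"
  have B0: "0 \<le> B" using B[of "\<lambda>_. 0"] by (simp add: nonneg_seqs_def)
  define cut where "cut R x = (\<Prod>i<J. cts_step R (R + 1) (x i))" for R and x :: "nat \<Rightarrow> real"
  have cut_bound: "\<bar>cut R x\<bar> \<le> 1" for R x
    unfolding cut_def abs_prod by (intro prod_le_1) (auto simp: cts_step_def)
  have one: "continuous_on nonneg_seqs (\<lambda>_. 1::real)" by simp
  have meas: "(\<lambda>\<omega>. cut R (\<lambda>i. \<zeta> i \<omega>)) \<in> borel_measurable P" for R
    unfolding cut_def cts_step_def[abs_def] by measurable
  have "(\<lambda>n. LINT \<omega>|P. cut (real n) (\<lambda>i. \<zeta> i \<omega>)) \<longlonglongrightarrow> (LINT \<omega>|P. 1)"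
  proof (rule integral_dominated_convergence[where w="\<lambda>_. 1"])
    show "AE \<omega> in P. (\<lambda>n. cut (real n) (\<lambda>i. \<zeta> i \<omega>)) \<longlonglongrightarrow> 1"
    proof (rule AE_I2)
      fix \<omega> assume \<omega>: "\<omega> \<in> space P"
      have le: "\<zeta> i \<omega> \<le> (\<Sum>i<J. \<zeta> i \<omega>)" if "i < J" for i
        using that lim.\<xi>_nonneg[OF \<omega>] by (intro member_le_sum) auto
      obtain N :: nat where "(\<Sum>i<J. \<zeta> i \<omega>) \<le> real N" using real_arch_simple by blast
      hence "\<forall>\<^sub>F n in sequentially. \<forall>i<J. \<zeta> i \<omega> \<le> real n"
        using le by (intro eventually_sequentiallyI[of N]) (meson of_nat_mono order_trans)
      hence "\<forall>\<^sub>F n in sequentially. cut (real n) (\<lambda>i. \<zeta> i \<omega>) = 1"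
        by eventually_elim (auto simp: cut_def cts_step_def intro!: prod.neutral)
      thus "(\<lambda>n. cut (real n) (\<lambda>i. \<zeta> i \<omega>)) \<longlonglongrightarrow> 1" by (rule tendsto_eventually)
    qed
  qed (use cut_bound meas in auto)
  hence "(\<lambda>n. LINT \<omega>|P. cut (real n) (\<lambda>i. \<zeta> i \<omega>)) \<longlonglongrightarrow> 1" by (simp add: lim.prob_space)
  moreover have "0 < \<delta> / (4 * (B + 1))" using \<delta> B0 by simp
  ultimately have "\<forall>\<^sub>F n in sequentially. dist (LINT \<omega>|P. cut (real n) (\<lambda>i. \<zeta> i \<omega>)) 1 < \<delta> / (4 * (B + 1))"
    by (rule tendstoD)
  then obtain n where n: "dist (LINT \<omega>|P. cut (real n) (\<lambda>i. \<zeta> i \<omega>)) 1 < \<delta> / (4 * (B + 1))"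
    using eventually_happens sequentially_bot by blast
  have R: "0 \<le> real n" by simp
  note cG = conv_truncated[OF G R, of J, folded cut_def]
  note c1 = conv_truncated[OF one R, of J, folded cut_def, simplified]
  have T: "((\<lambda>e. B * (1 - (LINT \<omega>|M e. cut (real n) (\<lambda>i. \<xi> e i \<omega>)))) \<longlongrightarrow> B * (1 - (LINT \<omega>|P. cut (real n) (\<lambda>i. \<zeta> i \<omega>)))) F"
    by (intro tendsto_intros c1(1))
  have small: "B * (1 - (LINT \<omega>|P. cut (real n) (\<lambda>i. \<zeta> i \<omega>))) \<le> \<delta> / 4"
  proof -
    have "B * (1 - (LINT \<omega>|P. cut (real n) (\<lambda>i. \<zeta> i \<omega>))) \<le> B * (\<delta> / (4 * (B + 1)))"
      using n B0 unfolding dist_real_def by (intro mult_left_mono) linarith+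
    also have "\<dots> \<le> (B + 1) * (\<delta> / (4 * (B + 1)))"
      using B0 \<delta> by (intro mult_right_mono) auto
    also have "\<dots> = \<delta> / 4" using B0 by (simp add: divide_simps)
    finally show ?thesis .
  qed
  have \<delta>4: "0 < \<delta> / 4" using \<delta> by simp
  show "\<forall>\<^sub>F e in F. dist (LINT \<omega>|M e. G (\<lambda>i. \<xi> e i \<omega>)) (LINT \<omega>|P. G (\<lambda>i. \<zeta> i \<omega>)) < \<delta>"
    using seq tendstoD[OF cG(1) \<delta>4] tendstoD[OF T \<delta>4] cG(2) c1(2)
  proof eventually_elim
    case (elim e)
    have "\<bar>(LINT \<omega>|M e. G (\<lambda>i. \<xi> e i \<omega>)) - (LINT \<omega>|M e. G (\<lambda>i. if i < J then \<xi> e i \<omega> else 0) * cut (real n) (\<lambda>i. \<xi> e i \<omega>))\<bar>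
      \<le> B * (1 - (LINT \<omega>|M e. cut (real n) (\<lambda>i. \<xi> e i \<omega>)))"
      using nonneg_sequence.truncation_error[OF elim(1) G B fin] elim(4,5) unfolding cut_def by blast
    moreover have "\<bar>(LINT \<omega>|P. G (\<lambda>i. \<zeta> i \<omega>)) - (LINT \<omega>|P. G (\<lambda>i. if i < J then \<zeta> i \<omega> else 0) * cut (real n) (\<lambda>i. \<zeta> i \<omega>))\<bar>
      \<le> B * (1 - (LINT \<omega>|P. cut (real n) (\<lambda>i. \<zeta> i \<omega>)))"
      using lim.truncation_error[OF G B fin] cG(3) c1(3) unfolding cut_def by blast
    ultimately show ?case using elim(2,3) small unfolding dist_real_def abs_less_iff abs_le_iff by linarith
  qed
qed

end

section \<open>Non-negative laws and their Laplace transforms\<close>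

definition nonneg_law :: "real measure \<Rightarrow> bool" where
  "nonneg_law \<mu> \<longleftrightarrow> real_distribution \<mu> \<and> (AE x in \<mu>. 0 \<le> x)"

lemma nonneg_law_distr:
  assumes "prob_space M" "f \<in> borel_measurable M" "AE \<omega> in M. 0 \<le> f \<omega>"
  shows "nonneg_law (distr M borel f)"
proof -
  interpret prob_space M by fact
  show ?thesis unfolding nonneg_law_def
    using assms(2,3) by (auto simp: AE_distr_iff)
qed

lemma laplace_transform_distr:
  assumes "f \<in> borel_measurable M"
  shows "laplace_transform (distr M borel f) s = (LINT \<omega>|M. exp (- s * f \<omega>))"
  unfolding laplace_transform_def using assms by (subst integral_distr) auto

lemma nonneg_law_integrable:
  assumes "nonneg_law \<mu>" "0 \<le> s"
  shows "integrable \<mu> (\<lambda>x. exp (- s * x))"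
proof -
  interpret real_distribution \<mu> using assms(1) by (simp add: nonneg_law_def)
  show ?thesis
    using assms by (intro integrable_const_bound[of _ 1]) (auto simp: nonneg_law_def elim!: eventually_mono)
qed

lemma laplace_transform_bounds:
  assumes \<mu>: "nonneg_law \<mu>" and s: "0 \<le> s"
  shows "0 < laplace_transform \<mu> s" "laplace_transform \<mu> s \<le> 1"
proof -
  interpret real_distribution \<mu> using \<mu> by (simp add: nonneg_law_def)
  note int = nonneg_law_integrable[OF \<mu> s]

  show "0 < laplace_transform \<mu> s"
    unfolding laplace_transform_def
    using integral_less_AE_space[of "\<lambda>_. 0" "\<lambda>x. exp (- s * x)"] int emeasure_space_1 by (simp del: space_eq_univ)
  show "laplace_transform \<mu> s \<le> 1"
    unfolding laplace_transform_def
    by (rule integral_le_const[OF int]) (use \<mu> s in \<open>auto simp: nonneg_law_def elim!: eventually_mono\<close>)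
qed

lemma laplace_transform_0: "nonneg_law \<mu> \<Longrightarrow> laplace_transform \<mu> 0 = 1"
  unfolding nonneg_law_def laplace_transform_def real_distribution_def
  using prob_space.prob_space by fastforce

lemma exp_cumulant:
  assumes "nonneg_law \<mu>" "0 \<le> s"
  shows "exp (- cumulant \<mu> s) = laplace_transform \<mu> s"
  using laplace_transform_bounds[OF assms] by (simp add: cumulant_def)

lemma tendsto_laplace_transform_0:
  assumes \<mu>: "nonneg_law \<mu>"
  shows "(\<lambda>n. laplace_transform \<mu> (1 / Suc n)) \<longlonglongrightarrow> 1"
proof -
  interpret real_distribution \<mu> using \<mu> by (simp add: nonneg_law_def)
  have "(\<lambda>n. LINT x|\<mu>. exp (- (1 / Suc n) * x)) \<longlonglongrightarrow> (LINT x|\<mu>. 1)"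
  proof (rule integral_dominated_convergence[where w="\<lambda>_. 1"])
    have "(\<lambda>n. exp (- (1 / Suc n) * x)) \<longlonglongrightarrow> exp (- 0 * x)" for x
      by (intro tendsto_intros LIMSEQ_Suc[OF lim_1_over_n])
    thus "AE x in \<mu>. (\<lambda>n. exp (- (1 / Suc n) * x)) \<longlonglongrightarrow> 1" by simp
    show "AE x in \<mu>. norm (exp (- (1 / Suc n) * x)) \<le> 1" for n
      using \<mu> by (auto simp: nonneg_law_def elim!: eventually_mono)
  qed auto
  thus ?thesis using prob_space by (simp add: laplace_transform_def)
qed

text \<open>A law is non-negative only almost surely, whereas \<open>nonneg_sequence\<close> asks
  for every point; truncation at 0 repairs this without changing the transforms.\<close>

lemma nonneg_sequence_law:
  assumes "nonneg_law \<mu>"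
  shows "nonneg_sequence \<mu> (\<lambda>_ x. max 0 x)"
  using assms unfolding nonneg_law_def nonneg_sequence_def nonneg_sequence_axioms_def real_distribution_def
  using borel_measurable_max measurable_cong_sets[of \<mu> borel borel borel] by (auto simp: real_distribution_axioms_def)

lemma laplace_law_max:
  assumes "nonneg_law \<mu>"
  shows "(LINT x|\<mu>. exp (- (\<Sum>i<J. real (c i) * max 0 x))) = laplace_transform \<mu> (\<Sum>i<(J::nat). c i)"
proof -
  interpret real_distribution \<mu> using assms by (simp add: nonneg_law_def)
  have "AE x in \<mu>. exp (- (\<Sum>i<J. real (c i) * max 0 x)) = exp (- real (\<Sum>i<J. c i) * x)"
    using assms unfolding nonneg_law_def by (auto simp: sum_distrib_right elim!: eventually_mono)
  thus ?thesis unfolding laplace_transform_def by (intro integral_cong_AE) auto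
qed

lemma laplace_convergence_law:
  assumes \<mu>s: "\<forall>\<^sub>F e in F. nonneg_law (\<mu>s e)" and \<mu>: "nonneg_law \<mu>"
    and conv: "\<And>s::nat. ((\<lambda>e. laplace_transform (\<mu>s e) s) \<longlongrightarrow> laplace_transform \<mu> s) F"
  shows "laplace_convergence \<mu> (\<lambda>_ x. max 0 x) \<mu>s (\<lambda>_ _ x. max 0 x) F"
proof -
  have "((\<lambda>e. LINT x|\<mu>s e. exp (- (\<Sum>i<J. real (c i) * max 0 x)))
      \<longlongrightarrow> (LINT x|\<mu>. exp (- (\<Sum>i<J. real (c i) * max 0 x)))) F" for J and c :: "nat \<Rightarrow> nat"
    unfolding laplace_law_max[OF \<mu>]
    by (rule Lim_transform_eventually[OF conv[of "\<Sum>i<J. c i"]])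
       (use \<mu>s in \<open>auto elim!: eventually_mono simp: laplace_law_max\<close>)
  thus ?thesis
    unfolding laplace_convergence_def laplace_convergence_axioms_def
    using nonneg_sequence_law[OF \<mu>] \<mu>s by (auto elim!: eventually_mono intro: nonneg_sequence_law)
qed

lemma integral_cts_step_max:
  assumes "nonneg_law \<mu>"
  shows "(LINT x|\<mu>. cts_step a b (max 0 x)) = (LINT x|\<mu>. cts_step a b x)"
proof -
  interpret real_distribution \<mu> using assms by (simp add: nonneg_law_def)
  show ?thesis
    using assms unfolding nonneg_law_def
    by (intro integral_cong_AE) (auto elim!: eventually_mono simp: cts_step_def[abs_def])
qed

lemma laplace_conv_imp_cts_step_conv:
  assumes \<mu>s: "\<forall>\<^sub>F e in F. nonneg_law (\<mu>s e)" and \<mu>: "nonneg_law \<mu>"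
    and conv: "\<And>s::nat. ((\<lambda>e. laplace_transform (\<mu>s e) s) \<longlongrightarrow> laplace_transform \<mu> s) F"
    and ab: "a < b"
  shows "((\<lambda>e. LINT x|\<mu>s e. cts_step a b x) \<longlongrightarrow> (LINT x|\<mu>. cts_step a b x)) F"
proof -
  interpret laplace_convergence \<mu> "\<lambda>_ x. max 0 x" \<mu>s "\<lambda>_ _ x. max 0 x" F
    by (rule laplace_convergence_law[OF assms(1-3)])
  have step: "continuous_on UNIV (cts_step a b)"
    by (rule uniformly_continuous_imp_continuous[OF cts_step_uniformly_continuous[OF ab]])
  have "((\<lambda>e. LINT x|\<mu>s e. cts_step a b (max 0 x)) \<longlongrightarrow> (LINT x|\<mu>. cts_step a b (max 0 x))) F"
  proof (rule conv_bounded_continuous[of "\<lambda>x. cts_step a b (x 0)" 1 1])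
    show "continuous_on nonneg_seqs (\<lambda>x. cts_step a b (x 0))"
      by (auto intro!: continuous_on_compose2[OF step] continuous_on_subset[OF continuous_on_product_coordinates])
  qed (auto simp: cts_step_def)
  hence "((\<lambda>e. LINT x|\<mu>s e. cts_step a b (max 0 x)) \<longlongrightarrow> (LINT x|\<mu>. cts_step a b x)) F"
    unfolding integral_cts_step_max[OF \<mu>] .
  thus ?thesis
    by (rule Lim_transform_eventually) (use \<mu>s in \<open>auto elim!: eventually_mono simp: integral_cts_step_max\<close>)
qed

text \<open>A distribution function at \<open>x\<close> lies between the expectations of a
  continuous step that ends at \<open>x\<close> and of one that starts there. Continuity of the
  limit at \<open>x\<close> makes both close to the limiting value.\<close>

lemma laplace_conv_imp_weak_conv:
  assumes \<mu>s: "\<forall>\<^sub>F e in F. nonneg_law (\<mu>s e)" and \<mu>: "nonneg_law \<mu>"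
    and conv: "\<And>s::nat. ((\<lambda>e. laplace_transform (\<mu>s e) s) \<longlongrightarrow> laplace_transform \<mu> s) F"
  shows "weak_conv_along \<mu>s \<mu> F"
  unfolding weak_conv_along_def
proof (intro allI impI tendstoI)
  interpret real_distribution \<mu> using \<mu> by (simp add: nonneg_law_def)
  fix x \<delta> :: real assume cont: "isCont (cdf \<mu>) x" and "0 < \<delta>"
  hence \<delta>: "0 < \<delta> / 2" by simp
  obtain d where d: "0 < d" "\<And>y. dist y x < d \<Longrightarrow> dist (cdf \<mu> y) (cdf \<mu> x) < \<delta> / 2"
    using cont \<delta> unfolding continuous_at_eps_delta by metis
  define y where "y = x + d / 2"
  define z where "z = x - d / 2"
  have yz: "x < y" "z < x" and y: "dist (cdf \<mu> y) (cdf \<mu> x) < \<delta> / 2" and z: "dist (cdf \<mu> z) (cdf \<mu> x) < \<delta> / 2"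
    using d by (auto simp: y_def z_def dist_real_def)
  show "\<forall>\<^sub>F e in F. dist (cdf (\<mu>s e) x) (cdf \<mu> x) < \<delta>"
    using \<mu>s tendstoD[OF laplace_conv_imp_cts_step_conv[OF assms yz(1)] \<delta>]
      tendstoD[OF laplace_conv_imp_cts_step_conv[OF assms yz(2)] \<delta>]
  proof eventually_elim
    case (elim e)
    interpret e: real_distribution "\<mu>s e" using elim by (simp add: nonneg_law_def)
    show ?case
      using elim(2,3) e.cdf_cts_step[OF yz(1)] e.cdf_cts_step[OF yz(2)] cdf_cts_step[OF yz(1)] cdf_cts_step[OF yz(2)] y z
      unfolding dist_real_def abs_less_iff by linarith
  qed
qed

text \<open>Uniqueness is the convergence statement for a constant family: the expectations of all
  continuous steps agree, and right continuity passes from these to distribution functions.\<close>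

lemma laplace_unique:
  assumes \<mu>: "nonneg_law \<mu>" and \<nu>: "nonneg_law \<nu>"
    and eq: "\<And>s::nat. laplace_transform \<mu> s = laplace_transform \<nu> s"
  shows "\<mu> = \<nu>"
proof -
  have step: "(LINT x|\<mu>. cts_step a b x) = (LINT x|\<nu>. cts_step a b x)" if "a < b" for a b
    using laplace_conv_imp_cts_step_conv[where F=sequentially and \<mu>s="\<lambda>_. \<mu>" and \<mu>=\<nu> and a=a and b=b] assms that
    by (simp add: tendsto_const_iff)
  have le: "cdf \<mu> x \<le> cdf \<nu> x"
    if \<mu>: "nonneg_law \<mu>" and \<nu>: "nonneg_law \<nu>"
      and step: "\<And>a b. a < b \<Longrightarrow> (LINT x|\<mu>. cts_step a b x) = (LINT x|\<nu>. cts_step a b x)" for \<mu> \<nu> x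
  proof -
    interpret \<mu>: real_distribution \<mu> using \<mu> by (simp add: nonneg_law_def)
    interpret \<nu>: real_distribution \<nu> using \<nu> by (simp add: nonneg_law_def)
    have "\<forall>\<^sub>F y in at_right x. cdf \<mu> x \<le> cdf \<nu> y"
      using eventually_at_right_less[of x] by eventually_elim (metis step \<mu>.cdf_cts_step(1) \<nu>.cdf_cts_step(2) order_trans)
    moreover have "(cdf \<nu> \<longlongrightarrow> cdf \<nu> x) (at_right x)"
      using \<nu>.cdf_is_right_cont[of x] by (simp add: continuous_within)
    ultimately show ?thesis by (intro tendsto_lowerbound) auto
  qed
  have "cdf \<mu> = cdf \<nu>" using le[OF \<mu> \<nu> step] le[OF \<nu> \<mu> step[symmetric]] by (intro ext antisym) auto
  thus ?thesis using \<mu> \<nu> by (intro cdf_unique) (auto simp: nonneg_law_def)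
qed

lemma weak_conv_imp_nonneg:
  assumes "real_distribution \<mu>" "\<And>n. nonneg_law (\<mu>s n)" "weak_conv_m \<mu>s \<mu>"
  shows "nonneg_law \<mu>"
proof -
  interpret real_distribution \<mu> by fact
  have neg: "cdf (\<mu>s n) x = 0" if "x < 0" for x n
  proof -
    interpret n: real_distribution "\<mu>s n" using assms(2) by (simp add: nonneg_law_def)
    have "AE y in \<mu>s n. y \<notin> {..x}" using assms(2)[of n] that unfolding nonneg_law_def by (auto elim!: eventually_mono)
    thus ?thesis unfolding cdf_def2 by (simp add: n.prob_eq_0)
  qed
  have "cdf \<mu> x = 0" if "x < 0" for x
  proof -
    \<comment> \<open>Only countably many points carry mass, so a continuity point of the limit lies
      between \<open>x\<close> and 0.\<close>
    have "countable {z. measure \<mu> {z} > 0}" by (rule countable_atoms)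
    moreover have "uncountable {x<..<0}" using that by (simp add: uncountable_open_interval)
    ultimately obtain z where z: "z \<in> {x<..<0}" "\<not> measure \<mu> {z} > 0"
      by (metis (no_types, lifting) countable_subset mem_Collect_eq subsetI)
    hence "isCont (cdf \<mu>) z" unfolding isCont_cdf using measure_nonneg[of \<mu> "{z}"] by linarith
    hence "(\<lambda>n. cdf (\<mu>s n) z) \<longlonglongrightarrow> cdf \<mu> z"
      using assms(3) by (simp add: weak_conv_m_def weak_conv_def)
    hence "cdf \<mu> z = 0" using z neg by (simp add: LIMSEQ_const_iff)
    thus ?thesis using cdf_nondecreasing[of x z] cdf_nonneg[of x] z by simp
  qed
  hence "AE y in \<mu>. y \<notin> {..- 1 / real (Suc n)}" for n
    by (subst prob_eq_0[symmetric]) (auto simp: cdf_def2[symmetric])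
  hence "AE y in \<mu>. \<forall>n. y \<notin> {..- 1 / real (Suc n)}" by (simp add: AE_all_countable)
  hence "AE y in \<mu>. 0 \<le> y"
  proof eventually_elim
    case (elim y)
    show ?case
    proof (rule ccontr)
      assume "\<not> 0 \<le> y"
      then obtain n where "inverse (real (Suc n)) < - y" using reals_Archimedean[of "- y"] by auto
      thus False using elim by (auto simp: inverse_eq_divide not_le dest!: spec[of _ n])
    qed
  qed
  thus ?thesis using assms(1) by (simp add: nonneg_law_def)
qed

lemma weak_conv_m_imp_laplace_conv:
  assumes "nonneg_law \<mu>" "\<And>n. nonneg_law (\<mu>s n)" "weak_conv_m \<mu>s \<mu>" "0 \<le> s"
  shows "(\<lambda>n. laplace_transform (\<mu>s n) s) \<longlonglongrightarrow> laplace_transform \<mu> s"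
proof -
  have eq: "(LINT x|\<nu>. exp (- s * max 0 x)) = laplace_transform \<nu> s" if \<nu>: "nonneg_law \<nu>" for \<nu>
  proof -
    interpret real_distribution \<nu> using \<nu> by (simp add: nonneg_law_def)
    have "AE x in \<nu>. exp (- s * max 0 x) = exp (- s * x)"
      using \<nu>[unfolded nonneg_law_def, THEN conjunct2] by (rule eventually_mono) simp
    thus ?thesis unfolding laplace_transform_def by (intro integral_cong_AE) auto
  qed
  have "(\<lambda>n. LINT x|\<mu>s n. exp (- s * max 0 x)) \<longlonglongrightarrow> (LINT x|\<mu>. exp (- s * max 0 x))"
    using assms(3)
    by (rule weak_conv_imp_integral_bdd_continuous_conv[rotated 2, where B=1])
       (use assms in \<open>auto simp: nonneg_law_def intro!: continuous_intros\<close>)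
  thus ?thesis using eq assms(1,2) by simp
qed

lemma weak_conv_along_imp_laplace_conv:
  assumes \<mu>: "nonneg_law \<mu>" and \<mu>s: "\<forall>\<^sub>F e in at_right (0::real). nonneg_law (\<mu>s e)"
    and conv: "weak_conv_along \<mu>s \<mu> (at_right 0)" and s: "0 \<le> s"
  shows "((\<lambda>e. laplace_transform (\<mu>s e) s) \<longlongrightarrow> laplace_transform \<mu> s) (at_right 0)"
proof -
  obtain b where b: "0 < b" "\<And>e. 0 < e \<Longrightarrow> e < b \<Longrightarrow> nonneg_law (\<mu>s e)"
    using \<mu>s unfolding eventually_at_right_field by blast
  show ?thesis
  proof (rule tendsto_at_right_sequentially[OF b(1)])
    fix S :: "nat \<Rightarrow> real" assume S: "\<And>n. 0 < S n" "\<And>n. S n < b" "S \<longlonglongrightarrow> 0"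
    have "filterlim S (at_right 0) sequentially"
      using S by (auto simp: filterlim_at less_imp_neq[THEN not_sym])
    hence "weak_conv_m (\<lambda>n. \<mu>s (S n)) \<mu>"
      using conv unfolding weak_conv_m_def weak_conv_def weak_conv_along_def by (auto intro: filterlim_compose)
    thus "(\<lambda>n. laplace_transform (\<mu>s (S n)) s) \<longlonglongrightarrow> laplace_transform \<mu> s"
      using \<mu> b(2) S s by (intro weak_conv_m_imp_laplace_conv) auto
  qed
qed

text \<open>Markov's inequality for the increasing function
  \<open>1 - exp (- s * x)\<close>.\<close>

lemma laplace_tail:
  assumes \<mu>: "nonneg_law \<mu>" and s: "0 < s" and R: "0 \<le> R"
  shows "measure \<mu> {R..} * (1 - exp (- s * R)) \<le> 1 - laplace_transform \<mu> s"
proof -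
  interpret real_distribution \<mu> using \<mu> by (simp add: nonneg_law_def)
  have int: "integrable \<mu> (\<lambda>x. exp (- s * x))" using nonneg_law_integrable[OF \<mu>] s by simp
  have "measure \<mu> {R..} * (1 - exp (- s * R)) = (LINT x|\<mu>. indicator {R..} x * (1 - exp (- s * R)))"
    by simp
  also have "\<dots> \<le> (LINT x|\<mu>. 1 - exp (- s * x))"
  proof (rule integral_mono_AE)
    show "AE x in \<mu>. indicator {R..} x * (1 - exp (- s * R)) \<le> 1 - exp (- s * x)"
      using \<mu> s unfolding nonneg_law_def by (auto elim!: eventually_mono simp: indicator_def)
  qed (use int finite_measure_axioms in \<open>auto simp: integrable_indicator_iff emeasure_eq_measure\<close>)
  also have "\<dots> = 1 - laplace_transform \<mu> s" using int prob_space by (simp add: laplace_transform_def)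
  finally show ?thesis .
qed

lemma tight_if_laplace_conv:
  assumes \<mu>s: "\<And>n. nonneg_law (\<mu>s n)"
    and conv: "\<And>k. (\<lambda>n. laplace_transform (\<mu>s n) (1 / Suc k)) \<longlonglongrightarrow> \<psi> k"
    and \<psi>: "\<psi> \<longlonglongrightarrow> 1"
  shows "tight \<mu>s"
  unfolding tight_def
proof (intro conjI allI impI)
  interpret n: real_distribution "\<mu>s n" for n using \<mu>s by (simp add: nonneg_law_def)
  show "real_distribution (\<mu>s n)" for n by unfold_locales
  fix \<epsilon> :: real assume \<epsilon>: "0 < \<epsilon>"
  have "\<forall>\<^sub>F k in sequentially. \<psi> k > 1 - \<epsilon> / 2" using order_tendstoD(1)[OF \<psi>] \<epsilon> by simp
  then obtain k where "\<psi> k > 1 - \<epsilon> / 2" using eventually_happens sequentially_bot by blast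
  hence "\<forall>\<^sub>F n in sequentially. laplace_transform (\<mu>s n) (1 / Suc k) > 1 - \<epsilon> / 2"
    using order_tendstoD(1)[OF conv] by blast
  then obtain N where N: "\<And>n. n \<ge> N \<Longrightarrow> laplace_transform (\<mu>s n) (1 / Suc k) > 1 - \<epsilon> / 2"
    unfolding eventually_sequentially by blast
  \<comment> \<open>Chosen so that the exponential at \<open>R\<close> equals 1/2; the tail beyond
    \<open>R\<close> is then at most twice the defect of the transform.\<close>
  define R where "R = ln 2 * Suc k"
  have R: "0 \<le> R" "exp (- (1 / Suc k) * R) = 1 / 2" by (auto simp: R_def exp_minus)
  have tail: "measure (\<mu>s n) {..R} > 1 - \<epsilon>" if "n \<ge> N" for n
  proof -
    have "measure (\<mu>s n) {R..} * (1 - exp (- (1 / Suc k) * R)) \<le> 1 - laplace_transform (\<mu>s n) (1 / Suc k)"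
      by (rule laplace_tail[OF \<mu>s]) (use R in auto)
    hence "measure (\<mu>s n) {R..} < \<epsilon>" using N[OF that] unfolding R(2) by simp
    moreover have "1 \<le> measure (\<mu>s n) {..R} + measure (\<mu>s n) {R..}"
    proof -
      have "measure (\<mu>s n) ({..R} \<union> {R..}) \<le> measure (\<mu>s n) {..R} + measure (\<mu>s n) {R..}"
        by (rule measure_Un_le) auto
      moreover have "{..R} \<union> {R..} = space (\<mu>s n)" by auto
      ultimately show ?thesis using n.prob_space by simp
    qed
    ultimately show ?thesis by linarith
  qed
  have "\<exists>b. measure (\<mu>s n) {..b} > 1 - \<epsilon>" for n
  proof -
    have "\<forall>\<^sub>F b in at_top. cdf (\<mu>s n) b > 1 - \<epsilon>"
      using order_tendstoD(1)[OF n.cdf_lim_at_top_prob] \<epsilon> by simp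
    thus ?thesis unfolding cdf_def2 using eventually_happens trivial_limit_at_top_linorder by blast
  qed
  then obtain b where b: "\<And>n. measure (\<mu>s n) {..b n} > 1 - \<epsilon>" by metis
  define B where "B = max R (Max (insert 0 (b ` {..<N})))"
  have B0: "0 \<le> B" unfolding B_def using R(1) by simp
  \<comment> \<open>The left end is -1 because the interval is open on the left and 0 may carry
    mass.\<close>
  have "measure (\<mu>s n) {-1<..B} > 1 - \<epsilon>" for n
  proof -
    have "\<exists>c\<le>B. measure (\<mu>s n) {..c} > 1 - \<epsilon>"
    proof (cases "n \<ge> N")
      case True thus ?thesis using tail by (intro exI[of _ R]) (auto simp: B_def)
    next
      case False
      hence "b n \<le> Max (insert 0 (b ` {..<N}))" by (intro Max_ge) auto
      thus ?thesis using b by (intro exI[of _ "b n"]) (auto simp: B_def)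
    qed
    then obtain c where c: "c \<le> B" "measure (\<mu>s n) {..c} > 1 - \<epsilon>" by blast
    have "measure (\<mu>s n) {..c} \<le> measure (\<mu>s n) {..B}"
      using c(1) by (intro n.finite_measure_mono) auto
    also have "\<dots> = measure (\<mu>s n) {-1<..B}"
      using \<mu>s[of n] unfolding nonneg_law_def
      by (intro n.finite_measure_eq_AE) (auto elim!: eventually_mono)
    finally show ?thesis using c by linarith
  qed
  thus "\<exists>a b. a < b \<and> (\<forall>n. measure (\<mu>s n) {a<..b} > 1 - \<epsilon>)" using B0
    by (intro exI[of _ "-1"] exI[of _ B]) auto
qed

text \<open>The behaviour of \<open>\<psi>\<close> near 0 excludes loss of mass, so some subsequence
  converges weakly. Its limit has the transform \<open>\<psi>\<close>, because the transforms
  converge along the full sequence.\<close>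

lemma laplace_limit_exists:
  assumes \<mu>s: "\<And>n. nonneg_law (\<mu>s n)"
    and conv: "\<And>s. 0 \<le> s \<Longrightarrow> (\<lambda>n. laplace_transform (\<mu>s n) s) \<longlonglongrightarrow> \<psi> s"
    and \<psi>: "(\<lambda>k. \<psi> (1 / Suc k)) \<longlonglongrightarrow> 1"
  obtains \<mu> where "nonneg_law \<mu>" "\<And>s. 0 \<le> s \<Longrightarrow> laplace_transform \<mu> s = \<psi> s"
proof -
  have "tight \<mu>s" by (rule tight_if_laplace_conv[OF \<mu>s conv \<psi>]) simp
  from tight_imp_convergent_subsubsequence[OF this strict_mono_id]
  obtain r \<mu> where r: "strict_mono r" "real_distribution \<mu>" "weak_conv_m (\<mu>s \<circ> r) \<mu>" by (auto simp: o_def id_def)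
  have \<mu>: "nonneg_law \<mu>" using weak_conv_imp_nonneg[OF r(2) _ r(3)] \<mu>s by simp
  have "laplace_transform \<mu> s = \<psi> s" if "0 \<le> s" for s
  proof (rule LIMSEQ_unique)
    show "(\<lambda>n. laplace_transform ((\<mu>s \<circ> r) n) s) \<longlonglongrightarrow> laplace_transform \<mu> s"
      by (rule weak_conv_m_imp_laplace_conv[OF \<mu> _ r(3) that]) (simp add: \<mu>s)
    show "(\<lambda>n. laplace_transform ((\<mu>s \<circ> r) n) s) \<longlonglongrightarrow> \<psi> s"
      using LIMSEQ_subseq_LIMSEQ[OF conv[OF that] r(1)] by (simp add: o_def)
  qed
  thus ?thesis using \<mu> that by blast
qed

section \<open>Monotone paths and the J-topology\<close>

definition mono_paths :: "(real \<Rightarrow> real) set" where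
  "mono_paths = {x \<in> extensional {0..}. 0 \<le> x 0 \<and> (\<forall>s\<ge>0. \<forall>t\<ge>s. x s \<le> x t) \<and>
     (\<forall>t\<ge>0. continuous (at_right t) x)}"

lemma mono_pathsD:
  assumes "x \<in> mono_paths"
  shows "0 \<le> s \<Longrightarrow> s \<le> t \<Longrightarrow> x s \<le> x t" "0 \<le> t \<Longrightarrow> 0 \<le> x t" "0 \<le> t \<Longrightarrow> (x \<longlongrightarrow> x t) (at_right t)"
proof -
  show mono: "0 \<le> s \<Longrightarrow> s \<le> t \<Longrightarrow> x s \<le> x t" for s t using assms by (auto simp: mono_paths_def)
  have "0 \<le> x 0" using assms by (simp add: mono_paths_def)
  thus "0 \<le> t \<Longrightarrow> 0 \<le> x t" using mono[of 0 t] by linarith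
  show "0 \<le> t \<Longrightarrow> (x \<longlongrightarrow> x t) (at_right t)" using assms by (auto simp: mono_paths_def continuous_within)
qed

text \<open>Monotonicity supplies the left limits, as suprema over the past.\<close>

lemma mono_paths_subset: "mono_paths \<subseteq> cadlag_paths"
proof
  fix x assume x: "x \<in> mono_paths"
  have "\<exists>l. (x \<longlongrightarrow> l) (at_left t)" if t: "0 < t" for t
  proof -
    have bdd: "bdd_above (x ` {0..<t})"
      using mono_pathsD(1)[OF x] by (intro bdd_aboveI[of _ "x t"]) auto
    have ev: "\<forall>\<^sub>F s in at_left t. 0 < s \<and> s < t"
      using t by (auto simp: eventually_at_left_field intro!: exI[of _ 0])
    have "(x \<longlongrightarrow> Sup (x ` {0..<t})) (at_left t)"
    proof (rule increasing_tendsto)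
      show "\<forall>\<^sub>F s in at_left t. x s \<le> Sup (x ` {0..<t})"
        using ev by eventually_elim (auto intro!: cSup_upper bdd)
      fix l assume "l < Sup (x ` {0..<t})"
      then obtain s where s: "s \<in> {0..<t}" "l < x s"
        using less_cSup_iff[OF _ bdd, of l] t by fastforce
      have "\<forall>\<^sub>F u in at_left t. s < u \<and> u < t"
        using s by (auto simp: eventually_at_left_field intro!: exI[of _ s])
      thus "\<forall>\<^sub>F u in at_left t. l < x u"
        by eventually_elim (use s mono_pathsD(1)[OF x] in \<open>auto intro: less_le_trans\<close>)
    qed
    thus ?thesis by blast
  qed
  thus "x \<in> cadlag_paths" using x by (auto simp: cadlag_paths_def mono_paths_def)
qed

definition grid_path :: "real \<Rightarrow> (nat \<Rightarrow> real) \<Rightarrow> real \<Rightarrow> real" where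
  "grid_path h a = (\<lambda>t\<in>{0..}. a (nat \<lfloor>t / h\<rfloor>))"

lemma nat_floor_mono: "x \<le> y \<Longrightarrow> nat \<lfloor>x\<rfloor> \<le> nat \<lfloor>y::real\<rfloor>"
  by (intro nat_mono floor_mono)

lemma nat_floor_div:
  fixes h t :: real
  assumes "0 < h" "0 \<le> t"
  shows "nat \<lfloor>t / h\<rfloor> = j \<longleftrightarrow> j * h \<le> t \<and> t < Suc j * h"
proof -
  have "nat \<lfloor>t / h\<rfloor> = j \<longleftrightarrow> \<lfloor>t / h\<rfloor> = int j" using assms by auto
  also have "\<dots> \<longleftrightarrow> j \<le> t / h \<and> t / h < Suc j" by (simp add: floor_eq_iff add.commute)
  finally show ?thesis using assms by (simp add: pos_le_divide_eq pos_divide_less_eq)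
qed

lemma grid_path_mono_paths:
  assumes "mono a" "0 \<le> a 0" and h: "0 < h"
  shows "grid_path h a \<in> mono_paths"
proof -
  have "continuous (at_right t) (grid_path h a)" if t: "0 \<le> t" for t
  proof -
    define j where "j = nat \<lfloor>t / h\<rfloor>"
    have j: "j * h \<le> t" "t < Suc j * h" using nat_floor_div[OF h t, of j] by (auto simp: j_def)
    have "\<forall>\<^sub>F s in at_right t. t < s \<and> s < Suc j * h"
      using j by (auto simp: eventually_at_right_field intro!: exI[of _ "Suc j * h"])
    hence "\<forall>\<^sub>F s in at_right t. grid_path h a s = grid_path h a t"
    proof eventually_elim
      case (elim s)
      have "nat \<lfloor>s / h\<rfloor> = j" using nat_floor_div[OF h, of s j] elim j t by auto
      thus ?case using elim t by (simp add: grid_path_def j_def)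
    qed
    thus ?thesis unfolding continuous_within by (rule tendsto_eventually)
  qed
  moreover have "grid_path h a s \<le> grid_path h a t" if "0 \<le> s" "s \<le> t" for s t
    using that h by (simp add: grid_path_def monoD[OF assms(1)] nat_floor_mono divide_right_mono)
  ultimately show ?thesis
    using assms by (auto simp: mono_paths_def grid_path_def)
qed

definition discretize :: "real \<Rightarrow> (real \<Rightarrow> real) \<Rightarrow> real \<Rightarrow> real" where
  "discretize h x = grid_path h (\<lambda>j. x (j * h))"

lemma discretize_mono_paths:
  assumes "x \<in> mono_paths" "0 < h"
  shows "discretize h x \<in> mono_paths"
  unfolding discretize_def using assms
  by (intro grid_path_mono_paths monoI mono_pathsD(1)[OF assms(1)]) (auto intro: mono_pathsD(2)[OF assms(1)])

section \<open>Time changes\<close>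

lemma time_changesD:
  assumes "\<tau> \<in> time_changes"
  shows "0 \<le> t \<Longrightarrow> 0 \<le> \<tau> t" "0 \<le> s \<Longrightarrow> s < t \<Longrightarrow> \<tau> s < \<tau> t" "0 \<le> u \<Longrightarrow> \<exists>t\<ge>0. \<tau> t = u" "inj_on \<tau> {0..}"
proof -
  have im: "\<tau> ` {0..} = {0..}" and mono: "strict_mono_on {0..} \<tau>" using assms by (auto simp: time_changes_def)
  show "0 \<le> t \<Longrightarrow> 0 \<le> \<tau> t" using im by auto
  show "0 \<le> s \<Longrightarrow> s < t \<Longrightarrow> \<tau> s < \<tau> t" using mono by (auto simp: strict_mono_on_def)
  show "0 \<le> u \<Longrightarrow> \<exists>t\<ge>0. \<tau> t = u" using im by (metis atLeast_iff imageE)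
  show "inj_on \<tau> {0..}" using mono by (rule strict_mono_on_imp_inj_on)
qed

lemma id_time_change: "(\<lambda>t. t) \<in> time_changes"
  by (auto simp: time_changes_def strict_mono_on_def)

lemma time_change_comp:
  assumes "\<sigma> \<in> time_changes" "\<tau> \<in> time_changes"
  shows "(\<lambda>t. \<sigma> (\<tau> t)) \<in> time_changes"
  using assms time_changesD[OF assms(1)] time_changesD[OF assms(2)]
  unfolding time_changes_def strict_mono_on_def by (auto simp flip: image_image)

lemma time_change_inverse:
  assumes \<tau>: "\<tau> \<in> time_changes"
  obtains \<sigma> where "\<sigma> \<in> time_changes" "\<And>t. 0 \<le> t \<Longrightarrow> \<sigma> (\<tau> t) = t" "\<And>t. 0 \<le> t \<Longrightarrow> \<tau> (\<sigma> t) = t"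
proof
  let ?\<sigma> = "inv_into {0..} \<tau>"
  have im: "\<tau> ` {0..} = {0..}" using \<tau> by (auto simp: time_changes_def)
  show 1: "?\<sigma> (\<tau> t) = t" if "0 \<le> t" for t using time_changesD(4)[OF \<tau>] that by (simp add: inv_into_f_f)
  show 2: "\<tau> (?\<sigma> t) = t" if "0 \<le> t" for t using im that by (simp add: f_inv_into_f)
  have nn: "0 \<le> ?\<sigma> t" if "0 \<le> t" for t using inv_into_into[of t \<tau> "{0..}"] im that by simp
  have "?\<sigma> s < ?\<sigma> t" if "0 \<le> s" "s < t" for s t
  proof (rule ccontr)
    assume "\<not> ?\<sigma> s < ?\<sigma> t"
    hence "?\<sigma> t < ?\<sigma> s \<or> ?\<sigma> t = ?\<sigma> s" by auto
    thus False using time_changesD(2)[OF \<tau>, of "?\<sigma> t" "?\<sigma> s"] nn[of t] 2[of s] 2[of t] that by auto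
  qed
  moreover have "?\<sigma> ` {0..} = {0..}"
  proof
    show "?\<sigma> ` {0..} \<subseteq> {0..}" using nn by auto
    show "{0..} \<subseteq> ?\<sigma> ` {0..}" using 1 time_changesD(1)[OF \<tau>] by (metis atLeast_iff image_eqI subsetI)
  qed
  ultimately show "?\<sigma> \<in> time_changes" by (auto simp: time_changes_def strict_mono_on_def)
qed

text \<open>Piecewise linear interpolation of the knots \<open>p j\<close> at the times
  \<open>j * h\<close>. The hypotheses place each later knot in the half-open block that ends at
  \<open>j * h\<close>, which gives both strict monotonicity and the distance bound
  \<open>h\<close>.\<close>

lemma interpolated_time_change:
  fixes p :: "nat \<Rightarrow> real"
  assumes h: "0 < h" and p0: "p 0 = 0" and p: "\<And>j. p j \<le> j * h" "\<And>j. j * h < p (Suc j)"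
  obtains \<sigma> where "\<sigma> \<in> time_changes" "\<And>u. 0 \<le> u \<Longrightarrow> \<bar>\<sigma> u - u\<bar> \<le> h"
    "\<And>u j. 0 \<le> u \<Longrightarrow> j = nat \<lfloor>u / h\<rfloor> \<Longrightarrow> p j \<le> \<sigma> u \<and> \<sigma> u < p (Suc j)"
proof
  define ix where "ix u = nat \<lfloor>u / h\<rfloor>" for u
  define \<sigma> where "\<sigma> u = p (ix u) + (u / h - ix u) * (p (Suc (ix u)) - p (ix u))" for u
  have ix: "ix u * h \<le> u" "u < Suc (ix u) * h" if "0 \<le> u" for u
    using nat_floor_div[OF h that, of "ix u"] by (auto simp: ix_def)
  have fr: "0 \<le> u / h - ix u" "u / h - ix u < 1" if "0 \<le> u" for u
    using ix[OF that] h by (auto simp: field_simps)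
  have inc: "p j < p (Suc j)" for j using p(1)[of j] p(2)[of j] by linarith
  hence "strict_mono p" by (intro strict_monoI_Suc)
  hence mono: "p i \<le> p j" if "i \<le> j" for i j using that by (simp add: strict_mono_less_eq)
  show in_cell: "p j \<le> \<sigma> u \<and> \<sigma> u < p (Suc j)" if u: "0 \<le> u" and j: "j = nat \<lfloor>u / h\<rfloor>" for u j
  proof -
    have "(u / h - ix u) * (p (Suc j) - p j) < 1 * (p (Suc j) - p j)"
      using fr[OF u] inc[of j] by (intro mult_strict_right_mono) auto
    moreover have "0 \<le> (u / h - ix u) * (p (Suc j) - p j)"
      using fr[OF u] inc[of j] by (intro mult_nonneg_nonneg) auto
    ultimately show ?thesis using j by (simp add: \<sigma>_def ix_def)
  qed
  show "\<bar>\<sigma> u - u\<bar> \<le> h" if u: "0 \<le> u" for u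
  proof -
    define j f where "j = ix u" and "f = u / h - ix u"
    let ?j = j and ?f = f
    have f: "0 \<le> f" "f < 1" using fr[OF u] by (auto simp: f_def)
    have ueq: "u = ?j * h + ?f * h" using h by (simp add: f_def j_def field_simps)
    have le: "?j * h - h \<le> p ?j"
    proof (cases ?j)
      case 0 thus ?thesis using p0 h by simp
    next
      case (Suc k)
      thus ?thesis using p(2)[of k] by (simp add: algebra_simps)
    qed
    \<comment> \<open>A convex combination of two neighbouring knots. Their upper bounds average to
      \<open>u\<close> and their lower bounds to \<open>u - h\<close>.\<close>
    have "\<sigma> u = (1 - ?f) * p ?j + ?f * p (Suc ?j)" by (simp add: \<sigma>_def f_def j_def algebra_simps)
    moreover have "(1 - ?f) * p ?j \<le> (1 - ?f) * (?j * h)" "?f * p (Suc ?j) \<le> ?f * (Suc ?j * h)"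
      "(1 - ?f) * (?j * h - h) \<le> (1 - ?f) * p ?j" "?f * (?j * h) \<le> ?f * p (Suc ?j)"
      using f p(1)[of ?j] p(1)[of "Suc ?j"] p(2)[of ?j] le by (auto intro!: mult_left_mono)
    moreover have "(1 - ?f) * (?j * h) + ?f * (Suc ?j * h) = ?j * h + ?f * h"
      "(1 - ?f) * (?j * h - h) + ?f * (?j * h) = ?j * h + ?f * h - h"
      by (simp_all add: algebra_simps)
    moreover have "\<bar>s - u\<bar> \<le> h" if "s = a + b" "a \<le> a1" "b \<le> b1" "a2 \<le> a" "b2 \<le> b" "a1 + b1 = j * h + f * h"
      "a2 + b2 = j * h + f * h - h" for s a b a1 b1 a2 b2
      using that h ueq by linarith
    ultimately show ?thesis by blast
  qed
  have \<sigma>_mono: "\<sigma> s < \<sigma> t" if "0 \<le> s" "s < t" for s t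
  proof (cases "ix s = ix t")
    case True
    have "(s / h - ix t) * (p (Suc (ix t)) - p (ix t)) < (t / h - ix t) * (p (Suc (ix t)) - p (ix t))"
      using that h inc[of "ix t"] by (intro mult_strict_right_mono) (auto simp: divide_strict_right_mono)
    thus ?thesis by (simp add: \<sigma>_def True)
  next
    case False
    have "ix s \<le> ix t" unfolding ix_def using that h by (intro nat_floor_mono divide_right_mono) auto
    hence "Suc (ix s) \<le> ix t" using False by simp
    hence "p (Suc (ix s)) \<le> p (ix t)" by (rule mono)
    thus ?thesis using in_cell[of s "ix s"] in_cell[of t "ix t"] that unfolding ix_def by fastforce
  qed
  have "\<exists>u\<ge>0. \<sigma> u = t" if t: "0 \<le> t" for t
  proof -
    obtain N :: nat where N: "t / h < N" using reals_Archimedean2 by blast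
    hence tN: "t < p (Suc N)" using p(2)[of N] h by (simp add: pos_divide_less_eq)
    \<comment> \<open>The first cell whose right knot lies beyond \<open>t\<close>; solving the
      linear equation in this cell gives the preimage of \<open>t\<close>.\<close>
    define j where "j = (LEAST j. t < p (Suc j))"
    have j: "t < p (Suc j)" unfolding j_def using tN by (rule LeastI)
    have j': "p j \<le> t"
    proof (cases j)
      case 0 thus ?thesis using p0 t by simp
    next
      case (Suc k)
      thus ?thesis using not_less_Least[of k "\<lambda>j. t < p (Suc j)"] unfolding j_def[symmetric] by simp
    qed
    define f where "f = (t - p j) / (p (Suc j) - p j)"
    have f: "0 \<le> f" "f < 1" unfolding f_def using j j' inc[of j] by (auto simp: divide_simps)
    define u where "u = (j + f) * h"
    have u: "0 \<le> u" unfolding u_def using f h by simp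
    have "ix u = j" unfolding ix_def using nat_floor_div[OF h u, of j] f h by (simp add: u_def algebra_simps)
    moreover have "u / h - j = f" using h by (simp add: u_def)
    ultimately have "\<sigma> u = p j + f * (p (Suc j) - p j)" by (simp add: \<sigma>_def)
    also have "\<dots> = t" unfolding f_def using inc[of j] by simp
    finally show ?thesis using u by blast
  qed
  moreover have "0 \<le> \<sigma> u" if "0 \<le> u" for u
    using in_cell[OF that refl] mono[of 0 "nat \<lfloor>u / h\<rfloor>"] p0 by linarith
  ultimately have "\<sigma> ` {0..} = {0..}" by (auto simp: image_iff Bex_def)
  thus "\<sigma> \<in> time_changes" using \<sigma>_mono by (auto simp: time_changes_def strict_mono_on_def)
qed

section \<open>Discretized paths\<close>

text \<open>Excludes two increments of size \<open>r\<close> separated by a point of the block. For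
  monotone paths this is the three-point modulus of the J-topology: comparing \<open>t\<close> with
  the ends of the block covers all triples inside it.\<close>

definition one_jump_block :: "(real \<Rightarrow> real) \<Rightarrow> real \<Rightarrow> real \<Rightarrow> nat \<Rightarrow> bool" where
  "one_jump_block x h r j \<longleftrightarrow>
     (\<forall>t\<in>{real j * h..real (Suc j) * h}. x t - x (real j * h) < r \<or> x (real (Suc j) * h) - x t < r)"

text \<open>The time change moves the first passage over \<open>x (j h) + r\<close> inside a block to the end of the block.\<close>

lemma discretize_in_J_nbhd:
  assumes x: "x \<in> mono_paths" and h: "0 < h" "h < \<delta>" and r: "0 < r" "r \<le> \<delta>" and T: "T < J * h"
    and block: "\<And>j. j < J \<Longrightarrow> one_jump_block x h r j"
  shows "discretize h x \<in> J_nbhd x T \<delta>"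
proof -
  \<comment> \<open>The times of block \<open>j\<close> at which the path has already risen by
    \<open>r\<close>. The infimum is matched with the end \<open>Suc j * h\<close> of the block, so
    that the jump of the discretized path is moved onto the true rise.\<close>
  define A where "A j = {t \<in> {j * h..Suc j * h}. x (j * h) + r \<le> x t}" for j :: nat
  define hit where "hit j \<longleftrightarrow> j < J \<and> A j \<noteq> {}" for j
  define p where "p j = (case j of 0 \<Rightarrow> 0 | Suc k \<Rightarrow> if hit k then Inf (A k) else Suc k * h)" for j
  have bdd: "bdd_below (A j)" for j by (auto simp: A_def bdd_below_def intro!: exI[of _ "j * h"])
  have A_sub: "A j \<subseteq> {j * h..Suc j * h}" for j by (auto simp: A_def)
  have Inf_in: "j * h \<le> Inf (A j) \<and> Inf (A j) \<le> Suc j * h" if ne: "A j \<noteq> {}" for j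
  proof -
    obtain a where a: "a \<in> A j" using ne by blast
    have "Inf (A j) \<le> a" using a bdd by (rule cInf_lower)
    moreover have "j * h \<le> Inf (A j)" using ne A_sub[of j] by (intro cInf_greatest) auto
    ultimately show ?thesis using a A_sub[of j] by auto
  qed
  \<comment> \<open>Right continuity carries the inequality from the points just after the infimum
    to the infimum itself.\<close>
  have Inf_val: "x (j * h) + r \<le> x (Inf (A j))" if ne: "A j \<noteq> {}" for j
  proof -
    let ?s = "Inf (A j)"
    have s0: "0 \<le> ?s" using Inf_in[OF ne] h by (meson mult_nonneg_nonneg of_nat_0_le_iff less_imp_le order_trans)
    have "\<forall>\<^sub>F t in at_right ?s. ?s < t" by (simp add: eventually_at_right_less)
    hence "\<forall>\<^sub>F t in at_right ?s. x (j * h) + r \<le> x t"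
    proof eventually_elim
      case (elim t)
      then obtain a where a: "a \<in> A j" "a < t" using cInf_lessD[OF ne] by blast
      have "0 \<le> a" using a(1) s0 cInf_lower[OF a(1) bdd] by linarith
      hence "x a \<le> x t" using a(2) by (intro mono_pathsD(1)[OF x]) auto
      thus ?case using a(1) by (auto simp: A_def)
    qed
    thus ?thesis using mono_pathsD(3)[OF x s0] by (intro tendsto_lowerbound[of x]) auto
  qed
  have p_le: "p j \<le> j * h" for j
    using Inf_in by (cases j) (auto simp: p_def hit_def)
  have p_gt: "j * h < p (Suc j)" for j
  proof (cases "hit j")
    case True
    hence ne: "A j \<noteq> {}" by (simp add: hit_def)
    have "Inf (A j) \<noteq> j * h" using Inf_val[OF ne] r by auto
    thus ?thesis using True Inf_in[OF ne] by (simp add: p_def)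
  next
    case False thus ?thesis using h by (simp add: p_def)
  qed
  have p0: "p 0 = 0" by (simp add: p_def)
  obtain \<sigma> where \<sigma>: "\<sigma> \<in> time_changes" "\<And>u. 0 \<le> u \<Longrightarrow> \<bar>\<sigma> u - u\<bar> \<le> h"
    "\<And>u j. 0 \<le> u \<Longrightarrow> j = nat \<lfloor>u / h\<rfloor> \<Longrightarrow> p j \<le> \<sigma> u \<and> \<sigma> u < p (Suc j)"
    using interpolated_time_change[OF h(1) p0 p_le p_gt] by metis
  obtain \<tau> where \<tau>: "\<tau> \<in> time_changes" "\<And>t. 0 \<le> t \<Longrightarrow> \<sigma> (\<tau> t) = t"
    using time_change_inverse[OF \<sigma>(1)] by metis
  \<comment> \<open>Either \<open>t\<close> lies in block \<open>j\<close> before the passage, where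
    the path is within \<open>r\<close> of its value at the start; or it lies in the previous block
    after the passage, where the one-jump condition leaves less than \<open>r\<close> up to the end
    of that block.\<close>
  have near: "\<bar>x (j * h) - x t\<bar> < r" if t: "p j \<le> t" "t < p (Suc j)" "t \<le> T" "0 \<le> t" for t j
  proof (cases "j * h \<le> t")
    case True
    hence "j * h < J * h" using t T by linarith
    hence "j < J" using h by simp
    have "t \<notin> A j"
    proof
      assume "t \<in> A j"
      hence "hit j" "Inf (A j) \<le> t" using \<open>j < J\<close> cInf_lower[OF _ bdd] by (auto simp: hit_def)
      thus False using t(2) by (simp add: p_def)
    qed
    moreover have "t \<le> Suc j * h" using t(2) p_le[of "Suc j"] by linarith
    ultimately have "x t < x (j * h) + r" using True by (auto simp: A_def not_le)
    moreover have "x (j * h) \<le> x t" using True h by (intro mono_pathsD(1)[OF x]) auto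
    ultimately show ?thesis by linarith
  next
    case False
    then obtain k where k: "j = Suc k" using t(4) by (cases j) auto
    have hit: "hit k" using t(1) False k by (auto simp: p_def split: if_splits)
    have tI: "Inf (A k) \<le> t" using t(1) k hit by (simp add: p_def)
    have ne: "A k \<noteq> {}" using hit by (simp add: hit_def)
    have "0 \<le> Inf (A k)" using Inf_in[OF ne] h
      by (meson mult_nonneg_nonneg of_nat_0_le_iff less_imp_le order_trans)
    hence "x (Inf (A k)) \<le> x t" using tI by (intro mono_pathsD(1)[OF x])
    hence "\<not> x t - x (k * h) < r" using Inf_val[OF ne] by linarith
    moreover have "t \<in> {k * h..Suc k * h}" using tI Inf_in[OF ne] False k by auto
    ultimately have "x (Suc k * h) - x t < r"
      using block[of k] hit unfolding one_jump_block_def hit_def by blast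
    moreover have "x t \<le> x (j * h)" using False t by (intro mono_pathsD(1)[OF x]) auto
    ultimately show ?thesis unfolding k by linarith
  qed
  have "\<bar>\<tau> t - t\<bar> < \<delta>" if "0 \<le> t" for t
    using \<sigma>(2)[of "\<tau> t"] \<tau>(2)[OF that] time_changesD(1)[OF \<tau>(1) that] h by (simp add: abs_minus_commute)
  moreover have "\<bar>discretize h x (\<tau> t) - x t\<bar> < \<delta>" if t: "t \<in> {0..T}" for t
  proof -
    define j where "j = nat \<lfloor>\<tau> t / h\<rfloor>"
    have \<tau>t: "0 \<le> \<tau> t" using time_changesD(1)[OF \<tau>(1)] t by simp
    have "p j \<le> t \<and> t < p (Suc j)" using \<sigma>(3)[OF \<tau>t j_def] \<tau>(2) t by simp
    hence "\<bar>x (j * h) - x t\<bar> < r" using near t by simp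
    moreover have "discretize h x (\<tau> t) = x (j * h)" using \<tau>t by (simp add: discretize_def grid_path_def j_def)
    ultimately show ?thesis using r by simp
  qed
  moreover have "discretize h x \<in> cadlag_paths"
    using discretize_mono_paths[OF x h(1)] mono_paths_subset by blast
  ultimately show ?thesis unfolding J_nbhd_def by (intro CollectI conjI bexI[OF _ \<tau>(1)]) auto
qed

text \<open>One-sided limits make the oscillation smaller than \<open>r\<close> on either side of
  each time, and a Lebesgue number of the cover makes this uniform. A fine block lies in one such
  neighbourhood, and each of its points is on the same side of the centre as one of the two
  ends.\<close>

lemma one_jump_blocks_fine:
  assumes x: "x \<in> mono_paths" and r: "0 < r" and T: "0 \<le> T"
  obtains h0 where "0 < h0" "\<And>h j. 0 < h \<Longrightarrow> h < h0 \<Longrightarrow> j * h \<le> T \<Longrightarrow> one_jump_block x h r j"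
proof -
  have "\<exists>d>0. (\<forall>s\<in>{t - d<..<t} \<inter> {0..}. \<forall>s'\<in>{t - d<..<t} \<inter> {0..}. x s - x s' < r)
      \<and> (\<forall>s\<in>{t..<t + d}. \<forall>s'\<in>{t..<t + d}. x s - x s' < r)" if t: "0 \<le> t" for t
  proof -
    have "\<forall>\<^sub>F s in at_right t. x s < x t + r"
      using order_tendstoD(2)[OF mono_pathsD(3)[OF x t], of "x t + r"] r by simp
    then obtain b where b: "b > t" "\<And>s. t < s \<Longrightarrow> s < b \<Longrightarrow> x s < x t + r"
      unfolding eventually_at_right_field by blast
    have right: "x s - x s' < r" if "s \<in> {t..<b}" "s' \<in> {t..<b}" for s s'
    proof -
      have "x t \<le> x s'" using that t by (intro mono_pathsD(1)[OF x]) auto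
      moreover have "x s < x t + r" using that b(2)[of s] r by (cases "s = t") auto
      ultimately show ?thesis by linarith
    qed
    have "\<exists>a<t. \<forall>s\<in>{a<..<t} \<inter> {0..}. \<forall>s'\<in>{a<..<t} \<inter> {0..}. x s - x s' < r"
    proof (cases "t = 0")
      case True thus ?thesis by (intro exI[of _ "-1"]) auto
    next
      case False
      moreover have "x \<in> cadlag_paths" using x mono_paths_subset by blast
      ultimately have "\<exists>l. (x \<longlongrightarrow> l) (at_left t)"
        using t by (simp add: cadlag_paths_def)
      then obtain l where l: "(x \<longlongrightarrow> l) (at_left t)" by blast
      have "\<forall>\<^sub>F s in at_left t. dist (x s) l < r / 2" using tendstoD[OF l, of "r / 2"] r by simp
      then obtain a where a: "a < t" "\<And>s. a < s \<Longrightarrow> s < t \<Longrightarrow> dist (x s) l < r / 2"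
        unfolding eventually_at_left_field by blast
      have "x s - x s' < r" if "s \<in> {a<..<t}" "s' \<in> {a<..<t}" for s s'
      proof -
        have "dist (x s) l < r / 2" "dist (x s') l < r / 2" using a(2) that by auto
        thus ?thesis unfolding dist_real_def by linarith
      qed
      thus ?thesis using a(1) by blast
    qed
    then obtain a where "a < t" "\<forall>s\<in>{a<..<t} \<inter> {0..}. \<forall>s'\<in>{a<..<t} \<inter> {0..}. x s - x s' < r" by blast
    thus ?thesis using right b(1) by (intro exI[of _ "min (t - a) (b - t)"]) auto
  qed
  then obtain d where d: "\<And>t. 0 \<le> t \<Longrightarrow> 0 < d t"
    "\<And>t s s'. 0 \<le> t \<Longrightarrow> s \<in> {t - d t<..<t} \<inter> {0..} \<Longrightarrow> s' \<in> {t - d t<..<t} \<inter> {0..} \<Longrightarrow> x s - x s' < r"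
    "\<And>t s s'. 0 \<le> t \<Longrightarrow> s \<in> {t..<t + d t} \<Longrightarrow> s' \<in> {t..<t + d t} \<Longrightarrow> x s - x s' < r"
    by metis
  define C where "C = (\<lambda>t. {t - d t<..<t + d t}) ` {0..T}"
  have cover: "{0..T} \<subseteq> \<Union>C" using d(1) unfolding C_def by force
  have op: "open G" if "G \<in> C" for G using that by (auto simp: C_def)
  obtain e where e: "0 < e" "\<And>s. s \<in> {0..T} \<Longrightarrow> \<exists>G\<in>C. ball s e \<subseteq> G"
    using Heine_Borel_lemma[OF compact_Icc cover op] by blast
  show ?thesis
  proof (rule that[OF e(1)])
    fix h :: real and j :: nat assume h: "0 < h" "h < e" "j * h \<le> T"
    have "j * h \<in> {0..T}" using h by simp
    then obtain t where t: "t \<in> {0..T}" "ball (j * h) e \<subseteq> {t - d t<..<t + d t}"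
      using e(2) unfolding C_def by blast
    have "{j * h..Suc j * h} \<subseteq> ball (j * h) e" using h by (auto simp: dist_real_def algebra_simps)
    hence sub: "{j * h..Suc j * h} \<subseteq> {t - d t<..<t + d t}" using t(2) by blast
    have nn: "0 \<le> j * h" using h by simp
    show "one_jump_block x h r j"
      unfolding one_jump_block_def
    proof
      fix s assume s: "s \<in> {j * h..Suc j * h}"
      have jh: "j * h \<in> {j * h..Suc j * h}" "Suc j * h \<in> {j * h..Suc j * h}" using h by (auto simp: algebra_simps)
      have t0: "0 \<le> t" using t(1) by simp
      show "x s - x (j * h) < r \<or> x (Suc j * h) - x s < r"
      proof (cases "s < t")
        case True
        have "j * h \<in> {t - d t<..<t} \<inter> {0..}" "s \<in> {t - d t<..<t} \<inter> {0..}"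
          using True s nn sub jh by (auto simp: subset_iff)
        thus ?thesis using d(2)[OF t0] by blast
      next
        case False
        have "Suc j * h \<in> {t..<t + d t}" "s \<in> {t..<t + d t}"
          using False s sub jh by (auto simp: subset_iff)
        thus ?thesis using d(3)[OF t0] by blast
      qed
    qed
  qed
qed

definition J_seq_conv :: "(nat \<Rightarrow> real \<Rightarrow> real) \<Rightarrow> (real \<Rightarrow> real) \<Rightarrow> bool" where
  "J_seq_conv xs x \<longleftrightarrow> (\<forall>T>0. \<forall>\<delta>>0. \<forall>\<^sub>F n in sequentially. xs n \<in> J_nbhd x T \<delta>)"

lemma discretize_J_seq_conv:
  assumes x: "x \<in> mono_paths" and h: "\<And>n. 0 < h n" "h \<longlonglongrightarrow> 0"
  shows "J_seq_conv (\<lambda>n. discretize (h n) x) x"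
  unfolding J_seq_conv_def
proof (intro allI impI)
  fix T \<delta> :: real assume T: "0 < T" and \<delta>: "0 < \<delta>"
  obtain h0 where h0: "0 < h0" "\<And>h j. 0 < h \<Longrightarrow> h < h0 \<Longrightarrow> real j * h \<le> T + 1 \<Longrightarrow> one_jump_block x h \<delta> j"
    using one_jump_blocks_fine[OF x \<delta>, of "T + 1"] T by auto
  have "\<forall>\<^sub>F n in sequentially. h n < min h0 (min \<delta> 1)"
    using order_tendstoD(2)[OF h(2), of "min h0 (min \<delta> 1)"] h0(1) \<delta> by simp
  thus "\<forall>\<^sub>F n in sequentially. discretize (h n) x \<in> J_nbhd x T \<delta>"
  proof eventually_elim
    case (elim n)
    define J where "J = Suc (nat \<lfloor>T / h n\<rfloor>)"
    have J: "real (J - 1) * h n \<le> T" "T < J * h n"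
      using nat_floor_div[OF h(1)[of n], of T "nat \<lfloor>T / h n\<rfloor>"] T by (auto simp: J_def)
    show ?case
    proof (rule discretize_in_J_nbhd[OF x h(1) _ \<delta> order_refl J(2)])
      show "h n < \<delta>" using elim by simp
      fix j assume "j < J"
      hence "real j * h n \<le> real (J - 1) * h n" using h(1)[of n] by (intro mult_right_mono) auto
      with J(1) have "real j * h n \<le> T + 1" by linarith
      thus "one_jump_block x (h n) \<delta> j" using elim h(1) by (intro h0(2)) auto
    qed
  qed
qed

text \<open>On a common grid the identity is a sufficient time change, and only finitely many cells
  meet \<open>[0, T]\<close>.\<close>

lemma grid_path_J_seq_conv:
  assumes h: "0 < h" and conv: "\<And>j. (\<lambda>n. a n j) \<longlonglongrightarrow> b j" and mem: "\<And>n. grid_path h (a n) \<in> mono_paths"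
  shows "J_seq_conv (\<lambda>n. grid_path h (a n)) (grid_path h b)"
  unfolding J_seq_conv_def
proof (intro allI impI)
  fix T \<delta> :: real assume T: "0 < T" and \<delta>: "0 < \<delta>"
  have "\<forall>\<^sub>F n in sequentially. \<forall>j\<in>{..nat \<lfloor>T / h\<rfloor>}. dist (a n j) (b j) < \<delta>"
    using tendstoD[OF conv \<delta>] by (intro eventually_ball_finite) auto
  thus "\<forall>\<^sub>F n in sequentially. grid_path h (a n) \<in> J_nbhd (grid_path h b) T \<delta>"
  proof eventually_elim
    case (elim n)
    have "\<bar>grid_path h (a n) t - grid_path h b t\<bar> < \<delta>" if "t \<in> {0..T}" for t
      using elim that h by (auto simp: grid_path_def dist_real_def intro!: nat_floor_mono divide_right_mono)
    thus ?case using mem[of n] mono_paths_subset \<delta> by (auto simp: J_nbhd_def intro!: bexI[OF _ id_time_change])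
  qed
qed

lemma J_continuous_nbhd:
  assumes f: "continuous_map J_topology euclideanreal f" and x: "x \<in> cadlag_paths" and e: "0 < e"
  obtains T \<delta> where "0 < T" "0 < \<delta>" "\<And>y. y \<in> J_nbhd x T \<delta> \<Longrightarrow> \<bar>f y - f x\<bar> < e"
proof -
  have "openin J_topology {y \<in> topspace J_topology. f y \<in> ball (f x) e}"
    by (rule openin_continuous_map_preimage[OF f]) simp
  hence "\<exists>T>0. \<exists>\<delta>>0. J_nbhd x T \<delta> \<subseteq> {y \<in> topspace J_topology. f y \<in> ball (f x) e}"
    unfolding openin_J_topology using x e by (auto simp: topspace_J_topology)
  thus ?thesis using that by (auto simp: dist_real_def abs_minus_commute subset_iff)
qed

lemma J_continuous_seq:
  assumes f: "continuous_map J_topology euclideanreal f" and x: "x \<in> cadlag_paths" and "J_seq_conv xs x"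
  shows "(\<lambda>n. f (xs n)) \<longlonglongrightarrow> f x"
proof (rule tendstoI)
  fix e :: real assume e: "0 < e"
  obtain T \<delta> where "0 < T" "0 < \<delta>" and *: "\<And>y. y \<in> J_nbhd x T \<delta> \<Longrightarrow> \<bar>f y - f x\<bar> < e"
    using J_continuous_nbhd[OF f x e] by blast
  hence "\<forall>\<^sub>F n in sequentially. xs n \<in> J_nbhd x T \<delta>" using assms(3) by (auto simp: J_seq_conv_def)
  thus "\<forall>\<^sub>F n in sequentially. dist (f (xs n)) (f x) < e"
    by eventually_elim (simp add: * dist_real_def)
qed

section \<open>A pseudometric and Lipschitz approximation from below\<close>

text \<open>A sharp cutoff at \<open>n\<close> could turn a small time change near \<open>n\<close>
  into a large distance. With slope at most 1 the cutoff changes by no more than the time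
  does.\<close>

definition ramp :: "nat \<Rightarrow> real \<Rightarrow> real" where "ramp n t = max 0 (min 1 (n - t))"

lemma ramp_bounds: "0 \<le> ramp n t" "ramp n t \<le> 1" and ramp_lipschitz: "\<bar>ramp n s - ramp n t\<bar> \<le> \<bar>s - t\<bar>"
  by (auto simp: ramp_def)

text \<open>Each path is cut off at its own time argument, \<open>y\<close> at
  \<open>\<tau> t\<close> and \<open>x\<close> at \<open>t\<close>. This makes the relation
  symmetric under inversion and additive under composition of time changes.\<close>

definition J_close :: "nat \<Rightarrow> real \<Rightarrow> (real \<Rightarrow> real) \<Rightarrow> (real \<Rightarrow> real) \<Rightarrow> bool" where
  "J_close n r x y \<longleftrightarrow> (\<exists>\<tau>\<in>time_changes. \<forall>t\<ge>0.
     \<bar>\<tau> t - t\<bar> \<le> r \<and> \<bar>ramp n (\<tau> t) * y (\<tau> t) - ramp n t * x t\<bar> \<le> r)"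

lemma J_closeI:
  assumes "\<tau> \<in> time_changes"
    "\<And>t. 0 \<le> t \<Longrightarrow> \<bar>\<tau> t - t\<bar> \<le> r \<and> \<bar>ramp n (\<tau> t) * y (\<tau> t) - ramp n t * x t\<bar> \<le> r"
  shows "J_close n r x y"
  unfolding J_close_def by (rule bexI[OF _ assms(1)]) (use assms(2) in simp)

text \<open>Only a pseudometric: the ramp hides everything after time \<open>n\<close>.\<close>

definition J_dist :: "nat \<Rightarrow> (real \<Rightarrow> real) \<Rightarrow> (real \<Rightarrow> real) \<Rightarrow> real" where
  "J_dist n x y = Inf {r. J_close n r x y}"

lemma J_close_nonneg: "J_close n r x y \<Longrightarrow> 0 \<le> r"
  unfolding J_close_def by (meson abs_ge_zero order_refl order_trans)

lemma J_close_mono: "J_close n r x y \<Longrightarrow> r \<le> r' \<Longrightarrow> J_close n r' x y"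
  unfolding J_close_def by (meson order_trans)

lemma J_close_sym:
  assumes "J_close n r x y"
  shows "J_close n r y x"
proof -
  obtain \<tau> where \<tau>: "\<tau> \<in> time_changes"
    "\<And>t. 0 \<le> t \<Longrightarrow> \<bar>\<tau> t - t\<bar> \<le> r \<and> \<bar>ramp n (\<tau> t) * y (\<tau> t) - ramp n t * x t\<bar> \<le> r"
    using assms by (auto simp: J_close_def)
  obtain \<sigma> where \<sigma>: "\<sigma> \<in> time_changes" "\<And>t. 0 \<le> t \<Longrightarrow> \<tau> (\<sigma> t) = t"
    using time_change_inverse[OF \<tau>(1)] by metis
  have "\<bar>\<sigma> t - t\<bar> \<le> r \<and> \<bar>ramp n (\<sigma> t) * x (\<sigma> t) - ramp n t * y t\<bar> \<le> r" if "0 \<le> t" for t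
    using \<tau>(2)[OF time_changesD(1)[OF \<sigma>(1) that]] \<sigma>(2)[OF that] by (simp add: abs_minus_commute)
  thus ?thesis by (rule J_closeI[OF \<sigma>(1)])
qed

lemma J_close_trans:
  assumes "J_close n r x y" "J_close n s y z"
  shows "J_close n (r + s) x z"
proof -
  obtain \<tau> where \<tau>: "\<tau> \<in> time_changes"
    "\<And>t. 0 \<le> t \<Longrightarrow> \<bar>\<tau> t - t\<bar> \<le> r \<and> \<bar>ramp n (\<tau> t) * y (\<tau> t) - ramp n t * x t\<bar> \<le> r"
    using assms(1) by (auto simp: J_close_def)
  obtain \<sigma> where \<sigma>: "\<sigma> \<in> time_changes"
    "\<And>t. 0 \<le> t \<Longrightarrow> \<bar>\<sigma> t - t\<bar> \<le> s \<and> \<bar>ramp n (\<sigma> t) * z (\<sigma> t) - ramp n t * y t\<bar> \<le> s"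
    using assms(2) by (auto simp: J_close_def)
  have "\<bar>\<sigma> (\<tau> t) - t\<bar> \<le> r + s \<and> \<bar>ramp n (\<sigma> (\<tau> t)) * z (\<sigma> (\<tau> t)) - ramp n t * x t\<bar> \<le> r + s" if "0 \<le> t" for t
    using \<tau>(2)[OF that] \<sigma>(2)[OF time_changesD(1)[OF \<tau>(1) that]] by linarith
  thus ?thesis by (rule J_closeI[OF time_change_comp[OF \<sigma>(1) \<tau>(1)]])
qed

text \<open>Keeps the set in \<open>J_dist\<close> non-empty, so that its infimum is meaningful. The
  identity is enough because a monotone path cut off at \<open>n\<close> is bounded by its value at
  \<open>n\<close>.\<close>

lemma J_close_exists:
  assumes "x \<in> mono_paths" "y \<in> mono_paths"
  shows "J_close n (x n + y n) x y"
proof -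
  have b: "0 \<le> ramp n t * z t \<and> ramp n t * z t \<le> z n" if "z \<in> mono_paths" "0 \<le> t" for z t
  proof (cases "t \<le> n")
    case True
    have "ramp n t * z t \<le> 1 * z n"
      using mono_pathsD[OF that(1)] that(2) True ramp_bounds by (intro mult_mono) auto
    thus ?thesis using mono_pathsD(2)[OF that] ramp_bounds[of n t] by simp
  next
    case False
    thus ?thesis using mono_pathsD(2)[OF that(1), of n] by (simp add: ramp_def)
  qed
  have "\<bar>t - t\<bar> \<le> x n + y n \<and> \<bar>ramp n t * y t - ramp n t * x t\<bar> \<le> x n + y n" if "0 \<le> t" for t
    using b[OF assms(1) that] b[OF assms(2) that] by auto
  thus ?thesis by (rule J_closeI[OF id_time_change])
qed

lemma J_dist_le: "J_close n r x y \<Longrightarrow> J_dist n x y \<le> r"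
  unfolding J_dist_def by (intro cInf_lower) (auto intro!: bdd_belowI[of _ 0] J_close_nonneg)

lemma J_dist_less:
  assumes "x \<in> mono_paths" "y \<in> mono_paths" "J_dist n x y < r"
  shows "J_close n r x y"
proof -
  have "{r. J_close n r x y} \<noteq> {}" using J_close_exists[OF assms(1,2)] by blast
  from cInf_lessD[OF this assms(3)[unfolded J_dist_def]]
  obtain s where "J_close n s x y" "s < r" by blast
  thus ?thesis using J_close_mono by simp
qed

lemma J_dist_nonneg: "x \<in> mono_paths \<Longrightarrow> y \<in> mono_paths \<Longrightarrow> 0 \<le> J_dist n x y"
  unfolding J_dist_def using J_close_exists by (intro cInf_greatest) (auto intro: J_close_nonneg)

lemma J_dist_triangle:
  assumes "x \<in> mono_paths" "y \<in> mono_paths" "z \<in> mono_paths"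
  shows "J_dist n x z \<le> J_dist n x y + J_dist n y z"
proof (rule field_le_epsilon)
  fix e :: real assume "0 < e"
  hence "J_close n (J_dist n x y + e / 2) x y" "J_close n (J_dist n y z + e / 2) y z"
    using assms by (auto intro!: J_dist_less)
  from J_dist_le[OF J_close_trans[OF this]] show "J_dist n x z \<le> J_dist n x y + J_dist n y z + e" by simp
qed

lemma J_dist_sym: "J_dist n x y = J_dist n y x"
  unfolding J_dist_def using J_close_sym by metis

text \<open>The margin keeps \<open>t\<close> and \<open>\<tau> t\<close> at most
  \<open>n - 1\<close>, where both ramps equal 1.\<close>

lemma J_dist_imp_nbhd:
  assumes "x \<in> mono_paths" "y \<in> mono_paths" "J_dist n x y < \<delta>" "T + \<delta> \<le> real n - 1"
  shows "y \<in> J_nbhd x T \<delta>"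
proof -
  obtain r where r: "J_dist n x y < r" "r < \<delta>" using dense[OF assms(3)] by blast
  have "J_close n r x y" using J_dist_less[OF assms(1,2) r(1)] .
  then obtain \<tau> where \<tau>: "\<tau> \<in> time_changes"
    "\<And>t. 0 \<le> t \<Longrightarrow> \<bar>\<tau> t - t\<bar> \<le> r \<and> \<bar>ramp n (\<tau> t) * y (\<tau> t) - ramp n t * x t\<bar> \<le> r"
    by (auto simp: J_close_def)
  have "\<bar>\<tau> t - t\<bar> < \<delta>" if "0 \<le> t" for t using \<tau>(2)[OF that] r by simp
  moreover have "\<bar>y (\<tau> t) - x t\<bar> < \<delta>" if t: "t \<in> {0..T}" for t
  proof -
    have *: "\<bar>\<tau> t - t\<bar> \<le> r" "\<bar>ramp n (\<tau> t) * y (\<tau> t) - ramp n t * x t\<bar> \<le> r" using \<tau>(2) t by auto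
    have "ramp n t = 1" "ramp n (\<tau> t) = 1" using * t r assms(4) by (auto simp: ramp_def)
    thus ?thesis using *(2) r by simp
  qed
  ultimately show ?thesis using assms(2) mono_paths_subset
    unfolding J_nbhd_def by (intro CollectI conjI bexI[OF _ \<tau>(1)]) auto
qed

text \<open>Shifting the ramp costs up to \<open>\<delta>\<close> times the height of the path,
  hence the factor \<open>1 + x (n + 1)\<close>. Beyond \<open>n + 1\<close> both ramps vanish, as
  the time change moves points by less than 1.\<close>

lemma J_nbhd_imp_dist:
  assumes x: "x \<in> mono_paths" and y: "y \<in> J_nbhd x (n + 1) \<delta>" and \<delta>: "\<delta> \<le> 1"
  shows "J_dist n x y \<le> \<delta> * (1 + x (n + 1))"
proof (rule J_dist_le)
  obtain \<tau> where \<tau>: "\<tau> \<in> time_changes" "\<And>t. 0 \<le> t \<Longrightarrow> \<bar>\<tau> t - t\<bar> < \<delta>"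
    "\<And>t. t \<in> {0..real n + 1} \<Longrightarrow> \<bar>y (\<tau> t) - x t\<bar> < \<delta>"
    using y by (auto simp: J_nbhd_def)
  have xn: "0 \<le> x (n + 1)" using mono_pathsD(2)[OF x, of "n + 1"] by simp
  have \<delta>0: "0 < \<delta>" using \<tau>(2)[of 0] by linarith
  hence \<delta>x: "\<delta> \<le> \<delta> * (1 + x (n + 1))" using xn by (simp add: mult_le_cancel_left1)
  have "\<bar>ramp n (\<tau> t) * y (\<tau> t) - ramp n t * x t\<bar> \<le> \<delta> * (1 + x (n + 1))" if t: "0 \<le> t" for t
  proof (cases "t \<le> n + 1")
    case True
    have "ramp n (\<tau> t) * y (\<tau> t) - ramp n t * x t
        = ramp n (\<tau> t) * (y (\<tau> t) - x t) + (ramp n (\<tau> t) - ramp n t) * x t" by (simp add: algebra_simps)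
    also have "\<bar>\<dots>\<bar> \<le> ramp n (\<tau> t) * \<bar>y (\<tau> t) - x t\<bar> + \<bar>ramp n (\<tau> t) - ramp n t\<bar> * \<bar>x t\<bar>"
      using abs_triangle_ineq[of "ramp n (\<tau> t) * (y (\<tau> t) - x t)" "(ramp n (\<tau> t) - ramp n t) * x t"]
      by (simp add: abs_mult ramp_bounds)
    also have "\<dots> \<le> 1 * \<delta> + \<delta> * x (n + 1)"
      using \<tau>(3)[of t] \<tau>(2)[OF t] ramp_bounds[of n "\<tau> t"] ramp_lipschitz[of n "\<tau> t" t] t True \<delta>0
        mono_pathsD(1)[OF x t, of "n + 1"] mono_pathsD(2)[OF x t]
      by (intro add_mono mult_mono) auto
    finally show ?thesis by (simp add: distrib_left)
  next
    case False
    hence "ramp n t = 0" "ramp n (\<tau> t) = 0" using \<tau>(2)[OF t] \<delta> by (auto simp: ramp_def)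
    thus ?thesis using \<delta>x \<delta>0 by simp
  qed
  moreover have "\<bar>\<tau> t - t\<bar> \<le> \<delta> * (1 + x (n + 1))" if "0 \<le> t" for t using \<tau>(2)[OF that] \<delta>x by linarith
  ultimately show "J_close n (\<delta> * (1 + x (real n + 1))) x y" by (intro J_closeI[OF \<tau>(1)]) (auto simp: add.commute)
qed

lemma J_seq_conv_imp_dist:
  assumes x: "x \<in> mono_paths" and xs: "\<And>k. xs k \<in> mono_paths" and conv: "J_seq_conv xs x"
  shows "(\<lambda>k. J_dist n x (xs k)) \<longlonglongrightarrow> 0"
proof (rule tendstoI)
  fix e :: real assume e: "0 < e"
  have xn: "0 \<le> x (n + 1)" using mono_pathsD(2)[OF x, of "n + 1"] by simp
  define \<delta> where "\<delta> = min 1 (e / 2 / (1 + x (n + 1)))"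
  have \<delta>: "0 < \<delta>" "\<delta> \<le> 1" using e xn by (auto simp: \<delta>_def)
  have "\<delta> \<le> e / 2 / (1 + x (n + 1))" by (simp add: \<delta>_def)
  hence "\<delta> * (1 + x (n + 1)) \<le> e / 2" using xn
    by (subst (asm) pos_le_divide_eq) auto
  hence \<delta>e: "\<delta> * (1 + x (n + 1)) < e" using e by linarith
  have "\<forall>\<^sub>F k in sequentially. xs k \<in> J_nbhd x (real n + 1) \<delta>"
    using conv \<delta>(1) by (auto simp: J_seq_conv_def)
  thus "\<forall>\<^sub>F k in sequentially. dist (J_dist n x (xs k)) 0 < e"
  proof eventually_elim
    case (elim k)
    have "J_dist n x (xs k) \<le> \<delta> * (1 + x (n + 1))" using J_nbhd_imp_dist[OF x _ \<delta>(2), of "xs k" n] elim by (simp add: add.commute)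
    thus ?case using J_dist_nonneg[OF x xs, of n k] \<delta>e by simp
  qed
qed

text \<open>Lipschitz regularization from below, that is, an infimal convolution. The one index
  \<open>n\<close> is both the slope and the horizon of the pseudometric, so that a single limit
  removes both.\<close>

definition J_envelope :: "((real \<Rightarrow> real) \<Rightarrow> real) \<Rightarrow> nat \<Rightarrow> (real \<Rightarrow> real) \<Rightarrow> real" where
  "J_envelope f n x = (INF y\<in>mono_paths. f y + n * J_dist n x y)"

locale bounded_path_functional =
  fixes f :: "(real \<Rightarrow> real) \<Rightarrow> real" and B :: real
  assumes bounded: "\<And>x. x \<in> mono_paths \<Longrightarrow> \<bar>f x\<bar> \<le> B"
begin

lemma envelope_bdd: "x \<in> mono_paths \<Longrightarrow> bdd_below ((\<lambda>y. f y + n * J_dist n x y) ` mono_paths)"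
proof (rule bdd_belowI2[of _ "- B"])
  fix y assume "x \<in> mono_paths" "y \<in> mono_paths"
  hence "\<bar>f y\<bar> \<le> B" "0 \<le> n * J_dist n x y"
    by (blast intro: bounded, blast intro: mult_nonneg_nonneg of_nat_0_le_iff J_dist_nonneg)
  thus "- B \<le> f y + n * J_dist n x y" by linarith
qed

lemma envelope_le:
  assumes "x \<in> mono_paths"
  shows "J_envelope f n x \<le> f x"
proof -
  have "J_close n 0 x x" unfolding J_close_def using id_time_change by force
  hence "J_dist n x x = 0" using J_dist_le J_dist_nonneg[OF assms assms] by (metis antisym)
  thus ?thesis unfolding J_envelope_def using cINF_lower[OF envelope_bdd[OF assms] assms, of n] by simp
qed

lemma envelope_ge:
  assumes "x \<in> mono_paths"
  shows "- B \<le> J_envelope f n x"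
  unfolding J_envelope_def
proof (rule cINF_greatest)
  fix y assume "y \<in> mono_paths"
  hence "\<bar>f y\<bar> \<le> B" "0 \<le> n * J_dist n x y" using assms
    by (blast intro: bounded, blast intro: mult_nonneg_nonneg of_nat_0_le_iff J_dist_nonneg)
  thus "- B \<le> f y + n * J_dist n x y" by linarith
qed (use assms in auto)

lemma envelope_abs: "x \<in> mono_paths \<Longrightarrow> \<bar>J_envelope f n x\<bar> \<le> B"
  using envelope_le[of x n] envelope_ge[of x n] bounded[of x] by linarith

lemma envelope_lipschitz:
  assumes x: "x \<in> mono_paths" and y: "y \<in> mono_paths"
  shows "\<bar>J_envelope f n x - J_envelope f n y\<bar> \<le> n * J_dist n x y"
proof -
  have le: "J_envelope f n x \<le> J_envelope f n y + n * J_dist n x y"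
    if x: "x \<in> mono_paths" and y: "y \<in> mono_paths" for x y
  proof -
    have "J_envelope f n x - n * J_dist n x y \<le> f z + n * J_dist n y z" if z: "z \<in> mono_paths" for z
    proof -
      have "J_envelope f n x \<le> f z + n * J_dist n x z"
        unfolding J_envelope_def by (rule cINF_lower[OF envelope_bdd[OF x] z])
      also have "\<dots> \<le> f z + n * (J_dist n x y + J_dist n y z)"
        using J_dist_triangle[OF x y z, of n] by (intro add_left_mono mult_left_mono) auto
      finally show ?thesis by (simp add: algebra_simps)
    qed
    hence "J_envelope f n x - n * J_dist n x y \<le> J_envelope f n y"
      unfolding J_envelope_def[of f n y] using x by (intro cINF_greatest) auto
    thus ?thesis by simp
  qed
  show ?thesis using le[OF x y] le[OF y x] J_dist_sym[of n x y] by (simp add: abs_le_iff)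
qed

lemma envelope_seq:
  assumes x: "x \<in> mono_paths" and xs: "\<And>k. xs k \<in> mono_paths" and conv: "J_seq_conv xs x"
  shows "(\<lambda>k. J_envelope f n (xs k)) \<longlonglongrightarrow> J_envelope f n x"
proof -
  have "(\<lambda>k. J_envelope f n (xs k) - J_envelope f n x) \<longlonglongrightarrow> 0"
  proof (rule Lim_null_comparison)
    show "\<forall>\<^sub>F k in sequentially. norm (J_envelope f n (xs k) - J_envelope f n x) \<le> n * J_dist n x (xs k)"
      using envelope_lipschitz[OF xs x] unfolding J_dist_sym[of n x] by (intro always_eventually) simp
    show "(\<lambda>k. n * J_dist n x (xs k)) \<longlonglongrightarrow> 0"
      using tendsto_mult_right_zero[OF J_seq_conv_imp_dist[OF assms]] .
  qed
  thus ?thesis using Lim_null by blast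
qed

lemma envelope_conv:
  assumes x: "x \<in> mono_paths" and f: "continuous_map J_topology euclideanreal f"
  shows "(\<lambda>n. J_envelope f n x) \<longlonglongrightarrow> f x"
proof (rule tendstoI)
  fix e :: real assume e: "0 < e"
  hence e2: "0 < e / 2" by simp
  obtain T \<delta> where T: "0 < T" "0 < \<delta>" and nb: "\<And>y. y \<in> J_nbhd x T \<delta> \<Longrightarrow> \<bar>f y - f x\<bar> < e / 2"
    using J_continuous_nbhd[OF f _ e2, of x] x mono_paths_subset by blast
  \<comment> \<open>From \<open>N\<close> on the horizon covers the neighbourhood, and the penalty
    \<open>n * \<delta>\<close> is at least \<open>2 * B\<close>, so that distant \<open>y\<close>
    cannot lower the infimum.\<close>
  obtain N :: nat where N: "T + \<delta> + 1 + 2 * B / \<delta> \<le> real N" using real_arch_simple by blast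
  have B: "0 \<le> B" using bounded[OF x] by linarith
  have "dist (J_envelope f n x) (f x) < e" if n: "N \<le> n" for n
  proof -
    have Nn: "real N \<le> real n" using n by simp
    have "0 \<le> 2 * B / \<delta>" using B T by simp
    hence n1: "T + \<delta> \<le> real n - 1" and n2: "2 * B / \<delta> \<le> n" using N Nn T by linarith+
    have "f x - e / 2 \<le> J_envelope f n x"
      unfolding J_envelope_def
    proof (rule cINF_greatest)
      fix y assume y: "y \<in> mono_paths"
      show "f x - e / 2 \<le> f y + n * J_dist n x y"
      proof (cases "J_dist n x y < \<delta>")
        case True
        hence "\<bar>f y - f x\<bar> < e / 2" using J_dist_imp_nbhd[OF x y True n1] nb by blast
        moreover have "0 \<le> n * J_dist n x y" using J_dist_nonneg[OF x y] by simp
        ultimately show ?thesis by linarith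
      next
        case False
        have "2 * B \<le> n * \<delta>" using n2 T by (simp add: pos_divide_le_eq)
        also have "\<dots> \<le> n * J_dist n x y" using False by (intro mult_left_mono) auto
        finally show ?thesis using bounded[OF x] bounded[OF y] e by linarith
      qed
    qed (use x in auto)
    thus ?thesis using envelope_le[OF x, of n] e by (simp add: dist_real_def)
  qed
  thus "\<forall>\<^sub>F n in sequentially. dist (J_envelope f n x) (f x) < e"
    by (auto simp: eventually_sequentially)
qed

end

section \<open>Independence and joint Laplace transforms\<close>

text \<open>Restriction to the first \<open>J\<close> coordinates turns the infinite product into a
  finite one.\<close>

lemma integral_PiM_prod:
  fixes N :: "nat \<Rightarrow> real measure" and f :: "nat \<Rightarrow> real \<Rightarrow> real"
  assumes N: "\<And>i. real_distribution (N i)"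
    and f: "\<And>i. f i \<in> borel_measurable borel" "\<And>i x. \<bar>f i x\<bar> \<le> 1"
  shows "(LINT x|PiM UNIV N. (\<Prod>i<J. f i (x i))) = (\<Prod>i<J. LINT x|N i. f i x)"
proof -
  interpret N: real_distribution "N i" for i by (rule N)
  interpret product_prob_space N UNIV by unfold_locales
  interpret fin: finite_product_prob_space N "{..<J}" by unfold_locales auto
  have [measurable]: "f i \<in> borel_measurable (N i)" for i
    using f(1)[of i] by (simp add: N.measurable_finite_borel)
  have "(LINT x|PiM UNIV N. (\<Prod>i<J. f i (x i))) = (LINT x|PiM UNIV N. (\<Prod>i<J. f i (restrict x {..<J} i)))"
    by (intro Bochner_Integration.integral_cong refl prod.cong) auto
  also have "\<dots> = (LINT x|distr (PiM UNIV N) (PiM {..<J} N) (\<lambda>x. restrict x {..<J}). (\<Prod>i<J. f i (x i)))"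
    by (subst integral_distr) (auto intro!: measurable_restrict_subset)
  also have "\<dots> = (LINT x|PiM {..<J} N. (\<Prod>i<J. f i (x i)))"
    by (subst distr_PiM_restrict_finite) auto
  also have "\<dots> = (\<Prod>i<J. LINT x|N i. f i x)"
    using f(2) by (intro product_integral_prod) (auto intro!: N.integrable_const_bound[of _ 1])
  finally show ?thesis .
qed

lemma nonneg_sequence_PiM:
  fixes N :: "nat \<Rightarrow> real measure"
  assumes N: "\<And>i. nonneg_law (N i)"
  shows "nonneg_sequence (PiM UNIV N) (\<lambda>i x. max 0 (x i))"
proof -
  interpret N: real_distribution "N i" for i using N by (simp add: nonneg_law_def)
  interpret product_prob_space N UNIV by unfold_locales
  have "(\<lambda>x. max 0 (x i)) \<in> borel_measurable (PiM UNIV N)" for i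
  proof -
    have "(\<lambda>x. x i) \<in> measurable (PiM UNIV N) (N i)" by measurable
    hence "(\<lambda>x. x i) \<in> borel_measurable (PiM UNIV N)" by (simp cong: measurable_cong_sets)
    thus ?thesis by measurable
  qed
  thus ?thesis using P.prob_space_axioms by (simp add: nonneg_sequence_def nonneg_sequence_axioms_def)
qed

lemma laplace_max:
  assumes "nonneg_law \<mu>"
  shows "(LINT x|\<mu>. exp (- (c * max 0 x))) = laplace_transform \<mu> c"
proof -
  interpret real_distribution \<mu> using assms by (simp add: nonneg_law_def)
  have "AE x in \<mu>. exp (- (c * max 0 x)) = exp (- c * x)"
    using assms[unfolded nonneg_law_def, THEN conjunct2] by (rule eventually_mono) simp
  thus ?thesis unfolding laplace_transform_def by (intro integral_cong_AE) auto
qed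

lemma PiM_joint_laplace:
  fixes N :: "nat \<Rightarrow> real measure"
  assumes N: "\<And>i. nonneg_law (N i)" and c: "\<And>i. 0 \<le> c i"
  shows "(LINT x|PiM UNIV N. exp (- (\<Sum>i<J. c i * max 0 (x i)))) = (\<Prod>i<J. laplace_transform (N i) (c i))"
proof -
  have "(LINT x|PiM UNIV N. exp (- (\<Sum>i<J. c i * max 0 (x i)))) = (LINT x|PiM UNIV N. (\<Prod>i<J. exp (- (c i * max 0 (x i)))))"
    by (intro Bochner_Integration.integral_cong refl) (simp add: exp_sum[symmetric] sum_negf)
  also have "\<dots> = (\<Prod>i<J. LINT x|N i. exp (- (c i * max 0 x)))"
    using N c by (intro integral_PiM_prod) (auto simp: nonneg_law_def)
  finally show ?thesis by (simp add: laplace_max[OF N])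
qed

text \<open>The variables are compared with independent ones having the same marginals: equal joint
  transforms give equal expectations of products of bounded continuous functions, by the convergence
  theorem for a constant family. Half-lines are limits of such functions and form a generator stable
  under intersection.\<close>

lemma (in nonneg_sequence) indep_if_joint_laplace:
  assumes joint: "\<And>J (c :: nat \<Rightarrow> nat). (LINT \<omega>|M. exp (- (\<Sum>i<J. c i * \<xi> i \<omega>))) = (\<Prod>i<J. LINT \<omega>|M. exp (- (c i * \<xi> i \<omega>)))"
  shows "indep_vars (\<lambda>_. borel) \<xi> UNIV"
proof -
  define N where "N i = distr M borel (\<xi> i)" for i
  have N: "nonneg_law (N i)" for i
    unfolding N_def using \<xi>_nonneg by (intro nonneg_law_distr prob_space_axioms) auto
  have N_lap: "laplace_transform (N i) c = (LINT \<omega>|M. exp (- (c * \<xi> i \<omega>)))" for i c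
    unfolding N_def by (subst laplace_transform_distr) auto
  interpret lc: laplace_convergence "PiM UNIV N" "\<lambda>i x. max 0 (x i)" "\<lambda>_. M" "\<lambda>_. \<xi>" "sequentially"
    unfolding laplace_convergence_def laplace_convergence_axioms_def
    using nonneg_sequence_PiM[OF N] nonneg_sequence_axioms
    by (auto simp: PiM_joint_laplace[OF N] joint N_lap)
  have prod_E: "(LINT \<omega>|M. (\<Prod>i<J. \<phi> i (\<xi> i \<omega>))) = (\<Prod>i<J. LINT \<omega>|M. \<phi> i (\<xi> i \<omega>))"
    if \<phi>: "\<And>i. continuous_on UNIV (\<phi> i)" "\<And>i x. 0 \<le> \<phi> i x \<and> \<phi> i x \<le> 1" for \<phi> :: "nat \<Rightarrow> real \<Rightarrow> real" and J
  proof -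
    have [measurable]: "\<phi> i \<in> borel_measurable borel" for i
      using \<phi>(1) by (rule borel_measurable_continuous_onI)
    have "(\<lambda>_::nat. LINT \<omega>|M. (\<Prod>i<J. \<phi> i (\<xi> i \<omega>))) \<longlonglongrightarrow> (LINT x|PiM UNIV N. (\<Prod>i<J. \<phi> i (max 0 (x i))))"
    proof (rule lc.conv_bounded_continuous[of "\<lambda>x. \<Prod>i<J. \<phi> i (x i)" 1 J])
      show "continuous_on nonneg_seqs (\<lambda>x. \<Prod>i<J. \<phi> i (x i))"
        by (intro continuous_intros continuous_on_compose2[OF \<phi>(1)]) (auto intro: continuous_on_subset[OF continuous_on_product_coordinates])
      show "\<bar>\<Prod>i<J. \<phi> i (x i)\<bar> \<le> 1" for x
        unfolding abs_prod using \<phi>(2) by (intro prod_le_1) auto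
    qed auto
    hence "(LINT \<omega>|M. (\<Prod>i<J. \<phi> i (\<xi> i \<omega>))) = (LINT x|PiM UNIV N. (\<Prod>i<J. \<phi> i (max 0 (x i))))"
      by (simp add: tendsto_const_iff)
    also have "\<dots> = (\<Prod>i<J. LINT x|N i. \<phi> i (max 0 x))"
      using N \<phi>(2) by (intro integral_PiM_prod) (auto simp: nonneg_law_def)
    also have "\<dots> = (\<Prod>i<J. LINT \<omega>|M. \<phi> i (\<xi> i \<omega>))"
    proof (intro prod.cong refl)
      fix i
      have "(LINT x|N i. \<phi> i (max 0 x)) = (LINT \<omega>|M. \<phi> i (max 0 (\<xi> i \<omega>)))"
        unfolding N_def by (subst integral_distr) auto
      also have "\<dots> = (LINT \<omega>|M. \<phi> i (\<xi> i \<omega>))"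
        using \<xi>_nonneg by (intro Bochner_Integration.integral_cong refl) (simp add: max_def)
      finally show "(LINT x|N i. \<phi> i (max 0 x)) = (LINT \<omega>|M. \<phi> i (\<xi> i \<omega>))" .
    qed
    finally show ?thesis .
  qed
  \<comment> \<open>The whole space is added because the product criterion asks for a generator that
    contains it; it too is a limit of continuous functions.\<close>
  define E where "E = insert UNIV (range (\<lambda>a::real. {..a}))"
  have appr: "\<exists>\<phi> :: nat \<Rightarrow> real \<Rightarrow> real. (\<forall>k. continuous_on UNIV (\<phi> k)) \<and> (\<forall>k x. 0 \<le> \<phi> k x \<and> \<phi> k x \<le> 1) \<and>
      (\<forall>x. (\<lambda>k. \<phi> k x) \<longlonglongrightarrow> indicator A x)" if "A \<in> E" for A
  proof (cases "A = UNIV")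
    case True thus ?thesis by (intro exI[of _ "\<lambda>_ _. 1"]) auto
  next
    case False
    then obtain a where A: "A = {..a}" using \<open>A \<in> E\<close> by (auto simp: E_def)
    let ?\<phi> = "\<lambda>k. cts_step a (a + 1 / Suc k)"
    have "(\<lambda>k. ?\<phi> k x) \<longlonglongrightarrow> indicator A x" for x
    proof (cases "x \<le> a")
      case True thus ?thesis by (simp add: A cts_step_def)
    next
      case False
      have "\<forall>\<^sub>F k in sequentially. 1 / Suc k < x - a"
        using order_tendstoD(2)[OF LIMSEQ_Suc[OF lim_1_over_n], of "x - a"] False by simp
      hence "\<forall>\<^sub>F k in sequentially. ?\<phi> k x = indicator A x"
        by eventually_elim (use False in \<open>auto simp: A cts_step_def\<close>)
      thus ?thesis by (rule tendsto_eventually)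
    qed
    moreover have "continuous_on UNIV (?\<phi> k)" for k
      by (rule uniformly_continuous_imp_continuous[OF cts_step_uniformly_continuous]) simp
    moreover have "0 \<le> ?\<phi> k x \<and> ?\<phi> k x \<le> 1" for k x by (auto simp: cts_step_def divide_simps)
    ultimately show ?thesis by (intro exI[of _ ?\<phi>] conjI allI) auto
  qed
  have prob_prod: "prob (\<Inter>i\<in>{..<J}. \<xi> i -` A i \<inter> space M) = (\<Prod>i<J. prob (\<xi> i -` A i \<inter> space M))"
    if A: "\<And>i. i < J \<Longrightarrow> A i \<in> E" and J: "0 < J" for A J
  proof -
    define A' where "A' i = (if i < J then A i else UNIV)" for i
    have A': "A' i \<in> E" for i using A by (auto simp: A'_def E_def)
    have A'_borel: "A' i \<in> sets borel" for i using A'[of i] by (auto simp: E_def)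
    obtain \<phi> where \<phi>: "\<And>i k. continuous_on UNIV (\<phi> i k)" "\<And>i k x. 0 \<le> \<phi> i k x \<and> \<phi> i k x \<le> (1::real)"
      "\<And>i x. (\<lambda>k. \<phi> i k x) \<longlonglongrightarrow> indicator (A' i) x"
      using appr[OF A'] by metis
    have [measurable]: "\<phi> i k \<in> borel_measurable borel" for i k
      using \<phi>(1) by (rule borel_measurable_continuous_onI)
    have meas: "\<xi> i -` A' i \<inter> space M \<in> events" for i using A'_borel by measurable
    have "(\<lambda>k. LINT \<omega>|M. (\<Prod>i<J. \<phi> i k (\<xi> i \<omega>))) \<longlonglongrightarrow> (LINT \<omega>|M. (\<Prod>i<J. indicator (A' i) (\<xi> i \<omega>)))"
    proof (rule integral_dominated_convergence[where w="\<lambda>_. 1"])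
      show "AE \<omega> in M. (\<lambda>k. \<Prod>i<J. \<phi> i k (\<xi> i \<omega>)) \<longlonglongrightarrow> (\<Prod>i<J. indicator (A' i) (\<xi> i \<omega>))"
        by (intro AE_I2 tendsto_prod \<phi>(3))
      show "AE \<omega> in M. norm (\<Prod>i<J. \<phi> i k (\<xi> i \<omega>)) \<le> 1" for k
        using \<phi>(2) by (intro AE_I2) (auto simp: abs_prod intro!: prod_le_1)
    qed (use A'_borel in auto)
    moreover have "(\<lambda>k. \<Prod>i<J. LINT \<omega>|M. \<phi> i k (\<xi> i \<omega>)) \<longlonglongrightarrow> (\<Prod>i<J. LINT \<omega>|M. indicator (A' i) (\<xi> i \<omega>))"
    proof (intro tendsto_prod integral_dominated_convergence[where w="\<lambda>_. 1"])
      fix i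
      show "AE \<omega> in M. (\<lambda>k. \<phi> i k (\<xi> i \<omega>)) \<longlonglongrightarrow> indicator (A' i) (\<xi> i \<omega>)" by (intro AE_I2 \<phi>(3))
      show "AE \<omega> in M. norm (\<phi> i k (\<xi> i \<omega>)) \<le> 1" for k using \<phi>(2) by (intro AE_I2) auto
      show "(\<lambda>\<omega>. indicat_real (A' i) (\<xi> i \<omega>)) \<in> borel_measurable M" using A'_borel by measurable
    qed auto
    ultimately have "(LINT \<omega>|M. (\<Prod>i<J. indicator (A' i) (\<xi> i \<omega>))) = (\<Prod>i<J. LINT \<omega>|M. indicat_real (A' i) (\<xi> i \<omega>))"
      unfolding prod_E[OF \<phi>(1,2)] by (rule LIMSEQ_unique)
    moreover have "(LINT \<omega>|M. indicat_real (A' i) (\<xi> i \<omega>)) = prob (\<xi> i -` A i \<inter> space M)" if "i < J" for i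
    proof -
      have "(LINT \<omega>|M. indicat_real (A' i) (\<xi> i \<omega>)) = (LINT \<omega>|M. indicator (\<xi> i -` A' i \<inter> space M) \<omega>)"
        by (intro Bochner_Integration.integral_cong refl) (auto simp: indicator_def)
      thus ?thesis using meas[of i] that by (simp add: A'_def)
    qed
    moreover have "(LINT \<omega>|M. (\<Prod>i<J. indicator (A' i) (\<xi> i \<omega>))) = prob (\<Inter>i\<in>{..<J}. \<xi> i -` A i \<inter> space M)"
    proof -
      have "(\<Inter>i\<in>{..<J}. \<xi> i -` A' i \<inter> space M) \<in> events"
        using meas J by (intro sets.finite_INT) auto
      moreover have "(\<Prod>i<J. indicat_real (A' i) (\<xi> i \<omega>)) = indicator (\<Inter>i\<in>{..<J}. \<xi> i -` A' i \<inter> space M) \<omega>"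
        if "\<omega> \<in> space M" for \<omega>
        using that by (auto simp: indicator_def)
      hence "(LINT \<omega>|M. (\<Prod>i<J. indicator (A' i) (\<xi> i \<omega>)))
          = (LINT \<omega>|M. indicat_real (\<Inter>i\<in>{..<J}. \<xi> i -` A' i \<inter> space M) \<omega>)"
        by (intro Bochner_Integration.integral_cong refl)
      moreover have "(\<Inter>i\<in>{..<J}. \<xi> i -` A' i \<inter> space M) = (\<Inter>i\<in>{..<J}. \<xi> i -` A i \<inter> space M)"
        by (intro INF_cong refl) (simp add: A'_def)
      ultimately show ?thesis by simp
    qed
    ultimately show ?thesis by simp
  qed
  have fin: "indep_vars (\<lambda>_. borel) \<xi> {..<J}" if J: "0 < J" for J
  proof (subst indep_vars_finite[where E="\<lambda>_. E"])
    show "{..<J} \<noteq> {}" using J by auto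
    have sub: "range (\<lambda>a::real. {..a}) \<subseteq> E" by (auto simp: E_def)
    show "sets borel = sigma_sets (space borel) E"
    proof -
      have "sigma_sets UNIV E = sigma_sets UNIV (range (\<lambda>a::real. {..a}))"
        by (rule sigma_sets_eqI) (auto simp: E_def intro: sigma_sets_top sigma_sets.Basic)
      moreover have "sets (borel::real measure) = sigma_sets UNIV (range (\<lambda>a::real. {..a}))"
        by (subst borel_eq_atMost) (simp add: sets_measure_of)
      ultimately show ?thesis by simp
    qed
    show "Int_stable E" unfolding Int_stable_def
    proof (intro ballI)
      fix A B assume "A \<in> E" "B \<in> E"
      thus "A \<inter> B \<in> E" by (auto simp: E_def)
    qed
    show "\<forall>A\<in>(\<Pi> i\<in>{..<J}. E). prob (\<Inter>j\<in>{..<J}. \<xi> j -` A j \<inter> space M) = (\<Prod>j<J. prob (\<xi> j -` A j \<inter> space M))"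
      using prob_prod J by (auto simp: Pi_iff)
  qed (auto simp: E_def)
  show ?thesis
    unfolding indep_vars_def2
  proof (intro conjI ballI)
    show "indep_sets (\<lambda>i. {\<xi> i -` A \<inter> space M |A. A \<in> sets borel}) UNIV"
    proof (subst indep_sets_finite_index_sets, intro allI impI)
      fix I :: "nat set" assume I: "I \<noteq> {}" "finite I"
      have "I \<subseteq> {..<Suc (Max I)}" using I by (auto simp: less_Suc_eq_le)
      moreover have "indep_sets (\<lambda>i. {\<xi> i -` A \<inter> space M |A. A \<in> sets borel}) {..<Suc (Max I)}"
        using fin[of "Suc (Max I)"] by (simp add: indep_vars_def2)
      ultimately show "indep_sets (\<lambda>i. {\<xi> i -` A \<inter> space M |A. A \<in> sets borel}) I"
        using indep_sets_mono_index by blast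
    qed
  qed simp
qed

section \<open>Subordinators\<close>

text \<open>Truncation at 0 makes every path of the walk monotone, instead of almost every path.\<close>

definition walk :: "(nat \<Rightarrow> real) \<Rightarrow> nat \<Rightarrow> real" where
  "walk x j = (\<Sum>k<j. max 0 (x k))"

definition dyadic_times :: "real set" where
  "dyadic_times = {t. \<exists>n k::nat. t = k / 2 ^ n}"

text \<open>\<open>\<nu> n\<close> is the intended law of an increment over a time of length
  \<open>1 / 2 ^ n\<close>. With dyadic lengths the refinement of a grid merely splits each step
  into two.\<close>

locale subordinator_roots =
  fixes A :: "real \<Rightarrow> real" and \<nu> :: "nat \<Rightarrow> real measure"
  assumes roots: "\<And>n. nonneg_law (\<nu> n)" "\<And>n s. 0 \<le> s \<Longrightarrow> laplace_transform (\<nu> n) s = exp (- A s / 2 ^ n)"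
begin

sublocale N: real_distribution "\<nu> n" for n using roots(1) by (simp add: nonneg_law_def)

abbreviation steps :: "nat \<Rightarrow> (nat \<Rightarrow> real) measure" where
  "steps n \<equiv> PiM UNIV (\<lambda>_. \<nu> n)"

sublocale S: product_prob_space "\<lambda>_. \<nu> n" UNIV for n by unfold_locales

lemma sets_steps: "sets (steps n) = sets (PiM UNIV (\<lambda>_. borel))"
  by (intro sets_PiM_cong) auto

lemma steps_coord[measurable]: "(\<lambda>x. x i) \<in> borel_measurable (steps n)"
proof -
  have "(\<lambda>x. x i) \<in> measurable (steps n) (\<nu> n)" by measurable
  thus ?thesis by (simp cong: measurable_cong_sets)
qed

lemma A_0: "A 0 = 0"
  using roots(2)[of 0 0] laplace_transform_0[OF roots(1)[of 0]] by simp

lemma steps_laplace: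
  assumes "\<And>k. 0 \<le> c k"
  shows "(LINT x|steps n. exp (- (\<Sum>k<K. c k * max 0 (x k)))) = exp (- (\<Sum>k<K. A (c k)) / 2 ^ n)"
  using PiM_joint_laplace[of "\<lambda>_. \<nu> n" c K] roots assms
  by (simp add: exp_sum[symmetric] sum_negf sum_divide_distrib)

text \<open>Sums of neighbouring pairs of finer steps are independent with the coarser law. Both
  facts are read off joint transforms, since two terms \<open>A s / 2 ^ Suc n\<close> add up to
  \<open>A s / 2 ^ n\<close>.\<close>

lemma steps_refine: "steps n = distr (steps (Suc n)) (PiM UNIV (\<lambda>_. borel))
   (\<lambda>x j. max 0 (x (2 * j)) + max 0 (x (2 * j + 1)))"
proof -
  define y where "y j x = max 0 (x (2 * j)) + max 0 (x (2 * j + 1))" for j and x :: "nat \<Rightarrow> real"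
  have meas: "y j \<in> borel_measurable (steps (Suc n))" for j unfolding y_def by measurable
  have nn: "0 \<le> y j x" for j x unfolding y_def by simp
  have pr: "prob_space (steps (Suc n))" by (rule prob_space_PiM[OF N.prob_space_axioms])
  interpret nonneg_sequence "steps (Suc n)" y
    unfolding nonneg_sequence_def nonneg_sequence_axioms_def
    using pr meas nn by blast
  have pair: "(\<Sum>k<2 * J. f k) = (\<Sum>j<J. f (2 * j) + f (2 * j + 1))" for f :: "nat \<Rightarrow> real" and J
    by (induction J) (auto simp: algebra_simps)
  have joint: "(LINT x|steps (Suc n). exp (- (\<Sum>j<J. c j * y j x))) = exp (- (\<Sum>j<J. A (c j)) / 2 ^ n)"
    if "\<And>j. 0 \<le> c j" for c :: "nat \<Rightarrow> real" and J
  proof -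
    have "(\<Sum>j<J. c j * y j x) = (\<Sum>k<2 * J. c (k div 2) * max 0 (x k))" for x
      unfolding pair by (simp add: y_def distrib_left)
    hence "(LINT x|steps (Suc n). exp (- (\<Sum>j<J. c j * y j x))) = exp (- (\<Sum>k<2 * J. A (c (k div 2))) / 2 ^ Suc n)"
      using steps_laplace[of "\<lambda>k. c (k div 2)" "Suc n" "2 * J"] that by simp
    also have "(\<Sum>k<2 * J. A (c (k div 2))) = 2 * (\<Sum>j<J. A (c j))"
      unfolding pair by (simp add: sum_distrib_left)
    finally show ?thesis by simp
  qed
  have single: "(LINT x|steps (Suc n). exp (- (c * y j x))) = exp (- A c / 2 ^ n)" if "0 \<le> c" for c j
  proof -
    \<comment> \<open>Weights concentrated on \<open>j\<close> extract one marginal from the joint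
      formula; the other coordinates contribute \<open>A 0 = 0\<close>.\<close>
    define d where "d i = (if i = j then c else 0)" for i
    have s: "(\<Sum>i<Suc j. g (d i) i) = g c j" if "\<And>i. g 0 i = 0" for g :: "real \<Rightarrow> nat \<Rightarrow> real"
    proof -
      have "(\<Sum>i<j. g (d i) i) = 0" using that by (intro sum.neutral) (simp add: d_def)
      thus ?thesis by (simp add: d_def)
    qed
    have "(\<Sum>i<Suc j. A (d i)) = A c" using s[of "\<lambda>c i. A c"] A_0 by blast
    moreover have "(\<Sum>i<Suc j. d i * y i x) = c * y j x" for x using s[of "\<lambda>c i. c * y i x"] by (simp only: mult_zero_left)
    moreover have "0 \<le> d i" for i using that by (simp add: d_def)
    ultimately show ?thesis using joint[of d "Suc j"] by (simp only:)
  qed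
  have "prob_space.indep_vars (steps (Suc n)) (\<lambda>_. borel) y UNIV"
    by (rule indep_if_joint_laplace)
       (simp add: joint single exp_sum[symmetric] sum_negf sum_divide_distrib)
  hence "distr (steps (Suc n)) (PiM UNIV (\<lambda>_. borel)) (\<lambda>x. \<lambda>i\<in>UNIV. y i x) = PiM UNIV (\<lambda>i. distr (steps (Suc n)) borel (y i))"
    using meas by (subst (asm) prob_space.indep_vars_iff_distr_eq_PiM[OF pr]) auto
  moreover have "distr (steps (Suc n)) borel (y i) = \<nu> n" for i
  proof (rule laplace_unique[OF _ roots(1)])
    show "nonneg_law (distr (steps (Suc n)) borel (y i))"
      using nn by (intro nonneg_law_distr pr meas) auto
    show "laplace_transform (distr (steps (Suc n)) borel (y i)) (real s) = laplace_transform (\<nu> n) (real s)" for s :: nat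
      using single[of "real s" i] meas by (subst laplace_transform_distr) (auto simp: roots(2))
  qed
  ultimately show ?thesis by (simp add: y_def[abs_def] restrict_def)
qed

section \<open>Finite-dimensional laws on dyadic times and their extension\<close>

definition walk_law :: "real set \<Rightarrow> nat \<Rightarrow> (real \<Rightarrow> real) measure" where
  "walk_law J n = distr (steps n) (PiM J (\<lambda>_. borel)) (\<lambda>x. \<lambda>t\<in>J. walk x (nat \<lfloor>t * 2 ^ n\<rfloor>))"

lemma walk_measurable[measurable]: "(\<lambda>x. walk x j) \<in> borel_measurable (steps n)"
  unfolding walk_def by measurable

lemma walk_law_measurable: "(\<lambda>x. \<lambda>t\<in>J. walk x (nat \<lfloor>t * 2 ^ n\<rfloor>)) \<in> measurable (steps n) (PiM J (\<lambda>_. borel))"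
  by (intro measurable_restrict) simp

lemma walk_refine: "walk (\<lambda>j. max 0 (x (2 * j)) + max 0 (x (2 * j + 1))) j = walk x (2 * j)"
  unfolding walk_def by (induction j) auto

text \<open>Times on the grid of mesh \<open>1 / 2 ^ n\<close>: for these the floor in
  \<open>walk_law\<close> is exact, and passing to a finer level does not change the law.\<close>

definition level_ok :: "real set \<Rightarrow> nat \<Rightarrow> bool" where
  "level_ok J n \<longleftrightarrow> (\<forall>t\<in>J. \<exists>k::nat. t = k / 2 ^ n)"

lemma level_ok_Suc: "level_ok J n \<Longrightarrow> level_ok J (Suc n)"
  unfolding level_ok_def
proof
  fix t assume "\<forall>t\<in>J. \<exists>k::nat. t = k / 2 ^ n" "t \<in> J"
  then obtain k :: nat where "t = k / 2 ^ n" by blast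
  thus "\<exists>k::nat. t = k / 2 ^ Suc n" by (intro exI[of _ "2 * k"]) simp
qed

lemma level_ok_mono:
  assumes "level_ok J n" "n \<le> n'"
  shows "level_ok J n'"
  using assms(2,1) by (induction n' rule: dec_induct) (auto intro: level_ok_Suc)

lemma level_ok_subset: "level_ok H n \<Longrightarrow> J \<subseteq> H \<Longrightarrow> level_ok J n"
  by (auto simp: level_ok_def)

lemma walk_law_Suc:
  assumes "level_ok J n"
  shows "walk_law J (Suc n) = walk_law J n"
proof -
  let ?y = "\<lambda>x j. max 0 (x (2 * j)) + max 0 (x (2 * j + 1) :: real)"
  have y: "?y \<in> measurable (steps (Suc n)) (PiM UNIV (\<lambda>_. borel))"
    by (rule measurable_PiM_single') auto
  have w: "(\<lambda>x. \<lambda>t\<in>J. walk x (nat \<lfloor>t * 2 ^ n\<rfloor>)) \<in> measurable (PiM UNIV (\<lambda>_. borel)) (PiM J (\<lambda>_. borel))"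
    using walk_law_measurable[of n J] measurable_cong_sets[OF sets_steps refl] by blast
  have "walk_law J n = distr (distr (steps (Suc n)) (PiM UNIV (\<lambda>_. borel)) ?y) (PiM J (\<lambda>_. borel)) (\<lambda>x. \<lambda>t\<in>J. walk x (nat \<lfloor>t * 2 ^ n\<rfloor>))"
    unfolding walk_law_def by (subst steps_refine) simp
  also have "\<dots> = distr (steps (Suc n)) (PiM J (\<lambda>_. borel)) (\<lambda>x. \<lambda>t\<in>J. walk (?y x) (nat \<lfloor>t * 2 ^ n\<rfloor>))"
    by (subst distr_distr[OF w y]) (simp add: o_def)
  also have "(\<lambda>x. \<lambda>t\<in>J. walk (?y x) (nat \<lfloor>t * 2 ^ n\<rfloor>)) = (\<lambda>x. \<lambda>t\<in>J. walk x (nat \<lfloor>t * 2 ^ Suc n\<rfloor>))"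
  proof (rule ext, rule restrict_ext)
    fix x t assume "t \<in> J"
    then obtain k :: nat where t: "t = k / 2 ^ n" using assms by (auto simp: level_ok_def)
    have "nat \<lfloor>t * 2 ^ n\<rfloor> = k" "nat \<lfloor>t * 2 ^ Suc n\<rfloor> = 2 * k"
    proof -
      have "t * 2 ^ n = real k" "t * 2 ^ Suc n = real (2 * k)" using t by auto
      thus "nat \<lfloor>t * 2 ^ n\<rfloor> = k" "nat \<lfloor>t * 2 ^ Suc n\<rfloor> = 2 * k" by (simp_all only: floor_of_nat nat_int)
    qed
    thus "walk (?y x) (nat \<lfloor>t * 2 ^ n\<rfloor>) = walk x (nat \<lfloor>t * 2 ^ Suc n\<rfloor>)" by (simp only: walk_refine)
  qed
  finally show ?thesis by (simp only: walk_law_def)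
qed

lemma walk_law_eq:
  assumes "level_ok J n" "level_ok J n'"
  shows "walk_law J n = walk_law J n'"
proof -
  have "walk_law J (n + d) = walk_law J n" if "level_ok J n" for n d
    by (induction d) (use walk_law_Suc level_ok_mono[OF that] in auto)
  from this[OF assms(1), of n'] this[OF assms(2), of n] show ?thesis by (simp add: add.commute)
qed

lemma level_exists:
  assumes "finite J" "J \<subseteq> dyadic_times"
  shows "\<exists>n. level_ok J n"
  using assms
proof (induction J)
  case empty thus ?case by (simp add: level_ok_def)
next
  case (insert t J)
  then obtain n where n: "level_ok J n" by auto
  obtain n' and k :: nat where t: "t = k / 2 ^ n'" using insert by (auto simp: dyadic_times_def)
  hence "level_ok {t} n'" by (auto simp: level_ok_def)
  hence "level_ok {t} (max n n')" "level_ok J (max n n')" using n level_ok_mono by auto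
  thus ?case by (auto simp: level_ok_def)
qed

text \<open>On finite sets of dyadic times the chosen level is immaterial, as all admissible levels
  give the same law.\<close>

definition fdd :: "real set \<Rightarrow> (real \<Rightarrow> real) measure" where
  "fdd J = walk_law J (SOME n. level_ok J n)"

lemma fdd_eq: "level_ok J n \<Longrightarrow> fdd J = walk_law J n"
  unfolding fdd_def by (rule walk_law_eq) (rule someI)

text \<open>A level that resolves \<open>H\<close> also resolves \<open>J\<close>, so both laws come
  from one and the same walk and consistency is mere restriction.\<close>

lemma fdd_projective: "polish_projective dyadic_times fdd"
  unfolding polish_projective_def projective_family_def
proof (intro conjI allI impI)
  fix J H :: "real set" assume JH: "J \<subseteq> H" "finite H" "H \<subseteq> dyadic_times"
  then obtain n where n: "level_ok H n" using level_exists by blast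
  have "distr (fdd H) (PiM J (\<lambda>_. borel)) (\<lambda>f. restrict f J)
      = distr (steps n) (PiM J (\<lambda>_. borel)) ((\<lambda>f. restrict f J) \<circ> (\<lambda>x. \<lambda>t\<in>H. walk x (nat \<lfloor>t * 2 ^ n\<rfloor>)))"
    unfolding fdd_eq[OF n] walk_law_def
    by (rule distr_distr[OF measurable_restrict_subset[OF JH(1)] walk_law_measurable])
  also have "((\<lambda>f. restrict f J) \<circ> (\<lambda>x. \<lambda>t\<in>H. walk x (nat \<lfloor>t * 2 ^ n\<rfloor>))) = (\<lambda>x. \<lambda>t\<in>J. walk x (nat \<lfloor>t * 2 ^ n\<rfloor>))"
    using JH(1) by (auto simp: fun_eq_iff restrict_def)
  finally show "fdd J = distr (fdd H) (PiM J (\<lambda>_. borel)) (\<lambda>f. restrict f J)"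
    unfolding fdd_eq[OF level_ok_subset[OF n JH(1)]] walk_law_def[of J] by (rule sym)
next
  fix J :: "real set" assume "finite J" "J \<subseteq> dyadic_times"
  then obtain n where n: "level_ok J n" using level_exists by blast
  show "prob_space (fdd J)" unfolding fdd_eq[OF n] walk_law_def
    by (rule S.prob_space_distr[OF walk_law_measurable])
qed

sublocale W: polish_projective dyadic_times fdd by (rule fdd_projective)

abbreviation W :: "(real \<Rightarrow> real) measure" where "W \<equiv> W.lim"

lemma distr_W:
  assumes "finite J" "J \<subseteq> dyadic_times"
  shows "distr W (PiM J (\<lambda>_. borel)) (\<lambda>\<omega>. restrict \<omega> J) = fdd J"
proof (rule measure_eqI)
  have r: "(\<lambda>\<omega>. restrict \<omega> J) \<in> measurable W (PiM J (\<lambda>_. borel))"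
    using measurable_restrict_subset[OF assms(2)] by (simp cong: measurable_cong_sets)
  show "sets (distr W (PiM J (\<lambda>_. borel)) (\<lambda>\<omega>. restrict \<omega> J)) = sets (fdd J)"
    using W.sets_P[OF assms] by simp
  fix X assume "X \<in> sets (distr W (PiM J (\<lambda>_. borel)) (\<lambda>\<omega>. restrict \<omega> J))"
  hence X: "X \<in> sets (PiM J (\<lambda>_. borel))" by simp
  have "emeasure (distr W (PiM J (\<lambda>_. borel)) (\<lambda>\<omega>. restrict \<omega> J)) X = emeasure W (prod_emb dyadic_times (\<lambda>_. borel) J X)"
    using r X by (subst emeasure_distr) (auto simp: prod_emb_def space_PiM)
  also have "\<dots> = emeasure (fdd J) X" by (rule W.emeasure_lim_emb[OF assms(2,1) X])
  finally show "emeasure (distr W (PiM J (\<lambda>_. borel)) (\<lambda>\<omega>. restrict \<omega> J)) X = emeasure (fdd J) X" .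
qed

lemma W_coord[measurable]: "(\<lambda>\<omega>. \<omega> t) \<in> borel_measurable W"
proof (cases "t \<in> dyadic_times")
  case True
  thus ?thesis using measurable_component_singleton[of t dyadic_times "\<lambda>_. borel"] by (simp cong: measurable_cong_sets)
next
  case False
  hence "\<omega> t = undefined" if "\<omega> \<in> space W" for \<omega>
    using that by (auto simp: space_PiM PiE_def extensional_def)
  thus ?thesis by (subst measurable_cong[where g="\<lambda>_. undefined"]) auto
qed

text \<open>Transfers expectations of functions of finitely many dyadic values from the extended
  measure to the random walk, where transforms are explicit.\<close>

lemma integral_W:
  assumes J: "finite J" "J \<subseteq> dyadic_times" "level_ok J n"
    and f: "f \<in> borel_measurable (PiM J (\<lambda>_. borel))" and dep: "\<And>\<omega>. f \<omega> = f (restrict \<omega> J)"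
  shows "(LINT \<omega>|W. f \<omega> :: real) = (LINT x|steps n. f (\<lambda>t\<in>J. walk x (nat \<lfloor>t * 2 ^ n\<rfloor>)))"
proof -
  have r: "(\<lambda>\<omega>. restrict \<omega> J) \<in> measurable W (PiM J (\<lambda>_. borel))"
    using measurable_restrict_subset[OF J(2)] by (simp cong: measurable_cong_sets)
  have "(LINT \<omega>|W. f \<omega>) = (LINT \<omega>|W. f (restrict \<omega> J))"
    by (rule Bochner_Integration.integral_cong[OF refl dep])
  also have "\<dots> = (LINT \<omega>|distr W (PiM J (\<lambda>_. borel)) (\<lambda>\<omega>. restrict \<omega> J). f \<omega>)"
    by (rule integral_distr[OF r f, symmetric])
  also have "\<dots> = (LINT x|steps n. f (\<lambda>t\<in>J. walk x (nat \<lfloor>t * 2 ^ n\<rfloor>)))"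
    unfolding distr_W[OF J(1,2)] fdd_eq[OF J(3)] walk_law_def
    by (rule integral_distr[OF walk_law_measurable f])
  finally show ?thesis .
qed

text \<open>The inner sum is the step function equal to \<open>s i\<close> on block
  \<open>i\<close>. Because only \<open>g 0 = 0\<close> is asked for, the identity serves both the
  linear form in the exponent, with \<open>g\<close> the identity, and the cumulants, with
  \<open>g = A\<close>.\<close>

lemma block_sum:
  fixes g :: "real \<Rightarrow> real" and kk :: "nat \<Rightarrow> nat"
  assumes "mono kk" and g: "g 0 = 0"
  shows "(\<Sum>k<kk N. g (\<Sum>i<N. if kk i \<le> k \<and> k < kk (Suc i) then s i else 0) * y k)
    = (\<Sum>i<N. g (s i) * (\<Sum>k=kk i..<kk (Suc i). y k))"
proof (induction N)
  case 0 thus ?case by (simp add: g)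
next
  case (Suc N)
  let ?c = "\<lambda>N k. \<Sum>i<N. if kk i \<le> k \<and> k < kk (Suc i) then s i else 0"
  have le: "kk i \<le> kk j" if "i \<le> j" for i j using assms(1) that by (rule monoD)
  have "{..<kk (Suc N)} = {..<kk N} \<union> {kk N..<kk (Suc N)}" using le[of N "Suc N"] by auto
  hence "(\<Sum>k<kk (Suc N). g (?c (Suc N) k) * y k)
      = (\<Sum>k<kk N. g (?c (Suc N) k) * y k) + (\<Sum>k=kk N..<kk (Suc N). g (?c (Suc N) k) * y k)"
    by (simp add: sum.union_disjoint ivl_disj_int)
  also have "(\<Sum>k<kk N. g (?c (Suc N) k) * y k) = (\<Sum>k<kk N. g (?c N k) * y k)"
    by (intro sum.cong refl) simp
  also have "(\<Sum>k=kk N..<kk (Suc N). g (?c (Suc N) k) * y k) = (\<Sum>k=kk N..<kk (Suc N). g (s N) * y k)"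
  proof (intro sum.cong refl)
    fix k assume k: "k \<in> {kk N..<kk (Suc N)}"
    have "?c N k = 0"
    proof (intro sum.neutral ballI)
      fix i assume "i \<in> {..<N}"
      hence "kk (Suc i) \<le> kk N" by (intro le) auto
      thus "(if kk i \<le> k \<and> k < kk (Suc i) then s i else 0) = 0" using k by auto
    qed
    thus "g (?c (Suc N) k) * y k = g (s N) * y k" using k by simp
  qed
  finally show ?case using Suc by (simp add: sum_distrib_left)
qed

lemma walk_diff: "i \<le> j \<Longrightarrow> walk x j - walk x i = (\<Sum>k=i..<j. max 0 (x k))"
proof -
  assume "i \<le> j"
  hence "{..<j} = {..<i} \<union> {i..<j}" by auto
  thus ?thesis by (simp add: walk_def sum.union_disjoint ivl_disj_int)
qed

lemma walk_increments_laplace: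
  assumes kk: "mono kk" and s: "\<And>i. 0 \<le> s i"
  shows "(LINT x|steps n. exp (- (\<Sum>i<N. s i * (walk x (kk (Suc i)) - walk x (kk i)))))
    = exp (- (\<Sum>i<N. (real (kk (Suc i)) / 2 ^ n - real (kk i) / 2 ^ n) * A (s i)))"
proof -
  define c where "c k = (\<Sum>i<N. if kk i \<le> k \<and> k < kk (Suc i) then s i else 0)" for k
  have c: "0 \<le> c k" for k unfolding c_def using s by (intro sum_nonneg) auto
  have le: "kk i \<le> kk (Suc i)" for i using kk by (rule monoD) simp
  have "(\<Sum>i<N. s i * (walk x (kk (Suc i)) - walk x (kk i))) = (\<Sum>k<kk N. c k * max 0 (x k))" for x
    using block_sum[OF kk, where g="\<lambda>z. z" and N=N and s=s and y="\<lambda>k. max 0 (x k)"] unfolding c_def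
    by (simp add: walk_diff[OF le])
  hence "(LINT x|steps n. exp (- (\<Sum>i<N. s i * (walk x (kk (Suc i)) - walk x (kk i)))))
      = exp (- (\<Sum>k<kk N. A (c k)) / 2 ^ n)"
    using steps_laplace[of c, where n=n and K="kk N"] c by simp
  also have "(\<Sum>k<kk N. A (c k)) = (\<Sum>i<N. A (s i) * (real (kk (Suc i)) - real (kk i)))"
    using block_sum[where g=A and kk=kk and N=N and s=s and y="\<lambda>_. 1", OF kk A_0] le
    unfolding c_def by (simp add: of_nat_diff)
  also have "- \<dots> / 2 ^ n = - (\<Sum>i<N. (real (kk (Suc i)) / 2 ^ n - real (kk i) / 2 ^ n) * A (s i))"
    by (simp add: sum_divide_distrib diff_divide_distrib[symmetric] mult.commute)
  finally show ?thesis .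
qed

section \<open>Right-continuous paths from the dyadic values\<close>

definition good :: "(real \<Rightarrow> real) \<Rightarrow> bool" where
  "good \<omega> \<longleftrightarrow> (\<forall>p\<in>dyadic_times. \<forall>q\<in>dyadic_times. p \<le> q \<longrightarrow> 0 \<le> \<omega> p \<and> \<omega> p \<le> \<omega> q)"

text \<open>The right-continuous regularization. Where monotonicity fails, on a null set, the zero
  path is taken, so that every path and not merely almost every one is monotone. At a dyadic time
  the value may differ from the given one; only laws are compared later.\<close>

definition Y :: "real \<Rightarrow> (real \<Rightarrow> real) \<Rightarrow> real" where
  "Y t \<omega> = (if good \<omega> then INF q\<in>{q \<in> dyadic_times. t < q}. \<omega> q else 0)"

text \<open>The successor puts the approximation strictly above \<open>t\<close>, also at grid
  points, as the infimum in \<open>Y\<close> demands.\<close>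

definition apx :: "nat \<Rightarrow> real \<Rightarrow> real" where
  "apx n t = real (Suc (nat \<lfloor>t * 2 ^ n\<rfloor>)) / 2 ^ n"

lemma apx_dyadic: "apx n t \<in> dyadic_times"
  unfolding apx_def dyadic_times_def by blast

lemma apx_bounds:
  assumes "0 \<le> t"
  shows "t < apx n t" "apx n t \<le> t + 1 / 2 ^ n"
proof -
  have "real (nat \<lfloor>t * 2 ^ n\<rfloor>) = of_int \<lfloor>t * 2 ^ n\<rfloor>" using assms by simp
  hence "real (nat \<lfloor>t * 2 ^ n\<rfloor>) \<le> t * 2 ^ n" "t * 2 ^ n < real (nat \<lfloor>t * 2 ^ n\<rfloor>) + 1" by linarith+
  thus "t < apx n t" "apx n t \<le> t + 1 / 2 ^ n" by (auto simp: apx_def field_simps)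
qed

lemma apx_tendsto:
  assumes "0 \<le> t"
  shows "(\<lambda>n. apx n t) \<longlonglongrightarrow> t"
proof (rule tendsto_sandwich[of "\<lambda>_. t" _ _ "\<lambda>n. t + (1 / 2) ^ n"])
  show "\<forall>\<^sub>F n in sequentially. t \<le> apx n t" using apx_bounds[OF assms] by (auto intro: always_eventually less_imp_le)
  show "\<forall>\<^sub>F n in sequentially. apx n t \<le> t + (1 / 2) ^ n"
    using apx_bounds(2)[OF assms] by (auto intro!: always_eventually simp: power_one_over)
  have "(\<lambda>n. t + (1 / 2) ^ n) \<longlonglongrightarrow> t + 0" by (intro tendsto_intros LIMSEQ_power_zero) auto
  thus "(\<lambda>n. t + (1 / 2) ^ n) \<longlonglongrightarrow> t" by simp
qed simp

lemma good_nonneg: "good \<omega> \<Longrightarrow> q \<in> dyadic_times \<Longrightarrow> 0 \<le> \<omega> q"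
  and good_mono: "good \<omega> \<Longrightarrow> p \<in> dyadic_times \<Longrightarrow> q \<in> dyadic_times \<Longrightarrow> p \<le> q \<Longrightarrow> \<omega> p \<le> \<omega> q"
  unfolding good_def by auto

lemma Y_bdd: "good \<omega> \<Longrightarrow> bdd_below (\<omega> ` {q \<in> dyadic_times. t < q})"
  by (rule bdd_belowI2[of _ 0]) (auto intro: good_nonneg)

lemma Y_le: "good \<omega> \<Longrightarrow> q \<in> dyadic_times \<Longrightarrow> t < q \<Longrightarrow> Y t \<omega> \<le> \<omega> q"
  unfolding Y_def by (simp add: cINF_lower[OF Y_bdd])

lemma dyadic_above: "0 \<le> t \<Longrightarrow> {q \<in> dyadic_times. t < q} \<noteq> {}"
  using apx_dyadic[of 0 t] apx_bounds(1)[of t 0] by blast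

lemma Y_approx:
  assumes "good \<omega>" "0 \<le> t" "Y t \<omega> < a"
  obtains q where "q \<in> dyadic_times" "t < q" "\<omega> q < a"
proof -
  have "(INF q\<in>{q \<in> dyadic_times. t < q}. \<omega> q) < a" using assms by (simp add: Y_def)
  hence "\<exists>q\<in>{q \<in> dyadic_times. t < q}. \<omega> q < a"
    by (subst (asm) cINF_less_iff[OF dyadic_above[OF assms(2)] Y_bdd[OF assms(1)]])
  thus ?thesis using that by blast
qed

lemma Y_nonneg: "0 \<le> t \<Longrightarrow> 0 \<le> Y t \<omega>"
  unfolding Y_def using cINF_greatest[OF dyadic_above, of t 0 \<omega>] good_nonneg[of \<omega>] by auto

lemma Y_mono:
  assumes "0 \<le> s" "s \<le> t"
  shows "Y s \<omega> \<le> Y t \<omega>"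
proof (cases "good \<omega>")
  case True
  have "Y s \<omega> \<le> (INF q\<in>{q \<in> dyadic_times. t < q}. \<omega> q)"
    by (rule cINF_greatest[OF dyadic_above]) (use assms True in \<open>auto intro!: Y_le\<close>)
  thus ?thesis using True by (simp add: Y_def)
qed (simp add: Y_def)

lemma Y_path: "path_of Y \<omega> \<in> mono_paths"
proof -
  have "continuous (at_right t) (path_of Y \<omega>)" if t: "0 \<le> t" for t
  proof (cases "good \<omega>")
    case False
    have "\<forall>\<^sub>F s in at_right t. path_of Y \<omega> s = path_of Y \<omega> t"
      using eventually_at_right_less[of t] by eventually_elim (use t False in \<open>simp add: path_of_def Y_def\<close>)
    thus ?thesis unfolding continuous_within by (rule tendsto_eventually)
  next
    case True
    have "(path_of Y \<omega> \<longlongrightarrow> Y t \<omega>) (at_right t)"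
    proof (rule decreasing_tendsto)
      show "\<forall>\<^sub>F s in at_right t. Y t \<omega> \<le> path_of Y \<omega> s"
        using eventually_at_right_less[of t] by eventually_elim (use t in \<open>simp add: path_of_def Y_mono\<close>)
      fix a assume "Y t \<omega> < a"
      then obtain q where q: "q \<in> dyadic_times" "t < q" "\<omega> q < a" using Y_approx[OF True t] by blast
      have "\<forall>\<^sub>F s in at_right t. t < s \<and> s < q"
        using q by (auto simp: eventually_at_right_field intro!: exI[of _ q])
      thus "\<forall>\<^sub>F s in at_right t. path_of Y \<omega> s < a"
        by eventually_elim (use t q Y_le[OF True q(1)] in \<open>auto simp: path_of_def intro: le_less_trans\<close>)
    qed
    thus ?thesis using t by (simp add: continuous_within path_of_def)
  qed
  thus ?thesis by (auto simp: mono_paths_def path_of_def Y_nonneg Y_mono)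
qed

lemma Y_lim:
  assumes "good \<omega>" "0 \<le> t"
  shows "(\<lambda>n. \<omega> (apx n t)) \<longlonglongrightarrow> Y t \<omega>"
proof (rule decreasing_tendsto)
  show "\<forall>\<^sub>F n in sequentially. Y t \<omega> \<le> \<omega> (apx n t)"
    using assms by (auto intro!: always_eventually Y_le apx_dyadic apx_bounds)
  fix a assume "Y t \<omega> < a"
  then obtain q where q: "q \<in> dyadic_times" "t < q" "\<omega> q < a" using Y_approx[OF assms] by blast
  have "\<forall>\<^sub>F n in sequentially. apx n t < q" using order_tendstoD(2)[OF apx_tendsto[OF assms(2)] q(2)] .
  thus "\<forall>\<^sub>F n in sequentially. \<omega> (apx n t) < a"
    by eventually_elim (use q good_mono[OF assms(1) apx_dyadic q(1)] in \<open>auto intro: le_less_trans less_imp_le\<close>)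
qed

lemma countable_dyadic_times: "countable dyadic_times"
proof -
  have "dyadic_times = (\<Union>n. range (\<lambda>k :: nat. real k / 2 ^ n))" by (auto simp: dyadic_times_def)
  moreover have "countable (\<Union>n. range (\<lambda>k :: nat. real k / 2 ^ n))" by (intro countable_UN) auto
  ultimately show ?thesis by simp
qed

lemma good_sets: "{\<omega> \<in> space W. good \<omega>} \<in> sets W"
  unfolding good_def
  by (intro sets.sets_Collect_countable_All' countable_dyadic_times sets.sets_Collect_imp sets.sets_Collect_const
      sets.sets_Collect_conj borel_measurable_le borel_measurable_const W_coord)

lemma Y_measurable:
  assumes t: "0 \<le> t"
  shows "Y t \<in> borel_measurable W"
proof (rule borel_measurable_LIMSEQ_real)
  have [measurable]: "Measurable.pred W good" using good_sets by (simp add: pred_def)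
  show "(\<lambda>\<omega>. if good \<omega> then \<omega> (apx n t) else 0) \<in> borel_measurable W" for n by measurable
  show "(\<lambda>n. if good \<omega> then \<omega> (apx n t) else 0) \<longlonglongrightarrow> Y t \<omega>" for \<omega>
    using Y_lim[OF _ t] by (cases "good \<omega>") (auto simp: Y_def)
qed

text \<open>There are countably many pairs of dyadic times, and each pair is governed by the
  two-dimensional law of a non-decreasing walk.\<close>

lemma AE_good: "AE \<omega> in W. good \<omega>"
  unfolding good_def
proof (intro AE_ball_countable' countable_dyadic_times AE_impI)
  fix p q assume pq: "p \<in> dyadic_times" "q \<in> dyadic_times" "p \<le> q"
  let ?J = "{p, q}"
  have J: "finite ?J" "?J \<subseteq> dyadic_times" using pq by auto
  then obtain n where n: "level_ok ?J n" using level_exists by blast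
  have w: "0 \<le> walk x i \<and> walk x i \<le> walk x j" if "i \<le> j" for x i j
    unfolding walk_def using that by (auto intro!: sum_nonneg sum_mono2)
  have p: "nat \<lfloor>p * 2 ^ n\<rfloor> \<le> nat \<lfloor>q * 2 ^ n\<rfloor>" using pq(3) by (intro nat_floor_mono mult_right_mono) auto
  let ?B = "\<lambda>\<omega>. 0 \<le> \<omega> p \<and> \<omega> p \<le> (\<omega> q :: real)"
  have comp: "(\<lambda>\<omega>. \<omega> p) \<in> borel_measurable (PiM ?J (\<lambda>_. borel))" "(\<lambda>\<omega>. \<omega> q) \<in> borel_measurable (PiM ?J (\<lambda>_. borel))"
    by (auto intro!: measurable_component_singleton)
  have B: "{\<omega> \<in> space (PiM ?J (\<lambda>_. borel)). ?B \<omega>} \<in> sets (PiM ?J (\<lambda>_. borel))"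
    by (intro sets.sets_Collect_conj borel_measurable_le borel_measurable_const comp)
  have "AE \<omega> in fdd ?J. ?B \<omega>"
    unfolding fdd_eq[OF n] walk_law_def
    by (subst AE_distr_iff[OF walk_law_measurable B]) (auto simp: w[OF p])
  hence "AE \<omega> in distr W (PiM ?J (\<lambda>_. borel)) (\<lambda>\<omega>. restrict \<omega> ?J). ?B \<omega>" by (simp only: distr_W[OF J])
  moreover have "(\<lambda>\<omega>. restrict \<omega> ?J) \<in> measurable W (PiM ?J (\<lambda>_. borel))"
    using measurable_restrict_subset[OF J(2)] by (simp cong: measurable_cong_sets)
  ultimately have "AE \<omega> in W. ?B (restrict \<omega> ?J)" by (rule AE_distrD[rotated])
  thus "AE \<omega> in W. 0 \<le> \<omega> p \<and> \<omega> p \<le> \<omega> q" by simp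
qed

lemma W_increments_laplace:
  assumes t: "mono t" "0 \<le> t 0" and s: "\<And>i. 0 \<le> s i"
  shows "(LINT \<omega>|W. exp (- (\<Sum>i<N. s i * (\<omega> (apx n (t (Suc i))) - \<omega> (apx n (t i))))))
    = exp (- (\<Sum>i<N. (apx n (t (Suc i)) - apx n (t i)) * A (s i)))"
proof -
  let ?a = "\<lambda>i. apx n (t i)" and ?J = "(\<lambda>i. apx n (t i)) ` {..N}"
  let ?f = "\<lambda>\<omega>. exp (- (\<Sum>i<N. s i * (\<omega> (?a (Suc i)) - \<omega> (?a i :: real)))) :: real"
  define kk where "kk i = Suc (nat \<lfloor>t i * 2 ^ n\<rfloor>)" for i
  have kk: "mono kk" unfolding kk_def
    by (intro monoI Suc_le_mono[THEN iffD2] nat_floor_mono mult_right_mono monoD[OF t(1)]) auto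
  have a: "?a i = real (kk i) / 2 ^ n" for i by (simp add: apx_def kk_def)
  have fl: "nat \<lfloor>?a i * 2 ^ n\<rfloor> = kk i" for i unfolding a by simp
  have "(LINT \<omega>|W. ?f \<omega>) = (LINT x|steps n. ?f (\<lambda>t\<in>?J. walk x (nat \<lfloor>t * 2 ^ n\<rfloor>)))"
  proof (rule integral_W)
    show "level_ok ?J n" unfolding level_ok_def using a by blast
    have "(\<lambda>\<omega>. \<omega> (?a i)) \<in> borel_measurable (PiM ?J (\<lambda>_. borel))" if "i \<le> N" for i
      using that by (intro measurable_component_singleton) auto
    thus "?f \<in> borel_measurable (PiM ?J (\<lambda>_. borel))"
      by (intro borel_measurable_exp[THEN measurable_compose[rotated]] borel_measurable_uminus borel_measurable_sum
          borel_measurable_times borel_measurable_diff) auto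
    show "?f \<omega> = ?f (restrict \<omega> ?J)" for \<omega>
      by (intro arg_cong[where f=exp] arg_cong[where f=uminus] sum.cong refl) auto
  qed (use apx_dyadic in auto)
  also have "\<dots> = (LINT x|steps n. exp (- (\<Sum>i<N. s i * (walk x (kk (Suc i)) - walk x (kk i)))))"
    by (intro Bochner_Integration.integral_cong refl arg_cong[where f=exp] arg_cong[where f=uminus] sum.cong)
       (auto simp: fl)
  also have "\<dots> = exp (- (\<Sum>i<N. (real (kk (Suc i)) / 2 ^ n - real (kk i) / 2 ^ n) * A (s i)))"
    by (rule walk_increments_laplace[OF kk s])
  finally show ?thesis by (simp only: a)
qed

lemma W_single_laplace:
  assumes t: "0 \<le> t" and s: "0 \<le> s"
  shows "(LINT \<omega>|W. exp (- (s * \<omega> (apx n t)))) = exp (- (apx n t * A s))"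
proof -
  let ?a = "apx n t"
  define k where "k = Suc (nat \<lfloor>t * 2 ^ n\<rfloor>)"
  have a: "?a = real k / 2 ^ n" by (simp add: apx_def k_def)
  have fl: "nat \<lfloor>?a * 2 ^ n\<rfloor> = k" unfolding a by simp
  have "(LINT \<omega>|W. exp (- (s * \<omega> ?a))) = (LINT x|steps n. exp (- (s * (\<lambda>t\<in>{?a}. walk x (nat \<lfloor>t * 2 ^ n\<rfloor>)) ?a)))"
  proof (rule integral_W)
    show "level_ok {?a} n" unfolding level_ok_def using a by blast
    have [measurable]: "(\<lambda>\<omega>. \<omega> ?a) \<in> borel_measurable (PiM {?a} (\<lambda>_. borel))"
      by (intro measurable_component_singleton) auto
    show "(\<lambda>\<omega>. exp (- (s * \<omega> ?a))) \<in> borel_measurable (PiM {?a} (\<lambda>_. borel))" by measurable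
  qed (use apx_dyadic in auto)
  \<comment> \<open>The value itself is written as the increment over the one block from 0 to
    \<open>k\<close>.\<close>
  also have "\<dots> = (LINT x|steps n. exp (- (\<Sum>i<1. s * (walk x (Suc i * k) - walk x (i * k)))))"
    by (simp add: fl walk_def)
  also have "\<dots> = exp (- (\<Sum>i<1. (real (Suc i * k) / 2 ^ n - real (i * k) / 2 ^ n) * A s))"
    by (rule walk_increments_laplace) (use s in \<open>auto intro!: monoI\<close>)
  finally show ?thesis by (simp add: a)
qed

text \<open>Dominated convergence along dyadic approximations. All times are rounded at the same
  level \<open>n\<close>, which keeps the increments non-negative and the integrand at most
  1.\<close>

lemma Y_increments_laplace:
  assumes t: "mono t" "0 \<le> t 0" and s: "\<And>i. 0 \<le> s i"
  shows "(LINT \<omega>|W. exp (- (\<Sum>i<N. s i * (Y (t (Suc i)) \<omega> - Y (t i) \<omega>))))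
    = exp (- (\<Sum>i<N. (t (Suc i) - t i) * A (s i)))"
proof (rule LIMSEQ_unique)
  have t0: "0 \<le> t i" for i using monoD[OF t(1), of 0 i] t(2) by simp
  have [measurable]: "Y (t i) \<in> borel_measurable W" for i by (rule Y_measurable[OF t0])
  show "(\<lambda>n. LINT \<omega>|W. exp (- (\<Sum>i<N. s i * (\<omega> (apx n (t (Suc i))) - \<omega> (apx n (t i))))))
    \<longlonglongrightarrow> (LINT \<omega>|W. exp (- (\<Sum>i<N. s i * (Y (t (Suc i)) \<omega> - Y (t i) \<omega>))))"
  proof (rule integral_dominated_convergence[where w="\<lambda>_. 1"])
    show "AE \<omega> in W. (\<lambda>n. exp (- (\<Sum>i<N. s i * (\<omega> (apx n (t (Suc i))) - \<omega> (apx n (t i))))))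
        \<longlonglongrightarrow> exp (- (\<Sum>i<N. s i * (Y (t (Suc i)) \<omega> - Y (t i) \<omega>)))"
      using AE_good by eventually_elim (intro tendsto_intros Y_lim t0)
    show "AE \<omega> in W. norm (exp (- (\<Sum>i<N. s i * (\<omega> (apx n (t (Suc i))) - \<omega> (apx n (t i)))))) \<le> 1" for n
      using AE_good
    proof eventually_elim
      case (elim \<omega>)
      have "apx n (t i) \<le> apx n (t (Suc i))" for i
        unfolding apx_def using monoD[OF t(1), of i "Suc i"]
        by (intro divide_right_mono of_nat_mono Suc_le_mono[THEN iffD2] nat_floor_mono mult_right_mono) auto
      hence "\<omega> (apx n (t i)) \<le> \<omega> (apx n (t (Suc i)))" for i by (intro good_mono[OF elim] apx_dyadic)
      hence "0 \<le> (\<Sum>i<N. s i * (\<omega> (apx n (t (Suc i))) - \<omega> (apx n (t i))))"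
        using s by (intro sum_nonneg mult_nonneg_nonneg) auto
      thus ?case by simp
    qed
  qed auto
  show "(\<lambda>n. LINT \<omega>|W. exp (- (\<Sum>i<N. s i * (\<omega> (apx n (t (Suc i))) - \<omega> (apx n (t i))))))
    \<longlonglongrightarrow> exp (- (\<Sum>i<N. (t (Suc i) - t i) * A (s i)))"
    unfolding W_increments_laplace[OF assms] by (intro tendsto_intros apx_tendsto t0)
qed

lemma Y_laplace:
  assumes t: "0 \<le> t" and s: "0 \<le> s"
  shows "(LINT \<omega>|W. exp (- s * Y t \<omega>)) = exp (- t * A s)"
proof (rule LIMSEQ_unique)
  have [measurable]: "Y t \<in> borel_measurable W" by (rule Y_measurable[OF t])
  show "(\<lambda>n. LINT \<omega>|W. exp (- (s * \<omega> (apx n t)))) \<longlonglongrightarrow> (LINT \<omega>|W. exp (- s * Y t \<omega>))"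
  proof (rule integral_dominated_convergence[where w="\<lambda>_. 1"])
    have "AE \<omega> in W. (\<lambda>n. exp (- (s * \<omega> (apx n t)))) \<longlonglongrightarrow> exp (- (s * Y t \<omega>))"
      using AE_good by eventually_elim (intro tendsto_intros Y_lim t)
    thus "AE \<omega> in W. (\<lambda>n. exp (- (s * \<omega> (apx n t)))) \<longlonglongrightarrow> exp (- s * Y t \<omega>)" by simp
    show "AE \<omega> in W. norm (exp (- (s * \<omega> (apx n t)))) \<le> 1" for n
      using AE_good by eventually_elim (use s good_nonneg[OF _ apx_dyadic] in auto)
  qed auto
  have "(\<lambda>n. exp (- (apx n t * A s))) \<longlonglongrightarrow> exp (- (t * A s))" by (intro tendsto_intros apx_tendsto t)
  thus "(\<lambda>n. LINT \<omega>|W. exp (- (s * \<omega> (apx n t)))) \<longlonglongrightarrow> exp (- t * A s)"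
    unfolding W_single_laplace[OF assms] by simp
qed

text \<open>The transform at time 0 is 1, so the non-negative variable
  \<open>1 - exp (- Y 0 \<omega>)\<close> has mean zero.\<close>

lemma Y_0: "AE \<omega> in W. Y 0 \<omega> = 0"
proof -
  have [measurable]: "Y 0 \<in> borel_measurable W" by (rule Y_measurable) simp
  have int: "integrable W (\<lambda>\<omega>. exp (- Y 0 \<omega>))"
    using Y_nonneg[of 0] by (intro W.P.integrable_const_bound[of _ 1]) auto
  have "(LINT \<omega>|W. 1 - exp (- Y 0 \<omega>)) = 0"
    using Y_laplace[of 0 1] int W.P.prob_space by simp
  hence "AE \<omega> in W. 1 - exp (- Y 0 \<omega>) = 0"
    using int Y_nonneg[of 0] by (subst (asm) integral_nonneg_eq_0_iff_AE) auto
  thus ?thesis by eventually_elim simp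
qed

lemma Y_increments_indep:
  assumes t: "mono t" "0 \<le> t 0"
  shows "prob_space.indep_vars W (\<lambda>_. borel) (\<lambda>k \<omega>. Y (t (Suc k)) \<omega> - Y (t k) \<omega>) UNIV"
proof -
  have t0: "0 \<le> t i" for i using monoD[OF t(1), of 0 i] t(2) by simp
  have [measurable]: "Y (t i) \<in> borel_measurable W" for i by (rule Y_measurable[OF t0])
  have ns: "nonneg_sequence W (\<lambda>k \<omega>. Y (t (Suc k)) \<omega> - Y (t k) \<omega>)"
    unfolding nonneg_sequence_def nonneg_sequence_axioms_def
    using W.P.prob_space_axioms Y_mono[OF t0 monoD[OF t(1)]] by auto
  \<comment> \<open>The joint formula for shifted times and a single term.\<close>
  have single: "(LINT \<omega>|W. exp (- (c * (Y (t (Suc i)) \<omega> - Y (t i) \<omega>)))) = exp (- ((t (Suc i) - t i) * A c))"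
    if "0 \<le> c" for i c
    using Y_increments_laplace[of "\<lambda>j. t (i + j)" "\<lambda>_. c" 1] t0[of i] t(1) that by (simp add: mono_def)
  show ?thesis
    by (rule nonneg_sequence.indep_if_joint_laplace[OF ns])
       (simp add: Y_increments_laplace[OF t] single exp_sum[symmetric] sum_negf)
qed

lemma levy: "levy_process W Y"
proof (intro levy_process.intro levy_process_axioms.intro)
  show "prob_space W" by (rule W.P.prob_space_axioms)
  show "cadlag_process W Y"
    unfolding cadlag_process_def using W.P.prob_space_axioms Y_measurable Y_path mono_paths_subset by blast
  show "AE \<omega> in W. Y 0 \<omega> = 0" by (rule Y_0)
  fix t :: "nat \<Rightarrow> real" and n assume "0 \<le> t 0" "mono t"
  thus "prob_space.indep_vars W (\<lambda>_. borel) (\<lambda>k \<omega>. Y (t (Suc k)) \<omega> - Y (t k) \<omega>) {..<n}"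
    using prob_space.indep_vars_subset[OF W.P.prob_space_axioms Y_increments_indep] by blast
next
  fix s h :: real assume sh: "0 \<le> s" "0 \<le> h"
  have [measurable]: "Y (s + h) \<in> borel_measurable W" "Y s \<in> borel_measurable W" "Y h \<in> borel_measurable W"
    using sh by (auto intro: Y_measurable)
  have "(LINT \<omega>|W. exp (- (c * (Y (s + h) \<omega> - Y s \<omega>)))) = exp (- (h * A c))" if "0 \<le> c" for c
    using Y_increments_laplace[of "\<lambda>j. s + j * h" "\<lambda>_. c" 1] sh that
    by (simp add: mono_def mult_right_mono)
  thus "distr W borel (\<lambda>\<omega>. Y (s + h) \<omega> - Y s \<omega>) = distr W borel (Y h)"
    using sh Y_mono[of s "s + h"] Y_nonneg[of h] Y_laplace[of h]
    by (intro laplace_unique nonneg_law_distr W.P.prob_space_axioms) (auto simp: laplace_transform_distr)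
qed

end

section \<open>Infinite divisibility from roots of the transform\<close>

lemma infinitely_divisible_if_roots:
  assumes \<mu>: "nonneg_law \<mu>"
    and roots: "\<And>n::nat. n \<ge> 1 \<Longrightarrow> \<exists>\<nu>. nonneg_law \<nu> \<and> (\<forall>s\<ge>0. laplace_transform \<nu> s ^ n = laplace_transform \<mu> s)"
  shows "infinitely_divisible \<mu>"
  unfolding infinitely_divisible_def
proof (intro allI impI)
  fix n :: nat assume "n \<ge> 1"
  then obtain \<nu> where \<nu>: "nonneg_law \<nu>" "\<And>s. 0 \<le> s \<Longrightarrow> laplace_transform \<nu> s ^ n = laplace_transform \<mu> s"
    using roots by blast
  interpret \<nu>: real_distribution \<nu> using \<nu>(1) by (simp add: nonneg_law_def)
  interpret product_prob_space "\<lambda>_. \<nu>" "{..<n}" by unfold_locales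
  interpret fin: finite_product_prob_space "\<lambda>_. \<nu>" "{..<n}" by unfold_locales auto
  let ?R = "PiM {..<n} (\<lambda>_. \<nu>)" and ?S = "\<lambda>x. \<Sum>k<n. x k"
  have coord: "(\<lambda>x. x k) \<in> borel_measurable ?R" if "k < n" for k
  proof -
    have "(\<lambda>x. x k) \<in> measurable ?R \<nu>" using that by (intro measurable_component_singleton) auto
    thus ?thesis by (simp cong: measurable_cong_sets)
  qed
  have S: "?S \<in> borel_measurable ?R" using coord by (intro borel_measurable_sum) auto
  have "AE x in ?R. \<forall>k\<in>{..<n}. 0 \<le> x k"
    using \<nu>(1) by (intro AE_finite_allI AE_PiM_component) (auto simp: nonneg_law_def \<nu>.prob_space_axioms)
  hence "AE x in ?R. 0 \<le> ?S x" by eventually_elim (auto intro: sum_nonneg)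
  hence "nonneg_law (distr ?R borel ?S)"
    by (intro nonneg_law_distr S P.prob_space_axioms)
  moreover have "laplace_transform (distr ?R borel ?S) (real s) = laplace_transform \<mu> (real s)" for s :: nat
  proof -
    have "laplace_transform (distr ?R borel ?S) (real s) = (LINT x|?R. (\<Prod>k<n. exp (- real s * x k)))"
      by (subst laplace_transform_distr[OF S]) (simp add: exp_sum[symmetric] sum_distrib_left sum_negf)
    also have "\<dots> = (\<Prod>k<n. LINT x|\<nu>. exp (- real s * x))"
      using nonneg_law_integrable[OF \<nu>(1), of "real s"] by (intro product_integral_prod) auto
    also have "\<dots> = laplace_transform \<mu> (real s)" using \<nu>(2)[of "real s"] by (simp add: laplace_transform_def)
    finally show ?thesis .
  qed
  ultimately have "distr ?R borel ?S = \<mu>" by (intro laplace_unique \<mu>)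
  thus "\<exists>\<nu>. real_distribution \<nu> \<and> distr (PiM {..<n} (\<lambda>_. \<nu>)) borel (\<lambda>x. \<Sum>k<n. x k) = \<mu>"
    using \<nu>.real_distribution_axioms by blast
qed

section \<open>Partial sums of the renewal process\<close>

context markov_renewal
begin

definition S :: "nat \<Rightarrow> 'w \<Rightarrow> real" where "S n \<omega> = (\<Sum>k=1..n. \<kappa> k \<omega>)"

lemma S_history: "k \<le> n \<Longrightarrow> S k \<in> borel_measurable (history m M X n)"
  unfolding S_def using borel_measurable_kappa[OF X_history] by (intro borel_measurable_sum) auto

lemma S_measurable[measurable]: "S n \<in> borel_measurable M"
  using history_measurable[OF S_history[OF order_refl]] .

lemma S_mono: "\<omega> \<in> space M \<Longrightarrow> k \<le> n \<Longrightarrow> S k \<omega> \<le> S n \<omega>"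
  unfolding S_def using \<kappa>_nonneg by (intro sum_mono2) auto

lemma S_diff: "S (n + l) \<omega> - S n \<omega> = (\<Sum>k=Suc n..n + l. \<kappa> k \<omega>)"
proof -
  have "{1..n + l} = {1..n} \<union> {Suc n..n + l}" by auto
  hence "(\<Sum>k=1..n + l. \<kappa> k \<omega>) = (\<Sum>k=1..n. \<kappa> k \<omega>) + (\<Sum>k=Suc n..n + l. \<kappa> k \<omega>)"
    by (simp only:) (subst sum.union_disjoint, auto)
  thus ?thesis unfolding S_def by simp
qed

text \<open>The estimate holds for all starting states with the same \<open>b\<close>; whatever the
  state at time \<open>n\<close> is, the past factor \<open>H\<close> splits off up to the error
  \<open>e\<close>.\<close>

lemma laplace_increment:
  assumes H: "H \<in> borel_measurable (history m M X n)" "\<And>\<omega>. \<omega> \<in> space M \<Longrightarrow> 0 \<le> H \<omega> \<and> H \<omega> \<le> 1"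
    and s: "0 \<le> s" and est: "\<And>i. i \<in> {1..m} \<Longrightarrow> \<bar>kernel_iter m (laplace_kernel K s) l (\<lambda>_. 1) i - b\<bar> \<le> e"
  shows "\<bar>(LINT \<omega>|M. H \<omega> * exp (- s * (S (n + l) \<omega> - S n \<omega>))) - (LINT \<omega>|M. H \<omega>) * b\<bar> \<le> e"
proof -
  let ?u = "\<lambda>\<omega>. kernel_iter m (laplace_kernel K s) l (\<lambda>_. 1) (\<eta> n \<omega>)"
  have HM: "H \<in> borel_measurable M" by (rule history_measurable[OF H(1)])
  have uM: "?u \<in> borel_measurable M" by (rule measurable_from_state[OF measurable_X])
  have e: "\<bar>?u \<omega> - b\<bar> \<le> e" if "\<omega> \<in> space M" for \<omega> using est[OF \<eta>_in[OF that]] .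
  have intH: "integrable M H" using H(2) HM by (intro integrable_const_bound[of _ 1]) auto
  have intHu: "integrable M (\<lambda>\<omega>. H \<omega> * (?u \<omega> - b))"
  proof (rule integrable_const_bound[of _ e])
    show "AE \<omega> in M. norm (H \<omega> * (?u \<omega> - b)) \<le> e"
    proof (rule AE_I2)
      fix \<omega> assume w: "\<omega> \<in> space M"
      have "\<bar>H \<omega>\<bar> * \<bar>?u \<omega> - b\<bar> \<le> 1 * e" using H(2)[OF w] e[OF w] by (intro mult_mono) auto
      thus "norm (H \<omega> * (?u \<omega> - b)) \<le> e" by (simp add: abs_mult)
    qed
  qed (use HM uM in measurable)
  have "(LINT \<omega>|M. H \<omega> * exp (- s * (S (n + l) \<omega> - S n \<omega>))) = (LINT \<omega>|M. H \<omega> * ?u \<omega>)"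
    using laplace_steps[OF H s, of l "\<lambda>_. 1"] by (simp add: S_diff)
  also have "\<dots> = (LINT \<omega>|M. H \<omega> * (?u \<omega> - b) + H \<omega> * b)"
    by (intro Bochner_Integration.integral_cong refl) (simp add: algebra_simps)
  also have "\<dots> = (LINT \<omega>|M. H \<omega> * (?u \<omega> - b)) + (LINT \<omega>|M. H \<omega>) * b"
    using intHu intH by simp
  finally have "\<bar>(LINT \<omega>|M. H \<omega> * exp (- s * (S (n + l) \<omega> - S n \<omega>))) - (LINT \<omega>|M. H \<omega>) * b\<bar>
      = \<bar>LINT \<omega>|M. H \<omega> * (?u \<omega> - b)\<bar>" by simp
  also have "\<dots> \<le> (LINT \<omega>|M. \<bar>H \<omega> * (?u \<omega> - b)\<bar>)" by (rule integral_abs_bound)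
  also have "\<dots> \<le> e"
  proof (rule integral_le_const)
    show "AE \<omega> in M. \<bar>H \<omega> * (?u \<omega> - b)\<bar> \<le> e"
    proof (rule AE_I2)
      fix \<omega> assume w: "\<omega> \<in> space M"
      have "\<bar>H \<omega>\<bar> * \<bar>?u \<omega> - b\<bar> \<le> 1 * e" using H(2)[OF w] e[OF w] by (intro mult_mono) auto
      thus "\<bar>H \<omega> * (?u \<omega> - b)\<bar> \<le> e" by (simp add: abs_mult)
    qed
  qed (use intHu in auto)
  finally show ?thesis .
qed

text \<open>Markov's inequality for \<open>1 - exp (- x)\<close>, conditionally on the past: the
  transform of the increment at frequency 1 is bounded below uniformly in the state at time
  \<open>n\<close>.\<close>

lemma increment_tail:
  assumes A: "A \<in> sets (history m M X n)" and r: "0 < r"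
    and low: "\<And>i. i \<in> {1..m} \<Longrightarrow> 1 - kernel_iter m (laplace_kernel K 1) l (\<lambda>_. 1) i \<le> \<beta>"
  shows "prob {\<omega> \<in> A. r \<le> S (n + l) \<omega> - S n \<omega>} \<le> \<beta> / (1 - exp (- r)) * prob A"
proof -
  have AM: "A \<in> events" using A subalgebra_history by (auto simp: subalgebra_def)
  have A_sub: "A \<subseteq> space M" using AM by (rule sets.sets_into_space)
  let ?u = "\<lambda>\<omega>. kernel_iter m (laplace_kernel K 1) l (\<lambda>_. 1) (\<eta> n \<omega>)"
  have E: "{\<omega> \<in> A. r \<le> S (n + l) \<omega> - S n \<omega>} \<in> events"
  proof -
    have "A \<inter> {\<omega> \<in> space M. r \<le> S (n + l) \<omega> - S n \<omega>} \<in> events" using AM by measurable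
    also have "A \<inter> {\<omega> \<in> space M. r \<le> S (n + l) \<omega> - S n \<omega>} = {\<omega> \<in> A. r \<le> S (n + l) \<omega> - S n \<omega>}" using A_sub by auto
    finally show ?thesis .
  qed
  have intA: "integrable M (indicat_real A)" using AM by (simp add: less_top[symmetric])
  have pos: "0 \<le> S (n + l) \<omega> - S n \<omega>" if "\<omega> \<in> space M" for \<omega> using S_mono[OF that, of n "n + l"] by simp
  have int: "integrable M (\<lambda>\<omega>. indicator A \<omega> * exp (- 1 * (S (n + l) \<omega> - S n \<omega>)))"
    using AM pos by (intro integrable_weighted[of "indicator A" 1]) (auto simp: indicator_def)
  have step: "(LINT \<omega>|M. indicator A \<omega> * exp (- 1 * (S (n + l) \<omega> - S n \<omega>))) = (LINT \<omega>|M. indicator A \<omega> * ?u \<omega>)"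
    using laplace_steps[of "indicator A" n 1 1 l "\<lambda>_. 1"] A by (simp add: S_diff indicator_def[of A])
  have uM: "?u \<in> borel_measurable M" by (rule measurable_from_state[OF measurable_X])
  have "(1 - exp (- r)) * prob {\<omega> \<in> A. r \<le> S (n + l) \<omega> - S n \<omega>}
      = (LINT \<omega>|M. (1 - exp (- r)) * indicator {\<omega> \<in> A. r \<le> S (n + l) \<omega> - S n \<omega>} \<omega>)"
    using E by simp
  also have "\<dots> \<le> (LINT \<omega>|M. indicator A \<omega> - indicator A \<omega> * exp (- 1 * (S (n + l) \<omega> - S n \<omega>)))"
  proof (rule integral_mono)
    show "integrable M (\<lambda>\<omega>. indicat_real A \<omega> - indicator A \<omega> * exp (- 1 * (S (n + l) \<omega> - S n \<omega>)))"
      using int AM by (intro Bochner_Integration.integrable_diff) (auto simp: less_top[symmetric])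
    fix \<omega> assume "\<omega> \<in> space M"
    thus "(1 - exp (- r)) * indicator {\<omega> \<in> A. r \<le> S (n + l) \<omega> - S n \<omega>} \<omega>
        \<le> indicator A \<omega> - indicator A \<omega> * exp (- 1 * (S (n + l) \<omega> - S n \<omega>))"
      using pos by (auto simp: indicator_def)
  qed (use E in \<open>auto simp: less_top[symmetric]\<close>)
  also have "\<dots> = prob A - (LINT \<omega>|M. indicator A \<omega> * ?u \<omega>)"
    using intA AM unfolding Bochner_Integration.integral_diff[OF intA int] step by simp
  also have "\<dots> \<le> \<beta> * prob A"
  proof -
    have "(LINT \<omega>|M. indicator A \<omega> * (1 - \<beta>)) \<le> (LINT \<omega>|M. indicator A \<omega> * ?u \<omega>)"
    proof (rule integral_mono)
      have "(\<lambda>\<omega>. indicator A \<omega> * ?u \<omega>) \<in> borel_measurable M" using AM uM by measurable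
      moreover have "\<bar>indicator A \<omega> * ?u \<omega>\<bar> \<le> (\<Sum>i=1..m. \<bar>kernel_iter m (laplace_kernel K 1) l (\<lambda>_. 1) i\<bar>)"
        if "\<omega> \<in> space M" for \<omega>
      proof -
        have "\<bar>?u \<omega>\<bar> \<le> (\<Sum>i=1..m. \<bar>kernel_iter m (laplace_kernel K 1) l (\<lambda>_. 1) i\<bar>)"
          using \<eta>_in[OF that, of n] by (intro member_le_sum[of "\<eta> n \<omega>" "{1..m}" "\<lambda>i. \<bar>kernel_iter m (laplace_kernel K 1) l (\<lambda>_. 1) i\<bar>"]) auto
        thus ?thesis by (auto simp: indicator_def intro: sum_nonneg)
      qed
      ultimately show "integrable M (\<lambda>\<omega>. indicator A \<omega> * ?u \<omega>)"
        by (intro integrable_const_bound[where B="\<Sum>i=1..m. \<bar>kernel_iter m (laplace_kernel K 1) l (\<lambda>_. 1) i\<bar>"]) auto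
      show "integrable M (\<lambda>\<omega>. indicator A \<omega> * (1 - \<beta>))" using intA by simp
      fix \<omega> assume "\<omega> \<in> space M"
      thus "indicator A \<omega> * (1 - \<beta>) \<le> indicator A \<omega> * ?u \<omega>"
        using low[OF \<eta>_in, of \<omega> n] by (auto simp: indicator_def)
    qed
    moreover have "(LINT \<omega>|M. indicator A \<omega> * (1 - \<beta>)) = prob A * (1 - \<beta>)" using AM by simp
    ultimately show ?thesis by (simp add: algebra_simps)
  qed
  finally show ?thesis using r by (simp add: field_simps)
qed

text \<open>Stop at the first passage of the increment over \<open>r\<close> and apply the Markov property there.\<close>

lemma two_large_increments:
  assumes r: "0 < r"
    and low: "\<And>i l. i \<in> {1..m} \<Longrightarrow> l \<le> L \<Longrightarrow> 1 - kernel_iter m (laplace_kernel K 1) l (\<lambda>_. 1) i \<le> \<beta>"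
  shows "prob {\<omega> \<in> space M. \<exists>l\<in>{n..n + L}. r \<le> S l \<omega> - S n \<omega> \<and> r \<le> S (n + L) \<omega> - S l \<omega>}
    \<le> (\<beta> / (1 - exp (- r)))\<^sup>2"
proof -
  let ?b = "\<beta> / (1 - exp (- r))"
  have \<beta>: "0 \<le> \<beta>" using low[of 1 0] m by simp
  hence b: "0 \<le> ?b" using r by simp
  \<comment> \<open>First passage at index \<open>l\<close>: these events are disjoint, and each is
    decided by the history up to \<open>l\<close>.\<close>
  define A where "A l = {\<omega> \<in> space M. r \<le> S l \<omega> - S n \<omega> \<and> (\<forall>k\<in>{n..<l}. S k \<omega> - S n \<omega> < r)}" for l
  have A_hist: "A l \<in> sets (history m M X l)" if "n \<le> l" for l
  proof -
    have [measurable]: "S k \<in> borel_measurable (history m M X l)" if "k \<le> l" for k using S_history that .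
    have a: "{\<omega> \<in> space (history m M X l). r \<le> S l \<omega> - S n \<omega>} \<in> sets (history m M X l)"
      using that by measurable
    have b: "{\<omega> \<in> space (history m M X l). \<forall>k\<in>{n..<l}. S k \<omega> - S n \<omega> < r} \<in> sets (history m M X l)"
    proof (intro sets.sets_Collect_finite_All)
      fix k assume "k \<in> {n..<l}"
      hence "k \<le> l" by simp
      thus "{\<omega> \<in> space (history m M X l). S k \<omega> - S n \<omega> < r} \<in> sets (history m M X l)"
        using that by measurable
    qed simp
    show ?thesis using sets.sets_Collect_conj[OF b a] unfolding A_def by simp
  qed
  have AM: "A l \<in> events" if "n \<le> l" for l
    using A_hist[OF that] subalgebra_history by (auto simp: subalgebra_def)
  define B where "B l = {\<omega> \<in> A l. r \<le> S (n + L) \<omega> - S l \<omega>}" for l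
  have BM: "B l \<in> events" if "n \<le> l" for l
  proof -
    have "A l \<inter> {\<omega> \<in> space M. r \<le> S (n + L) \<omega> - S l \<omega>} \<in> events" using AM[OF that] by measurable
    also have "A l \<inter> {\<omega> \<in> space M. r \<le> S (n + L) \<omega> - S l \<omega>} = B l" by (auto simp: B_def A_def)
    finally show ?thesis .
  qed
  have disj: "disjoint_family_on A {n..n + L}"
    unfolding disjoint_family_on_def
  proof (intro ballI impI)
    fix k l assume kl: "k \<in> {n..n + L}" "l \<in> {n..n + L}" "k \<noteq> l"
    have *: False if "k < l" "n \<le> k" "\<omega> \<in> A k" "\<omega> \<in> A l" for k l \<omega>
    proof -
      have "S k \<omega> - S n \<omega> < r" "r \<le> S k \<omega> - S n \<omega>" using that by (auto simp: A_def)
      thus False by linarith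
    qed
    show "A k \<inter> A l = {}"
    proof (rule equals0I)
      fix \<omega> assume "\<omega> \<in> A k \<inter> A l"
      hence "\<omega> \<in> A k" "\<omega> \<in> A l" by blast+
      moreover have "n \<le> k" "n \<le> l" using kl by simp_all
      ultimately show False using *[of k l \<omega>] *[of l k \<omega>] kl(3) by (meson linorder_neqE_nat)
    qed
  qed
  have cover: "{\<omega> \<in> space M. \<exists>l\<in>{n..n + L}. r \<le> S l \<omega> - S n \<omega> \<and> r \<le> S (n + L) \<omega> - S l \<omega>} \<subseteq> (\<Union>l\<in>{n..n + L}. B l)"
  proof
    fix \<omega> assume "\<omega> \<in> {\<omega> \<in> space M. \<exists>l\<in>{n..n + L}. r \<le> S l \<omega> - S n \<omega> \<and> r \<le> S (n + L) \<omega> - S l \<omega>}"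
    then obtain l where l: "\<omega> \<in> space M" "l \<in> {n..n + L}" "r \<le> S l \<omega> - S n \<omega>" "r \<le> S (n + L) \<omega> - S l \<omega>" by blast
    define Q where "Q k \<longleftrightarrow> n \<le> k \<and> r \<le> S k \<omega> - S n \<omega>" for k
    define k where "k = (LEAST k. Q k)"
    have Ql: "Q l" using l by (simp add: Q_def)
    have "Q k" unfolding k_def using Ql by (rule LeastI)
    hence k: "n \<le> k \<and> r \<le> S k \<omega> - S n \<omega>" by (simp add: Q_def)
    have kl: "k \<le> l" unfolding k_def using Ql by (rule Least_le)
    have "S j \<omega> - S n \<omega> < r" if "j \<in> {n..<k}" for j
    proof -
      have "\<not> Q j" using not_less_Least[of j Q] that unfolding k_def by simp
      thus ?thesis using that by (simp add: Q_def not_le)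
    qed
    hence "\<omega> \<in> A k" using k l(1) by (auto simp: A_def)
    moreover have "r \<le> S (n + L) \<omega> - S k \<omega>" using S_mono[OF l(1) kl] l(4) by linarith
    ultimately have "\<omega> \<in> B k" by (simp add: B_def)
    moreover have "k \<in> {n..n + L}" using k kl l(2) by simp
    ultimately show "\<omega> \<in> (\<Union>l\<in>{n..n + L}. B l)" by (rule UN_I[rotated])
  qed
  have "prob {\<omega> \<in> space M. \<exists>l\<in>{n..n + L}. r \<le> S l \<omega> - S n \<omega> \<and> r \<le> S (n + L) \<omega> - S l \<omega>} \<le> prob (\<Union>l\<in>{n..n + L}. B l)"
    using cover BM by (intro finite_measure_mono) auto
  also have "\<dots> \<le> (\<Sum>l=n..n + L. prob (B l))"
    using BM by (intro finite_measure_subadditive_finite) auto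
  also have "\<dots> \<le> (\<Sum>l=n..n + L. ?b * prob (A l))"
  proof (intro sum_mono)
    fix l assume l: "l \<in> {n..n + L}"
    have "prob {\<omega> \<in> A l. r \<le> S (l + (n + L - l)) \<omega> - S l \<omega>} \<le> ?b * prob (A l)"
      using l by (intro increment_tail A_hist r low) auto
    thus "prob (B l) \<le> ?b * prob (A l)" using l by (simp add: B_def)
  qed
  also have "\<dots> = ?b * prob (\<Union>l\<in>{n..n + L}. A l)"
    using disj AM by (subst finite_measure_finite_Union) (auto simp: sum_distrib_left)
  \<comment> \<open>A passage up to \<open>n + L\<close> forces the whole increment to be at least
    \<open>r\<close>; the same tail bound, now without conditioning, yields the second
    factor.\<close>
  also have "\<dots> \<le> ?b * prob {\<omega> \<in> space M. r \<le> S (n + L) \<omega> - S n \<omega>}"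
  proof (intro mult_left_mono b finite_measure_mono)
    show "(\<Union>l\<in>{n..n + L}. A l) \<subseteq> {\<omega> \<in> space M. r \<le> S (n + L) \<omega> - S n \<omega>}"
    proof
      fix \<omega> assume "\<omega> \<in> (\<Union>l\<in>{n..n + L}. A l)"
      then obtain l where "l \<in> {n..n + L}" "\<omega> \<in> A l" by blast
      thus "\<omega> \<in> {\<omega> \<in> space M. r \<le> S (n + L) \<omega> - S n \<omega>}"
        using S_mono[of \<omega> l "n + L"] by (auto simp: A_def)
    qed
  qed measurable
  also have "\<dots> \<le> ?b * (?b * prob (space M))"
  proof -
    have "prob {\<omega> \<in> space M. r \<le> S (n + L) \<omega> - S n \<omega>} \<le> ?b * prob (space M)"
      using sets.top[of "history m M X n"] by (intro increment_tail r low) auto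
    thus ?thesis using b by (rule mult_left_mono)
  qed
  finally show ?thesis by (simp add: prob_space power2_eq_square)
qed

end

section \<open>Asymptotics\<close>

lemma minus_ln_le:
  fixes a :: real
  assumes "0 \<le> a" "a < 1"
  shows "- ln (1 - a) \<le> a / (1 - a)"
proof -
  have "- ln (1 - a) = ln (inverse (1 - a))" using assms by (simp add: ln_inverse)
  also have "\<dots> \<le> inverse (1 - a) - 1" using assms by (intro ln_le_minus_one) auto
  also have "\<dots> = a / (1 - a)" using assms by (simp add: field_simps)
  finally show ?thesis .
qed

text \<open>The exponent \<open>n * ln (1 - a)\<close> is squeezed between
  \<open>- (n * a) / (1 - a)\<close> and \<open>- (n * a)\<close>.\<close>

lemma tendsto_power_exp:
  fixes a v :: "'e \<Rightarrow> real" and n :: "'e \<Rightarrow> nat"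
  assumes a: "\<forall>\<^sub>F e in F. 0 \<le> a e" and v: "filterlim v at_top F"
    and va: "((\<lambda>e. v e * a e) \<longlongrightarrow> b) F" and nv: "((\<lambda>e. n e / v e) \<longlongrightarrow> t) F"
  shows "((\<lambda>e. (1 - a e) ^ n e) \<longlongrightarrow> exp (- t * b)) F"
    and "((\<lambda>e. n e * a e) \<longlongrightarrow> t * b) F" and "(a \<longlongrightarrow> 0) F"
proof -
  have vpos: "\<forall>\<^sub>F e in F. 0 < v e" using v by (simp add: filterlim_at_top_dense)
  have inv: "((\<lambda>e. inverse (v e)) \<longlongrightarrow> 0) F" by (rule tendsto_inverse_0_at_top[OF v])
  show a0: "(a \<longlongrightarrow> 0) F"
  proof (rule Lim_transform_eventually)
    show "((\<lambda>e. v e * a e * inverse (v e)) \<longlongrightarrow> 0) F" using tendsto_mult[OF va inv] by simp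
    show "\<forall>\<^sub>F e in F. v e * a e * inverse (v e) = a e" using vpos by eventually_elim simp
  qed
  show na: "((\<lambda>e. n e * a e) \<longlongrightarrow> t * b) F"
  proof (rule Lim_transform_eventually[OF tendsto_mult[OF nv va]])
    show "\<forall>\<^sub>F e in F. n e / v e * (v e * a e) = n e * a e" using vpos by eventually_elim simp
  qed
  have half: "\<forall>\<^sub>F e in F. a e < 1 / 2" using order_tendstoD(2)[OF a0, of "1/2"] by simp
  have "((\<lambda>e. n e * ln (1 - a e)) \<longlongrightarrow> - (t * b)) F"
  proof (rule tendsto_sandwich)
    show "((\<lambda>e. - (n e * a e) / (1 - a e)) \<longlongrightarrow> - (t * b)) F"
      using tendsto_divide[OF tendsto_minus[OF na] tendsto_diff[OF tendsto_const a0, of 1]] by simp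
    show "((\<lambda>e. - (n e * a e)) \<longlongrightarrow> - (t * b)) F" by (rule tendsto_minus[OF na])
    show "\<forall>\<^sub>F e in F. - (n e * a e) / (1 - a e) \<le> n e * ln (1 - a e)" using half a
    proof eventually_elim
      case (elim e)
      have "- ln (1 - a e) \<le> a e / (1 - a e)" using elim by (intro minus_ln_le) auto
      hence "n e * (- ln (1 - a e)) \<le> n e * (a e / (1 - a e))" by (intro mult_left_mono) auto
      thus ?case by simp
    qed
    show "\<forall>\<^sub>F e in F. n e * ln (1 - a e) \<le> - (n e * a e)" using half a
    proof eventually_elim
      case (elim e)
      have "ln (1 - a e) \<le> - a e" using ln_le_minus_one[of "1 - a e"] elim by simp
      hence "n e * ln (1 - a e) \<le> n e * (- a e)" by (intro mult_left_mono) auto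
      thus ?case by simp
    qed
  qed
  hence "((\<lambda>e. exp (n e * ln (1 - a e))) \<longlongrightarrow> exp (- t * b)) F" by (intro tendsto_exp) simp
  thus "((\<lambda>e. (1 - a e) ^ n e) \<longlongrightarrow> exp (- t * b)) F"
    by (rule Lim_transform_eventually) (use half in eventually_elim, simp add: exp_of_nat_mult)
qed

text \<open>The converse of the preceding limit. That \<open>a\<close> tends to 0 has to be derived:
  \<open>n * a\<close> is at most \<open>- (n * ln (1 - a))\<close>, which converges because
  \<open>\<psi>\<close> is positive.\<close>

lemma tendsto_power_imp:
  fixes a v :: "'e \<Rightarrow> real" and n :: "'e \<Rightarrow> nat"
  assumes a: "\<forall>\<^sub>F e in F. 0 \<le> a e \<and> a e \<le> 1" and v: "filterlim v at_top F"
    and nv: "((\<lambda>e. n e / v e) \<longlongrightarrow> 1) F"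
    and conv: "((\<lambda>e. (1 - a e) ^ n e) \<longlongrightarrow> \<psi>) F" and \<psi>: "0 < \<psi>"
  shows "((\<lambda>e. v e * a e) \<longlongrightarrow> - ln \<psi>) F"
proof -
  have vpos: "\<forall>\<^sub>F e in F. 0 < v e" using v by (simp add: filterlim_at_top_dense)
  have npos: "\<forall>\<^sub>F e in F. 0 < n e" using order_tendstoD(1)[OF nv zero_less_one] vpos
    by eventually_elim (simp add: zero_less_divide_iff)
  have pos: "\<forall>\<^sub>F e in F. a e < 1" using order_tendstoD(1)[OF conv \<psi>] npos a
    by eventually_elim (metis diff_gt_0_iff_gt diff_self less_eq_real_def power_eq_0_iff zero_less_iff_neq_zero less_irrefl zero_power)
  have ln: "((\<lambda>e. - (n e * ln (1 - a e))) \<longlongrightarrow> - ln \<psi>) F"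
  proof (rule Lim_transform_eventually[OF tendsto_minus[OF tendsto_ln[OF conv]]])
    show "\<forall>\<^sub>F e in F. - ln ((1 - a e) ^ n e) = - (n e * ln (1 - a e))"
      using pos by eventually_elim (simp add: ln_realpow)
  qed (use \<psi> in simp)
  have low: "\<forall>\<^sub>F e in F. n e * a e \<le> - (n e * ln (1 - a e))" using pos a
  proof eventually_elim
    case (elim e)
    have "ln (1 - a e) \<le> - a e" using ln_le_minus_one[of "1 - a e"] elim by simp
    hence "n e * ln (1 - a e) \<le> n e * (- a e)" by (intro mult_left_mono) auto
    thus ?case by simp
  qed
  have up: "\<forall>\<^sub>F e in F. - (n e * ln (1 - a e)) * (1 - a e) \<le> n e * a e" using pos a
  proof eventually_elim
    case (elim e)
    have "- ln (1 - a e) \<le> a e / (1 - a e)" using elim by (intro minus_ln_le) auto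
    hence "- ln (1 - a e) * (1 - a e) \<le> a e" using elim by (simp add: pos_le_divide_eq)
    hence "n e * (- ln (1 - a e) * (1 - a e)) \<le> n e * a e" by (intro mult_left_mono) auto
    thus ?case by (simp add: algebra_simps)
  qed
  have ninv: "((\<lambda>e. v e / n e) \<longlongrightarrow> 1) F"
    using tendsto_inverse[OF nv] by (simp add: inverse_eq_divide)
  have a0: "(a \<longlongrightarrow> 0) F"
  proof (rule tendsto_sandwich[where f="\<lambda>_. 0"])
    show "\<forall>\<^sub>F e in F. 0 \<le> a e" using a by eventually_elim simp
    show "\<forall>\<^sub>F e in F. a e \<le> - (n e * ln (1 - a e)) * (v e / n e) * inverse (v e)"
      using low npos vpos
    proof eventually_elim
      case (elim e)
      have "a e = (n e * a e) * inverse (n e)" using elim by simp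
      also have "\<dots> \<le> - (n e * ln (1 - a e)) * inverse (n e)" using elim by (intro mult_right_mono) auto
      also have "\<dots> = - (n e * ln (1 - a e)) * (v e / n e) * inverse (v e)" using elim by (simp add: field_simps)
      finally show ?case .
    qed
    show "((\<lambda>e. - (n e * ln (1 - a e)) * (v e / n e) * inverse (v e)) \<longlongrightarrow> 0) F"
      using tendsto_mult[OF tendsto_mult[OF ln ninv] tendsto_inverse_0_at_top[OF v]] by simp
  qed simp
  have "((\<lambda>e. n e * a e) \<longlongrightarrow> - ln \<psi>) F"
  proof (rule tendsto_sandwich[OF up low _ ln])
    show "((\<lambda>e. - (n e * ln (1 - a e)) * (1 - a e)) \<longlongrightarrow> - ln \<psi>) F"
      using tendsto_mult[OF ln tendsto_diff[OF tendsto_const a0, of 1]] by simp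
  qed
  from tendsto_mult[OF ninv this]
  have "((\<lambda>e. v e / n e * (n e * a e)) \<longlongrightarrow> - ln \<psi>) F" by simp
  thus ?thesis by (rule Lim_transform_eventually) (use npos in eventually_elim, simp)
qed

lemma nat_floor_quotient:
  fixes v :: "'e \<Rightarrow> real"
  assumes v: "filterlim v at_top F" and t: "0 \<le> t"
  shows "((\<lambda>e. nat \<lfloor>t * v e\<rfloor> / v e) \<longlongrightarrow> t) F"
proof (rule tendsto_sandwich)
  have vpos: "\<forall>\<^sub>F e in F. 0 < v e" using v by (simp add: filterlim_at_top_dense)
  show "((\<lambda>e. t - inverse (v e)) \<longlongrightarrow> t) F"
    using tendsto_diff[OF tendsto_const tendsto_inverse_0_at_top[OF v], of t] by simp
  show "\<forall>\<^sub>F e in F. t - inverse (v e) \<le> nat \<lfloor>t * v e\<rfloor> / v e" using vpos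
  proof eventually_elim
    case (elim e)
    have "t * v e - 1 \<le> nat \<lfloor>t * v e\<rfloor>" using t elim by simp
    hence "(t * v e - 1) / v e \<le> nat \<lfloor>t * v e\<rfloor> / v e" using elim by (intro divide_right_mono) auto
    thus ?case using elim by (simp add: field_simps)
  qed
  show "\<forall>\<^sub>F e in F. nat \<lfloor>t * v e\<rfloor> / v e \<le> t" using vpos
  proof eventually_elim
    case (elim e)
    have "nat \<lfloor>t * v e\<rfloor> \<le> t * v e" using t elim by simp
    thus ?case using elim by (simp add: pos_divide_le_eq)
  qed
qed simp

section \<open>The defect of a renewal process with a ring\<close>

definition defect :: "nat \<Rightarrow> (nat \<Rightarrow> (nat \<times> real \<times> nat) measure) \<Rightarrow> (nat \<Rightarrow> real) \<Rightarrow> real \<Rightarrow> real" where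
  "defect m K \<pi> s = (\<Sum>i=1..m. \<pi> i * (1 - state_laplace K s i))"

text \<open>From \<open>i\<close> the ring is followed to its end, which is also its beginning, and
  from there on to \<open>j\<close>.\<close>

lemma ring_ergodic:
  fixes N :: nat and z :: "nat \<Rightarrow> nat" and p :: "nat \<Rightarrow> nat \<Rightarrow> real"
  assumes z: "z N = z 0" "z ` {0..N} = {1..m}"
    and p: "\<And>k. k \<in> {1..N} \<Longrightarrow> 0 < p (z (k - 1)) (z k)"
  shows "ergodic_chain m p"
  unfolding ergodic_chain_def
proof (intro ballI)
  let ?E = "{(k, l). k \<in> {1..m} \<and> l \<in> {1..m} \<and> p k l > 0}"
  have zm: "z k \<in> {1..m}" if "k \<le> N" for k
  proof -
    have "z k \<in> z ` {0..N}" using that by (intro imageI) simp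
    thus ?thesis by (simp only: z(2))
  qed
  have edge: "(z k, z (Suc k)) \<in> ?E" if "k < N" for k
    using p[of "Suc k"] zm[of k] zm[of "Suc k"] that by simp
  have walk: "a \<le> b \<Longrightarrow> b \<le> N \<Longrightarrow> (z a, z b) \<in> ?E\<^sup>*" for a b
  proof (induction b rule: dec_induct)
    case (step b)
    have "(z a, z b) \<in> ?E\<^sup>*" by (rule step.IH) (use step in simp)
    moreover have "(z b, z (Suc b)) \<in> ?E" by (rule edge) (use step in simp)
    ultimately show ?case by (rule rtrancl.rtrancl_into_rtrancl)
  qed simp
  fix i j assume "i \<in> {1..m}" "j \<in> {1..m}"
  hence "i \<in> z ` {0..N}" "j \<in> z ` {0..N}" by (simp_all only: z(2))
  then obtain a b where ab: "a \<le> N" "i = z a" "b \<le> N" "j = z b" by fastforce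
  have "(z a, z N) \<in> ?E\<^sup>*" "(z 0, z b) \<in> ?E\<^sup>*" by (rule walk; use ab in simp)+
  thus "(i, j) \<in> ?E\<^sup>*" unfolding ab(2,4) z(1) by (rule rtrancl_trans)
qed

locale ring_renewal = step_kernel m K for m K +
  fixes N :: nat and c :: real and z :: "nat \<Rightarrow> nat" and \<pi> :: "nat \<Rightarrow> real"
  assumes c: "0 < c" "c \<le> 1"
    and N: "N \<ge> 1" "z N = z 0" "z ` {0..N} = {1..m}"
    and ring: "\<And>k. k \<in> {1..N} \<Longrightarrow> c \<le> trans_prob K (z (k - 1)) (z k)"
    and stationary: "stationary_distribution m (trans_prob K) \<pi>"
begin

abbreviation a :: "real \<Rightarrow> real" where "a \<equiv> defect m K \<pi>"

lemma laplace_kernel_le_trans_prob: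
  "i \<in> {1..m} \<Longrightarrow> j \<in> {1..m} \<Longrightarrow> 0 \<le> s \<Longrightarrow> laplace_kernel K s i j \<le> trans_prob K i j"
  using laplace_kernel_antimono[of i 0 s j] laplace_kernel_0[of i j] by simp

lemma dominated: "0 \<le> s \<Longrightarrow> dominated_ring_kernel m N c z (trans_prob K) (laplace_kernel K s) \<pi>"
  by (rule dominated_ring_kernel.intro)
    (use c m N ring stationary trans_prob_sum laplace_kernel_nonneg laplace_kernel_le_trans_prob in auto)

lemma mean_defect_eq: "0 \<le> s \<Longrightarrow> dominated_ring_kernel.mean_defect m (laplace_kernel K s) \<pi> = a s"
  unfolding dominated_ring_kernel.mean_defect_def[OF dominated] defect_def
  by (intro sum.cong refl) (simp add: laplace_kernel_sum[simplified])

lemma a_bounds: "0 \<le> s \<Longrightarrow> 0 \<le> a s" "0 \<le> s \<Longrightarrow> a s \<le> 1"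
  using dominated_ring_kernel.mean_defect_nonneg[OF dominated] dominated_ring_kernel.mean_defect_le_1[OF dominated]
  by (auto simp: mean_defect_eq)

lemma iter_estimate:
  assumes "0 \<le> s" "i \<in> {1..m}"
  shows "\<bar>kernel_iter m (laplace_kernel K s) n (\<lambda>_. 1) i - (1 - a s) ^ n\<bar>
    \<le> 2 * N * m / c ^ (4 * N) * a s * (1 + n * a s)"
  using dominated_ring_kernel.kernel_iter_estimate[OF dominated assms(2), of s n] assms(1) by (simp add: mean_defect_eq)

lemma iter_lower:
  assumes "0 \<le> s" "i \<in> {1..m}" "n \<le> k"
  shows "1 - kernel_iter m (laplace_kernel K s) n (\<lambda>_. 1) i \<le> k * (a s * (m / c ^ (2 * N)))"
proof -
  have "1 - kernel_iter m (laplace_kernel K s) n (\<lambda>_. 1) i \<le> n * (a s * (m / c ^ (2 * N)))"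
    using dominated_ring_kernel.u_lower[OF dominated assms(2), of s n] assms(1)
    by (simp add: dominated_ring_kernel.step_defect_def[OF dominated] mean_defect_eq)
  also have "\<dots> \<le> k * (a s * (m / c ^ (2 * N)))"
    using assms a_bounds[of s] c by (intro mult_right_mono) auto
  finally show ?thesis .
qed

lemma a_continuous: "continuous_on {0..} a"
  unfolding defect_def using continuous_state_laplace by (intro continuous_intros) auto

lemma \<pi>_weights: "i \<in> {1..m} \<Longrightarrow> 0 \<le> \<pi> i" "(\<Sum>i=1..m. \<pi> i) = 1"
  using stationary by (auto simp: stationary_distribution_def)

lemma a_eq: "a s = 1 - (\<Sum>i=1..m. \<pi> i * state_laplace K s i)"
  unfolding defect_def by (simp add: right_diff_distrib sum_subtractf \<pi>_weights(2)[simplified])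

lemma a_0: "a 0 = 0"
  unfolding defect_def using prob_space.prob_space[OF prob_space_K] by (simp add: state_laplace_def)

text \<open>The intermediate value theorem from \<open>a 0 = 0\<close>. It supplies the frequency
  with prescribed defect in the converse direction.\<close>

lemma a_attains:
  assumes "0 \<le> s" "0 \<le> y" "y \<le> a s"
  obtains s' where "0 \<le> s'" "s' \<le> s" "a s' = y"
  using IVT'[of a 0 y s] assms a_0 continuous_on_subset[OF a_continuous, of "{0..s}"] by auto

lemma iid_sum:
  assumes iid: "iid_with_cdf P \<theta> (averaged_step_cdf m K \<pi>)"
  shows "nonneg_law (distr P borel (\<lambda>\<omega>. \<Sum>n=1..k. \<theta> n \<omega>))"
    and "0 \<le> s \<Longrightarrow> laplace_transform (distr P borel (\<lambda>\<omega>. \<Sum>n=1..k. \<theta> n \<omega>)) s = (1 - a s) ^ k"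
proof -
  interpret P: prob_space P using iid by (simp add: iid_with_cdf_def)
  have indep: "P.indep_vars (\<lambda>_. borel) \<theta> {1..}" using iid by (simp add: iid_with_cdf_def)
  have meas: "\<theta> n \<in> borel_measurable P" if "n \<ge> 1" for n
    using indep that by (simp add: P.indep_vars_def)
  have cdf: "cdf (distr P borel (\<theta> n)) = averaged_step_cdf m K \<pi>" if "n \<ge> 1" for n
    using iid that by (simp add: iid_with_cdf_def)
  have rd: "real_distribution (distr P borel (\<theta> n))" if "n \<ge> 1" for n
    using meas[OF that] by simp
  have nn: "AE \<omega> in P. 0 \<le> \<theta> n \<omega>" if "n \<ge> 1" for n
  proof -
    have "AE x in distr P borel (\<theta> n). 0 \<le> x"
      by (rule expectation_averaged_step_cdf(1)[OF _ \<pi>_weights(2) rd[OF that] cdf[OF that]]) (rule \<pi>_weights(1))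
    thus ?thesis using meas[OF that] by (subst (asm) AE_distr_iff) auto
  qed
  have lap: "(LINT \<omega>|P. exp (- s * \<theta> n \<omega>)) = 1 - a s" if "n \<ge> 1" "0 \<le> s" for n s
  proof -
    have "laplace_transform (distr P borel (\<theta> n)) s = (\<Sum>i=1..m. \<pi> i * state_laplace K s i)"
      by (rule expectation_averaged_step_cdf(2)[OF _ \<pi>_weights(2) rd[OF that(1)] cdf[OF that(1)] that(2)])
        (rule \<pi>_weights(1))
    thus ?thesis using meas[OF that(1)] by (simp add: laplace_transform_distr a_eq)
  qed
  have meas_sum: "(\<lambda>\<omega>. \<Sum>n=1..k. \<theta> n \<omega>) \<in> borel_measurable P" using meas by (intro borel_measurable_sum) auto
  have "AE \<omega> in P. \<forall>n\<in>{1..k}. 0 \<le> \<theta> n \<omega>" using nn by (intro AE_finite_allI) auto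
  hence "AE \<omega> in P. 0 \<le> (\<Sum>n=1..k. \<theta> n \<omega>)" by eventually_elim (auto intro: sum_nonneg)
  thus "nonneg_law (distr P borel (\<lambda>\<omega>. \<Sum>n=1..k. \<theta> n \<omega>))"
    by (intro nonneg_law_distr P.prob_space_axioms meas_sum)
  assume s: "0 \<le> s"
  have ind: "P.indep_vars (\<lambda>_. borel) (\<lambda>n \<omega>. exp (- s * \<theta> n \<omega>)) {1..k}"
    by (rule P.indep_vars_compose2[OF P.indep_vars_subset[OF indep], where Y="\<lambda>_ x. exp (- s * x)"]) auto
  have int: "integrable P (\<lambda>\<omega>. exp (- s * \<theta> n \<omega>))" if "n \<in> {1..k}" for n
    using nn[of n] meas[of n] that s by (intro P.integrable_const_bound[of _ 1]) (auto elim!: eventually_mono)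
  have "laplace_transform (distr P borel (\<lambda>\<omega>. \<Sum>n=1..k. \<theta> n \<omega>)) s = (LINT \<omega>|P. (\<Prod>n\<in>{1..k}. exp (- s * \<theta> n \<omega>)))"
    by (subst laplace_transform_distr[OF meas_sum]) (simp add: exp_sum[symmetric] sum_distrib_left)
  also have "\<dots> = (\<Prod>n\<in>{1..k}. LINT \<omega>|P. exp (- s * \<theta> n \<omega>))"
    by (rule P.indep_vars_lebesgue_integral[OF _ ind int]) auto
  also have "\<dots> = (1 - a s) ^ k" using lap s by simp
  finally show "laplace_transform (distr P borel (\<lambda>\<omega>. \<Sum>n=1..k. \<theta> n \<omega>)) s = (1 - a s) ^ k" .
qed

end

locale ring_renewal_process = ring_renewal m K N c z \<pi> + markov_renewal m K q M X
  for m K N c z \<pi> q and M :: "'w measure" and X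
begin

lemma laplace_S_estimate:
  assumes s: "0 \<le> s"
  shows "\<bar>(LINT \<omega>|M. exp (- s * S n \<omega>)) - (1 - a s) ^ n\<bar> \<le> 2 * N * m / c ^ (4 * N) * a s * (1 + n * a s)"
proof -
  have "S 0 \<omega> = 0" for \<omega> by (simp add: S_def)
  thus ?thesis
    using laplace_increment[of "\<lambda>_. 1" 0 s n, OF _ _ s iter_estimate[OF s]] prob_space by simp
qed

lemma laplace_S_antimono:
  assumes "0 \<le> s" "s \<le> t"
  shows "(LINT \<omega>|M. exp (- t * S n \<omega>)) \<le> (LINT \<omega>|M. exp (- s * S n \<omega>))"
proof (rule integral_mono)
  have nn: "0 \<le> S n \<omega>" if "\<omega> \<in> space M" for \<omega> using S_mono[OF that, of 0 n] by (simp add: S_def)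
  show "integrable M (\<lambda>\<omega>. exp (- t * S n \<omega>))" "integrable M (\<lambda>\<omega>. exp (- s * S n \<omega>))"
    using nn assms by (auto intro!: integrable_const_bound[of _ 1])
  fix \<omega> assume "\<omega> \<in> space M"
  thus "exp (- t * S n \<omega>) \<le> exp (- s * S n \<omega>)" using nn assms by (simp add: mult_right_mono)
qed

text \<open>The exponential of the earlier increments is a functional of the past bounded by 1, so
  the last increment splits off with the error of the iterated kernel.\<close>

lemma laplace_joint_step:
  assumes kk: "mono kk" and s: "\<And>i. 0 \<le> s i"
  defines "E \<equiv> \<lambda>J. LINT \<omega>|M. exp (- (\<Sum>i<J. s i * (S (kk (Suc i)) \<omega> - S (kk i) \<omega>)))"
  shows "\<bar>E (Suc J) - E J * (1 - a (s J)) ^ (kk (Suc J) - kk J)\<bar>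
    \<le> 2 * N * m / c ^ (4 * N) * a (s J) * (1 + real (kk (Suc J) - kk J) * a (s J))"
proof -
  let ?H = "\<lambda>\<omega>. exp (- (\<Sum>i<J. s i * (S (kk (Suc i)) \<omega> - S (kk i) \<omega>)))"
  have le: "kk i \<le> kk j" if "i \<le> j" for i j using kk that by (rule monoD)
  have H: "?H \<in> borel_measurable (history m M X (kk J))"
  proof -
    have "S (kk i) \<in> borel_measurable (history m M X (kk J))" if "i \<le> J" for i
      by (rule S_history[OF le[OF that]])
    thus ?thesis
      by (intro borel_measurable_exp[THEN measurable_compose[rotated]] borel_measurable_uminus borel_measurable_sum
          borel_measurable_times borel_measurable_diff) auto
  qed
  have H01: "0 \<le> ?H \<omega> \<and> ?H \<omega> \<le> 1" if "\<omega> \<in> space M" for \<omega>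
    using s S_mono[OF that le] by (auto intro!: sum_nonneg mult_nonneg_nonneg)
  have l: "kk J + (kk (Suc J) - kk J) = kk (Suc J)" using le[of J "Suc J"] by simp
  have "E (Suc J) = (LINT \<omega>|M. ?H \<omega> * exp (- s J * (S (kk J + (kk (Suc J) - kk J)) \<omega> - S (kk J) \<omega>)))"
    unfolding E_def l by (intro Bochner_Integration.integral_cong refl) (simp add: exp_add[symmetric])
  thus ?thesis
    using laplace_increment[OF H H01 s[of J] iter_estimate[OF s[of J]], of "kk (Suc J) - kk J"] unfolding E_def by simp
qed

end

section \<open>Limits of transforms as the parameter tends to 0\<close>

locale renewal_asymptotics =
  fixes m N :: nat and c :: real and z :: "nat \<Rightarrow> nat"
    and K :: "real \<Rightarrow> nat \<Rightarrow> (nat \<times> real \<times> nat) measure" and \<pi> :: "real \<Rightarrow> nat \<Rightarrow> real" and v :: "real \<Rightarrow> real"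
  assumes regular: "\<forall>\<^sub>F \<epsilon> in at_right 0. ring_renewal m (K \<epsilon>) N c z (\<pi> \<epsilon>)"
    and v_lim: "filterlim v at_top (at_right 0)"
begin

abbreviation ad :: "real \<Rightarrow> real \<Rightarrow> real" where "ad \<epsilon> \<equiv> defect m (K \<epsilon>) (\<pi> \<epsilon>)"

abbreviation C :: real where "C \<equiv> real (2 * N * m) / c ^ (4 * N)"

lemma v_pos: "\<forall>\<^sub>F \<epsilon> in at_right 0. 0 < v \<epsilon>"
  using v_lim by (simp add: filterlim_at_top_dense)

lemma a_ev: "0 \<le> s \<Longrightarrow> \<forall>\<^sub>F \<epsilon> in at_right 0. 0 \<le> ad \<epsilon> s \<and> ad \<epsilon> s \<le> 1"
  using regular by eventually_elim (use ring_renewal.a_bounds in blast)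

definition family :: "(real \<Rightarrow> nat \<Rightarrow> real) \<Rightarrow> (real \<Rightarrow> 'w measure) \<Rightarrow> (real \<Rightarrow> nat \<Rightarrow> 'w \<Rightarrow> nat \<times> real \<times> nat) \<Rightarrow> bool" where
  "family q M X \<longleftrightarrow> (\<forall>\<^sub>F \<epsilon> in at_right 0. ring_renewal_process m (K \<epsilon>) N c z (\<pi> \<epsilon>) (q \<epsilon>) (M \<epsilon>) (X \<epsilon>))"

lemma kappa_process_S:
  assumes "ring_renewal_process m (K \<epsilon>) N c z (\<pi> \<epsilon>) q M X"
  shows "kappa_process w X t \<omega> = markov_renewal.S X (nat \<lfloor>t * w\<rfloor>) \<omega>"
proof -
  interpret ring_renewal_process m "K \<epsilon>" N c z "\<pi> \<epsilon>" q M X by fact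
  show ?thesis by (simp add: S_def kappa_process_def)
qed

lemma error_tendsto:
  assumes n: "((\<lambda>\<epsilon>. real (n \<epsilon>) / v \<epsilon>) \<longlongrightarrow> t) (at_right 0)"
    and b: "\<forall>\<^sub>F \<epsilon> in at_right 0. 0 \<le> b \<epsilon>" "((\<lambda>\<epsilon>. v \<epsilon> * b \<epsilon>) \<longlongrightarrow> \<beta>) (at_right 0)"
  shows "((\<lambda>\<epsilon>. C * b \<epsilon> * (1 + n \<epsilon> * b \<epsilon>)) \<longlongrightarrow> 0) (at_right 0)"
  using tendsto_mult[OF tendsto_mult[OF tendsto_const[of C] tendsto_power_exp(3)[OF b(1) v_lim b(2) n]]
      tendsto_add[OF tendsto_const[of 1] tendsto_power_exp(2)[OF b(1) v_lim b(2) n]]] by simp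

text \<open>Induction over the number of increments: each one splits off a factor
  \<open>(1 - a) ^ l\<close> with an error tending to 0, and the limit of this factor depends
  neither on the initial law nor on the earlier increments.\<close>

lemma joint_laplace_limit:
  assumes fam: "family q M X" and conv: "\<And>s. 0 \<le> s \<Longrightarrow> ((\<lambda>\<epsilon>. v \<epsilon> * ad \<epsilon> s) \<longlongrightarrow> A s) (at_right 0)"
    and t: "mono t" "0 \<le> t 0" and s: "\<And>i. 0 \<le> s i"
  shows "((\<lambda>\<epsilon>. LINT \<omega>|M \<epsilon>. exp (- (\<Sum>i<J. s i * (kappa_process (v \<epsilon>) (X \<epsilon>) (t (Suc i)) \<omega> - kappa_process (v \<epsilon>) (X \<epsilon>) (t i) \<omega>))))
    \<longlongrightarrow> exp (- (\<Sum>i<J. (t (Suc i) - t i) * A (s i)))) (at_right 0)"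
proof (induction J)
  case 0
  have "\<forall>\<^sub>F \<epsilon> in at_right 0. 1 = (LINT \<omega>|M \<epsilon>. 1::real)"
    using fam unfolding family_def
  proof eventually_elim
    case (elim \<epsilon>)
    interpret ring_renewal_process m "K \<epsilon>" N c z "\<pi> \<epsilon>" "q \<epsilon>" "M \<epsilon>" "X \<epsilon>" by fact
    show ?case using prob_space by simp
  qed
  thus ?case by (simp add: tendsto_eventually eventually_mono)
next
  case (Suc J)
  define E where "E J \<epsilon> = (LINT \<omega>|M \<epsilon>. exp (- (\<Sum>i<J. s i * (kappa_process (v \<epsilon>) (X \<epsilon>) (t (Suc i)) \<omega> - kappa_process (v \<epsilon>) (X \<epsilon>) (t i) \<omega>))))" for J \<epsilon>
  define l where "l \<epsilon> = nat \<lfloor>t (Suc J) * v \<epsilon>\<rfloor> - nat \<lfloor>t J * v \<epsilon>\<rfloor>" for \<epsilon>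
  have t0: "0 \<le> t i" for i using monoD[OF t(1), of 0 i] t(2) by simp
  have l: "((\<lambda>\<epsilon>. real (l \<epsilon>) / v \<epsilon>) \<longlongrightarrow> t (Suc J) - t J) (at_right 0)"
  proof (rule Lim_transform_eventually[OF tendsto_diff[OF nat_floor_quotient[OF v_lim t0] nat_floor_quotient[OF v_lim t0]]])
    show "\<forall>\<^sub>F \<epsilon> in at_right 0. real (nat \<lfloor>t (Suc J) * v \<epsilon>\<rfloor>) / v \<epsilon> - real (nat \<lfloor>t J * v \<epsilon>\<rfloor>) / v \<epsilon> = real (l \<epsilon>) / v \<epsilon>"
      using v_pos
    proof eventually_elim
      case (elim \<epsilon>)
      have "nat \<lfloor>t J * v \<epsilon>\<rfloor> \<le> nat \<lfloor>t (Suc J) * v \<epsilon>\<rfloor>"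
        using monoD[OF t(1), of J "Suc J"] elim by (intro nat_floor_mono mult_right_mono) auto
      thus ?case by (simp add: l_def of_nat_diff diff_divide_distrib)
    qed
  qed
  have a0: "\<forall>\<^sub>F \<epsilon> in at_right 0. 0 \<le> ad \<epsilon> (s J)" using a_ev[OF s[of J]] by eventually_elim simp
  note pe = tendsto_power_exp[OF a0 v_lim conv[OF s] l]
  have main: "((\<lambda>\<epsilon>. E J \<epsilon> * (1 - ad \<epsilon> (s J)) ^ l \<epsilon>) \<longlongrightarrow> exp (- (\<Sum>i<Suc J. (t (Suc i) - t i) * A (s i)))) (at_right 0)"
    using tendsto_mult[OF Suc pe(1)] unfolding E_def by (simp add: exp_add[symmetric] algebra_simps)
  have "((\<lambda>\<epsilon>. E (Suc J) \<epsilon> - E J \<epsilon> * (1 - ad \<epsilon> (s J)) ^ l \<epsilon>) \<longlongrightarrow> 0) (at_right 0)"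
  proof (rule Lim_null_comparison[OF _ error_tendsto[OF l a0 conv[OF s]]])
    show "\<forall>\<^sub>F \<epsilon> in at_right 0. norm (E (Suc J) \<epsilon> - E J \<epsilon> * (1 - ad \<epsilon> (s J)) ^ l \<epsilon>) \<le> C * ad \<epsilon> (s J) * (1 + l \<epsilon> * ad \<epsilon> (s J))"
      using fam[unfolded family_def] v_pos
    proof eventually_elim
      case (elim \<epsilon>)
      interpret ring_renewal_process m "K \<epsilon>" N c z "\<pi> \<epsilon>" "q \<epsilon>" "M \<epsilon>" "X \<epsilon>" by fact
      define kk where "kk i = nat \<lfloor>t i * v \<epsilon>\<rfloor>" for i
      have kk: "mono kk" unfolding kk_def
        using elim monoD[OF t(1)] by (intro monoI nat_floor_mono mult_right_mono) auto
      have "E J \<epsilon> = (LINT \<omega>|M \<epsilon>. exp (- (\<Sum>i<J. s i * (S (kk (Suc i)) \<omega> - S (kk i) \<omega>))))" for J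
        unfolding E_def kk_def kappa_process_S[OF elim(1)] ..
      thus ?case using laplace_joint_step[OF kk s, where J=J] by (simp add: l_def kk_def)
    qed
  qed
  from tendsto_add[OF this main] show ?case unfolding E_def by simp
qed

text \<open>The error estimate says nothing until \<open>v * a\<close> is known to be bounded, and
  this is not among the hypotheses. The bound \<open>T / v\<close> for the defect is established
  beforehand; then the power is close to the transform, and its convergence determines the limit of
  \<open>v * a\<close>.\<close>

lemma kappa_laplace_imp:
  assumes fam: "family q M X" and s: "0 \<le> s" and \<psi>: "0 < \<psi>"
    and conv: "((\<lambda>\<epsilon>. LINT \<omega>|M \<epsilon>. exp (- s * kappa_process (v \<epsilon>) (X \<epsilon>) 1 \<omega>)) \<longlongrightarrow> \<psi>) (at_right 0)"
  shows "((\<lambda>\<epsilon>. v \<epsilon> * ad \<epsilon> s) \<longlongrightarrow> - ln \<psi>) (at_right 0)"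
proof -
  define n where "n \<epsilon> = nat \<lfloor>1 * v \<epsilon>\<rfloor>" for \<epsilon>
  have n: "((\<lambda>\<epsilon>. real (n \<epsilon>) / v \<epsilon>) \<longlongrightarrow> 1) (at_right 0)"
    unfolding n_def by (rule nat_floor_quotient[OF v_lim]) simp
  \<comment> \<open>Chosen with \<open>exp (- T) < \<psi>\<close>: a defect as large as
    \<open>T / v\<close> would push the transform below its limit. The maximum with 0 keeps
    \<open>b\<close> non-negative.\<close>
  define T where "T = max 0 (1 - ln \<psi>)"
  have T: "0 \<le> T" "exp (- T) < \<psi>"
  proof -
    have "exp (- T) \<le> exp (ln \<psi> - 1)" by (simp add: T_def)
    also have "\<dots> < exp (ln \<psi>)" by simp
    finally show "exp (- T) < \<psi>" using \<psi> by simp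
  qed (simp add: T_def)
  define b where "b \<epsilon> = T / v \<epsilon>" for \<epsilon>
  have b0: "\<forall>\<^sub>F \<epsilon> in at_right 0. 0 \<le> b \<epsilon>" using v_pos by eventually_elim (simp add: b_def T)
  have vb: "((\<lambda>\<epsilon>. v \<epsilon> * b \<epsilon>) \<longlongrightarrow> T) (at_right 0)"
    by (rule tendsto_eventually) (use v_pos in eventually_elim, simp add: b_def)
  have err: "((\<lambda>\<epsilon>. C * b \<epsilon> * (1 + n \<epsilon> * b \<epsilon>)) \<longlongrightarrow> 0) (at_right 0)" by (rule error_tendsto[OF n b0 vb])
  have "((\<lambda>\<epsilon>. (1 - b \<epsilon>) ^ n \<epsilon> + C * b \<epsilon> * (1 + n \<epsilon> * b \<epsilon>)) \<longlongrightarrow> exp (- 1 * T) + 0) (at_right 0)"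
    by (intro tendsto_add tendsto_power_exp(1)[OF b0 v_lim vb n] err)
  hence "((\<lambda>\<epsilon>. (LINT \<omega>|M \<epsilon>. exp (- s * kappa_process (v \<epsilon>) (X \<epsilon>) 1 \<omega>)) - ((1 - b \<epsilon>) ^ n \<epsilon> + C * b \<epsilon> * (1 + n \<epsilon> * b \<epsilon>)))
      \<longlongrightarrow> \<psi> - (exp (- 1 * T) + 0)) (at_right 0)"
    by (intro tendsto_diff conv)
  hence "\<forall>\<^sub>F \<epsilon> in at_right 0. 0 < (LINT \<omega>|M \<epsilon>. exp (- s * kappa_process (v \<epsilon>) (X \<epsilon>) 1 \<omega>)) - ((1 - b \<epsilon>) ^ n \<epsilon> + C * b \<epsilon> * (1 + n \<epsilon> * b \<epsilon>))"
    using T by (intro order_tendstoD(1)) auto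
  hence le: "\<forall>\<^sub>F \<epsilon> in at_right 0. ad \<epsilon> s \<le> b \<epsilon>"
    using fam[unfolded family_def] b0
  proof eventually_elim
    case (elim \<epsilon>)
    interpret ring_renewal_process m "K \<epsilon>" N c z "\<pi> \<epsilon>" "q \<epsilon>" "M \<epsilon>" "X \<epsilon>" by fact
    show ?case
    proof (rule ccontr)
      \<comment> \<open>Otherwise some \<open>s' \<le> s\<close> has defect exactly \<open>b\<close>, which makes the transform at \<open>s'\<close>, and hence at \<open>s\<close>, too small.\<close>
      assume "\<not> ?thesis"
      then obtain s' where s': "0 \<le> s'" "s' \<le> s" "ad \<epsilon> s' = b \<epsilon>" using a_attains[OF s elim(3)] by force
      have "(LINT \<omega>|M \<epsilon>. exp (- s * S (n \<epsilon>) \<omega>)) \<le> (LINT \<omega>|M \<epsilon>. exp (- s' * S (n \<epsilon>) \<omega>))"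
        by (rule laplace_S_antimono[OF s'(1,2)])
      also have "\<dots> \<le> (1 - b \<epsilon>) ^ n \<epsilon> + C * b \<epsilon> * (1 + n \<epsilon> * b \<epsilon>)"
        using laplace_S_estimate[OF s'(1), of "n \<epsilon>"] unfolding s'(3) by linarith
      finally show False using elim(1) unfolding kappa_process_S[OF elim(2)] n_def by linarith
    qed
  qed
  have C0: "0 \<le> C" by (intro divide_nonneg_nonneg zero_le_even_power) auto
  have "((\<lambda>\<epsilon>. (LINT \<omega>|M \<epsilon>. exp (- s * kappa_process (v \<epsilon>) (X \<epsilon>) 1 \<omega>)) - (1 - ad \<epsilon> s) ^ n \<epsilon>) \<longlongrightarrow> 0) (at_right 0)"
  proof (rule Lim_null_comparison[OF _ err])
    show "\<forall>\<^sub>F \<epsilon> in at_right 0. norm ((LINT \<omega>|M \<epsilon>. exp (- s * kappa_process (v \<epsilon>) (X \<epsilon>) 1 \<omega>)) - (1 - ad \<epsilon> s) ^ n \<epsilon>)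
        \<le> C * b \<epsilon> * (1 + n \<epsilon> * b \<epsilon>)"
      using fam[unfolded family_def] le a_ev[OF s]
    proof eventually_elim
      case (elim \<epsilon>)
      interpret ring_renewal_process m "K \<epsilon>" N c z "\<pi> \<epsilon>" "q \<epsilon>" "M \<epsilon>" "X \<epsilon>" by fact
      have "norm ((LINT \<omega>|M \<epsilon>. exp (- s * kappa_process (v \<epsilon>) (X \<epsilon>) 1 \<omega>)) - (1 - ad \<epsilon> s) ^ n \<epsilon>)
          \<le> C * ad \<epsilon> s * (1 + n \<epsilon> * ad \<epsilon> s)"
        using laplace_S_estimate[OF s, of "n \<epsilon>"] unfolding kappa_process_S[OF elim(1)] n_def by simp
      also have "\<dots> \<le> C * b \<epsilon> * (1 + n \<epsilon> * b \<epsilon>)"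
      proof (rule mult_mono)
        have b: "0 \<le> b \<epsilon>" using elim by linarith
        show "C * ad \<epsilon> s \<le> C * b \<epsilon>" using elim C0 by (intro mult_left_mono) auto
        show "1 + n \<epsilon> * ad \<epsilon> s \<le> 1 + n \<epsilon> * b \<epsilon>" using elim by (intro add_left_mono mult_left_mono) auto
        show "0 \<le> C * b \<epsilon>" using C0 b by (rule mult_nonneg_nonneg)
        show "0 \<le> 1 + n \<epsilon> * ad \<epsilon> s" using elim by (intro add_nonneg_nonneg mult_nonneg_nonneg) auto
      qed
      finally show ?case .
    qed
  qed
  hence "((\<lambda>\<epsilon>. (1 - ad \<epsilon> s) ^ n \<epsilon>) \<longlongrightarrow> \<psi>) (at_right 0)"
    using tendsto_diff[OF conv] by fastforce
  thus ?thesis by (rule tendsto_power_imp[OF a_ev[OF s] v_lim n _ \<psi>])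
qed

end

section \<open>Functionals of monotone processes\<close>

text \<open>Index 0 carries the initial value, so that partial sums return the values on the
  grid.\<close>

definition incr :: "real \<Rightarrow> (real \<Rightarrow> 'a \<Rightarrow> real) \<Rightarrow> nat \<Rightarrow> 'a \<Rightarrow> real" where
  "incr h Z i \<omega> = (case i of 0 \<Rightarrow> Z 0 \<omega> | Suc k \<Rightarrow> Z (real (Suc k) * h) \<omega> - Z (real k * h) \<omega>)"

definition grid_sum :: "real \<Rightarrow> (nat \<Rightarrow> real) \<Rightarrow> real \<Rightarrow> real" where
  "grid_sum h \<xi> = grid_path h (\<lambda>j. \<Sum>i<Suc j. \<xi> i)"

lemma incr_sum: "(\<Sum>i<Suc j. incr h Z i \<omega>) = Z (real j * h) \<omega>"
  by (induction j) (auto simp: incr_def)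

lemma grid_sum_mono_paths:
  assumes "\<xi> \<in> nonneg_seqs" "0 < h"
  shows "grid_sum h \<xi> \<in> mono_paths"
  unfolding grid_sum_def using assms
  by (intro grid_path_mono_paths monoI sum_mono2) (auto simp: nonneg_seqs_def)

lemma discretize_eq_grid_sum:
  assumes "0 < h"
  shows "discretize h (path_of Z \<omega>) = grid_sum h (\<lambda>i. incr h Z i \<omega>)"
  unfolding discretize_def grid_sum_def incr_sum
  using assms by (auto simp: grid_path_def path_of_def fun_eq_iff)

locale mono_process = prob_space M for M :: "'a measure" +
  fixes Z :: "real \<Rightarrow> 'a \<Rightarrow> real"
  assumes Z_measurable: "\<And>t. 0 \<le> t \<Longrightarrow> Z t \<in> borel_measurable M"
    and Z_path: "\<And>\<omega>. \<omega> \<in> space M \<Longrightarrow> path_of Z \<omega> \<in> mono_paths"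
begin

lemma Z_nonneg: "\<omega> \<in> space M \<Longrightarrow> 0 \<le> t \<Longrightarrow> 0 \<le> Z t \<omega>"
  using mono_pathsD(2)[OF Z_path, of \<omega> t] by (simp add: path_of_def)

lemma Z_mono: "\<omega> \<in> space M \<Longrightarrow> 0 \<le> s \<Longrightarrow> s \<le> t \<Longrightarrow> Z s \<omega> \<le> Z t \<omega>"
  using mono_pathsD(1)[OF Z_path, of \<omega> s t] by (simp add: path_of_def)

lemma incr_sequence:
  assumes h: "0 < h"
  shows "nonneg_sequence M (incr h Z)"
  unfolding nonneg_sequence_def nonneg_sequence_axioms_def
proof (intro conjI allI impI)
  show "prob_space M" by (rule prob_space_axioms)
  fix i
  show "incr h Z i \<in> borel_measurable M"
    using h by (cases i) (auto simp: incr_def[abs_def] intro!: borel_measurable_diff Z_measurable)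
  fix \<omega> assume "\<omega> \<in> space M"
  thus "0 \<le> incr h Z i \<omega>"
    using h Z_nonneg by (cases i) (auto simp: incr_def intro!: Z_mono mult_right_mono)
qed

end

text \<open>Sequential continuity along monotone paths is all that is asked, so that a J-continuous
  functional and its envelopes both qualify.\<close>

locale path_functional =
  fixes F :: "(real \<Rightarrow> real) \<Rightarrow> real" and B :: real
  assumes F_bound: "\<And>x. x \<in> mono_paths \<Longrightarrow> \<bar>F x\<bar> \<le> B"
    and F_seq: "\<And>x xs. x \<in> mono_paths \<Longrightarrow> (\<And>k. xs k \<in> mono_paths) \<Longrightarrow> J_seq_conv xs x \<Longrightarrow> (\<lambda>k. F (xs k)) \<longlonglongrightarrow> F x"
begin

text \<open>Coordinatewise convergence of increments on a fixed grid is J-convergence of the step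
  paths.\<close>

lemma grid_continuous:
  assumes h: "0 < h"
  shows "continuous_on nonneg_seqs (\<lambda>\<xi>. F (grid_sum h \<xi>))"
  unfolding continuous_on_sequentially
proof (intro allI impI ballI)
  fix \<xi> \<zeta> assume \<zeta>: "\<zeta> \<in> nonneg_seqs" and "(\<forall>n. \<xi> n \<in> nonneg_seqs) \<and> \<xi> \<longlonglongrightarrow> \<zeta>"
  hence \<xi>: "\<And>n. \<xi> n \<in> nonneg_seqs" and lim: "\<xi> \<longlonglongrightarrow> \<zeta>" by auto
  have coord: "(\<lambda>n. \<xi> n i) \<longlonglongrightarrow> \<zeta> i" for i
    by (rule continuous_on_tendsto_compose[OF continuous_on_product_coordinates lim]) auto
  have "J_seq_conv (\<lambda>n. grid_sum h (\<xi> n)) (grid_sum h \<zeta>)"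
    unfolding grid_sum_def
    by (rule grid_path_J_seq_conv[OF h])
      (intro tendsto_sum coord, rule grid_sum_mono_paths[unfolded grid_sum_def, OF \<xi> h])
  thus "((\<lambda>\<xi>. F (grid_sum h \<xi>)) \<circ> \<xi>) \<longlonglongrightarrow> F (grid_sum h \<zeta>)"
    unfolding o_def by (intro F_seq grid_sum_mono_paths \<zeta> \<xi> h)
qed

lemma integrable_discretize:
  assumes Z: "mono_process M Z" and h: "0 < h"
  shows "integrable M (\<lambda>\<omega>. F (discretize h (path_of Z \<omega>)))"
  unfolding discretize_eq_grid_sum[OF h]
  by (rule nonneg_sequence.integrable_nonneg_seqs[OF mono_process.incr_sequence[OF Z h] grid_continuous[OF h], where B=B])
     (intro F_bound grid_sum_mono_paths h)

lemma discretize_tendsto: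
  assumes x: "x \<in> mono_paths"
  shows "(\<lambda>k. F (discretize (1 / real (Suc k)) x)) \<longlonglongrightarrow> F x"
  by (intro F_seq x discretize_mono_paths discretize_J_seq_conv LIMSEQ_Suc[OF lim_1_over_n]) auto

text \<open>Measurability is not evident for a functional of the whole path. It holds because the
  functional is the pointwise limit of its values at discretized paths, which are continuous
  functions of the sequence of increments.\<close>

lemma integrable_path:
  assumes Z: "mono_process M Z"
  shows "integrable M (\<lambda>\<omega>. F (path_of Z \<omega>))"
    and "(\<lambda>k. LINT \<omega>|M. F (discretize (1 / real (Suc k)) (path_of Z \<omega>))) \<longlonglongrightarrow> (LINT \<omega>|M. F (path_of Z \<omega>))"
proof -
  interpret mono_process M Z by fact
  have meas: "(\<lambda>\<omega>. F (discretize (1 / real (Suc k)) (path_of Z \<omega>))) \<in> borel_measurable M" for k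
    using integrable_discretize[OF Z, of "1 / real (Suc k)"] by simp
  have lim_meas: "(\<lambda>\<omega>. F (path_of Z \<omega>)) \<in> borel_measurable M"
    by (rule borel_measurable_LIMSEQ_real[OF discretize_tendsto[OF Z_path] meas])
  thus "integrable M (\<lambda>\<omega>. F (path_of Z \<omega>))"
    using F_bound[OF Z_path] by (intro integrable_const_bound[of _ B]) auto
  show "(\<lambda>k. LINT \<omega>|M. F (discretize (1 / real (Suc k)) (path_of Z \<omega>))) \<longlonglongrightarrow> (LINT \<omega>|M. F (path_of Z \<omega>))"
  proof (rule integral_dominated_convergence[where w="\<lambda>_. B"])
    show "AE \<omega> in M. (\<lambda>k. F (discretize (1 / real (Suc k)) (path_of Z \<omega>))) \<longlonglongrightarrow> F (path_of Z \<omega>)"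
      by (intro AE_I2 discretize_tendsto Z_path)
    show "AE \<omega> in M. norm (F (discretize (1 / real (Suc k)) (path_of Z \<omega>))) \<le> B" for k
      using F_bound[OF discretize_mono_paths[OF Z_path, of _ "1 / real (Suc k)"]] by (intro AE_I2) auto
  qed (use meas lim_meas in auto)
qed

end

lemma continuous_path_functional:
  assumes "continuous_map J_topology euclideanreal f" "\<And>x. x \<in> mono_paths \<Longrightarrow> \<bar>f x\<bar> \<le> B"
  shows "path_functional f B"
  using assms J_continuous_seq[OF assms(1)] mono_paths_subset by unfold_locales auto

lemma envelope_path_functional:
  assumes "bounded_path_functional f B"
  shows "path_functional (J_envelope f n) B"
  using bounded_path_functional.envelope_abs[OF assms] bounded_path_functional.envelope_seq[OF assms]
  by unfold_locales auto

text \<open>The pseudometric with horizon \<open>n\<close> does not see later increments: the two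
  paths have distance 0, and the envelope is Lipschitz. This is the finite dependence that the
  convergence theorem for sequences asks for.\<close>

lemma envelope_grid_finite:
  assumes f: "bounded_path_functional f B" and h: "0 < h" and \<xi>: "\<xi> \<in> nonneg_seqs" and J: "real n < real J * h"
  shows "J_envelope f n (grid_sum h (\<lambda>i. if i < J then \<xi> i else 0)) = J_envelope f n (grid_sum h \<xi>)"
proof -
  let ?\<xi> = "\<lambda>i. if i < J then \<xi> i else 0"
  have mem: "grid_sum h ?\<xi> \<in> mono_paths" "grid_sum h \<xi> \<in> mono_paths"
    using \<xi> by (auto intro!: grid_sum_mono_paths h simp: nonneg_seqs_def)
  have eq: "grid_sum h ?\<xi> t = grid_sum h \<xi> t" if t: "0 \<le> t" "t < n" for t :: real
  proof -
    define j where "j = nat \<lfloor>t / h\<rfloor>"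
    have "real j * h \<le> t" using nat_floor_div[OF h t(1), of j] by (simp add: j_def)
    hence "real j * h < real J * h" using t J by linarith
    hence "j < J" using h by simp
    thus ?thesis using t by (simp add: grid_sum_def grid_path_def j_def[symmetric])
  qed
  have "J_close n 0 (grid_sum h ?\<xi>) (grid_sum h \<xi>)"
  proof (rule J_closeI[OF id_time_change])
    fix t :: real assume t: "0 \<le> t"
    show "\<bar>t - t\<bar> \<le> 0 \<and> \<bar>ramp n t * grid_sum h \<xi> t - ramp n t * grid_sum h ?\<xi> t\<bar> \<le> 0"
      using eq[OF t] by (cases "t < n") (auto simp: ramp_def)
  qed
  hence "J_dist n (grid_sum h ?\<xi>) (grid_sum h \<xi>) = 0"
    using J_dist_le J_dist_nonneg[OF mem] by (metis antisym)
  thus ?thesis using bounded_path_functional.envelope_lipschitz[OF f mem, of n] by simp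
qed

lemma J_dist_discretize:
  assumes x: "x \<in> mono_paths" and h: "0 < h" "h < \<delta>" and \<delta>: "\<delta> \<le> 1" and J: "real n + 1 < real J * h"
    and block: "\<And>j. j < J \<Longrightarrow> one_jump_block x h \<delta> j" and R: "x (real n + 1) \<le> R"
  shows "J_dist n x (discretize h x) \<le> \<delta> * (1 + R)"
proof -
  have \<delta>0: "0 < \<delta>" using h by linarith
  have "discretize h x \<in> J_nbhd x (real n + 1) \<delta>"
    by (rule discretize_in_J_nbhd[OF x h \<delta>0 order_refl J block])
  hence "J_dist n x (discretize h x) \<le> \<delta> * (1 + x (real n + 1))"
    using J_nbhd_imp_dist[OF x _ \<delta>, of "discretize h x" n] by (simp add: add.commute)
  also have "\<dots> \<le> \<delta> * (1 + R)" using R \<delta>0 by (intro mult_left_mono) auto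
  finally show ?thesis .
qed

lemma (in ring_renewal_process) kappa_mono_process:
  assumes w: "0 < w"
  shows "mono_process M (kappa_process w X)"
proof
  have eq: "kappa_process w X t \<omega> = S (nat \<lfloor>t * w\<rfloor>) \<omega>" for t \<omega>
    by (simp add: S_def kappa_process_def)
  show "kappa_process w X t \<in> borel_measurable M" for t unfolding eq[abs_def] by measurable
  fix \<omega> assume \<omega>: "\<omega> \<in> space M"
  have "path_of (kappa_process w X) \<omega> = grid_path (1 / w) (\<lambda>k. S k \<omega>)"
    by (auto simp: path_of_def grid_path_def eq fun_eq_iff)
  moreover have "grid_path (1 / w) (\<lambda>k. S k \<omega>) \<in> mono_paths"
    using w S_mono[OF \<omega>] by (intro grid_path_mono_paths monoI) (auto simp: S_def)
  ultimately show "path_of (kappa_process w X) \<omega> \<in> mono_paths" by simp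
qed

text \<open>The block condition ranges over all real times, so its failure is only covered by an
  event. The process changes at integer indices alone, which reduces the failure to finitely many
  indices and to the bound for two large increments.\<close>

lemma (in ring_renewal_process) block_probability:
  assumes w: "0 < w" and h: "0 < h" and r: "0 < r"
  obtains E where "E \<in> events"
    "{\<omega> \<in> space M. \<not> one_jump_block (path_of (kappa_process w X) \<omega>) h r j} \<subseteq> E"
    "prob E \<le> (((h * w + 1) * (a 1 * (m / c ^ (2 * N)))) / (1 - exp (- r)))\<^sup>2"
proof
  define n where "n = nat \<lfloor>(real j * h) * w\<rfloor>"
  define L where "L = nat \<lfloor>(real (Suc j) * h) * w\<rfloor> - n"
  have n_le: "n \<le> nat \<lfloor>(real (Suc j) * h) * w\<rfloor>"
    unfolding n_def using h w by (intro nat_floor_mono mult_right_mono) auto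
  hence nL: "nat \<lfloor>(real (Suc j) * h) * w\<rfloor> = n + L" by (simp add: L_def)
  \<comment> \<open>The difference of two floors exceeds \<open>h * w\<close> by at most 1; in the
    bound this extra step is multiplied by a defect that tends to 0.\<close>
  have L: "real L \<le> h * w + 1"
  proof -
    have "real (n + L) \<le> (real (Suc j) * h) * w" unfolding nL[symmetric] using h w by simp
    moreover have "(real j * h) * w - 1 \<le> real n" unfolding n_def using h w by simp
    ultimately show ?thesis by (simp add: algebra_simps)
  qed
  have eq: "kappa_process w X t \<omega> = S (nat \<lfloor>t * w\<rfloor>) \<omega>" for t \<omega>
    by (simp add: S_def kappa_process_def)
  define \<beta> where "\<beta> = real L * (a 1 * (m / c ^ (2 * N)))"
  let ?E = "{\<omega> \<in> space M. \<exists>l\<in>{n..n + L}. r \<le> S l \<omega> - S n \<omega> \<and> r \<le> S (n + L) \<omega> - S l \<omega>}"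
  show "?E \<in> events" by measurable
  show "{\<omega> \<in> space M. \<not> one_jump_block (path_of (kappa_process w X) \<omega>) h r j} \<subseteq> ?E"
  proof
    fix \<omega> assume "\<omega> \<in> {\<omega> \<in> space M. \<not> one_jump_block (path_of (kappa_process w X) \<omega>) h r j}"
    then obtain t where \<omega>: "\<omega> \<in> space M" and t: "real j * h \<le> t" "t \<le> real (Suc j) * h"
      and *: "r \<le> path_of (kappa_process w X) \<omega> t - path_of (kappa_process w X) \<omega> (real j * h)"
        "r \<le> path_of (kappa_process w X) \<omega> (real (Suc j) * h) - path_of (kappa_process w X) \<omega> t"
      unfolding one_jump_block_def by (auto simp: not_less)
    have t0: "0 \<le> real j * h" using h by simp
    have nn: "0 \<le> t" "0 \<le> real (Suc j) * h" using t t0 by linarith+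
    define l where "l = nat \<lfloor>t * w\<rfloor>"
    have "n \<le> l" unfolding l_def n_def using t w by (intro nat_floor_mono mult_right_mono) auto
    moreover have "l \<le> n + L"
      unfolding l_def nL[symmetric] using t w by (intro nat_floor_mono mult_right_mono) auto
    moreover have "r \<le> S l \<omega> - S n \<omega>" "r \<le> S (n + L) \<omega> - S l \<omega>"
    proof -
      have p: "path_of (kappa_process w X) \<omega> u = S (nat \<lfloor>u * w\<rfloor>) \<omega>" if "0 \<le> u" for u
        using that by (simp add: path_of_def eq)
      show "r \<le> S l \<omega> - S n \<omega>" "r \<le> S (n + L) \<omega> - S l \<omega>"
        using * unfolding p[OF nn(1)] p[OF nn(2)] p[OF t0] nL l_def n_def by blast+
    qed
    ultimately show "\<omega> \<in> ?E" using \<omega> by (intro CollectI conjI bexI[of _ l]) simp_all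
  qed
  have a1: "0 \<le> a 1 * (m / c ^ (2 * N))" using a_bounds(1)[of 1] c by simp
  have "prob ?E \<le> (\<beta> / (1 - exp (- r)))\<^sup>2"
    unfolding \<beta>_def by (rule two_large_increments[OF r]) (rule iter_lower, auto)
  also have "\<dots> \<le> (((h * w + 1) * (a 1 * (m / c ^ (2 * N)))) / (1 - exp (- r)))\<^sup>2"
  proof (rule power_mono)
    have "\<beta> \<le> (h * w + 1) * (a 1 * (m / c ^ (2 * N)))" unfolding \<beta>_def using L a1 by (rule mult_right_mono)
    thus "\<beta> / (1 - exp (- r)) \<le> (h * w + 1) * (a 1 * (m / c ^ (2 * N))) / (1 - exp (- r))"
      using r by (intro divide_right_mono) auto
    have "0 \<le> \<beta>" unfolding \<beta>_def by (rule mult_nonneg_nonneg[OF of_nat_0_le_iff a1])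
    thus "0 \<le> \<beta> / (1 - exp (- r))" using r by simp
  qed
  finally show "prob ?E \<le> (((h * w + 1) * (a 1 * (m / c ^ (2 * N)))) / (1 - exp (- r)))\<^sup>2" .
qed

text \<open>Off a bad event the path is close to its discretization and the envelope is Lipschitz;
  on it the trivial bound \<open>2 * B\<close> is used. The bad event also contains the paths that
  reach \<open>R\<close> by time \<open>n + 1\<close>, because the distance bound grows with the
  height of the path.\<close>

lemma (in ring_renewal_process) envelope_discretize_error:
  assumes f: "bounded_path_functional f B" and w: "0 < w" and h: "0 < h" "h < \<delta>" and \<delta>: "\<delta> \<le> 1"
    and J: "real n + 1 < real J * h" and R: "0 \<le> R"
  shows "\<bar>(LINT \<omega>|M. J_envelope f n (path_of (kappa_process w X) \<omega>))
      - (LINT \<omega>|M. J_envelope f n (discretize h (path_of (kappa_process w X) \<omega>)))\<bar>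
    \<le> n * (\<delta> * (1 + R)) + 2 * B * (real J * (((h * w + 1) * (a 1 * (m / c ^ (2 * N)))) / (1 - exp (- \<delta>)))\<^sup>2
        + prob {\<omega> \<in> space M. R \<le> kappa_process w X (real n + 1) \<omega>})"
proof -
  interpret Z: mono_process M "kappa_process w X" by (rule kappa_mono_process[OF w])
  interpret g: path_functional "J_envelope f n" B by (rule envelope_path_functional[OF f])
  define q where "q = (((h * w + 1) * (a 1 * (m / c ^ (2 * N)))) / (1 - exp (- \<delta>)))\<^sup>2"
  have \<delta>0: "0 < \<delta>" using h by linarith
  have "\<exists>E. E \<in> events \<and> {\<omega> \<in> space M. \<not> one_jump_block (path_of (kappa_process w X) \<omega>) h \<delta> j} \<subseteq> E \<and> prob E \<le> q" for j
    by (rule block_probability[OF w h(1) \<delta>0, of j]) (unfold q_def, blast)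
  hence "\<forall>j. \<exists>E. E \<in> events \<and> {\<omega> \<in> space M. \<not> one_jump_block (path_of (kappa_process w X) \<omega>) h \<delta> j} \<subseteq> E \<and> prob E \<le> q"
    by blast
  from choice[OF this] obtain E where E': "\<forall>j. E j \<in> events
      \<and> {\<omega> \<in> space M. \<not> one_jump_block (path_of (kappa_process w X) \<omega>) h \<delta> j} \<subseteq> E j \<and> prob (E j) \<le> q" ..
  have E: "\<And>j. E j \<in> events"
    "\<And>j. {\<omega> \<in> space M. \<not> one_jump_block (path_of (kappa_process w X) \<omega>) h \<delta> j} \<subseteq> E j" "\<And>j. prob (E j) \<le> q"
    using E' by blast+
  define T where "T = {\<omega> \<in> space M. R \<le> kappa_process w X (real n + 1) \<omega>}"
  have T: "T \<in> events" unfolding T_def using Z.Z_measurable[of "real n + 1"] by measurable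
  define D where "D = (\<Union>j<J. E j) \<union> T"
  have D: "D \<in> events" unfolding D_def using E(1) T by auto
  have "prob D \<le> prob (\<Union>j<J. E j) + prob T" unfolding D_def using E(1) T by (intro measure_Un_le) auto
  also have "prob (\<Union>j<J. E j) \<le> (\<Sum>j<J. prob (E j))" using E(1) by (intro finite_measure_subadditive_finite) auto
  also have "\<dots> \<le> (\<Sum>j<J. q)" by (intro sum_mono E(3))
  finally have probD: "prob D \<le> real J * q + prob T" by simp
  have B: "0 \<le> B"
  proof -
    obtain \<omega> where "\<omega> \<in> space M" using not_empty by blast
    from g.F_bound[OF Z.Z_path[OF this]] show ?thesis by linarith
  qed
  let ?x = "\<lambda>\<omega>. path_of (kappa_process w X) \<omega>"
  have pt: "\<bar>J_envelope f n (?x \<omega>) - J_envelope f n (discretize h (?x \<omega>))\<bar> \<le> n * (\<delta> * (1 + R)) + 2 * B * indicator D \<omega>"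
    if \<omega>: "\<omega> \<in> space M" for \<omega>
  proof (cases "\<omega> \<in> D")
    case True
    have "\<bar>J_envelope f n (?x \<omega>)\<bar> \<le> B" "\<bar>J_envelope f n (discretize h (?x \<omega>))\<bar> \<le> B"
      using \<omega> h by (auto intro!: g.F_bound Z.Z_path discretize_mono_paths)
    moreover have "0 \<le> n * (\<delta> * (1 + R))" using \<delta>0 R by simp
    ultimately show ?thesis using True by simp
  next
    case False
    have x: "?x \<omega> \<in> mono_paths" by (rule Z.Z_path[OF \<omega>])
    have "\<bar>J_envelope f n (?x \<omega>) - J_envelope f n (discretize h (?x \<omega>))\<bar> \<le> n * J_dist n (?x \<omega>) (discretize h (?x \<omega>))"
      by (rule bounded_path_functional.envelope_lipschitz[OF f x discretize_mono_paths[OF x h(1)]])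
    also have "\<dots> \<le> n * (\<delta> * (1 + R))"
    proof (intro mult_left_mono J_dist_discretize[OF x h \<delta> J])
      show "one_jump_block (?x \<omega>) h \<delta> j" if "j < J" for j
        using False E(2)[of j] \<omega> that unfolding D_def by blast
      show "?x \<omega> (real n + 1) \<le> R" using False \<omega> by (simp add: D_def T_def path_of_def)
    qed simp
    finally show ?thesis using False by simp
  qed
  have int: "integrable M (\<lambda>\<omega>. J_envelope f n (?x \<omega>))" "integrable M (\<lambda>\<omega>. J_envelope f n (discretize h (?x \<omega>)))"
    using g.integrable_path(1)[OF Z.mono_process_axioms] g.integrable_discretize[OF Z.mono_process_axioms h(1)] by auto
  have "\<bar>(LINT \<omega>|M. J_envelope f n (?x \<omega>)) - (LINT \<omega>|M. J_envelope f n (discretize h (?x \<omega>)))\<bar>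
      = \<bar>LINT \<omega>|M. J_envelope f n (?x \<omega>) - J_envelope f n (discretize h (?x \<omega>))\<bar>" using int by simp
  also have "\<dots> \<le> (LINT \<omega>|M. \<bar>J_envelope f n (?x \<omega>) - J_envelope f n (discretize h (?x \<omega>))\<bar>)"
    by (rule integral_abs_bound)
  also have "\<dots> \<le> (LINT \<omega>|M. n * (\<delta> * (1 + R)) + 2 * B * indicator D \<omega>)"
    using int D by (intro integral_mono pt) (auto simp: less_top[symmetric])
  also have "\<dots> = n * (\<delta> * (1 + R)) + 2 * B * prob D"
    using D by (subst Bochner_Integration.integral_add) (auto simp: less_top[symmetric] prob_space)
  also have "\<dots> \<le> n * (\<delta> * (1 + R)) + 2 * B * (real J * q + prob T)"
    using probD B by (intro add_left_mono mult_left_mono) auto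
  finally show ?thesis by (simp add: q_def T_def)
qed

lemma (in ring_renewal_process) kappa_tail:
  assumes w: "0 < w" and t: "0 \<le> t"
  shows "prob {\<omega> \<in> space M. real (Suc k) \<le> kappa_process w X t \<omega>}
    \<le> 2 * (1 - (LINT \<omega>|M. exp (- (1 / real (Suc k)) * kappa_process w X t \<omega>)))"
proof -
  interpret Z: mono_process M "kappa_process w X" by (rule kappa_mono_process[OF w])
  let ?Z = "kappa_process w X t" and ?\<mu> = "distr M borel (kappa_process w X t)"
  have meas: "?Z \<in> borel_measurable M" by (rule Z.Z_measurable[OF t])
  have \<mu>: "nonneg_law ?\<mu>" by (rule nonneg_law_distr[OF prob_space_axioms meas]) (use Z.Z_nonneg t in auto)
  have "measure ?\<mu> {real (Suc k)..} * (1 - exp (- (1 / real (Suc k)) * real (Suc k))) \<le> 1 - laplace_transform ?\<mu> (1 / real (Suc k))"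
    by (rule laplace_tail[OF \<mu>]) auto
  moreover have "measure ?\<mu> {real (Suc k)..} = prob {\<omega> \<in> space M. real (Suc k) \<le> ?Z \<omega>}"
    using meas by (subst measure_distr) (auto intro!: arg_cong[where f=prob])
  moreover have "prob {\<omega> \<in> space M. real (Suc k) \<le> ?Z \<omega>} * (1 / 2)
      \<le> prob {\<omega> \<in> space M. real (Suc k) \<le> ?Z \<omega>} * (1 - exp (- (1 / real (Suc k)) * real (Suc k)))"
  proof (rule mult_left_mono)
    \<comment> \<open>The frequency is the reciprocal of the level, so the tail factor is
      \<open>1 - exp (- 1)\<close>, which is at least 1/2.\<close>
    have "exp (- 1) \<le> (1 / 2 :: real)" using exp_ge_add_one_self[of 1] by (simp add: exp_minus field_simps)
    thus "1 / 2 \<le> 1 - exp (- (1 / real (Suc k)) * real (Suc k))" by simp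
  qed simp
  ultimately show ?thesis using meas by (simp add: laplace_transform_distr)
qed

lemma incr_weighted_sum:
  "(\<Sum>i<Suc n. c i * incr h Z i \<omega>) = c 0 * Z 0 \<omega> + (\<Sum>i<n. c (Suc i) * (Z (real (Suc i) * h) \<omega> - Z (real i * h) \<omega>))"
  by (subst sum.lessThan_Suc_shift) (simp add: incr_def)

lemma mono_process_cadlag: "mono_process M Z \<Longrightarrow> cadlag_process M Z"
  unfolding cadlag_process_def mono_process_def mono_process_axioms_def using mono_paths_subset by blast

context renewal_asymptotics
begin

lemma kappa_process_0: "kappa_process w X 0 \<omega> = 0"
  by (simp add: kappa_process_def)

lemma kappa_mono_ev:
  assumes "family q M X"
  shows "\<forall>\<^sub>F \<epsilon> in at_right 0. mono_process (M \<epsilon>) (kappa_process (v \<epsilon>) (X \<epsilon>))"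
  using assms[unfolded family_def] v_pos
  by eventually_elim (rule ring_renewal_process.kappa_mono_process)

lemma kappa_laplace_limit:
  assumes fam: "family q M X" and conv: "\<And>s. 0 \<le> s \<Longrightarrow> ((\<lambda>\<epsilon>. v \<epsilon> * ad \<epsilon> s) \<longlongrightarrow> A s) (at_right 0)"
    and t: "0 \<le> t" and s: "0 \<le> s"
  shows "((\<lambda>\<epsilon>. LINT \<omega>|M \<epsilon>. exp (- s * kappa_process (v \<epsilon>) (X \<epsilon>) t \<omega>)) \<longlongrightarrow> exp (- t * A s)) (at_right 0)"
  using joint_laplace_limit[OF fam conv, where t="\<lambda>i. real i * t" and s="\<lambda>_. s" and J=1] t s
  by (simp add: mono_def mult_right_mono kappa_process_0)

end

text \<open>The limit process enters only through its monotone paths and joint transforms,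
  independently of its construction. The assumption \<open>A_lim\<close> controls the height of the
  paths.\<close>

locale renewal_limit = renewal_asymptotics m N c z K \<pi> v + lim: mono_process W Y
  for m N c z K \<pi> v and W :: "'b measure" and Y +
  fixes A :: "real \<Rightarrow> real"
  assumes defect_conv: "\<And>s. 0 \<le> s \<Longrightarrow> ((\<lambda>\<epsilon>. v \<epsilon> * ad \<epsilon> s) \<longlongrightarrow> A s) (at_right 0)"
    and A_lim: "(\<lambda>k. A (1 / real (Suc k))) \<longlonglongrightarrow> 0"
    and Y_0: "AE \<omega> in W. Y 0 \<omega> = 0"
    and Y_joint: "\<And>t s n. mono t \<Longrightarrow> 0 \<le> t 0 \<Longrightarrow> (\<And>i. 0 \<le> s i) \<Longrightarrow>
      (LINT \<omega>|W. exp (- (\<Sum>i<(n::nat). s i * (Y (t (Suc i)) \<omega> - Y (t i) \<omega>)))) = exp (- (\<Sum>i<n. (t (Suc i) - t i) * A (s i)))"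
begin

lemma grid_laplace_convergence:
  assumes fam: "family q M X" and h: "0 < h"
  shows "laplace_convergence W (incr h Y) M (\<lambda>\<epsilon>. incr h (kappa_process (v \<epsilon>) (X \<epsilon>))) (at_right 0)"
  unfolding laplace_convergence_def laplace_convergence_axioms_def
proof (intro conjI allI)
  show "nonneg_sequence W (incr h Y)" by (rule lim.incr_sequence[OF h])
  show "\<forall>\<^sub>F \<epsilon> in at_right 0. nonneg_sequence (M \<epsilon>) (incr h (kappa_process (v \<epsilon>) (X \<epsilon>)))"
    using kappa_mono_ev[OF fam] by eventually_elim (rule mono_process.incr_sequence[OF _ h])
  fix J and d :: "nat \<Rightarrow> nat"
  show "((\<lambda>\<epsilon>. LINT \<omega>|M \<epsilon>. exp (- (\<Sum>i<J. real (d i) * incr h (kappa_process (v \<epsilon>) (X \<epsilon>)) i \<omega>)))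
      \<longlongrightarrow> (LINT \<omega>|W. exp (- (\<Sum>i<J. real (d i) * incr h Y i \<omega>)))) (at_right 0)"
  proof (cases J)
    case 0
    have "\<forall>\<^sub>F \<epsilon> in at_right 0. (LINT \<omega>|M \<epsilon>. exp (- (\<Sum>i<J. real (d i) * incr h (kappa_process (v \<epsilon>) (X \<epsilon>)) i \<omega>))) = 1"
      using kappa_mono_ev[OF fam] by eventually_elim (simp add: 0 mono_process_def prob_space.prob_space)
    thus ?thesis by (simp add: 0 lim.prob_space tendsto_eventually)
  next
    case (Suc n)
    define t where "t i = real i * h" for i
    have t: "mono t" "0 \<le> t 0" using h by (auto simp: t_def mono_def)
    \<comment> \<open>\<open>Y\<close> starts at 0 only almost surely, while the renewal sums do so
      everywhere; hence the initial term is removed under the integral here.\<close>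
    have "(LINT \<omega>|W. exp (- (\<Sum>i<J. real (d i) * incr h Y i \<omega>)))
        = (LINT \<omega>|W. exp (- (\<Sum>i<n. real (d (Suc i)) * (Y (t (Suc i)) \<omega> - Y (t i) \<omega>))))"
    proof (rule integral_cong_AE)
      note ns = lim.incr_sequence[OF h]
      have [measurable]: "incr h Y i \<in> borel_measurable W" for i by (rule nonneg_sequence.\<xi>_measurable[OF ns])
      show "(\<lambda>\<omega>. exp (- (\<Sum>i<J. real (d i) * incr h Y i \<omega>))) \<in> borel_measurable W" by measurable
      have [measurable]: "Y (t i) \<in> borel_measurable W" for i using h by (intro lim.Z_measurable) (simp add: t_def)
      show "(\<lambda>\<omega>. exp (- (\<Sum>i<n. real (d (Suc i)) * (Y (t (Suc i)) \<omega> - Y (t i) \<omega>)))) \<in> borel_measurable W" by measurable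
      show "AE \<omega> in W. exp (- (\<Sum>i<J. real (d i) * incr h Y i \<omega>)) = exp (- (\<Sum>i<n. real (d (Suc i)) * (Y (t (Suc i)) \<omega> - Y (t i) \<omega>)))"
        using Y_0 unfolding Suc incr_weighted_sum t_def by eventually_elim simp
    qed
    also have "\<dots> = exp (- (\<Sum>i<n. (t (Suc i) - t i) * A (real (d (Suc i)))))"
      by (rule Y_joint[OF t]) simp
    finally show ?thesis
      using joint_laplace_limit[OF fam defect_conv t, where s="\<lambda>i. real (d (Suc i))" and J=n]
      unfolding Suc incr_weighted_sum t_def by (simp add: kappa_process_0)
  qed
qed

lemma envelope_grid_conv:
  assumes fam: "family q M X" and f: "bounded_path_functional f B" and h: "0 < h"
  shows "((\<lambda>\<epsilon>. LINT \<omega>|M \<epsilon>. J_envelope f n (discretize h (path_of (kappa_process (v \<epsilon>) (X \<epsilon>)) \<omega>)))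
    \<longlongrightarrow> (LINT \<omega>|W. J_envelope f n (discretize h (path_of Y \<omega>)))) (at_right 0)"
proof -
  interpret lc: laplace_convergence W "incr h Y" M "\<lambda>\<epsilon>. incr h (kappa_process (v \<epsilon>) (X \<epsilon>))" "at_right 0"
    by (rule grid_laplace_convergence[OF fam h])
  interpret g: path_functional "J_envelope f n" B by (rule envelope_path_functional[OF f])
  obtain J :: nat where "real n / h < real J" using reals_Archimedean2 by blast
  hence J: "real n < real J * h" using h by (simp add: pos_divide_less_eq)
  show ?thesis
    unfolding discretize_eq_grid_sum[OF h]
  proof (rule lc.conv_bounded_continuous[of "\<lambda>\<xi>. J_envelope f n (grid_sum h \<xi>)" B J])
    show "continuous_on nonneg_seqs (\<lambda>\<xi>. J_envelope f n (grid_sum h \<xi>))" by (rule g.grid_continuous[OF h])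
    show "\<bar>J_envelope f n (grid_sum h \<xi>)\<bar> \<le> B" if "\<xi> \<in> nonneg_seqs" for \<xi>
      by (rule g.F_bound[OF grid_sum_mono_paths[OF that h]])
    show "J_envelope f n (grid_sum h (\<lambda>i. if i < J then \<xi> i else 0)) = J_envelope f n (grid_sum h \<xi>)"
      if "\<xi> \<in> nonneg_seqs" for \<xi>
      by (rule envelope_grid_finite[OF f h that J])
  qed
qed

text \<open>One-sided because the envelope lies below \<open>f\<close>. The choices are made in the
  order: \<open>n\<close> for the envelope, \<open>R\<close> and \<open>\<delta>\<close> for the
  distance, then the mesh, and \<open>\<epsilon>\<close> last.\<close>

lemma functional_liminf:
  assumes fam: "family q M X" and f: "continuous_map J_topology euclideanreal f"
    and B: "\<And>x. x \<in> mono_paths \<Longrightarrow> \<bar>f x\<bar> \<le> B" and e: "0 < e"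
  shows "\<forall>\<^sub>F \<epsilon> in at_right 0. (LINT \<omega>|W. f (path_of Y \<omega>)) - e < (LINT \<omega>|M \<epsilon>. f (path_of (kappa_process (v \<epsilon>) (X \<epsilon>)) \<omega>))"
proof -
  interpret bf: bounded_path_functional f B by unfold_locales (rule B)
  interpret f: path_functional f B by (rule continuous_path_functional[OF f B])
  have env: "path_functional (J_envelope f n) B" for n by (rule envelope_path_functional[OF bf.bounded_path_functional_axioms])
  have lim_mp: "mono_process W Y" by (rule lim.mono_process_axioms)
  have B0: "0 \<le> B"
  proof -
    obtain \<omega> where "\<omega> \<in> space W" using lim.not_empty by blast
    from f.F_bound[OF lim.Z_path[OF this]] show ?thesis by linarith
  qed
  \<comment> \<open>The losses are one \<open>\<eta>\<close> each for the envelope, the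
    discretization of the limit and the convergence on the grid, and
    \<open>\<eta> + 4 * (B * \<eta>)\<close> for the discretization of the renewal path; together
    they stay below \<open>e\<close>.\<close>
  define \<eta> where "\<eta> = e / (8 * (1 + B))"
  have \<eta>: "0 < \<eta>" using e B0 by (simp add: \<eta>_def)
  have "(\<lambda>n. LINT \<omega>|W. J_envelope f n (path_of Y \<omega>)) \<longlonglongrightarrow> (LINT \<omega>|W. f (path_of Y \<omega>))"
  proof (rule integral_dominated_convergence[where w="\<lambda>_. B"])
    show "AE \<omega> in W. (\<lambda>n. J_envelope f n (path_of Y \<omega>)) \<longlonglongrightarrow> f (path_of Y \<omega>)"
      by (intro AE_I2 bf.envelope_conv f lim.Z_path)
    show "AE \<omega> in W. norm (J_envelope f n (path_of Y \<omega>)) \<le> B" for n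
      using bf.envelope_abs[OF lim.Z_path] by (intro AE_I2) auto
  qed (use f.integrable_path(1)[OF lim_mp] path_functional.integrable_path(1)[OF env lim_mp] in auto)
  from order_tendstoD(1)[OF this, of "(LINT \<omega>|W. f (path_of Y \<omega>)) - \<eta>"]
  have "\<forall>\<^sub>F n in sequentially. (LINT \<omega>|W. f (path_of Y \<omega>)) - \<eta> < (LINT \<omega>|W. J_envelope f n (path_of Y \<omega>))"
    using \<eta> by simp
  then obtain n where n: "(LINT \<omega>|W. f (path_of Y \<omega>)) - \<eta> < (LINT \<omega>|W. J_envelope f n (path_of Y \<omega>))"
    using eventually_happens sequentially_bot by blast
  \<comment> \<open>The limit of the tail bounds at time \<open>n + 1\<close>. It provides a height
    \<open>R\<close> that is reached only with small probability, for all small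
    \<open>\<epsilon>\<close> at once.\<close>
  have "(\<lambda>k. 2 * (1 - exp (- (real n + 1) * A (1 / real (Suc k))))) \<longlonglongrightarrow> 2 * (1 - exp (- (real n + 1) * 0))"
    by (intro tendsto_intros A_lim)
  hence "\<forall>\<^sub>F k in sequentially. 2 * (1 - exp (- (real n + 1) * A (1 / real (Suc k)))) < \<eta>"
    using \<eta> by (intro order_tendstoD(2)) auto
  then obtain k where k: "2 * (1 - exp (- (real n + 1) * A (1 / real (Suc k)))) < \<eta>"
    using eventually_happens sequentially_bot by blast
  define R where "R = real (Suc k)"
  define \<delta> where "\<delta> = min 1 (\<eta> / (real (Suc n) * (1 + R)))"
  have \<delta>: "0 < \<delta>" "\<delta> \<le> 1" using \<eta> by (auto simp: \<delta>_def R_def)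
  have n\<delta>: "real n * (\<delta> * (1 + R)) \<le> \<eta>"
  proof -
    have "\<delta> \<le> \<eta> / (real (Suc n) * (1 + R))" by (simp add: \<delta>_def)
    hence "\<delta> * (real (Suc n) * (1 + R)) \<le> \<eta>" by (subst (asm) pos_le_divide_eq) (auto simp: R_def)
    moreover have "real n * (\<delta> * (1 + R)) \<le> \<delta> * (real (Suc n) * (1 + R))"
      using \<delta> by (simp add: R_def algebra_simps)
    ultimately show ?thesis by linarith
  qed
  define D where "D = m / c ^ (2 * N)"
  define H where "H p = 1 / real (Suc p)" for p
  have H: "0 < H p" for p by (simp add: H_def)
  have H_lim: "H \<longlonglongrightarrow> 0" unfolding H_def[abs_def] by (rule LIMSEQ_Suc[OF lim_1_over_n])
  define Jn where "Jn p = Suc (nat \<lfloor>(real n + 1) / H p\<rfloor>)" for p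
  have Jn: "real n + 1 < real (Jn p) * H p" "real (Jn p) * H p \<le> real n + 1 + H p" for p
  proof -
    define i where "i = nat \<lfloor>(real n + 1) / H p\<rfloor>"
    have nn: "0 \<le> real n + 1" by simp
    have "real i * H p \<le> real n + 1 \<and> real n + 1 < real (Suc i) * H p"
      using nat_floor_div[OF H nn, of p i] by (simp add: i_def)
    moreover have "Jn p = Suc i" by (simp add: Jn_def i_def)
    ultimately show "real n + 1 < real (Jn p) * H p" "real (Jn p) * H p \<le> real n + 1 + H p"
      by (auto simp: algebra_simps)
  qed
  \<comment> \<open>The limit in \<open>\<epsilon>\<close> of the bound for all blocks together. The
    number of blocks is of order \<open>1 / H p\<close> and each contributes a term of order
    \<open>(H p) ^ 2\<close>, so the total vanishes with the mesh.\<close>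
  define Q where "Q p = real (Jn p) * (H p * (A 1 * D) / (1 - exp (- \<delta>)))\<^sup>2" for p
  have "Q \<longlonglongrightarrow> 0"
  proof (rule tendsto_sandwich[where f="\<lambda>_. 0"])
    show "\<forall>\<^sub>F p in sequentially. 0 \<le> Q p" by (simp add: Q_def)
    show "\<forall>\<^sub>F p in sequentially. Q p \<le> (real n + 1 + H p) * H p * (A 1 * D / (1 - exp (- \<delta>)))\<^sup>2"
    proof (intro always_eventually allI)
      fix p
      have "Q p = (real (Jn p) * H p) * H p * (A 1 * D / (1 - exp (- \<delta>)))\<^sup>2"
        by (simp add: Q_def power2_eq_square)
      also have "\<dots> \<le> (real n + 1 + H p) * H p * (A 1 * D / (1 - exp (- \<delta>)))\<^sup>2"
        using Jn(2)[of p] H[of p] by (intro mult_right_mono) auto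
      finally show "Q p \<le> (real n + 1 + H p) * H p * (A 1 * D / (1 - exp (- \<delta>)))\<^sup>2" .
    qed
    have "(\<lambda>p. (real n + 1 + H p) * H p * (A 1 * D / (1 - exp (- \<delta>)))\<^sup>2)
        \<longlonglongrightarrow> (real n + 1 + 0) * 0 * (A 1 * D / (1 - exp (- \<delta>)))\<^sup>2" by (intro tendsto_intros H_lim)
    thus "(\<lambda>p. (real n + 1 + H p) * H p * (A 1 * D / (1 - exp (- \<delta>)))\<^sup>2) \<longlonglongrightarrow> 0" by simp
  qed simp
  hence Q: "\<forall>\<^sub>F p in sequentially. Q p < \<eta>" using \<eta> by (rule order_tendstoD(2))
  have H\<delta>: "\<forall>\<^sub>F p in sequentially. H p < \<delta>" using order_tendstoD(2)[OF H_lim \<delta>(1)] .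
  have "(\<lambda>p. LINT \<omega>|W. J_envelope f n (discretize (H p) (path_of Y \<omega>))) \<longlonglongrightarrow> (LINT \<omega>|W. J_envelope f n (path_of Y \<omega>))"
    unfolding H_def by (rule path_functional.integrable_path(2)[OF env lim_mp])
  from order_tendstoD(1)[OF this, of "(LINT \<omega>|W. J_envelope f n (path_of Y \<omega>)) - \<eta>"]
  have "\<forall>\<^sub>F p in sequentially. (LINT \<omega>|W. J_envelope f n (path_of Y \<omega>)) - \<eta> < (LINT \<omega>|W. J_envelope f n (discretize (H p) (path_of Y \<omega>)))"
    using \<eta> by simp
  from eventually_happens[OF eventually_conj[OF this eventually_conj[OF Q H\<delta>]]]
  obtain p where p: "(LINT \<omega>|W. J_envelope f n (path_of Y \<omega>)) - \<eta> < (LINT \<omega>|W. J_envelope f n (discretize (H p) (path_of Y \<omega>)))"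
    "Q p < \<eta>" "H p < \<delta>" by auto
  let ?h = "H p" and ?J = "Jn p"
  \<comment> \<open>The summand 1 beside \<open>?h * v \<epsilon>\<close> is multiplied by the
    defect at frequency 1, which tends to 0.\<close>
  have "((\<lambda>\<epsilon>. real ?J * (((?h * v \<epsilon> + 1) * (ad \<epsilon> 1 * D)) / (1 - exp (- \<delta>)))\<^sup>2) \<longlongrightarrow> Q p) (at_right 0)"
  proof -
    have d0: "((\<lambda>\<epsilon>. ad \<epsilon> 1) \<longlongrightarrow> 0) (at_right 0)"
    proof -
      have "\<forall>\<^sub>F \<epsilon> in at_right 0. 0 \<le> ad \<epsilon> 1" using a_ev[of 1] by (simp add: eventually_mono)
      from tendsto_power_exp(3)[OF this v_lim defect_conv[OF zero_le_one] nat_floor_quotient[OF v_lim zero_le_one]]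
      show ?thesis .
    qed
    have "((\<lambda>\<epsilon>. real ?J * ((?h * (v \<epsilon> * ad \<epsilon> 1) * D + ad \<epsilon> 1 * D) / (1 - exp (- \<delta>)))\<^sup>2)
        \<longlongrightarrow> real ?J * ((?h * A 1 * D + 0 * D) / (1 - exp (- \<delta>)))\<^sup>2) (at_right 0)"
      using \<delta> by (intro tendsto_intros defect_conv d0) auto
    thus ?thesis by (simp add: Q_def algebra_simps)
  qed
  hence ev1: "\<forall>\<^sub>F \<epsilon> in at_right 0. real ?J * (((?h * v \<epsilon> + 1) * (ad \<epsilon> 1 * D)) / (1 - exp (- \<delta>)))\<^sup>2 < \<eta>"
    using p(2) by (rule order_tendstoD(2))
  have "((\<lambda>\<epsilon>. 2 * (1 - (LINT \<omega>|M \<epsilon>. exp (- (1 / real (Suc k)) * kappa_process (v \<epsilon>) (X \<epsilon>) (real n + 1) \<omega>))))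
      \<longlongrightarrow> 2 * (1 - exp (- (real n + 1) * A (1 / real (Suc k))))) (at_right 0)"
    by (intro tendsto_intros kappa_laplace_limit[OF fam defect_conv]) auto
  hence ev2: "\<forall>\<^sub>F \<epsilon> in at_right 0. 2 * (1 - (LINT \<omega>|M \<epsilon>. exp (- (1 / real (Suc k)) * kappa_process (v \<epsilon>) (X \<epsilon>) (real n + 1) \<omega>))) < \<eta>"
    using k by (rule order_tendstoD(2))
  have ev3: "\<forall>\<^sub>F \<epsilon> in at_right 0. (LINT \<omega>|W. J_envelope f n (discretize ?h (path_of Y \<omega>))) - \<eta>
      < (LINT \<omega>|M \<epsilon>. J_envelope f n (discretize ?h (path_of (kappa_process (v \<epsilon>) (X \<epsilon>)) \<omega>)))"
    using order_tendstoD(1)[OF envelope_grid_conv[OF fam bf.bounded_path_functional_axioms H]] \<eta> by simp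
  show ?thesis
    using fam[unfolded family_def] v_pos ev1 ev2 ev3
  proof eventually_elim
    case (elim \<epsilon>)
    interpret ring_renewal_process m "K \<epsilon>" N c z "\<pi> \<epsilon>" "q \<epsilon>" "M \<epsilon>" "X \<epsilon>" by fact
    interpret Z: mono_process "M \<epsilon>" "kappa_process (v \<epsilon>) (X \<epsilon>)" by (rule kappa_mono_process[OF elim(2)])
    let ?x = "path_of (kappa_process (v \<epsilon>) (X \<epsilon>))"
    have tail: "prob {\<omega> \<in> space (M \<epsilon>). R \<le> kappa_process (v \<epsilon>) (X \<epsilon>) (real n + 1) \<omega>} < \<eta>"
      using kappa_tail[OF elim(2), of "real n + 1" k] elim(4) unfolding R_def by simp
    have "\<bar>(LINT \<omega>|M \<epsilon>. J_envelope f n (?x \<omega>)) - (LINT \<omega>|M \<epsilon>. J_envelope f n (discretize ?h (?x \<omega>)))\<bar>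
        \<le> n * (\<delta> * (1 + R)) + 2 * B * (real ?J * (((?h * v \<epsilon> + 1) * (ad \<epsilon> 1 * (m / c ^ (2 * N)))) / (1 - exp (- \<delta>)))\<^sup>2
          + prob {\<omega> \<in> space (M \<epsilon>). R \<le> kappa_process (v \<epsilon>) (X \<epsilon>) (real n + 1) \<omega>})"
      by (rule envelope_discretize_error[OF bf.bounded_path_functional_axioms elim(2) H p(3) \<delta>(2) Jn(1)]) (simp add: R_def)
    also have "\<dots> \<le> \<eta> + 2 * B * (\<eta> + \<eta>)"
      using n\<delta> elim(3) tail B0 unfolding D_def by (intro add_mono mult_left_mono) auto
    finally have err: "\<bar>(LINT \<omega>|M \<epsilon>. J_envelope f n (?x \<omega>)) - (LINT \<omega>|M \<epsilon>. J_envelope f n (discretize ?h (?x \<omega>)))\<bar>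
        \<le> \<eta> + 4 * (B * \<eta>)" by simp
    have "(LINT \<omega>|M \<epsilon>. J_envelope f n (?x \<omega>)) \<le> (LINT \<omega>|M \<epsilon>. f (?x \<omega>))"
      using path_functional.integrable_path(1)[OF env Z.mono_process_axioms] f.integrable_path(1)[OF Z.mono_process_axioms]
      by (intro integral_mono bf.envelope_le Z.Z_path) auto
    moreover have "8 * \<eta> + 8 * (B * \<eta>) = e"
    proof -
      have "8 * \<eta> + 8 * (B * \<eta>) = 8 * (1 + B) * \<eta>" by (simp add: algebra_simps)
      also have "\<dots> = e" using B0 by (simp add: \<eta>_def)
      finally show ?thesis .
    qed
    moreover have "0 \<le> B * \<eta>" using B0 \<eta> by simp
    ultimately show ?case using err n p(1) elim(5) \<eta> by linarith
  qed
qed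

lemma functional_conv:
  assumes fam: "family q M X" and f: "continuous_map J_topology euclideanreal f"
    and B: "\<And>x. x \<in> mono_paths \<Longrightarrow> \<bar>f x\<bar> \<le> B"
  shows "((\<lambda>\<epsilon>. LINT \<omega>|M \<epsilon>. f (path_of (kappa_process (v \<epsilon>) (X \<epsilon>)) \<omega>)) \<longlongrightarrow> (LINT \<omega>|W. f (path_of Y \<omega>))) (at_right 0)"
proof (rule tendstoI)
  fix e :: real assume e: "0 < e"
  have f': "continuous_map J_topology euclideanreal (\<lambda>x. - f x)" using f by (rule continuous_map_minus)
  have B': "\<And>x. x \<in> mono_paths \<Longrightarrow> \<bar>- f x\<bar> \<le> B" using B by simp
  show "\<forall>\<^sub>F \<epsilon> in at_right 0. dist (LINT \<omega>|M \<epsilon>. f (path_of (kappa_process (v \<epsilon>) (X \<epsilon>)) \<omega>)) (LINT \<omega>|W. f (path_of Y \<omega>)) < e"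
  proof -
    have "\<forall>\<^sub>F \<epsilon> in at_right 0. (LINT \<omega>|W. f (path_of Y \<omega>)) - e < (LINT \<omega>|M \<epsilon>. f (path_of (kappa_process (v \<epsilon>) (X \<epsilon>)) \<omega>))"
      by (rule functional_liminf[OF fam f _ e]) (rule B)
    moreover have "\<forall>\<^sub>F \<epsilon> in at_right 0. (LINT \<omega>|W. - f (path_of Y \<omega>)) - e < (LINT \<omega>|M \<epsilon>. - f (path_of (kappa_process (v \<epsilon>) (X \<epsilon>)) \<omega>))"
      by (rule functional_liminf[OF fam f' _ e]) (rule B')
    ultimately show ?thesis by eventually_elim (simp add: dist_real_def abs_less_iff)
  qed
qed

lemma weak_convergence:
  assumes fam: "family q M X"
  shows "weak_conv_J M (\<lambda>\<epsilon>. kappa_process (v \<epsilon>) (X \<epsilon>)) W Y (at_right 0)"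
  unfolding weak_conv_J_def
proof (intro conjI allI impI)
  show "\<forall>\<^sub>F \<epsilon> in at_right 0. cadlag_process (M \<epsilon>) (kappa_process (v \<epsilon>) (X \<epsilon>))"
    using kappa_mono_ev[OF fam] by eventually_elim (rule mono_process_cadlag)
  show "cadlag_process W Y" by (rule mono_process_cadlag[OF lim.mono_process_axioms])
  fix f assume "continuous_map J_topology euclideanreal f \<and> bounded (f ` cadlag_paths)"
  hence f: "continuous_map J_topology euclideanreal f" and "bounded (f ` cadlag_paths)" by auto
  then obtain B where "\<forall>y\<in>f ` cadlag_paths. norm y \<le> B" by (auto simp: bounded_iff)
  hence B: "\<And>x. x \<in> mono_paths \<Longrightarrow> \<bar>f x\<bar> \<le> B" using mono_paths_subset by auto
  interpret f: path_functional f B by (rule continuous_path_functional[OF f B])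
  show "\<forall>\<^sub>F \<epsilon> in at_right 0. integrable (M \<epsilon>) (\<lambda>\<omega>. f (path_of (kappa_process (v \<epsilon>) (X \<epsilon>)) \<omega>))"
    using kappa_mono_ev[OF fam] by eventually_elim (rule f.integrable_path(1))
  show "integrable W (\<lambda>\<omega>. f (path_of Y \<omega>))" by (rule f.integrable_path(1)[OF lim.mono_process_axioms])
  show "((\<lambda>\<epsilon>. LINT \<omega>|M \<epsilon>. f (path_of (kappa_process (v \<epsilon>) (X \<epsilon>)) \<omega>)) \<longlongrightarrow> (LINT \<omega>|W. f (path_of Y \<omega>))) (at_right 0)"
    by (rule functional_conv[OF fam f B])
qed

end

section \<open>The limit law\<close>

lemma cumulant_tendsto_0:
  assumes "nonneg_law \<mu>"
  shows "(\<lambda>k. cumulant \<mu> (1 / real (Suc k))) \<longlonglongrightarrow> 0"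
proof -
  have "(\<lambda>k. - ln (laplace_transform \<mu> (1 / real (Suc k)))) \<longlonglongrightarrow> - ln 1"
    by (intro tendsto_intros tendsto_laplace_transform_0 assms) simp
  thus ?thesis by (simp add: cumulant_def)
qed

text \<open>Summing about \<open>h * v\<close> of the variables gives the transform
  \<open>exp (- h * A s)\<close> in the limit, and the behaviour of \<open>A\<close> near 0 makes
  this the transform of a law. Reciprocals of integers as \<open>h\<close> serve infinite
  divisibility, dyadic ones the increments of the limit process.\<close>

lemma (in renewal_asymptotics) root_laws:
  assumes laws: "\<forall>\<^sub>F \<epsilon> in at_right 0. \<forall>k. nonneg_law (T \<epsilon> k) \<and> (\<forall>s\<ge>0. laplace_transform (T \<epsilon> k) s = (1 - ad \<epsilon> s) ^ k)"
    and conv: "\<And>s. 0 \<le> s \<Longrightarrow> ((\<lambda>\<epsilon>. v \<epsilon> * ad \<epsilon> s) \<longlongrightarrow> A s) (at_right 0)"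
    and A: "(\<lambda>k. A (1 / real (Suc k))) \<longlonglongrightarrow> 0" and h: "0 \<le> h"
  obtains \<nu> where "nonneg_law \<nu>" "\<And>s. 0 \<le> s \<Longrightarrow> laplace_transform \<nu> s = exp (- h * A s)"
proof -
  obtain d :: real where d: "0 < d" "\<And>\<epsilon> k. 0 < \<epsilon> \<Longrightarrow> \<epsilon> < d \<Longrightarrow> nonneg_law (T \<epsilon> k) \<and> (\<forall>s\<ge>0. laplace_transform (T \<epsilon> k) s = (1 - ad \<epsilon> s) ^ k)"
    using laws unfolding eventually_at_right_field by blast
  \<comment> \<open>A sequence inside the range where the laws are controlled; the double successor
    keeps it strictly below \<open>d\<close>.\<close>
  define x where "x n = d / real (Suc (Suc n))" for n
  have x: "0 < x n" "x n < d" for n using d(1) by (auto simp: x_def divide_simps)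
  have x_lim: "filterlim x (at_right 0) sequentially"
  proof -
    have "(\<lambda>n. d * (1 / real (Suc (Suc n)))) \<longlonglongrightarrow> d * 0"
      by (intro tendsto_intros LIMSEQ_Suc[OF LIMSEQ_Suc[OF lim_1_over_n]])
    hence "x \<longlonglongrightarrow> 0" by (simp add: x_def[abs_def])
    thus ?thesis using x(1) by (auto simp: filterlim_at less_imp_neq[THEN not_sym])
  qed
  define k where "k n = nat \<lfloor>h * v (x n)\<rfloor>" for n
  show ?thesis
  proof (rule laplace_limit_exists[of "\<lambda>n. T (x n) (k n)" "\<lambda>s. exp (- h * A s)"])
    show "nonneg_law (T (x n) (k n))" for n using d(2)[OF x] by blast
    show "(\<lambda>n. laplace_transform (T (x n) (k n)) s) \<longlonglongrightarrow> exp (- h * A s)" if s: "0 \<le> s" for s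
    proof -
      have "\<forall>\<^sub>F \<epsilon> in at_right 0. 0 \<le> ad \<epsilon> s" using a_ev[OF s] by eventually_elim simp
      from filterlim_compose[OF tendsto_power_exp(1)[OF this v_lim conv[OF s] nat_floor_quotient[OF v_lim h]] x_lim]
      show ?thesis using d(2)[OF x] s by (simp add: k_def)
    qed
    have "(\<lambda>k. exp (- h * A (1 / real (Suc k)))) \<longlonglongrightarrow> exp (- h * 0)" by (intro tendsto_intros A)
    thus "(\<lambda>k. exp (- h * A (1 / real (Suc k)))) \<longlonglongrightarrow> 1" by simp
  qed (use that in blast)
qed

text \<open>Here the transform is exactly the power of \<open>1 - a\<close>, so no error term
  separates it from \<open>v * a\<close>.\<close>

lemma (in renewal_asymptotics) laplace_conv_iff:
  assumes laws: "\<forall>\<^sub>F \<epsilon> in at_right 0. \<forall>k. nonneg_law (T \<epsilon> k) \<and> (\<forall>s\<ge>0. laplace_transform (T \<epsilon> k) s = (1 - ad \<epsilon> s) ^ k)"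
    and \<mu>: "nonneg_law \<mu>"
  shows "weak_conv_along (\<lambda>\<epsilon>. T \<epsilon> (nat \<lfloor>v \<epsilon>\<rfloor>)) \<mu> (at_right 0) \<longleftrightarrow>
    (\<forall>s\<ge>0. ((\<lambda>\<epsilon>. v \<epsilon> * ad \<epsilon> s) \<longlongrightarrow> cumulant \<mu> s) (at_right 0))"
proof
  have quot: "((\<lambda>\<epsilon>. real (nat \<lfloor>v \<epsilon>\<rfloor>) / v \<epsilon>) \<longlongrightarrow> 1) (at_right 0)"
    using nat_floor_quotient[OF v_lim zero_le_one] by simp
  have laws': "\<forall>\<^sub>F \<epsilon> in at_right 0. nonneg_law (T \<epsilon> (nat \<lfloor>v \<epsilon>\<rfloor>))" using laws by eventually_elim blast
  have lap: "0 \<le> s \<Longrightarrow> \<forall>\<^sub>F \<epsilon> in at_right 0. laplace_transform (T \<epsilon> (nat \<lfloor>v \<epsilon>\<rfloor>)) s = (1 - ad \<epsilon> s) ^ nat \<lfloor>v \<epsilon>\<rfloor>" for s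
    using laws by eventually_elim blast
  {
    assume conv: "weak_conv_along (\<lambda>\<epsilon>. T \<epsilon> (nat \<lfloor>v \<epsilon>\<rfloor>)) \<mu> (at_right 0)"
    show "\<forall>s\<ge>0. ((\<lambda>\<epsilon>. v \<epsilon> * ad \<epsilon> s) \<longlongrightarrow> cumulant \<mu> s) (at_right 0)"
    proof (intro allI impI)
      fix s :: real assume s: "0 \<le> s"
      have "((\<lambda>\<epsilon>. (1 - ad \<epsilon> s) ^ nat \<lfloor>v \<epsilon>\<rfloor>) \<longlongrightarrow> laplace_transform \<mu> s) (at_right 0)"
        by (rule Lim_transform_eventually[OF weak_conv_along_imp_laplace_conv[OF \<mu> laws' conv s] lap[OF s]])
      from tendsto_power_imp[OF a_ev[OF s] v_lim quot this laplace_transform_bounds(1)[OF \<mu> s]]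
      show "((\<lambda>\<epsilon>. v \<epsilon> * ad \<epsilon> s) \<longlongrightarrow> cumulant \<mu> s) (at_right 0)" by (simp add: cumulant_def)
    qed
  next
    assume conv: "\<forall>s\<ge>0. ((\<lambda>\<epsilon>. v \<epsilon> * ad \<epsilon> s) \<longlongrightarrow> cumulant \<mu> s) (at_right 0)"
    show "weak_conv_along (\<lambda>\<epsilon>. T \<epsilon> (nat \<lfloor>v \<epsilon>\<rfloor>)) \<mu> (at_right 0)"
    proof (rule laplace_conv_imp_weak_conv[OF laws' \<mu>])
      fix k :: nat
      have s: "0 \<le> real k" by simp
      have a0: "\<forall>\<^sub>F \<epsilon> in at_right 0. 0 \<le> ad \<epsilon> (real k)" using a_ev[OF s] by eventually_elim simp
      have "((\<lambda>\<epsilon>. (1 - ad \<epsilon> (real k)) ^ nat \<lfloor>v \<epsilon>\<rfloor>) \<longlongrightarrow> exp (- 1 * cumulant \<mu> (real k))) (at_right 0)"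
        using tendsto_power_exp(1)[OF a0 v_lim conv[rule_format, OF s] quot] .
      hence "((\<lambda>\<epsilon>. (1 - ad \<epsilon> (real k)) ^ nat \<lfloor>v \<epsilon>\<rfloor>) \<longlongrightarrow> laplace_transform \<mu> (real k)) (at_right 0)"
        using exp_cumulant[OF \<mu> s] by simp
      thus "((\<lambda>\<epsilon>. laplace_transform (T \<epsilon> (nat \<lfloor>v \<epsilon>\<rfloor>)) (real k)) \<longlongrightarrow> laplace_transform \<mu> (real k)) (at_right 0)"
        by (rule Lim_transform_eventually) (use lap[OF s] in eventually_elim, simp)
    qed
  }
qed

text \<open>The right-hand side mentions none of \<open>q\<close>, \<open>M\<close> and
  \<open>X\<close>; this is the source of the independence from the initial distributions.\<close>

lemma (in renewal_asymptotics) kappa_conv_iff: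
  assumes fam: "family q M X" and \<mu>: "nonneg_law \<mu>"
  shows "weak_conv_along (\<lambda>\<epsilon>. distr (M \<epsilon>) borel (kappa_process (v \<epsilon>) (X \<epsilon>) 1)) \<mu> (at_right 0) \<longleftrightarrow>
    (\<forall>s\<ge>0. ((\<lambda>\<epsilon>. v \<epsilon> * ad \<epsilon> s) \<longlongrightarrow> cumulant \<mu> s) (at_right 0))"
proof
  let ?\<kappa> = "\<lambda>\<epsilon>. distr (M \<epsilon>) borel (kappa_process (v \<epsilon>) (X \<epsilon>) 1)"
  have laws: "\<forall>\<^sub>F \<epsilon> in at_right 0. nonneg_law (?\<kappa> \<epsilon>) \<and>
      (\<forall>s. laplace_transform (?\<kappa> \<epsilon>) s = (LINT \<omega>|M \<epsilon>. exp (- s * kappa_process (v \<epsilon>) (X \<epsilon>) 1 \<omega>)))"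
    using kappa_mono_ev[OF fam]
  proof eventually_elim
    case (elim \<epsilon>)
    interpret mono_process "M \<epsilon>" "kappa_process (v \<epsilon>) (X \<epsilon>)" by fact
    show ?case using Z_measurable[of 1] Z_nonneg[of _ 1]
      by (auto intro!: nonneg_law_distr prob_space_axioms simp: laplace_transform_distr)
  qed
  have laws': "\<forall>\<^sub>F \<epsilon> in at_right 0. nonneg_law (?\<kappa> \<epsilon>)" using laws by eventually_elim blast
  have lap: "\<forall>\<^sub>F \<epsilon> in at_right 0. laplace_transform (?\<kappa> \<epsilon>) s = (LINT \<omega>|M \<epsilon>. exp (- s * kappa_process (v \<epsilon>) (X \<epsilon>) 1 \<omega>))" for s
    using laws by eventually_elim blast
  {
    assume conv: "weak_conv_along ?\<kappa> \<mu> (at_right 0)"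
    show "\<forall>s\<ge>0. ((\<lambda>\<epsilon>. v \<epsilon> * ad \<epsilon> s) \<longlongrightarrow> cumulant \<mu> s) (at_right 0)"
    proof (intro allI impI)
      fix s :: real assume s: "0 \<le> s"
      show "((\<lambda>\<epsilon>. v \<epsilon> * ad \<epsilon> s) \<longlongrightarrow> cumulant \<mu> s) (at_right 0)"
        unfolding cumulant_def
        by (rule kappa_laplace_imp[OF fam s laplace_transform_bounds(1)[OF \<mu> s]])
          (rule Lim_transform_eventually[OF weak_conv_along_imp_laplace_conv[OF \<mu> laws' conv s] lap])
    qed
  next
    assume conv: "\<forall>s\<ge>0. ((\<lambda>\<epsilon>. v \<epsilon> * ad \<epsilon> s) \<longlongrightarrow> cumulant \<mu> s) (at_right 0)"
    show "weak_conv_along ?\<kappa> \<mu> (at_right 0)"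
    proof (rule laplace_conv_imp_weak_conv[OF laws' \<mu>])
      fix k :: nat
      have s: "0 \<le> real k" by simp
      have "((\<lambda>\<epsilon>. LINT \<omega>|M \<epsilon>. exp (- real k * kappa_process (v \<epsilon>) (X \<epsilon>) 1 \<omega>)) \<longlongrightarrow> exp (- 1 * cumulant \<mu> (real k))) (at_right 0)"
        by (rule kappa_laplace_limit[OF fam conv[rule_format] zero_le_one s])
      hence "((\<lambda>\<epsilon>. LINT \<omega>|M \<epsilon>. exp (- real k * kappa_process (v \<epsilon>) (X \<epsilon>) 1 \<omega>)) \<longlongrightarrow> laplace_transform \<mu> (real k)) (at_right 0)"
        using exp_cumulant[OF \<mu> s] by simp
      thus "((\<lambda>\<epsilon>. laplace_transform (?\<kappa> \<epsilon>) (real k)) \<longlongrightarrow> laplace_transform \<mu> (real k)) (at_right 0)"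
        by (rule Lim_transform_eventually) (use lap[of "real k"] in eventually_elim, simp)
    qed
  }
qed

lemma nonneg_nonzero_imp_nonneg_law: "nonneg_nonzero_law \<mu> \<Longrightarrow> nonneg_law \<mu>"
  by (simp add: nonneg_nonzero_law_def nonneg_law_def)

text \<open>Finitely many positive lower limits are replaced by one constant that is valid for all
  small \<open>\<epsilon>\<close>. Inserting 1 into the minimum ensures
  \<open>c \<le> 1\<close>.\<close>

lemma ring_chain_constants:
  assumes "ring_chain_condition m K"
  obtains N :: nat and z :: "nat \<Rightarrow> nat" and c :: real where "N \<ge> 1" "z N = z 0" "z ` {0..N} = {1..m}" "0 < c" "c \<le> 1"
    "\<forall>\<^sub>F \<epsilon> in at_right 0. \<forall>k\<in>{1..N}. c \<le> trans_prob (K \<epsilon>) (z (k - 1)) (z k)"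
proof -
  obtain N and z :: "nat \<Rightarrow> nat" where N: "N \<ge> 1" "z N = z 0" "z ` {0..N} = {1..m}"
    and pos: "\<And>k. k \<in> {1..N} \<Longrightarrow> Liminf (at_right 0) (\<lambda>\<epsilon>. ereal (trans_prob (K \<epsilon>) (z (k - 1)) (z k))) > 0"
    using assms unfolding ring_chain_condition_def by blast
  have "\<exists>y>0. \<forall>\<^sub>F \<epsilon> in at_right 0. y < trans_prob (K \<epsilon>) (z (k - 1)) (z k)" if k: "k \<in> {1..N}" for k
  proof -
    obtain y where y: "0 < ereal y" "ereal y < Liminf (at_right 0) (\<lambda>\<epsilon>. ereal (trans_prob (K \<epsilon>) (z (k - 1)) (z k)))"
      using ereal_dense2[OF pos[OF k]] by blast
    from less_LiminfD[OF y(2)] y(1) show ?thesis by auto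
  qed
  then obtain y where y: "\<And>k. k \<in> {1..N} \<Longrightarrow> 0 < y k"
    "\<And>k. k \<in> {1..N} \<Longrightarrow> \<forall>\<^sub>F \<epsilon> in at_right 0. y k < trans_prob (K \<epsilon>) (z (k - 1)) (z k)" by metis
  define c where "c = Min (insert 1 (y ` {1..N}))"
  have c: "0 < c" "c \<le> 1" using y(1) by (auto simp: c_def)
  have cy: "c \<le> y k" if "k \<in> {1..N}" for k
    unfolding c_def by (rule Min_le) (use that in auto)
  have "\<forall>\<^sub>F \<epsilon> in at_right 0. \<forall>k\<in>{1..N}. y k < trans_prob (K \<epsilon>) (z (k - 1)) (z k)"
    using y(2) by (intro eventually_ball_finite) auto
  hence "\<forall>\<^sub>F \<epsilon> in at_right 0. \<forall>k\<in>{1..N}. c \<le> trans_prob (K \<epsilon>) (z (k - 1)) (z k)"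
    by eventually_elim (metis cy less_imp_le order_trans)
  thus ?thesis using that N c by blast
qed

theorem theorem2:
  fixes \<epsilon>0 :: real and m :: nat
    and K :: "real \<Rightarrow> nat \<Rightarrow> (nat \<times> real \<times> nat) measure"
    and \<pi> :: "real \<Rightarrow> nat \<Rightarrow> real"
    and v :: "real \<Rightarrow> real"
    and P :: "real \<Rightarrow> 'v measure" and \<theta> :: "real \<Rightarrow> nat \<Rightarrow> 'v \<Rightarrow> real"
  assumes "\<epsilon>0 > 0" and "m \<ge> 1"
    and kernel: "\<And>\<epsilon>. \<epsilon> \<in> {0<..\<epsilon>0} \<Longrightarrow> semi_markov_kernel m (K \<epsilon>)"
    and B: "ring_chain_condition m K"
    and stationary: "\<And>\<epsilon>. \<epsilon> \<in> {0<..\<epsilon>0} \<Longrightarrow> ergodic_chain m (trans_prob (K \<epsilon>)) \<Longrightarrow>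
      stationary_distribution m (trans_prob (K \<epsilon>)) (\<pi> \<epsilon>)"
    and theta: "\<And>\<epsilon>. \<epsilon> \<in> {0<..\<epsilon>0} \<Longrightarrow> ergodic_chain m (trans_prob (K \<epsilon>)) \<Longrightarrow>
      iid_with_cdf (P \<epsilon>) (\<theta> \<epsilon>) (averaged_step_cdf m (K \<epsilon>) (\<pi> \<epsilon>))"
    and v_pos: "\<And>\<epsilon>. \<epsilon> \<in> {0<..\<epsilon>0} \<Longrightarrow> v \<epsilon> > 0"
    and v_lim: "filterlim v at_top (at_right 0)"
  shows
    "(\<forall>\<mu>. theta_conv v P \<theta> \<mu> \<longrightarrow>
        infinitely_divisible \<mu> \<and> (\<forall>s\<ge>0. laplace_transform \<mu> s = exp (- cumulant \<mu> s))) \<and>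
     ((\<exists>\<mu>. theta_conv v P \<theta> \<mu>) \<longrightarrow>
        (\<forall>q (M :: real \<Rightarrow> 'w measure) X. markov_renewal_family \<epsilon>0 m K q M X \<longrightarrow>
           (\<exists>\<mu>'. kappa_conv v M X \<mu>'))) \<and>
     ((\<exists>q (M :: real \<Rightarrow> 'w measure) X \<mu>'. markov_renewal_family \<epsilon>0 m K q M X \<and> kappa_conv v M X \<mu>') \<longrightarrow>
        (\<exists>\<mu>. theta_conv v P \<theta> \<mu>)) \<and>
     (\<forall>\<mu> q (M :: real \<Rightarrow> 'w measure) X \<mu>'.
        theta_conv v P \<theta> \<mu> \<and> markov_renewal_family \<epsilon>0 m K q M X \<and> kappa_conv v M X \<mu>' \<longrightarrow>
        infinitely_divisible \<mu>' \<and> (\<forall>s\<ge>0. laplace_transform \<mu>' s = exp (- cumulant \<mu> s))) \<and>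
     (\<forall>\<mu>. theta_conv v P \<theta> \<mu> \<longrightarrow>
        (\<exists>(L :: (real \<Rightarrow> real) measure) Y.
           levy_process L Y \<and> (\<forall>t\<ge>0. \<forall>\<omega>\<in>space L. Y t \<omega> \<ge> 0) \<and>
           (\<forall>s\<ge>0. \<forall>t\<ge>0. (LINT \<omega>|L. exp (- s * Y t \<omega>)) = exp (- t * cumulant \<mu> s)) \<and>
           (\<forall>q (M :: real \<Rightarrow> 'w measure) X. markov_renewal_family \<epsilon>0 m K q M X \<longrightarrow>
              weak_conv_J M (\<lambda>\<epsilon>. kappa_process (v \<epsilon>) (X \<epsilon>)) L Y (at_right 0))))"
proof -
  obtain N :: nat and z :: "nat \<Rightarrow> nat" and c :: real where N: "N \<ge> 1" "z N = z 0" "z ` {0..N} = {1..m}" and c: "0 < c" "c \<le> 1"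
    and ring: "\<forall>\<^sub>F \<epsilon> in at_right 0. \<forall>k\<in>{1..N}. c \<le> trans_prob (K \<epsilon>) (z (k - 1)) (z k)"
    using ring_chain_constants[OF B] .
  have small: "\<forall>\<^sub>F \<epsilon> in at_right 0. \<epsilon> \<in> {0<..\<epsilon>0}"
    using \<open>\<epsilon>0 > 0\<close> by (auto simp: eventually_at_right_field intro!: exI[of _ \<epsilon>0])
  \<comment> \<open>\<open>\<pi>\<close> and \<open>\<theta>\<close> are constrained only where the
    chain is ergodic; the ring provides this for every small \<open>\<epsilon>\<close>.\<close>
  have ring_iid: "\<forall>\<^sub>F \<epsilon> in at_right 0. ring_renewal m (K \<epsilon>) N c z (\<pi> \<epsilon>) \<and>
      iid_with_cdf (P \<epsilon>) (\<theta> \<epsilon>) (averaged_step_cdf m (K \<epsilon>) (\<pi> \<epsilon>))"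
    using small ring
  proof eventually_elim
    case (elim \<epsilon>)
    have "ergodic_chain m (trans_prob (K \<epsilon>))"
      by (rule ring_ergodic[OF N(2,3)]) (use elim c in \<open>force intro: less_le_trans\<close>)
    from stationary[OF elim(1) this] theta[OF elim(1) this] show ?case
      using kernel[OF elim(1)] \<open>m \<ge> 1\<close> N c elim(2)
      by (auto intro!: ring_renewal.intro ring_renewal_axioms.intro step_kernel.intro)
  qed
  interpret renewal_asymptotics m N c z K \<pi> v
    by unfold_locales (use ring_iid v_lim in \<open>auto elim: eventually_mono\<close>)
  define T where "T \<epsilon> k = distr (P \<epsilon>) borel (\<lambda>\<omega>. \<Sum>n = 1..k. \<theta> \<epsilon> n \<omega>)" for \<epsilon> k
  have laws: "\<forall>\<^sub>F \<epsilon> in at_right 0. \<forall>k. nonneg_law (T \<epsilon> k) \<and> (\<forall>s\<ge>0. laplace_transform (T \<epsilon> k) s = (1 - ad \<epsilon> s) ^ k)"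
    using ring_iid
  proof eventually_elim
    case (elim \<epsilon>)
    note sum = ring_renewal.iid_sum[OF elim[THEN conjunct1] elim[THEN conjunct2]]
    show ?case unfolding T_def by (intro allI conjI impI sum)
  qed
  \<comment> \<open>Together with \<open>kappa_iff\<close> this turns both convergences into the
    same statement on defects, so that a limit law of one kind is also a limit law of the
    other.\<close>
  have theta_iff: "theta_conv v P \<theta> \<mu> \<longleftrightarrow> nonneg_nonzero_law \<mu> \<and>
      (\<forall>s\<ge>0. ((\<lambda>\<epsilon>. v \<epsilon> * ad \<epsilon> s) \<longlongrightarrow> cumulant \<mu> s) (at_right 0))" for \<mu>
    unfolding theta_conv_def T_def[symmetric] using laplace_conv_iff[OF laws] nonneg_nonzero_imp_nonneg_law by blast
  have fam: "family q M X" if "markov_renewal_family \<epsilon>0 m K q M X" for q X and M :: "real \<Rightarrow> 'w measure"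
    unfolding family_def using small ring_iid
    by eventually_elim
      (use that in \<open>auto simp: markov_renewal_family_def ring_renewal_process_def markov_renewal_def ring_renewal_def\<close>)
  have kappa_iff: "kappa_conv v M X \<mu> \<longleftrightarrow> nonneg_nonzero_law \<mu> \<and>
      (\<forall>s\<ge>0. ((\<lambda>\<epsilon>. v \<epsilon> * ad \<epsilon> s) \<longlongrightarrow> cumulant \<mu> s) (at_right 0))"
    if "markov_renewal_family \<epsilon>0 m K q M X" for q X \<mu> and M :: "real \<Rightarrow> 'w measure"
    unfolding kappa_conv_def using kappa_conv_iff[OF fam[OF that]] nonneg_nonzero_imp_nonneg_law by blast
  have roots: "\<exists>\<nu>. nonneg_law \<nu> \<and> (\<forall>s\<ge>0. laplace_transform \<nu> s = exp (- h * cumulant \<mu> s))"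
    if \<mu>: "theta_conv v P \<theta> \<mu>" and h: "0 \<le> h" for \<mu> h
  proof -
    have conv: "0 \<le> s \<Longrightarrow> ((\<lambda>\<epsilon>. v \<epsilon> * ad \<epsilon> s) \<longlongrightarrow> cumulant \<mu> s) (at_right 0)" for s
      using \<mu> by (simp add: theta_iff)
    have "nonneg_law \<mu>" using \<mu> nonneg_nonzero_imp_nonneg_law by (simp add: theta_iff)
    from root_laws[OF laws conv cumulant_tendsto_0[OF this] h] show ?thesis by blast
  qed
  have div: "infinitely_divisible \<mu>" if \<mu>: "theta_conv v P \<theta> \<mu>" for \<mu>
  proof (rule infinitely_divisible_if_roots)
    show nl: "nonneg_law \<mu>" using \<mu> nonneg_nonzero_imp_nonneg_law by (simp add: theta_iff)
    fix n :: nat assume n: "n \<ge> 1"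
    obtain \<nu> where \<nu>: "nonneg_law \<nu>" "\<And>s. 0 \<le> s \<Longrightarrow> laplace_transform \<nu> s = exp (- (1 / real n) * cumulant \<mu> s)"
      using roots[OF \<mu>, of "1 / real n"] by auto
    have "laplace_transform \<nu> s ^ n = laplace_transform \<mu> s" if "0 \<le> s" for s
      using n by (simp add: \<nu>(2)[OF that] exp_of_nat_mult[symmetric] exp_cumulant[OF nl that])
    thus "\<exists>\<nu>. nonneg_law \<nu> \<and> (\<forall>s\<ge>0. laplace_transform \<nu> s ^ n = laplace_transform \<mu> s)" using \<nu>(1) by blast
  qed
  show ?thesis
  proof (intro conjI allI impI)
    fix \<mu> assume \<mu>: "theta_conv v P \<theta> \<mu>"
    show "infinitely_divisible \<mu>" by (rule div[OF \<mu>])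
    show "laplace_transform \<mu> s = exp (- cumulant \<mu> s)" if "0 \<le> s" for s
      using exp_cumulant[OF _ that] \<mu> nonneg_nonzero_imp_nonneg_law by (auto simp: theta_iff)
  next
    fix q X and M :: "real \<Rightarrow> 'w measure"
    assume "\<exists>\<mu>. theta_conv v P \<theta> \<mu>" "markov_renewal_family \<epsilon>0 m K q M X"
    thus "\<exists>\<mu>'. kappa_conv v M X \<mu>'" by (auto simp: theta_iff kappa_iff)
  next
    assume "\<exists>q (M :: real \<Rightarrow> 'w measure) X \<mu>'. markov_renewal_family \<epsilon>0 m K q M X \<and> kappa_conv v M X \<mu>'"
    thus "\<exists>\<mu>. theta_conv v P \<theta> \<mu>" by (auto simp: theta_iff kappa_iff)
  next
    fix \<mu> \<mu>' q X and M :: "real \<Rightarrow> 'w measure"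
    assume *: "theta_conv v P \<theta> \<mu> \<and> markov_renewal_family \<epsilon>0 m K q M X \<and> kappa_conv v M X \<mu>'"
    \<comment> \<open>The limit law of the renewal sums is itself a limit law in (D), so infinite
      divisibility carries over.\<close>
    hence th': "theta_conv v P \<theta> \<mu>'" by (auto simp: theta_iff kappa_iff)
    thus "infinitely_divisible \<mu>'" by (rule div)
    fix s :: real assume s: "0 \<le> s"
    \<comment> \<open>Both cumulants are limits of the same function of
      \<open>\<epsilon>\<close>.\<close>
    have "cumulant \<mu>' s = cumulant \<mu> s"
      using * th' s by (intro tendsto_unique[of "at_right 0" "\<lambda>\<epsilon>. v \<epsilon> * ad \<epsilon> s"]) (auto simp: theta_iff)
    moreover have "nonneg_law \<mu>'" using th' nonneg_nonzero_imp_nonneg_law by (auto simp: theta_iff)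
    ultimately show "laplace_transform \<mu>' s = exp (- cumulant \<mu> s)" using exp_cumulant[OF _ s, of \<mu>'] by simp
  next
    fix \<mu> assume \<mu>: "theta_conv v P \<theta> \<mu>"
    hence nl: "nonneg_law \<mu>" using nonneg_nonzero_imp_nonneg_law by (simp add: theta_iff)
    have "\<forall>n. \<exists>\<nu>. nonneg_law \<nu> \<and> (\<forall>s\<ge>0. laplace_transform \<nu> s = exp (- cumulant \<mu> s / 2 ^ n))"
      using roots[OF \<mu>, of "1 / 2 ^ n" for n] by simp
    from choice[OF this] obtain \<nu> where \<nu>: "\<forall>n. nonneg_law (\<nu> n) \<and> (\<forall>s\<ge>0. laplace_transform (\<nu> n) s = exp (- cumulant \<mu> s / 2 ^ n))" ..
    interpret sub: subordinator_roots "cumulant \<mu>" \<nu> by unfold_locales (use \<nu> in auto)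
    have mp: "mono_process sub.W sub.Y"
      using sub.W.P.prob_space_axioms sub.Y_measurable sub.Y_path by (simp add: mono_process_def mono_process_axioms_def)
    have lim: "renewal_limit m N c z K \<pi> v sub.W sub.Y (cumulant \<mu>)"
      unfolding renewal_limit_def renewal_limit_axioms_def
      using renewal_asymptotics_axioms mp \<mu> cumulant_tendsto_0[OF nl] sub.Y_0 sub.Y_increments_laplace
      by (auto simp: theta_iff)
    show "\<exists>(L :: (real \<Rightarrow> real) measure) Y.
           levy_process L Y \<and> (\<forall>t\<ge>0. \<forall>\<omega>\<in>space L. Y t \<omega> \<ge> 0) \<and>
           (\<forall>s\<ge>0. \<forall>t\<ge>0. (LINT \<omega>|L. exp (- s * Y t \<omega>)) = exp (- t * cumulant \<mu> s)) \<and>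
           (\<forall>q (M :: real \<Rightarrow> 'w measure) X. markov_renewal_family \<epsilon>0 m K q M X \<longrightarrow>
              weak_conv_J M (\<lambda>\<epsilon>. kappa_process (v \<epsilon>) (X \<epsilon>)) L Y (at_right 0))"
      by (intro exI[of _ sub.W] exI[of _ sub.Y] conjI allI ballI impI sub.levy sub.Y_nonneg sub.Y_laplace
          renewal_limit.weak_convergence[OF lim fam])
  qed
qed

end
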